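(* Let $A\to A'$ be a faithfully flat extension of noetherian normal integral domains, with induced morphism $p:\operatorname{Spec} A'\to\operatorname{Spec} A$. Suppose that the homomorphism of divisor class groups $p^*:\operatorname{Cl}(A)\to\operatorname{Cl}(A')$ is surjective. Then for every affinely trivial divisor $D$ on $\operatorname{Spec} A$ the divisor $p^*D$ on $\operatorname{Spec} A'$ is affinely trivial, and the affine class groups coincide: $p^*$ induces an isomorphism $\operatorname{AKG}(A)\to\operatorname{AKG}(A')$.
   Context: Let $X$ be a noetherian, separated, integral, normal scheme. A Weil divisor $D$ on $X$ is called coaffine if for every effective divisor $D'$ linearly equivalent to $D$ the complement $X\setminus\operatorname{supp} D'$ is affine. A divisor $E$ has property (K) if for every $n\in\mathbb{Z}$ the divisor $nE$ is coaffine or principal. A divisor $D$ is called affinely trivial if for every divisor $E$ having property (K), the divisor $D+E$ also has property (K). The affinely trivial divisors form a subgroup of the group $\operatorname{Div} X$ of Weil divisors that contains all principal divisors; the quotient of $\operatorname{Div} X$ by this subgroup is the affine class group $\operatorname{AKG}(X)$; for $X=\operatorname{Spec} A$ write $\operatorname{AKG}(A)$. $\operatorname{Cl}(A)$ denotes the Weil divisor class group. For a flat extension of normal noetherian domains, $p^*(\mathfrak{p})=\sum_{\mathfrak{P}}e(\mathfrak{P}/\mathfrak{p})\,\mathfrak{P}$, summing over height one primes $\mathfrak{P}$ of $A'$ lying over the height one prime $\mathfrak{p}$ with $e$ the ramification index. *)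

theory Defs
  imports "HOL-Algebra.Algebra" "HOL-Analysis.Abstract_Topology" "HOL-Library.Extended_Nat"
begin

section \<open>Localization and normal domains\<close>

text \<open>
  The fraction \<open>a/s\<close> is the class of all pairs \<open>(b, t)\<close> with
  \<open>u (a t - b s) = 0\<close> for some \<open>u \<in> S\<close>; the set \<open>S\<close> is always
  multiplicatively closed below.
\<close>

definition ring_frac :: "('a, 'm) ring_scheme \<Rightarrow> 'a set \<Rightarrow> 'a \<Rightarrow> 'a \<Rightarrow> ('a \<times> 'a) set" where
  "ring_frac R S a s = {(b, t). b \<in> carrier R \<and> t \<in> S \<and>
     (\<exists>u\<in>S. u \<otimes>\<^bsub>R\<^esub> (a \<otimes>\<^bsub>R\<^esub> t \<ominus>\<^bsub>R\<^esub> b \<otimes>\<^bsub>R\<^esub> s) = \<zero>\<^bsub>R\<^esub>)}"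

definition localization :: "('a, 'm) ring_scheme \<Rightarrow> 'a set \<Rightarrow> ('a \<times> 'a) set ring" where
  "localization R S =
    \<lparr>carrier = {ring_frac R S a s |a s. a \<in> carrier R \<and> s \<in> S},
     monoid.mult = (\<lambda>x y. \<Union>(a, s)\<in>x. \<Union>(b, t)\<in>y. ring_frac R S (a \<otimes>\<^bsub>R\<^esub> b) (s \<otimes>\<^bsub>R\<^esub> t)),
     monoid.one = ring_frac R S \<one>\<^bsub>R\<^esub> \<one>\<^bsub>R\<^esub>,
     ring.zero = ring_frac R S \<zero>\<^bsub>R\<^esub> \<one>\<^bsub>R\<^esub>,
     ring.add = (\<lambda>x y. \<Union>(a, s)\<in>x. \<Union>(b, t)\<in>y.
              ring_frac R S (a \<otimes>\<^bsub>R\<^esub> t \<oplus>\<^bsub>R\<^esub> b \<otimes>\<^bsub>R\<^esub> s) (s \<otimes>\<^bsub>R\<^esub> t))\<rparr>"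

definition loc_at_prime :: "('a, 'm) ring_scheme \<Rightarrow> 'a set \<Rightarrow> ('a \<times> 'a) set ring" where
  "loc_at_prime R P = localization R (carrier R - P)"

definition max_ideal_at :: "('a, 'm) ring_scheme \<Rightarrow> 'a set \<Rightarrow> ('a \<times> 'a) set set" where
  "max_ideal_at R P = {ring_frac R (carrier R - P) a s |a s. a \<in> P \<and> s \<in> carrier R - P}"

definition quotient_field :: "('a, 'm) ring_scheme \<Rightarrow> ('a \<times> 'a) set ring" where
  "quotient_field R = localization R (carrier R - {\<zero>\<^bsub>R\<^esub>})"

definition into_quotient_field :: "('a, 'm) ring_scheme \<Rightarrow> 'a \<Rightarrow> ('a \<times> 'a) set" where
  "into_quotient_field R a = ring_frac R (carrier R - {\<zero>\<^bsub>R\<^esub>}) a \<one>\<^bsub>R\<^esub>"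

definition integral_over :: "('a, 'm) ring_scheme \<Rightarrow> ('a \<times> 'a) set \<Rightarrow> bool" where
  "integral_over R x \<longleftrightarrow> (\<exists>n>0. \<exists>c\<in>{..<n} \<rightarrow> carrier R.
     x [^]\<^bsub>quotient_field R\<^esub> (n::nat) \<oplus>\<^bsub>quotient_field R\<^esub>
       (\<Oplus>\<^bsub>quotient_field R\<^esub> i\<in>{..<n}.
          into_quotient_field R (c i) \<otimes>\<^bsub>quotient_field R\<^esub> x [^]\<^bsub>quotient_field R\<^esub> i)
     = \<zero>\<^bsub>quotient_field R\<^esub>)"

definition noetherian_normal_domain :: "('a, 'm) ring_scheme \<Rightarrow> bool" where
  "noetherian_normal_domain R \<longleftrightarrow> noetherian_domain R \<and>
     (\<forall>x\<in>carrier (quotient_field R). integral_over R x \<longrightarrow> x \<in> into_quotient_field R ` carrier R)"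


section \<open>Faithfully flat ring homomorphisms\<close>

text \<open>
  For a map \<open>f\<close> carrying the subgroup \<open>H\<close> of \<open>G\<close> into the subgroup \<open>K\<close> of \<open>G'\<close>,
  \<open>coset_map G' K f\<close> is the induced map from \<open>G Mod H\<close> to \<open>G' Mod K\<close>: the union below
  is then a single coset.
\<close>

definition coset_map :: "('b, 'n) monoid_scheme \<Rightarrow> 'b set \<Rightarrow> ('a \<Rightarrow> 'b) \<Rightarrow> 'a set \<Rightarrow> 'b set" where
  "coset_map G' K f C = (\<Union>x\<in>C. K #>\<^bsub>G'\<^esub> f x)"

definition linear_maps ::
  "('a, 'm) ring_scheme \<Rightarrow> ('a, 'b, 'k) module_scheme \<Rightarrow> ('a, 'c, 'l) module_scheme \<Rightarrow> ('b \<Rightarrow> 'c) set" where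
  "linear_maps R M N = {f \<in> hom (add_monoid M) (add_monoid N).
     \<forall>a\<in>carrier R. \<forall>x\<in>carrier M. f (a \<odot>\<^bsub>M\<^esub> x) = a \<odot>\<^bsub>N\<^esub> f x}"

definition tensor_relations ::
  "('a, 'm) ring_scheme \<Rightarrow> ('a, 'b, 'k) module_scheme \<Rightarrow> ('a, 'c, 'l) module_scheme
    \<Rightarrow> ('b \<times> 'c \<Rightarrow>\<^sub>0 int) set" where
  "tensor_relations R M N = generate (free_Abelian_group (carrier M \<times> carrier N))
     ({frag_of (x \<oplus>\<^bsub>M\<^esub> x', y) - frag_of (x, y) - frag_of (x', y) |x x' y.
         x \<in> carrier M \<and> x' \<in> carrier M \<and> y \<in> carrier N} \<union>
      {frag_of (x, y \<oplus>\<^bsub>N\<^esub> y') - frag_of (x, y) - frag_of (x, y') |x y y'.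
         x \<in> carrier M \<and> y \<in> carrier N \<and> y' \<in> carrier N} \<union>
      {frag_of (a \<odot>\<^bsub>M\<^esub> x, y) - frag_of (x, a \<odot>\<^bsub>N\<^esub> y) |a x y.
         a \<in> carrier R \<and> x \<in> carrier M \<and> y \<in> carrier N})"

text \<open>The underlying abelian group of the tensor product is all that exactness needs.\<close>

definition tensor_product ::
  "('a, 'm) ring_scheme \<Rightarrow> ('a, 'b, 'k) module_scheme \<Rightarrow> ('a, 'c, 'l) module_scheme
    \<Rightarrow> ('b \<times> 'c \<Rightarrow>\<^sub>0 int) set monoid" where
  "tensor_product R M N =
     free_Abelian_group (carrier M \<times> carrier N) Mod tensor_relations R M N"

text \<open>For \<open>f\<close> a linear map from \<open>M\<close> to \<open>M'\<close>, the map \<open>f \<otimes> id\<close> into \<open>M' \<otimes> N\<close>.\<close>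

definition tensor_map ::
  "('a, 'm) ring_scheme \<Rightarrow> ('a, 'b, 'k) module_scheme \<Rightarrow> ('a, 'c, 'l) module_scheme \<Rightarrow> ('d \<Rightarrow> 'b)
    \<Rightarrow> ('d \<times> 'c \<Rightarrow>\<^sub>0 int) set \<Rightarrow> ('b \<times> 'c \<Rightarrow>\<^sub>0 int) set" where
  "tensor_map R M' N f =
     coset_map (free_Abelian_group (carrier M' \<times> carrier N)) (tensor_relations R M' N)
       (frag_extend (\<lambda>(x, y). frag_of (f x, y)))"

definition as_module :: "('b, 'n) ring_scheme \<Rightarrow> ('a \<Rightarrow> 'b) \<Rightarrow> ('a, 'b) module" where
  "as_module A' \<phi> = \<lparr>carrier = carrier A', monoid.mult = monoid.mult A', monoid.one = monoid.one A',
     ring.zero = ring.zero A', ring.add = ring.add A', smult = (\<lambda>a x. \<phi> a \<otimes>\<^bsub>A'\<^esub> x)\<rparr>"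

text \<open>
  A sequence of \<open>A\<close>-modules is exact if and only if it is exact after tensoring with \<open>A'\<close>.
  HOL cannot quantify over modules of all types; the type \<open>(nat \<Rightarrow> 'a) set\<close> contains every
  countably generated \<open>A\<close>-module up to isomorphism (as the set of cosets of a submodule of the
  finitely supported sequences). This is no restriction: flatness is detected by the inclusions
  of ideals into \<open>A\<close>, and faithfulness by the quotients of \<open>A\<close>
  by maximal ideals.
\<close>

definition faithfully_flat ::
  "('a, 'm) ring_scheme \<Rightarrow> ('b, 'n) ring_scheme \<Rightarrow> ('a \<Rightarrow> 'b) \<Rightarrow> bool" where
  "faithfully_flat A A' \<phi> \<longleftrightarrow> \<phi> \<in> ring_hom A A' \<and>
     (\<forall>(M1 :: ('a, (nat \<Rightarrow> 'a) set) module) (M2 :: ('a, (nat \<Rightarrow> 'a) set) module)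
       (M3 :: ('a, (nat \<Rightarrow> 'a) set) module) f g.
       Module.module A M1 \<and> Module.module A M2 \<and> Module.module A M3 \<and>
       f \<in> linear_maps A M1 M2 \<and> g \<in> linear_maps A M2 M3 \<longrightarrow>
       (f ` carrier M1 = a_kernel M2 M3 g \<longleftrightarrow>
        tensor_map A M2 (as_module A' \<phi>) f ` carrier (tensor_product A M1 (as_module A' \<phi>)) =
        kernel (tensor_product A M2 (as_module A' \<phi>)) (tensor_product A M3 (as_module A' \<phi>))
          (tensor_map A M3 (as_module A' \<phi>) g)))"


section \<open>Ringed spaces and affine schemes\<close>

record ('p, 's) ringed_space =
  rs_top :: "'p topology"
  rs_sections :: "'p set \<Rightarrow> 's ring"
  rs_res :: "'p set \<Rightarrow> 'p set \<Rightarrow> 's \<Rightarrow> 's"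

text \<open>
  An isomorphism of ringed spaces between locally ringed spaces is automatically one of
  locally ringed spaces.
\<close>

definition ringed_space_isomorphic :: "('p, 's) ringed_space \<Rightarrow> ('q, 't) ringed_space \<Rightarrow> bool" where
  "ringed_space_isomorphic Z Y \<longleftrightarrow> (\<exists>f h.
     homeomorphic_map (rs_top Z) (rs_top Y) f \<and>
     (\<forall>V. openin (rs_top Y) V \<longrightarrow>
        h V \<in> ring_iso (rs_sections Y V) (rs_sections Z {x \<in> topspace (rs_top Z). f x \<in> V})) \<and>
     (\<forall>V W. openin (rs_top Y) V \<and> openin (rs_top Y) W \<and> W \<subseteq> V \<longrightarrow>
        (\<forall>s\<in>carrier (rs_sections Y V).
           h W (rs_res Y V W s) =
           rs_res Z {x \<in> topspace (rs_top Z). f x \<in> V} {x \<in> topspace (rs_top Z). f x \<in> W} (h V s))))"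

definition open_subspace :: "('p, 's) ringed_space \<Rightarrow> 'p set \<Rightarrow> ('p, 's) ringed_space" where
  "open_subspace Z U = Z\<lparr>rs_top := subtopology (rs_top Z) U\<rparr>"

definition prime_spectrum :: "('a, 'm) ring_scheme \<Rightarrow> 'a set set" where
  "prime_spectrum R = {P. primeideal P R}"

definition zariski_open :: "('a, 'm) ring_scheme \<Rightarrow> 'a set set \<Rightarrow> bool" where
  "zariski_open R U \<longleftrightarrow> (\<exists>T \<subseteq> carrier R. U = {P \<in> prime_spectrum R. \<not> T \<subseteq> P})"

lemma istopology_zariski_open: "istopology (zariski_open R)"
  unfolding istopology_def
proof (intro conjI allI impI)
  fix U V assume "zariski_open R U" "zariski_open R V"
  then obtain S T where S: "S \<subseteq> carrier R" "U = {P \<in> prime_spectrum R. \<not> S \<subseteq> P}"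
    and T: "T \<subseteq> carrier R" "V = {P \<in> prime_spectrum R. \<not> T \<subseteq> P}"
    unfolding zariski_open_def by blast
  define W where "W = {s \<otimes>\<^bsub>R\<^esub> t |s t. s \<in> S \<and> t \<in> T} \<inter> carrier R"
  have "(\<not> S \<subseteq> P \<and> \<not> T \<subseteq> P) \<longleftrightarrow> \<not> W \<subseteq> P" if "P \<in> prime_spectrum R" for P
  proof -
    interpret primeideal P R using that by (simp add: prime_spectrum_def)
    show ?thesis
    proof
      assume "\<not> S \<subseteq> P \<and> \<not> T \<subseteq> P"
      then obtain s t where st: "s \<in> S" "s \<notin> P" "t \<in> T" "t \<notin> P" by blast
      with S T have "s \<in> carrier R" "t \<in> carrier R" by auto
      with st I_prime have "s \<otimes>\<^bsub>R\<^esub> t \<notin> P" by blast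
      moreover have "s \<otimes>\<^bsub>R\<^esub> t \<in> W"
        unfolding W_def using st m_closed[OF \<open>s \<in> carrier R\<close> \<open>t \<in> carrier R\<close>] by blast
      ultimately show "\<not> W \<subseteq> P" by blast
    next
      assume "\<not> W \<subseteq> P"
      then obtain s t where st: "s \<in> S" "t \<in> T" "s \<otimes>\<^bsub>R\<^esub> t \<notin> P" unfolding W_def by blast
      with S T have "s \<in> carrier R" "t \<in> carrier R" by auto
      with st I_l_closed I_r_closed show "\<not> S \<subseteq> P \<and> \<not> T \<subseteq> P" by blast
    qed
  qed
  then have "U \<inter> V = {P \<in> prime_spectrum R. \<not> W \<subseteq> P}" using S T by auto
  moreover have "W \<subseteq> carrier R" by (simp add: W_def)
  ultimately show "zariski_open R (U \<inter> V)" unfolding zariski_open_def by blast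
next
  fix \<K> assume K: "\<forall>K\<in>\<K>. zariski_open R K"
  define W where "W = \<Union>{T. T \<subseteq> carrier R \<and> {P \<in> prime_spectrum R. \<not> T \<subseteq> P} \<in> \<K>}"
  have "P \<in> \<Union>\<K> \<longleftrightarrow> P \<in> prime_spectrum R \<and> \<not> W \<subseteq> P" for P
  proof
    assume "P \<in> \<Union>\<K>"
    then obtain K where "K \<in> \<K>" "P \<in> K" by blast
    moreover from this K obtain T where "T \<subseteq> carrier R" "K = {P \<in> prime_spectrum R. \<not> T \<subseteq> P}"
      unfolding zariski_open_def by blast
    ultimately have "T \<subseteq> W" "P \<in> prime_spectrum R" "\<not> T \<subseteq> P" unfolding W_def by auto
    then show "P \<in> prime_spectrum R \<and> \<not> W \<subseteq> P" by blast
  next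
    assume P: "P \<in> prime_spectrum R \<and> \<not> W \<subseteq> P"
    then obtain w T where "w \<in> T" "w \<notin> P" "{P \<in> prime_spectrum R. \<not> T \<subseteq> P} \<in> \<K>"
      unfolding W_def by blast
    moreover from this P have "P \<in> {P \<in> prime_spectrum R. \<not> T \<subseteq> P}" by blast
    ultimately show "P \<in> \<Union>\<K>" by blast
  qed
  then have "\<Union>\<K> = {P \<in> prime_spectrum R. \<not> W \<subseteq> P}" by blast
  moreover have "W \<subseteq> carrier R" unfolding W_def by blast
  ultimately show "zariski_open R (\<Union>\<K>)" unfolding zariski_open_def by blast
qed

definition zariski :: "('a, 'm) ring_scheme \<Rightarrow> 'a set topology" where
  "zariski R = topology (zariski_open R)"

lemma openin_zariski: "openin (zariski R) = zariski_open R"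
  unfolding zariski_def by (rule topology_inverse'[OF istopology_zariski_open])

text \<open>
  Sections over \<open>U\<close> are the functions on \<open>U\<close> with values in the local rings that are
  locally given by a fraction \<open>a/f\<close>.
\<close>

definition structure_sheaf ::
  "('a, 'm) ring_scheme \<Rightarrow> 'a set set \<Rightarrow> ('a set \<Rightarrow> ('a \<times> 'a) set) ring" where
  "structure_sheaf R U =
    \<lparr>carrier = {s \<in> (\<Pi>\<^sub>E P\<in>U. carrier (loc_at_prime R P)).
       \<forall>P\<in>U. \<exists>V a f. openin (zariski R) V \<and> P \<in> V \<and> V \<subseteq> U \<and> a \<in> carrier R \<and> f \<in> carrier R \<and>
         (\<forall>Q\<in>V. f \<notin> Q \<and> s Q = ring_frac R (carrier R - Q) a f)},
     monoid.mult = (\<lambda>s t. \<lambda>P\<in>U. s P \<otimes>\<^bsub>loc_at_prime R P\<^esub> t P),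
     monoid.one = (\<lambda>P\<in>U. \<one>\<^bsub>loc_at_prime R P\<^esub>),
     ring.zero = (\<lambda>P\<in>U. \<zero>\<^bsub>loc_at_prime R P\<^esub>),
     ring.add = (\<lambda>s t. \<lambda>P\<in>U. s P \<oplus>\<^bsub>loc_at_prime R P\<^esub> t P)\<rparr>"

definition Spec :: "('a, 'm) ring_scheme \<Rightarrow> ('a set, 'a set \<Rightarrow> ('a \<times> 'a) set) ringed_space" where
  "Spec R = \<lparr>rs_top = zariski R, rs_sections = structure_sheaf R, rs_res = (\<lambda>U V s. restrict s V)\<rparr>"

text \<open>
  Taking \<open>B\<close> over the type of the sections of \<open>Z\<close> is no restriction, since
  \<open>Z \<cong> Spec B\<close> forces \<open>B\<close> to be isomorphic to the ring of global sections of \<open>Z\<close>.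
\<close>

definition affine_ringed_space :: "('p, 's) ringed_space \<Rightarrow> bool" where
  "affine_ringed_space Z \<longleftrightarrow> (\<exists>B :: 's ring. cring B \<and> ringed_space_isomorphic Z (Spec B))"


section \<open>Weil divisors on the spectrum of a noetherian normal domain\<close>

definition prime_height :: "('a, 'm) ring_scheme \<Rightarrow> 'a set \<Rightarrow> enat" where
  "prime_height R P = Sup {enat n |n. \<exists>Q :: nat \<Rightarrow> 'a set.
     (\<forall>i\<le>n. Q i \<in> prime_spectrum R) \<and> (\<forall>i<n. Q i \<subset> Q (Suc i)) \<and> Q n = P}"

definition height_one_primes :: "('a, 'm) ring_scheme \<Rightarrow> 'a set set" where
  "height_one_primes R = {P \<in> prime_spectrum R. prime_height R P = 1}"

text \<open>The group law on \<open>Div R\<close> is the addition \<open>(+)\<close> of formal integer combinations.\<close>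

definition Div :: "('a, 'm) ring_scheme \<Rightarrow> ('a set \<Rightarrow>\<^sub>0 int) monoid" where
  "Div R = free_Abelian_group (height_one_primes R)"

text \<open>
  For \<open>P\<close> of height one, so that \<open>R\<^sub>P\<close> is a discrete valuation ring, the \<open>n\<close> with
  \<open>T R\<^sub>P = (P R\<^sub>P)^n\<close>, where \<open>T \<subseteq> R\<close> contains a nonzero element.
\<close>

definition order_at :: "('a, 'm) ring_scheme \<Rightarrow> 'a set \<Rightarrow> 'a set \<Rightarrow> nat" where
  "order_at R P T = (THE n. genideal (loc_at_prime R P) ((\<lambda>a. ring_frac R (carrier R - P) a \<one>\<^bsub>R\<^esub>) ` T)
     = max_ideal_at R P [^]\<^bsub>ideals_set (loc_at_prime R P)\<^esub> n)"

definition valuation :: "('a, 'm) ring_scheme \<Rightarrow> 'a set \<Rightarrow> 'a \<Rightarrow> nat" where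
  "valuation R P a = order_at R P {a}"

text \<open>The divisor of \<open>a/b\<close> in the quotient field has coefficient \<open>v\<^sub>P(a) - v\<^sub>P(b)\<close> at \<open>P\<close>.\<close>

definition principal_divisors :: "('a, 'm) ring_scheme \<Rightarrow> ('a set \<Rightarrow>\<^sub>0 int) set" where
  "principal_divisors R = {D \<in> carrier (Div R).
     \<exists>a\<in>carrier R - {\<zero>\<^bsub>R\<^esub>}. \<exists>b\<in>carrier R - {\<zero>\<^bsub>R\<^esub>}. \<forall>P\<in>height_one_primes R.
       Poly_Mapping.lookup D P = int (valuation R P a) - int (valuation R P b)}"

definition Cl :: "('a, 'm) ring_scheme \<Rightarrow> ('a set \<Rightarrow>\<^sub>0 int) set monoid" where
  "Cl R = Div R Mod principal_divisors R"

definition effective_divisor :: "('a, 'm) ring_scheme \<Rightarrow> ('a set \<Rightarrow>\<^sub>0 int) \<Rightarrow> bool" where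
  "effective_divisor R D \<longleftrightarrow> D \<in> carrier (Div R) \<and> (\<forall>P. Poly_Mapping.lookup D P \<ge> 0)"

definition linearly_equivalent ::
  "('a, 'm) ring_scheme \<Rightarrow> ('a set \<Rightarrow>\<^sub>0 int) \<Rightarrow> ('a set \<Rightarrow>\<^sub>0 int) \<Rightarrow> bool" where
  "linearly_equivalent R D D' \<longleftrightarrow> D - D' \<in> principal_divisors R"

text \<open>The closure of the point \<open>P\<close> consists of the primes containing \<open>P\<close>.\<close>

definition divisor_support :: "('a, 'm) ring_scheme \<Rightarrow> ('a set \<Rightarrow>\<^sub>0 int) \<Rightarrow> 'a set set" where
  "divisor_support R D = {Q \<in> prime_spectrum R. \<exists>P\<in>Poly_Mapping.keys D. P \<subseteq> Q}"

definition coaffine :: "('a, 'm) ring_scheme \<Rightarrow> ('a set \<Rightarrow>\<^sub>0 int) \<Rightarrow> bool" where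
  "coaffine R D \<longleftrightarrow> D \<in> carrier (Div R) \<and>
     (\<forall>D'. effective_divisor R D' \<and> linearly_equivalent R D' D \<longrightarrow>
        affine_ringed_space (open_subspace (Spec R) (prime_spectrum R - divisor_support R D')))"

definition property_K :: "('a, 'm) ring_scheme \<Rightarrow> ('a set \<Rightarrow>\<^sub>0 int) \<Rightarrow> bool" where
  "property_K R E \<longleftrightarrow> E \<in> carrier (Div R) \<and>
     (\<forall>n::int. coaffine R (frag_cmul n E) \<or> frag_cmul n E \<in> principal_divisors R)"

definition affinely_trivial :: "('a, 'm) ring_scheme \<Rightarrow> ('a set \<Rightarrow>\<^sub>0 int) \<Rightarrow> bool" where
  "affinely_trivial R D \<longleftrightarrow> D \<in> carrier (Div R) \<and>
     (\<forall>E. property_K R E \<longrightarrow> property_K R (D + E))"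

definition AKG :: "('a, 'm) ring_scheme \<Rightarrow> ('a set \<Rightarrow>\<^sub>0 int) set monoid" where
  "AKG R = Div R Mod Collect (affinely_trivial R)"


section \<open>Pull-back of divisors\<close>

definition height_one_primes_over ::
  "('a, 'm) ring_scheme \<Rightarrow> ('b, 'n) ring_scheme \<Rightarrow> ('a \<Rightarrow> 'b) \<Rightarrow> 'a set \<Rightarrow> 'b set set" where
  "height_one_primes_over A A' \<phi> p = {P \<in> height_one_primes A'. {a \<in> carrier A. \<phi> a \<in> P} = p}"

definition ramification_index :: "('b, 'n) ring_scheme \<Rightarrow> ('a \<Rightarrow> 'b) \<Rightarrow> 'b set \<Rightarrow> 'a set \<Rightarrow> nat" where
  "ramification_index A' \<phi> P p = order_at A' P (\<phi> ` p)"

text \<open>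
  The sum is finite, the primes over \<open>p\<close> of height one being minimal over \<open>p A'\<close>.
\<close>

definition pullback_divisor ::
  "('a, 'm) ring_scheme \<Rightarrow> ('b, 'n) ring_scheme \<Rightarrow> ('a \<Rightarrow> 'b) \<Rightarrow> ('a set \<Rightarrow>\<^sub>0 int) \<Rightarrow> ('b set \<Rightarrow>\<^sub>0 int)" where
  "pullback_divisor A A' \<phi> = frag_extend (\<lambda>p.
     \<Sum>P\<in>height_one_primes_over A A' \<phi> p.
       frag_cmul (int (ramification_index A' \<phi> P p)) (frag_of P))"

definition pullback_Cl ::
  "('a, 'm) ring_scheme \<Rightarrow> ('b, 'n) ring_scheme \<Rightarrow> ('a \<Rightarrow> 'b)
    \<Rightarrow> ('a set \<Rightarrow>\<^sub>0 int) set \<Rightarrow> ('b set \<Rightarrow>\<^sub>0 int) set" where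
  "pullback_Cl A A' \<phi> = coset_map (Div A') (principal_divisors A') (pullback_divisor A A' \<phi>)"

definition pullback_AKG ::
  "('a, 'm) ring_scheme \<Rightarrow> ('b, 'n) ring_scheme \<Rightarrow> ('a \<Rightarrow> 'b)
    \<Rightarrow> ('a set \<Rightarrow>\<^sub>0 int) set \<Rightarrow> ('b set \<Rightarrow>\<^sub>0 int) set" where
  "pullback_AKG A A' \<phi> = coset_map (Div A') (Collect (affinely_trivial A')) (pullback_divisor A A' \<phi>)"

end

theory Submission
  imports Defs
begin

text \<open>
  Write \<open>L(-N)\<close> for the divisorial ideal of an effective divisor \<open>N\<close>. For \<open>N = div b - D \<ge> 0\<close> the
  effective divisors equivalent to \<open>D\<close> are the \<open>div g - N\<close> with \<open>0 \<noteq> g \<in> L(-N)\<close>. An open set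
  \<open>Spec A - V(J)\<close> is affine iff \<open>J\<close> generates the unit ideal in its ring of sections. With \<open>a \<in> L(-N)\<close>
  nonzero and \<open>M = div a - N\<close>, coaffineness of \<open>D\<close> thus becomes
  \<open>\<forall>g\<in>L(-N). \<exists>m. a g^m \<in> L(-M) L(-(m+1)N)\<close>. The set of such \<open>g\<close> is an ideal, so it is enough to test generators
  of \<open>L(-N)\<close>. Divisorial ideals are finite colon ideals, so flat extension commutes with forming them, and
  faithful flatness lets the ideal membership descend. Hence \<open>D\<close> is coaffine iff \<open>p\<^sup>*D\<close> is.
  On an affine scheme principal divisors are coaffine, so the same holds for property (K); as every
  divisor on \<open>Spec A'\<close> is equivalent to some \<open>p\<^sup>*E\<close>, it holds for affine triviality too.
\<close>

section \<open>Localization\<close>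

text \<open>The element \<open>a\<close> and the divisor \<open>M\<close> are fixed before
  \<open>g\<close> is chosen. Dividing \<open>L(-D')\<close> by \<open>g/a\<close> gives
  \<open>L(-M)\<close>, which is independent of \<open>g\<close>, and poles along \<open>D'\<close>
  are cleared by powers of \<open>g\<close>; what remains is an ideal membership inside the ring in
  which only the element \<open>a g^m\<close> depends on \<open>g\<close>. This uniformity lets the
  condition be tested on generators and transported along \<phi>. Flatness enters through two
  exactness statements only: the sequence from \<open>{j \<in> J. j y \<in> I}\<close> through
  \<open>J\<close> to \<open>A/I\<close> makes extension commute with colon ideals, and the zero
  endomorphism of \<open>A/J\<close> shows that a proper ideal stays proper. Normality enters
  through complete integral closedness: for nonzero \<open>b\<close> a prime associated to
  \<open>R/bR\<close> then has a uniformizer and height one, so \<open>a/b\<close> lies in the ring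
  as soon as it does so at all height one primes. This ties divisors to divisibility. The
  contraction of a height one prime must be shown to be zero or of height one, since otherwise
  pull-back would not respect principal divisors.\<close>

lemma UN_const_on: "A \<noteq> {} \<Longrightarrow> (\<And>x. x \<in> A \<Longrightarrow> f x = c) \<Longrightarrow> (\<Union>x\<in>A. f x) = c"
  by auto

text \<open>Local rings and the quotient field are both localizations of this kind. Zero divisors
  are allowed, because the ring representing an affine scheme is an arbitrary commutative ring;
  hence the auxiliary factor \<open>u\<close> in every equality of fractions.\<close>

locale mult_closed = cring R for R (structure) +
  fixes S
  assumes S_sub: "S \<subseteq> carrier R" and S_one: "\<one> \<in> S"
    and S_mult: "s \<in> S \<Longrightarrow> t \<in> S \<Longrightarrow> s \<otimes> t \<in> S"
begin

abbreviation "frc \<equiv> ring_frac R S"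
abbreviation "loc \<equiv> localization R S"

lemma S_carr: "s \<in> S \<Longrightarrow> s \<in> carrier R"
  using S_sub by blast

lemma frac_mem_iff:
  "(b, t) \<in> frc a s \<longleftrightarrow> b \<in> carrier R \<and> t \<in> S \<and> (\<exists>u\<in>S. u \<otimes> (a \<otimes> t \<ominus> b \<otimes> s) = \<zero>)"
  by (simp add: ring_frac_def)

lemma frac_self: "a \<in> carrier R \<Longrightarrow> s \<in> S \<Longrightarrow> (a, s) \<in> frc a s"
  using S_one S_carr by (auto simp: frac_mem_iff a_minus_def r_neg intro!: bexI[of _ \<one>])

lemma frac_sym:
  assumes "a \<in> carrier R" "s \<in> S" "(b, t) \<in> frc a s"
  shows "(a, s) \<in> frc b t"
proof -
  obtain u where u: "b \<in> carrier R" "t \<in> S" "u \<in> S" "u \<otimes> (a \<otimes> t \<ominus> b \<otimes> s) = \<zero>"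
    using assms(3) by (auto simp: frac_mem_iff)
  have c: "a \<in> carrier R" "s \<in> carrier R" "b \<in> carrier R" "t \<in> carrier R" "u \<in> carrier R"
    using u assms S_carr by auto
  have "u \<otimes> (b \<otimes> s \<ominus> a \<otimes> t) = \<ominus> (u \<otimes> (a \<otimes> t \<ominus> b \<otimes> s))"
    using c by algebra
  then show ?thesis using u c assms by (auto simp: frac_mem_iff)
qed

lemma frac_trans:
  assumes "a \<in> carrier R" "s \<in> S" "(b, t) \<in> frc a s" "(c, r) \<in> frc b t"
  shows "(c, r) \<in> frc a s"
proof -
  obtain u where u: "b \<in> carrier R" "t \<in> S" "u \<in> S" "u \<otimes> (a \<otimes> t \<ominus> b \<otimes> s) = \<zero>"
    using assms(3) by (auto simp: frac_mem_iff)
  obtain v where v: "c \<in> carrier R" "r \<in> S" "v \<in> S" "v \<otimes> (b \<otimes> r \<ominus> c \<otimes> t) = \<zero>"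
    using assms(4) by (auto simp: frac_mem_iff)
  have k: "a \<in> carrier R" "s \<in> carrier R" "b \<in> carrier R" "t \<in> carrier R" "u \<in> carrier R"
    "c \<in> carrier R" "r \<in> carrier R" "v \<in> carrier R"
    using u v assms S_carr by auto
  \<comment> \<open>Eliminating the middle denominator \<open>t\<close> costs a factor that need not
    be cancellable, so it joins the witness.\<close>
  have "(u \<otimes> v \<otimes> t) \<otimes> (a \<otimes> r \<ominus> c \<otimes> s)
     = (v \<otimes> r) \<otimes> (u \<otimes> (a \<otimes> t \<ominus> b \<otimes> s)) \<oplus> (u \<otimes> s) \<otimes> (v \<otimes> (b \<otimes> r \<ominus> c \<otimes> t))"
    using k by algebra
  also have "\<dots> = \<zero>" using u v k by simp
  finally show ?thesis using u v S_mult by (auto simp: frac_mem_iff)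
qed

lemma frac_eqI:
  assumes "a \<in> carrier R" "s \<in> S" "(b, t) \<in> frc a s"
  shows "frc b t = frc a s"
proof -
  have "b \<in> carrier R" "t \<in> S" using assms(3) by (auto simp: frac_mem_iff)
  then show ?thesis
    using frac_trans[OF assms(1,2,3)] frac_trans[OF _ _ frac_sym[OF assms(1,2,3)]]
    by (intro subset_antisym subrelI) blast+
qed

lemma frac_eq_iff:
  assumes "a \<in> carrier R" "s \<in> S" "b \<in> carrier R" "t \<in> S"
  shows "frc a s = frc b t \<longleftrightarrow> (\<exists>u\<in>S. u \<otimes> (a \<otimes> t \<ominus> b \<otimes> s) = \<zero>)"
proof
  assume "frc a s = frc b t"
  then have "(b, t) \<in> frc a s" using frac_self assms by auto
  then show "\<exists>u\<in>S. u \<otimes> (a \<otimes> t \<ominus> b \<otimes> s) = \<zero>" by (simp add: frac_mem_iff)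
next
  assume "\<exists>u\<in>S. u \<otimes> (a \<otimes> t \<ominus> b \<otimes> s) = \<zero>"
  then show "frc a s = frc b t"
    using frac_eqI[of a s b t] assms by (auto simp: frac_mem_iff)
qed

lemma frac_eqI':
  assumes "a \<in> carrier R" "s \<in> S" "b \<in> carrier R" "t \<in> S" "a \<otimes> t = b \<otimes> s"
  shows "frc a s = frc b t"
  using assms S_one S_carr by (subst frac_eq_iff) (auto intro!: bexI[of _ \<one>] simp: a_minus_def r_neg)

lemma loc_carrierE:
  assumes "x \<in> carrier loc"
  obtains a s where "x = frc a s" "a \<in> carrier R" "s \<in> S"
  using assms by (auto simp: localization_def)

lemma frac_carrier [simp]: "a \<in> carrier R \<Longrightarrow> s \<in> S \<Longrightarrow> frc a s \<in> carrier loc"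
  by (auto simp: localization_def)

lemma loc_one: "\<one>\<^bsub>loc\<^esub> = frc \<one> \<one>"
  and loc_zero: "\<zero>\<^bsub>loc\<^esub> = frc \<zero> \<one>"
  by (simp_all add: localization_def)

text \<open>Only the left representative varies; both operations are commutative, so
  \<open>loc_mult\<close> and \<open>loc_add\<close> obtain the right one by swapping the
  arguments.\<close>

lemma frac_mult_cong:
  assumes "a \<in> carrier R" "s \<in> S" "b \<in> carrier R" "t \<in> S" "(a', s') \<in> frc a s"
  shows "frc (a' \<otimes> b) (s' \<otimes> t) = frc (a \<otimes> b) (s \<otimes> t)"
    and "frc (a' \<otimes> t \<oplus> b \<otimes> s') (s' \<otimes> t) = frc (a \<otimes> t \<oplus> b \<otimes> s) (s \<otimes> t)"
proof -
  obtain u where u: "a' \<in> carrier R" "s' \<in> S" "u \<in> S" "u \<otimes> (a \<otimes> s' \<ominus> a' \<otimes> s) = \<zero>"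
    using assms(5) by (auto simp: frac_mem_iff)
  have k: "a \<in> carrier R" "s \<in> carrier R" "b \<in> carrier R" "t \<in> carrier R" "u \<in> carrier R"
    "a' \<in> carrier R" "s' \<in> carrier R"
    using u assms S_carr by auto
  have "u \<otimes> ((a \<otimes> b) \<otimes> (s' \<otimes> t) \<ominus> (a' \<otimes> b) \<otimes> (s \<otimes> t)) = (b \<otimes> t) \<otimes> (u \<otimes> (a \<otimes> s' \<ominus> a' \<otimes> s))"
    using k by algebra
  then have "u \<otimes> ((a \<otimes> b) \<otimes> (s' \<otimes> t) \<ominus> (a' \<otimes> b) \<otimes> (s \<otimes> t)) = \<zero>" using u k by simp
  then show "frc (a' \<otimes> b) (s' \<otimes> t) = frc (a \<otimes> b) (s \<otimes> t)"
    using u S_mult assms by (intro frac_eqI) (auto simp: frac_mem_iff)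
  have "(a \<otimes> t \<oplus> b \<otimes> s) \<otimes> (s' \<otimes> t) = (a \<otimes> s') \<otimes> (t \<otimes> t) \<oplus> (b \<otimes> s) \<otimes> (s' \<otimes> t)"
    "(a' \<otimes> t \<oplus> b \<otimes> s') \<otimes> (s \<otimes> t) = (a' \<otimes> s) \<otimes> (t \<otimes> t) \<oplus> (b \<otimes> s) \<otimes> (s' \<otimes> t)"
    using k by (simp_all add: l_distr r_distr m_ac a_ac)
  moreover have "(x \<otimes> y \<oplus> z) \<ominus> (x' \<otimes> y \<oplus> z) = y \<otimes> (x \<ominus> x')"
    if "x \<in> carrier R" "x' \<in> carrier R" "y \<in> carrier R" "z \<in> carrier R" for x x' y z
    using that by algebra
  ultimately have "(a \<otimes> t \<oplus> b \<otimes> s) \<otimes> (s' \<otimes> t) \<ominus> (a' \<otimes> t \<oplus> b \<otimes> s') \<otimes> (s \<otimes> t)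
    = (t \<otimes> t) \<otimes> (a \<otimes> s' \<ominus> a' \<otimes> s)" using k by simp
  then have "u \<otimes> ((a \<otimes> t \<oplus> b \<otimes> s) \<otimes> (s' \<otimes> t) \<ominus> (a' \<otimes> t \<oplus> b \<otimes> s') \<otimes> (s \<otimes> t))
    = u \<otimes> ((t \<otimes> t) \<otimes> (a \<otimes> s' \<ominus> a' \<otimes> s))" by (simp only:)
  also have "\<dots> = (t \<otimes> t) \<otimes> (u \<otimes> (a \<otimes> s' \<ominus> a' \<otimes> s))" using k by (intro m_lcomm) auto
  finally have "u \<otimes> ((a \<otimes> t \<oplus> b \<otimes> s) \<otimes> (s' \<otimes> t) \<ominus> (a' \<otimes> t \<oplus> b \<otimes> s') \<otimes> (s \<otimes> t)) = \<zero>"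
    using u k by simp
  then show "frc (a' \<otimes> t \<oplus> b \<otimes> s') (s' \<otimes> t) = frc (a \<otimes> t \<oplus> b \<otimes> s) (s \<otimes> t)"
    using u S_mult assms k by (intro frac_eqI) (auto simp: frac_mem_iff)
qed

lemma loc_mult:
  assumes a: "a \<in> carrier R" "s \<in> S" and b: "b \<in> carrier R" "t \<in> S"
  shows "frc a s \<otimes>\<^bsub>loc\<^esub> frc b t = frc (a \<otimes> b) (s \<otimes> t)"
proof -
  have *: "frc (a' \<otimes> b') (s' \<otimes> t') = frc (a \<otimes> b) (s \<otimes> t)"
    if m: "(a', s') \<in> frc a s" "(b', t') \<in> frc b t" for a' s' b' t'
  proof -
    have k: "a' \<in> carrier R" "s' \<in> S" "b' \<in> carrier R" "t' \<in> S" using m by (auto simp: frac_mem_iff)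
    have "frc (a' \<otimes> b') (s' \<otimes> t') = frc (a \<otimes> b') (s \<otimes> t')" by (rule frac_mult_cong) (use a k m in auto)
    also have "\<dots> = frc (b' \<otimes> a) (t' \<otimes> s)" using k a S_carr by (simp add: m_comm)
    also have "\<dots> = frc (b \<otimes> a) (t \<otimes> s)" by (rule frac_mult_cong) (use a b m in auto)
    finally show ?thesis using a b S_carr by (simp add: m_comm)
  qed
  have ne: "frc a s \<noteq> {}" "frc b t \<noteq> {}" using frac_self assms by auto
  \<comment> \<open>The product is a union over all representatives; by \<open>*\<close> every
    member of the union is the same class.\<close>
  show ?thesis
    unfolding localization_def monoid.simps
    by (rule UN_const_on[OF ne(1)], clarsimp, rule UN_const_on[OF ne(2)], clarsimp, rule *)
qed

lemma loc_add:
  assumes a: "a \<in> carrier R" "s \<in> S" and b: "b \<in> carrier R" "t \<in> S"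
  shows "frc a s \<oplus>\<^bsub>loc\<^esub> frc b t = frc (a \<otimes> t \<oplus> b \<otimes> s) (s \<otimes> t)"
proof -
  have *: "frc (a' \<otimes> t' \<oplus> b' \<otimes> s') (s' \<otimes> t') = frc (a \<otimes> t \<oplus> b \<otimes> s) (s \<otimes> t)"
    if m: "(a', s') \<in> frc a s" "(b', t') \<in> frc b t" for a' s' b' t'
  proof -
    have k: "a' \<in> carrier R" "s' \<in> S" "b' \<in> carrier R" "t' \<in> S" using m by (auto simp: frac_mem_iff)
    have "frc (a' \<otimes> t' \<oplus> b' \<otimes> s') (s' \<otimes> t') = frc (a \<otimes> t' \<oplus> b' \<otimes> s) (s \<otimes> t')"
      by (rule frac_mult_cong) (use a k m in auto)
    also have "\<dots> = frc (b' \<otimes> s \<oplus> a \<otimes> t') (t' \<otimes> s)" using k a S_carr by (simp add: m_comm a_comm)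
    also have "\<dots> = frc (b \<otimes> s \<oplus> a \<otimes> t) (t \<otimes> s)" by (rule frac_mult_cong) (use a b m in auto)
    finally show ?thesis using a b S_carr by (simp add: m_comm a_comm)
  qed
  have ne: "frc a s \<noteq> {}" "frc b t \<noteq> {}" using frac_self assms by auto
  show ?thesis
    unfolding localization_def ring.simps
    by (rule UN_const_on[OF ne(1)], clarsimp, rule UN_const_on[OF ne(2)], clarsimp, rule *)
qed

lemma loc_cring: "cring loc"
proof (rule cringI)
  show "abelian_group loc"
  proof (rule abelian_groupI)
    fix x y z assume x: "x \<in> carrier loc" and y: "y \<in> carrier loc" and z: "z \<in> carrier loc"
    obtain a s where [simp]: "x = frc a s" and a: "a \<in> carrier R" "s \<in> S" using x by (rule loc_carrierE)
    obtain b t where [simp]: "y = frc b t" and b: "b \<in> carrier R" "t \<in> S" using y by (rule loc_carrierE)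
    obtain c r where [simp]: "z = frc c r" and c: "c \<in> carrier R" "r \<in> S" using z by (rule loc_carrierE)
    note k = a(1) b(1) c(1) S_carr[OF a(2)] S_carr[OF b(2)] S_carr[OF c(2)]
    have "(a \<otimes> t \<oplus> b \<otimes> s) \<otimes> r \<oplus> c \<otimes> (s \<otimes> t) = a \<otimes> (t \<otimes> r) \<oplus> (b \<otimes> r \<oplus> c \<otimes> t) \<otimes> s"
      "s \<otimes> t \<otimes> r = s \<otimes> (t \<otimes> r)" "a \<otimes> t \<oplus> b \<otimes> s = b \<otimes> s \<oplus> a \<otimes> t" "s \<otimes> t = t \<otimes> s"
      using k by (simp_all add: l_distr r_distr m_ac a_ac)
    then show "x \<oplus>\<^bsub>loc\<^esub> y \<oplus>\<^bsub>loc\<^esub> z = x \<oplus>\<^bsub>loc\<^esub> (y \<oplus>\<^bsub>loc\<^esub> z)" "x \<oplus>\<^bsub>loc\<^esub> y = y \<oplus>\<^bsub>loc\<^esub> x"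
      using a b c k S_mult by (simp_all add: loc_add)
    show "x \<oplus>\<^bsub>loc\<^esub> y \<in> carrier loc" using a b k S_mult by (simp add: loc_add)
  next
    show "\<zero>\<^bsub>loc\<^esub> \<in> carrier loc" using S_one by (simp add: loc_zero)
  next
    fix x assume x: "x \<in> carrier loc"
    obtain a s where [simp]: "x = frc a s" and a: "a \<in> carrier R" "s \<in> S" using x by (rule loc_carrierE)
    note k = a(1) S_carr[OF a(2)]
    show "\<zero>\<^bsub>loc\<^esub> \<oplus>\<^bsub>loc\<^esub> x = x" using a k S_one by (simp add: loc_zero loc_add)
    have "frc (\<ominus> a) s \<oplus>\<^bsub>loc\<^esub> x = frc (\<ominus> a \<otimes> s \<oplus> a \<otimes> s) (s \<otimes> s)"
      using a by (simp add: loc_add)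
    also have "\<ominus> a \<otimes> s \<oplus> a \<otimes> s = \<zero>" using k by algebra
    also have "frc \<zero> (s \<otimes> s) = \<zero>\<^bsub>loc\<^esub>"
      unfolding loc_zero using a k S_mult S_one by (intro frac_eqI') auto
    finally show "\<exists>y\<in>carrier loc. y \<oplus>\<^bsub>loc\<^esub> x = \<zero>\<^bsub>loc\<^esub>" using a by (intro bexI[of _ "frc (\<ominus> a) s"]) auto
  qed
  show "comm_monoid loc"
  proof (rule comm_monoidI)
    fix x y z assume x: "x \<in> carrier loc" and y: "y \<in> carrier loc" and z: "z \<in> carrier loc"
    obtain a s where [simp]: "x = frc a s" and a: "a \<in> carrier R" "s \<in> S" using x by (rule loc_carrierE)
    obtain b t where [simp]: "y = frc b t" and b: "b \<in> carrier R" "t \<in> S" using y by (rule loc_carrierE)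
    obtain c r where [simp]: "z = frc c r" and c: "c \<in> carrier R" "r \<in> S" using z by (rule loc_carrierE)
    note k = a(1) b(1) c(1) S_carr[OF a(2)] S_carr[OF b(2)] S_carr[OF c(2)]
    show "x \<otimes>\<^bsub>loc\<^esub> y \<otimes>\<^bsub>loc\<^esub> z = x \<otimes>\<^bsub>loc\<^esub> (y \<otimes>\<^bsub>loc\<^esub> z)" "x \<otimes>\<^bsub>loc\<^esub> y = y \<otimes>\<^bsub>loc\<^esub> x"
      "x \<otimes>\<^bsub>loc\<^esub> y \<in> carrier loc"
      using a b c k S_mult by (simp_all add: loc_mult m_ac)
  next
    show "\<one>\<^bsub>loc\<^esub> \<in> carrier loc" using S_one by (simp add: loc_one)
  next
    fix x assume x: "x \<in> carrier loc"
    obtain a s where [simp]: "x = frc a s" and a: "a \<in> carrier R" "s \<in> S" using x by (rule loc_carrierE)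
    show "\<one>\<^bsub>loc\<^esub> \<otimes>\<^bsub>loc\<^esub> x = x" using a S_carr[OF a(2)] S_one by (simp add: loc_one loc_mult)
  qed
  fix x y z assume x: "x \<in> carrier loc" and y: "y \<in> carrier loc" and z: "z \<in> carrier loc"
  obtain a s where [simp]: "x = frc a s" and a: "a \<in> carrier R" "s \<in> S" using x by (rule loc_carrierE)
  obtain b t where [simp]: "y = frc b t" and b: "b \<in> carrier R" "t \<in> S" using y by (rule loc_carrierE)
  obtain c r where [simp]: "z = frc c r" and c: "c \<in> carrier R" "r \<in> S" using z by (rule loc_carrierE)
  note k = a(1) b(1) c(1) S_carr[OF a(2)] S_carr[OF b(2)] S_carr[OF c(2)]
  \<comment> \<open>The two sides carry the denominators \<open>(s t) r\<close> and
    \<open>(s r)(t r)\<close>, so distributivity is checked by cross-multiplication.\<close>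
  have eq: "((a \<otimes> t \<oplus> b \<otimes> s) \<otimes> c) \<otimes> ((s \<otimes> r) \<otimes> (t \<otimes> r)) = ((a \<otimes> c) \<otimes> (t \<otimes> r) \<oplus> (b \<otimes> c) \<otimes> (s \<otimes> r)) \<otimes> ((s \<otimes> t) \<otimes> r)"
    using k by (simp add: l_distr r_distr m_ac)
  show "(x \<oplus>\<^bsub>loc\<^esub> y) \<otimes>\<^bsub>loc\<^esub> z = x \<otimes>\<^bsub>loc\<^esub> z \<oplus>\<^bsub>loc\<^esub> y \<otimes>\<^bsub>loc\<^esub> z"
    using a b c k S_mult by (simp add: loc_mult loc_add) (intro frac_eqI' eq; simp)
qed

lemma loc_pow:
  assumes "a \<in> carrier R" "s \<in> S"
  shows "frc a s [^]\<^bsub>loc\<^esub> (n::nat) = frc (a [^] n) (s [^] n)" "s [^] n \<in> S"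
proof -
  interpret L: cring loc by (rule loc_cring)
  have "frc a s [^]\<^bsub>loc\<^esub> (n::nat) = frc (a [^] n) (s [^] n) \<and> s [^] n \<in> S"
    using assms S_carr S_mult S_one by (induction n) (simp_all add: loc_one loc_mult)
  then show "frc a s [^]\<^bsub>loc\<^esub> (n::nat) = frc (a [^] n) (s [^] n)" "s [^] n \<in> S" by auto
qed

end

section \<open>Existence of prime ideals and the ascending chain condition\<close>

lemma mult_closed_prime:
  assumes "primeideal P R" shows "mult_closed R (carrier R - P)"
proof -
  interpret primeideal P R by fact
  show ?thesis
    by unfold_locales (use I_prime I_notcarr one_imp_carrier in blast)+
qed

lemma (in domain) mult_closed_nonzero: "mult_closed R (carrier R - {\<zero>})"
  by unfold_locales (auto simp: integral_iff)

text \<open>An ideal maximal among those containing \<open>I\<close> and missing \<open>S\<close> is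
  prime: two elements outside it give sums \<open>m \<oplus> r a\<close> and
  \<open>n \<oplus> q b\<close> in \<open>S\<close>, whose product would lie in the ideal if
  \<open>a b\<close> did.\<close>

lemma (in mult_closed) exists_prime_avoiding:
  assumes I: "ideal I R" and disj: "I \<inter> S = {}"
  obtains P where "primeideal P R" "I \<subseteq> P" "P \<inter> S = {}"
proof -
  define F where "F = {J. ideal J R \<and> I \<subseteq> J \<and> J \<inter> S = {}}"
  have "\<exists>M\<in>F. \<forall>Y\<in>F. M \<subseteq> Y \<longrightarrow> Y = M"
  proof (rule subset_Zorn_nonempty)
    show "F \<noteq> {}" using assms by (auto simp: F_def)
    fix C assume C: "C \<noteq> {}" "subset.chain F C"
    then have CF: "C \<subseteq> F" by (simp add: subset.chain_def)
    have "subset.chain {I. ideal I R} C"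
      using C unfolding subset.chain_def F_def by blast
    then have "ideal (\<Union>C) R" using chain_Union_is_ideal[of C] C(1) by auto
    then show "\<Union>C \<in> F" using C(1) CF unfolding F_def by blast
  qed
  then obtain M where MF: "M \<in> F" and maxF: "\<forall>Y\<in>F. M \<subseteq> Y \<longrightarrow> Y = M" by blast
  have M: "ideal M R" "I \<subseteq> M" "M \<inter> S = {}" using MF by (auto simp: F_def)
  have max: "Y = M" if "ideal Y R" "M \<subseteq> Y" "Y \<inter> S = {}" for Y
    using maxF that M(2) by (auto simp: F_def)
  interpret M: ideal M R by (rule M)
  have key: "\<exists>s\<in>S. \<exists>m\<in>M. \<exists>r\<in>carrier R. s = m \<oplus> r \<otimes> a" if a: "a \<in> carrier R" "a \<notin> M" for a
  proof (rule ccontr)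
    assume neg: "\<not> ?thesis"
    have id: "ideal (M <+>\<^bsub>R\<^esub> PIdl a) R" by (intro add_ideals M(1) cgenideal_ideal a)
    have "M \<subseteq> M <+>\<^bsub>R\<^esub> PIdl a"
    proof
      fix m assume "m \<in> M"
      then have "m = m \<oplus> \<zero> \<otimes> a" using a M.Icarr by simp
      then show "m \<in> M <+>\<^bsub>R\<^esub> PIdl a"
        using \<open>m \<in> M\<close> unfolding set_add_def' cgenideal_def by blast
    qed
    moreover have "(M <+>\<^bsub>R\<^esub> PIdl a) \<inter> S = {}"
      using neg unfolding set_add_def' cgenideal_def by auto
    ultimately have "M <+>\<^bsub>R\<^esub> PIdl a = M" using max id by blast
    moreover have "a = \<zero> \<oplus> \<one> \<otimes> a" using a by simp
    then have "a \<in> M <+>\<^bsub>R\<^esub> PIdl a"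
      using M.zero_closed unfolding set_add_def' cgenideal_def by blast
    ultimately show False using a by simp
  qed
  have "primeideal M R"
  proof (rule primeidealI[OF M(1) is_cring])
    show "carrier R \<noteq> M" using M(3) S_one S_carr by auto
    fix a b assume ab: "a \<in> carrier R" "b \<in> carrier R" "a \<otimes> b \<in> M"
    show "a \<in> M \<or> b \<in> M"
    proof (rule ccontr)
      assume "\<not> (a \<in> M \<or> b \<in> M)"
      then have "a \<notin> M" "b \<notin> M" by auto
      obtain s m r t n q where *: "s \<in> S" "m \<in> M" "r \<in> carrier R" "s = m \<oplus> r \<otimes> a"
        "t \<in> S" "n \<in> M" "q \<in> carrier R" "t = n \<oplus> q \<otimes> b"
        using key[OF ab(1) \<open>a \<notin> M\<close>] key[OF ab(2) \<open>b \<notin> M\<close>] by blast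
      have mn: "s \<in> carrier R" "t \<in> carrier R" "m \<in> carrier R" "n \<in> carrier R" using *(1,2,5,6) M.Icarr S_carr by auto
      have "s \<otimes> t = m \<otimes> (n \<oplus> q \<otimes> b) \<oplus> ((r \<otimes> a) \<otimes> n \<oplus> (r \<otimes> q) \<otimes> (a \<otimes> b))"
        unfolding *(4,8) using mn *(3,7) ab by (simp add: l_distr r_distr m_ac a_ac)
      also have "\<dots> \<in> M" using *(2,3,6,7) ab mn(3,4) by (auto intro!: M.a_closed M.I_l_closed[of "a \<otimes> b"] M.I_l_closed[of n] M.I_r_closed[of m])
      finally show False using M(3) S_mult * by blast
    qed
  qed
  then show ?thesis using that M by blast
qed

lemma (in cring) exists_prime_above:
  assumes "ideal I R" "\<one> \<notin> I"
  obtains P where "primeideal P R" "I \<subseteq> P"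
proof -
  interpret mult_closed R "{\<one>}" by unfold_locales auto
  show ?thesis using exists_prime_avoiding[of I] assms that by auto
qed

text \<open>An element of all primes above \<open>I\<close> has a power in \<open>I\<close>. In this
  contrapositive form the fact supplies the exponents when denominators are cleared.\<close>

lemma (in cring) exists_prime_avoiding_powers:
  assumes "ideal I R" "g \<in> carrier R" "\<And>n::nat. g [^] n \<notin> I"
  obtains P where "primeideal P R" "I \<subseteq> P" "g \<notin> P"
proof -
  have one: "\<exists>n::nat. \<one> = g [^] n" by (rule exI[of _ 0]) simp
  have mul: "\<exists>k::nat. g [^] m \<otimes> g [^] n = g [^] k" for m n :: nat
    by (rule exI[of _ "m + n"]) (simp add: nat_pow_mult assms(2))
  interpret mult_closed R "{g [^] n |n::nat. True}"
    by unfold_locales (use one mul assms(2) in auto)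
  have g: "g \<in> {g [^] n |n::nat. True}"
    by (rule CollectI, rule exI[of _ 1]) (simp add: assms(2))
  have "I \<inter> {g [^] n |n::nat. True} = {}" using assms(3) by auto
  then obtain P where P: "primeideal P R" "I \<subseteq> P" "P \<inter> {g [^] n |n::nat. True} = {}"
    by (rule exists_prime_avoiding[OF assms(1)])
  have "g \<notin> P" using P(3) g by blast
  then show ?thesis by (rule that[OF P(1,2)])
qed

text \<open>The chain condition in the form used for noetherian induction: a counterexample or an
  annihilator is chosen maximal.\<close>

lemma (in noetherian_ring) exists_maximal_ideal_in:
  assumes "F \<noteq> {}" "\<And>I. I \<in> F \<Longrightarrow> ideal I R"
  shows "\<exists>M\<in>F. \<forall>J\<in>F. M \<subseteq> J \<longrightarrow> J = M"
proof (rule subset_Zorn)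
    fix C assume C: "subset.chain F C"
    show "\<exists>U\<in>F. \<forall>Y\<in>C. Y \<subseteq> U"
    proof (cases "C = {}")
      case True then show ?thesis using assms(1) by auto
    next
      case False
      have "subset.chain {I. ideal I R} C"
        using C assms(2) unfolding subset.chain_def by blast
      then have "\<Union>C \<in> C" by (rule ideal_chain_is_trivial[OF False])
      moreover have "C \<subseteq> F" using C by (simp add: subset.chain_def)
      ultimately show ?thesis by (intro bexI[of _ "\<Union>C"]) auto
    qed
qed

text \<open>This is the colon ideal \<open>(bR : a)\<close>, the annihilator of \<open>a\<close> in
  \<open>R/bR\<close>. Annihilators in \<open>R/bR\<close> are handled through such divisibility
  conditions.\<close>

lemma (in cring) divides_ideal:
  assumes "b \<in> carrier R" "a \<in> carrier R"
  shows "ideal {y \<in> carrier R. b divides y \<otimes> a} R"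
proof (rule idealI[OF ring_axioms])
  show "subgroup {y \<in> carrier R. b divides y \<otimes> a} (add_monoid R)"
  proof (rule subgroup.intro)
    fix x y assume "x \<in> {y \<in> carrier R. b divides y \<otimes> a}" "y \<in> {y \<in> carrier R. b divides y \<otimes> a}"
    then obtain u v where *: "x \<in> carrier R" "y \<in> carrier R" "u \<in> carrier R" "v \<in> carrier R"
      "x \<otimes> a = b \<otimes> u" "y \<otimes> a = b \<otimes> v" by (auto elim!: dividesE)
    have "(x \<oplus> y) \<otimes> a = b \<otimes> (u \<oplus> v)" using * assms by (simp add: l_distr r_distr)
    then show "x \<otimes>\<^bsub>add_monoid R\<^esub> y \<in> {y \<in> carrier R. b divides y \<otimes> a}"
      using * by (auto intro: dividesI[of "u \<oplus> v"])
  next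
    have "\<zero> \<otimes> a = b \<otimes> \<zero>" using assms by simp
    then show "\<one>\<^bsub>add_monoid R\<^esub> \<in> {y \<in> carrier R. b divides y \<otimes> a}"
      by (auto intro: dividesI[of \<zero>])
  next
    fix x assume "x \<in> {y \<in> carrier R. b divides y \<otimes> a}"
    then obtain u where *: "x \<in> carrier R" "u \<in> carrier R" "x \<otimes> a = b \<otimes> u" by (auto elim!: dividesE)
    have "(\<ominus> x) \<otimes> a = b \<otimes> (\<ominus> u)" using * assms by (simp add: l_minus r_minus)
    then show "inv\<^bsub>add_monoid R\<^esub> x \<in> {y \<in> carrier R. b divides y \<otimes> a}"
      using * by (auto simp flip: a_inv_def intro: dividesI[of "\<ominus> u"])
  qed auto
  fix x r assume "x \<in> {y \<in> carrier R. b divides y \<otimes> a}" and r: "r \<in> carrier R"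
  then obtain u where *: "x \<in> carrier R" "u \<in> carrier R" "x \<otimes> a = b \<otimes> u" by (auto elim!: dividesE)
  have "(r \<otimes> x) \<otimes> a = r \<otimes> (x \<otimes> a)" using * r assms by (simp add: m_assoc)
  also have "\<dots> = b \<otimes> (r \<otimes> u)" using * r assms by (simp add: m_lcomm)
  finally show "r \<otimes> x \<in> {y \<in> carrier R. b divides y \<otimes> a}" using * r by (auto intro: dividesI[of "r \<otimes> u"])
  then show "x \<otimes> r \<in> {y \<in> carrier R. b divides y \<otimes> a}" using * r by (simp add: m_comm)
qed

section \<open>Normal domains\<close>

locale normal_domain = noetherian_domain R for R (structure) +
  assumes normal: "x \<in> carrier (quotient_field R) \<Longrightarrow> integral_over R x
    \<Longrightarrow> x \<in> into_quotient_field R ` carrier R"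

lemma normal_domain_iff: "noetherian_normal_domain R \<longleftrightarrow> normal_domain R"
  by (auto simp: noetherian_normal_domain_def normal_domain_def normal_domain_axioms_def)

lemma (in mult_closed) loc_finsum:
  assumes "finite I" "\<And>i. i \<in> I \<Longrightarrow> f i \<in> carrier R" "s \<in> S"
  shows "(\<Oplus>\<^bsub>loc\<^esub>i\<in>I. frc (f i) s) = frc (\<Oplus>i\<in>I. f i) s"
proof -
  interpret L: cring loc by (rule loc_cring)
  show ?thesis using assms(1,2)
  proof (induction I)
    case empty
    have "frc \<zero> s = frc \<zero> \<one>" using assms(3) S_one S_carr by (intro frac_eqI') auto
    then show ?case by (simp add: loc_zero)
  next
    case (insert x F)
    have c: "f x \<in> carrier R" "(\<Oplus>i\<in>F. f i) \<in> carrier R" "s \<in> carrier R"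
      using insert assms(3) S_carr by (auto intro!: finsum_closed)
    have "(\<Oplus>\<^bsub>loc\<^esub>i\<in>insert x F. frc (f i) s) = frc (f x) s \<oplus>\<^bsub>loc\<^esub> frc (\<Oplus>i\<in>F. f i) s"
      using insert assms(3) by (subst L.finsum_insert) auto
    also have "\<dots> = frc (f x \<otimes> s \<oplus> (\<Oplus>i\<in>F. f i) \<otimes> s) (s \<otimes> s)" using c assms(3) by (simp add: loc_add)
    also have "\<dots> = frc (f x \<oplus> (\<Oplus>i\<in>F. f i)) s"
      using c assms(3) S_mult by (intro frac_eqI') (auto simp: l_distr r_distr m_ac)
    finally show ?case using insert by (subst finsum_insert) auto
  qed
qed

text \<open>An explicit form of the ideal generated by the \<open>y i\<close>. It keeps the
  coefficients visible, and these become the coefficients of an integral equation.\<close>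

lemma (in cring) linear_combinations_ideal:
  assumes "finite I" "\<And>i. i \<in> I \<Longrightarrow> y i \<in> carrier R"
  shows "ideal {(\<Oplus>i\<in>I. r i \<otimes> y i) |r. r \<in> I \<rightarrow> carrier R} R" (is "ideal ?J R")
proof (rule idealI[OF ring_axioms])
  have fc: "(\<Oplus>i\<in>I. r i \<otimes> y i) \<in> carrier R" if "r \<in> I \<rightarrow> carrier R" for r
    using that assms by (intro finsum_closed) auto
  have mem: "(\<Oplus>i\<in>I. r i \<otimes> y i) \<in> ?J" if "r \<in> I \<rightarrow> carrier R" for r using that by blast
  have smult: "x \<otimes> (\<Oplus>i\<in>I. r i \<otimes> y i) = (\<Oplus>i\<in>I. (x \<otimes> r i) \<otimes> y i)"
    if "r \<in> I \<rightarrow> carrier R" "x \<in> carrier R" for r x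
    using that assms by (subst finsum_rdistr) (auto intro!: finsum_cong' simp: m_assoc Pi_iff)
  have scl: "x \<otimes> a \<in> ?J" if a: "a \<in> ?J" and x: "x \<in> carrier R" for a x
  proof -
    obtain r where r: "a = (\<Oplus>i\<in>I. r i \<otimes> y i)" "r \<in> I \<rightarrow> carrier R" using a by blast
    have "(\<lambda>i. x \<otimes> r i) \<in> I \<rightarrow> carrier R" using r x by auto
    then show ?thesis unfolding r(1) smult[OF r(2) x] by (rule mem)
  qed
  have car: "a \<in> carrier R" if "a \<in> ?J" for a using that fc by auto
  show "subgroup ?J (add_monoid R)"
  proof (rule subgroup.intro)
    show "?J \<subseteq> carrier (add_monoid R)" using car by auto
    fix a b assume "a \<in> ?J" "b \<in> ?J"
    then obtain r q where r: "a = (\<Oplus>i\<in>I. r i \<otimes> y i)" "r \<in> I \<rightarrow> carrier R"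
      and q: "b = (\<Oplus>i\<in>I. q i \<otimes> y i)" "q \<in> I \<rightarrow> carrier R" by blast
    have "a \<oplus> b = (\<Oplus>i\<in>I. r i \<otimes> y i \<oplus> q i \<otimes> y i)"
      unfolding r q using r q assms by (subst finsum_addf) auto
    also have "\<dots> = (\<Oplus>i\<in>I. (r i \<oplus> q i) \<otimes> y i)"
      using r q assms by (intro finsum_cong') (auto simp: l_distr Pi_iff)
    finally have "a \<oplus> b = (\<Oplus>i\<in>I. (r i \<oplus> q i) \<otimes> y i)" .
    moreover have "(\<lambda>i. r i \<oplus> q i) \<in> I \<rightarrow> carrier R" using r q by auto
    ultimately have "a \<oplus> b \<in> ?J" using mem[of "\<lambda>i. r i \<oplus> q i"] by simp
    then show "a \<otimes>\<^bsub>add_monoid R\<^esub> b \<in> ?J" by simp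
  next
    have "(\<Oplus>i\<in>I. \<zero> \<otimes> y i) = (\<Oplus>i\<in>I. \<zero>)" using assms by (intro finsum_cong') auto
    then have z: "\<zero> = (\<Oplus>i\<in>I. \<zero> \<otimes> y i)" by simp
    have "\<zero> \<in> ?J" using mem[of "\<lambda>_. \<zero>"] z by simp
    then show "\<one>\<^bsub>add_monoid R\<^esub> \<in> ?J" by simp
  next
    fix a assume a: "a \<in> ?J"
    have "\<ominus> a = (\<ominus> \<one>) \<otimes> a" using car[OF a] by (simp add: l_minus)
    then have "\<ominus> a \<in> ?J" using scl[OF a, of "\<ominus> \<one>"] by simp
    then show "inv\<^bsub>add_monoid R\<^esub> a \<in> ?J" by (simp add: a_inv_def)
  qed
  fix a x assume a: "a \<in> ?J" and x: "x \<in> carrier R"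
  show "x \<otimes> a \<in> ?J" by (rule scl[OF a x])
  then show "a \<otimes> x \<in> ?J" using car[OF a] x by (simp add: m_comm)
qed

context normal_domain
begin

lemma pow_nonzero: "b \<in> carrier R \<Longrightarrow> b \<noteq> \<zero> \<Longrightarrow> b [^] (n::nat) \<noteq> \<zero>"
  by (induction n) (auto simp: integral_iff)

text \<open>Noetherian normal domains are completely integrally closed: the ascending chain of ideals
  \<open>(y 0, \<dots>, y (n - 1))\<close>, where \<open>y i = c (a/b)^i\<close>, becomes stationary, which makes \<open>a/b\<close> integral.\<close>

lemma completely_normal:
  assumes c: "c \<in> carrier R" "c \<noteq> \<zero>" and a: "a \<in> carrier R" and b: "b \<in> carrier R" "b \<noteq> \<zero>"
    and div: "\<And>n::nat. b [^] n divides c \<otimes> a [^] n"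
  shows "b divides a"
proof -
  define y where "y n = (SOME y. y \<in> carrier R \<and> c \<otimes> a [^] n = b [^] n \<otimes> y)" for n :: nat
  have "\<exists>y. y \<in> carrier R \<and> c \<otimes> a [^] n = b [^] n \<otimes> y" for n :: nat
    using div[of n] by (auto elim!: dividesE)
  from someI_ex[OF this] have y: "y n \<in> carrier R" "c \<otimes> a [^] n = b [^] n \<otimes> y n" for n :: nat
    unfolding y_def by auto
  define J where "J n = {(\<Oplus>i\<in>{..<n}. r i \<otimes> y i) |r. r \<in> {..<n} \<rightarrow> carrier R}" for n :: nat
  have Jmem: "(\<Oplus>i\<in>{..<n}. r i \<otimes> y i) \<in> J n" if "r \<in> {..<n} \<rightarrow> carrier R" for r n
    unfolding J_def using that by blast
  have J: "ideal (J n) R" for n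
    unfolding J_def by (rule linear_combinations_ideal) (use y in auto)
  have "\<exists>M\<in>range J. \<forall>K\<in>range J. M \<subseteq> K \<longrightarrow> K = M"
    by (rule exists_maximal_ideal_in) (use J in auto)
  then obtain M where M: "M \<in> range J" "\<forall>K\<in>range J. M \<subseteq> K \<longrightarrow> K = M" by (rule bexE)
  then obtain n where n: "M = J n" by auto
  have "J n \<subseteq> J (Suc n)"
  proof
    fix z assume "z \<in> J n"
    then obtain r where r: "z = (\<Oplus>i\<in>{..<n}. r i \<otimes> y i)" "r \<in> {..<n} \<rightarrow> carrier R" unfolding J_def by blast
    have "(\<Oplus>i\<in>{..<Suc n}. (if i < n then r i else \<zero>) \<otimes> y i)
      = (\<Oplus>i\<in>{..<n}. (if i < n then r i else \<zero>) \<otimes> y i)"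
      using r y by (simp add: lessThan_Suc Pi_iff)
    also have "\<dots> = z" unfolding r(1) using r y by (intro finsum_cong') (auto simp: Pi_iff)
    finally have "z = (\<Oplus>i\<in>{..<Suc n}. (if i < n then r i else \<zero>) \<otimes> y i)" ..
    moreover have "(\<lambda>i. if i < n then r i else \<zero>) \<in> {..<Suc n} \<rightarrow> carrier R" using r by (auto simp: Pi_iff)
    ultimately show "z \<in> J (Suc n)" using Jmem[of "\<lambda>i. if i < n then r i else \<zero>" "Suc n"] by simp
  qed
  then have Jn: "J (Suc n) = J n" using M(2)[THEN bspec, of "J (Suc n)"] n by auto
  have "(\<Oplus>i\<in>{..<Suc n}. (if i < n then \<zero> else \<one>) \<otimes> y i) =
     \<one> \<otimes> y n \<oplus> (\<Oplus>i\<in>{..<n}. (if i < n then \<zero> else \<one>) \<otimes> y i)"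
    using y by (simp add: lessThan_Suc)
  also have "(\<Oplus>i\<in>{..<n}. (if i < n then \<zero> else \<one>) \<otimes> y i) = (\<Oplus>i\<in>{..<n}. \<zero>)"
    using y by (intro finsum_cong') auto
  finally have "y n = (\<Oplus>i\<in>{..<Suc n}. (if i < n then \<zero> else \<one>) \<otimes> y i)" using y by simp
  moreover have "(\<lambda>i. if i < n then \<zero> else \<one>) \<in> {..<Suc n} \<rightarrow> carrier R" by auto
  ultimately have "y n \<in> J (Suc n)" using Jmem[of "\<lambda>i. if i < n then \<zero> else \<one>" "Suc n"] by simp
  then have "y n \<in> J n" by (simp add: Jn)
  then obtain r where r: "r \<in> {..<n} \<rightarrow> carrier R" "y n = (\<Oplus>i\<in>{..<n}. r i \<otimes> y i)" unfolding J_def by blast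
  \<comment> \<open>\<open>J 0\<close> is zero while \<open>y 0 = c\<close> is not;
    \<open>integral_over\<close> asks for a positive degree.\<close>
  have "n > 0"
  proof (rule ccontr)
    assume "\<not> n > 0"
    then have "y 0 = \<zero>" using r by simp
    then show False using y(2)[of 0] c by simp
  qed
  interpret S: mult_closed R "carrier R - {\<zero>}" by (rule mult_closed_nonzero)
  define x where "x = S.frc a b"
  interpret L: cring S.loc by (rule S.loc_cring)
  have Q: "quotient_field R = S.loc" by (simp add: quotient_field_def)
  have into: "into_quotient_field R = (\<lambda>a. S.frc a \<one>)" by (simp add: into_quotient_field_def fun_eq_iff)
  \<comment> \<open>\<open>x^i = y i / c\<close> for all \<open>i\<close>, so a relation expressing
    \<open>y n\<close> by earlier \<open>y i\<close> is an integral equation for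
    \<open>x = a/b\<close>.\<close>
  have xp: "x [^]\<^bsub>S.loc\<^esub> i = S.frc (y i) c" for i :: nat
    unfolding x_def using a b c y pow_nonzero
    by (simp add: S.loc_pow) (intro S.frac_eqI', auto simp: m_comm)
  define q where "q i = \<ominus> r i" for i
  have q: "q \<in> {..<n} \<rightarrow> carrier R" using r by (auto simp: q_def Pi_iff)
  have "(\<Oplus>\<^bsub>S.loc\<^esub>i\<in>{..<n}. S.frc (q i) \<one> \<otimes>\<^bsub>S.loc\<^esub> x [^]\<^bsub>S.loc\<^esub> i) = (\<Oplus>\<^bsub>S.loc\<^esub>i\<in>{..<n}. S.frc (q i \<otimes> y i) c)"
    using q y c by (intro L.finsum_cong') (auto simp: xp S.loc_mult Pi_iff)
  also have "\<dots> = S.frc (\<Oplus>i\<in>{..<n}. q i \<otimes> y i) c"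
    using q y c by (intro S.loc_finsum) auto
  also have "(\<Oplus>i\<in>{..<n}. q i \<otimes> y i) = (\<Oplus>i\<in>{..<n}. (\<ominus> \<one>) \<otimes> (r i \<otimes> y i))"
    using r y by (intro finsum_cong') (auto simp: q_def Pi_iff l_minus)
  also have "\<dots> = (\<ominus> \<one>) \<otimes> (\<Oplus>i\<in>{..<n}. r i \<otimes> y i)"
    using r y by (subst finsum_rdistr) auto
  also have "\<dots> = \<ominus> y n" unfolding r(2)[symmetric] using y(1)[of n] by (simp add: l_minus)
  finally have "x [^]\<^bsub>S.loc\<^esub> n \<oplus>\<^bsub>S.loc\<^esub> (\<Oplus>\<^bsub>S.loc\<^esub>i\<in>{..<n}. S.frc (q i) \<one> \<otimes>\<^bsub>S.loc\<^esub> x [^]\<^bsub>S.loc\<^esub> i)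
     = S.frc (y n) c \<oplus>\<^bsub>S.loc\<^esub> S.frc (\<ominus> y n) c" by (simp add: xp)
  also have "\<dots> = S.frc (y n \<otimes> c \<oplus> (\<ominus> y n) \<otimes> c) (c \<otimes> c)" using y c by (simp add: S.loc_add)
  also have "y n \<otimes> c \<oplus> (\<ominus> y n) \<otimes> c = \<zero>" using y c by (simp add: l_minus r_neg)
  also have "S.frc \<zero> (c \<otimes> c) = \<zero>\<^bsub>S.loc\<^esub>"
    unfolding S.loc_zero using c by (intro S.frac_eqI') (auto simp: integral_iff)
  finally have "integral_over R x"
    unfolding integral_over_def Q into using \<open>n > 0\<close> q by (intro exI[of _ n] conjI bexI[of _ q])
  moreover have "x \<in> carrier (quotient_field R)" unfolding Q x_def using a b by simp
  ultimately obtain z where z: "z \<in> carrier R" "x = S.frc z \<one>" using normal unfolding into by auto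
  then have "\<exists>u\<in>carrier R - {\<zero>}. u \<otimes> (a \<otimes> \<one> \<ominus> z \<otimes> b) = \<zero>"
    using a b z unfolding x_def by (subst (asm) S.frac_eq_iff) auto
  then have "a \<ominus> z \<otimes> b = \<zero>" using a b z by (auto simp: integral_iff)
  then have "a = b \<otimes> z" using a b z by (simp add: m_comm)
  then show ?thesis using z by (auto intro: dividesI)
qed

end

section \<open>Primes of height one\<close>

text \<open>In a domain every chain of primes can be started at the zero ideal. This description
  removes chains from all later arguments.\<close>

lemma (in domain) height_one_iff:
  "P \<in> height_one_primes R \<longleftrightarrow>
     primeideal P R \<and> P \<noteq> {\<zero>} \<and> (\<forall>Q. primeideal Q R \<and> Q \<subset> P \<longrightarrow> Q = {\<zero>})"
proof -
  define ch where "ch n Q P \<longleftrightarrow> (\<forall>i\<le>n. Q i \<in> prime_spectrum R) \<and> (\<forall>i<n. Q i \<subset> Q (Suc i)) \<and> Q n = P"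
    for n and Q :: "nat \<Rightarrow> 'a set" and P
  have ht: "prime_height R P = Sup {enat n |n. \<exists>Q. ch n Q P}"
    unfolding prime_height_def ch_def by simp
  have zero: "\<zero> \<in> P" if "primeideal P R" for P
    using that by (simp add: additive_subgroup.zero_closed ideal.axioms(1) primeideal.axioms(1))
  have chain_le: "enat n \<le> prime_height R P" if "ch n Q P" for n Q
    unfolding ht using that by (intro Sup_upper) auto
  show ?thesis
  proof
    assume "P \<in> height_one_primes R"
    then have P: "primeideal P R" and h: "prime_height R P = 1"
      by (auto simp: height_one_primes_def prime_spectrum_def)
    have "P \<noteq> {\<zero>}"
    proof
      assume P0: "P = {\<zero>}"
      have "n = 0" if c: "ch n Q P" for n Q
      proof (rule ccontr)
        assume "n \<noteq> 0"
        then obtain m where m: "n = Suc m" using not0_implies_Suc by blast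
        have "Q m \<subset> P" "primeideal (Q m) R"
          using c m by (auto simp: ch_def prime_spectrum_def)
        then show False using zero[of "Q m"] P0 by auto
      qed
      then have "prime_height R P \<le> 0" unfolding ht by (intro Sup_least) (auto simp: zero_enat_def)
      then show False using h by simp
    qed
    moreover have "Q = {\<zero>}" if Q: "primeideal Q R" "Q \<subset> P" for Q
    proof (rule ccontr)
      assume "Q \<noteq> {\<zero>}"
      then have "{\<zero>} \<subset> Q" using zero[OF Q(1)] by auto
      \<comment> \<open>A nonzero prime strictly below \<open>P\<close> gives the chain zero,
        \<open>Q\<close>, \<open>P\<close> of length two.\<close>
      then have "ch 2 (\<lambda>i. if i = 0 then {\<zero>} else if i = 1 then Q else P) P"
        unfolding ch_def using Q(2) by (simp add: prime_spectrum_def numeral_2_eq_2 less_Suc_eq Q(1) P zeroprimeideal)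
      then have "enat 2 \<le> prime_height R P" by (rule chain_le)
      then show False by (simp add: one_enat_def h)
    qed
    ultimately show "primeideal P R \<and> P \<noteq> {\<zero>} \<and> (\<forall>Q. primeideal Q R \<and> Q \<subset> P \<longrightarrow> Q = {\<zero>})"
      using P by blast
  next
    assume *: "primeideal P R \<and> P \<noteq> {\<zero>} \<and> (\<forall>Q. primeideal Q R \<and> Q \<subset> P \<longrightarrow> Q = {\<zero>})"
    then have "{\<zero>} \<subset> P" using zero[of P] by auto
    then have "ch 1 (\<lambda>i. if i = 0 then {\<zero>} else P) P"
      unfolding ch_def using * by (simp add: prime_spectrum_def zeroprimeideal)
    then have "enat 1 \<le> prime_height R P" by (rule chain_le)
    moreover have "n \<le> 1" if c: "ch n Q P" for n Q
    proof (rule ccontr)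
      assume "\<not> n \<le> 1"
      then have "n = Suc (Suc (n - 2))" by simp
      then obtain m where m: "n = Suc (Suc m)" by blast
      have "Q m \<subset> Q (Suc m)" "Q (Suc m) \<subset> P" "primeideal (Q m) R" "primeideal (Q (Suc m)) R"
        using c m by (auto simp: ch_def prime_spectrum_def)
      then show False using * zero[of "Q m"] by blast
    qed
    then have "prime_height R P \<le> 1" unfolding ht by (intro Sup_least) (auto simp: one_enat_def)
    ultimately have "prime_height R P = 1" by (simp add: one_enat_def)
    then show "P \<in> height_one_primes R"
      using * by (auto simp: height_one_primes_def prime_spectrum_def)
  qed
qed

text \<open>The elementwise form of \<open>P R_P = t R_P\<close>, with a single \<open>s\<close>
  outside \<open>P\<close> serving all elements of \<open>P\<close>.\<close>

definition uniformizing :: "('a, 'm) ring_scheme \<Rightarrow> 'a set \<Rightarrow> 'a \<Rightarrow> 'a \<Rightarrow> bool" where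
  "uniformizing R P t s \<longleftrightarrow> t \<in> P \<and> s \<in> carrier R - P \<and>
     (\<forall>y\<in>P. \<exists>y'\<in>carrier R. s \<otimes>\<^bsub>R\<^esub> y = t \<otimes>\<^bsub>R\<^esub> y')"

lemma (in cring) divides_sum:
  assumes "b \<in> carrier R" "b divides x" "b divides y"
  shows "b divides (x \<oplus> y)"
proof -
  obtain u v where "u \<in> carrier R" "x = b \<otimes> u" "v \<in> carrier R" "y = b \<otimes> v"
    using assms(2,3) by (auto elim!: dividesE)
  then show ?thesis using assms(1) by (intro dividesI[of "u \<oplus> v"]) (auto simp: r_distr)
qed

lemma (in cring) divides_lmult:
  assumes "y \<in> carrier R" "b \<in> carrier R" "b divides x" shows "b divides (y \<otimes> x)"
proof -
  obtain u where "u \<in> carrier R" "x = b \<otimes> u" using assms(3) by (auto elim!: dividesE)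
  then show ?thesis using assms by (intro dividesI[of "y \<otimes> u"]) (auto simp: m_lcomm)
qed

section \<open>Uniformizers and associated primes in a normal domain\<close>

context normal_domain
begin

text \<open>Multiplication by \<open>a/b\<close> maps \<open>P\<close> into \<open>R\<close>,
  sending \<open>y\<close> to \<open>m y\<close>. If some value \<open>m t\<close> is outside
  \<open>P\<close>, it serves as the \<open>s\<close> for \<open>t\<close>. If all values stay in
  \<open>P\<close>, then \<open>b (a/b)^n\<close> lies in \<open>R\<close> for all \<open>n\<close>,
  and complete integral closedness makes \<open>a/b\<close> an element of \<open>R\<close>, against
  the hypothesis.\<close>

lemma uniformizer_of_quotient:
  assumes P: "primeideal P R" "P = {y \<in> carrier R. b divides y \<otimes> a}"
    and ab: "a \<in> carrier R" "b \<in> carrier R" "b \<noteq> \<zero>" "\<not> b divides a"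
  shows "\<exists>t s. uniformizing R P t s"
proof -
  have "\<exists>z. z \<in> carrier R \<and> y \<otimes> a = b \<otimes> z" if "y \<in> P" for y
    using that P(2) by (auto elim!: dividesE)
  then obtain m where m: "m y \<in> carrier R" "y \<otimes> a = b \<otimes> m y" if "y \<in> P" for y by metis
  have Pc: "y \<in> carrier R" if "y \<in> P" for y using that P(2) by blast
  show ?thesis
  proof (cases "\<exists>t\<in>P. m t \<notin> P")
    case True
    then obtain t where t: "t \<in> P" "m t \<notin> P" by blast
    \<comment> \<open>Both products equal \<open>t y a / b\<close>.\<close>
    have "m t \<otimes> y = t \<otimes> m y" if y: "y \<in> P" for y
    proof -
      note c = Pc[OF y] Pc[OF t(1)] m(1)[OF y] m(1)[OF t(1)] ab
      have "b \<otimes> (m t \<otimes> y) = (b \<otimes> m t) \<otimes> y" using c by (simp add: m_assoc)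
      also have "\<dots> = (t \<otimes> a) \<otimes> y" using m(2)[OF t(1)] by simp
      also have "\<dots> = t \<otimes> (y \<otimes> a)" using c by (simp add: m_ac)
      also have "\<dots> = b \<otimes> (t \<otimes> m y)" using c m(2)[OF y] by (simp add: m_ac)
      finally show ?thesis using c by (simp add: m_lcancel)
    qed
    then have "uniformizing R P t (m t)" using t m by (auto simp: uniformizing_def)
    then show ?thesis by blast
  next
    case False
    have bP: "b \<in> P" unfolding P(2) using ab by (auto intro: dividesI)
    \<comment> \<open>The map \<open>y \<mapsto> y a / b\<close> is iterated on \<open>P\<close>,
      starting at \<open>b\<close>.\<close>
    have ex: "\<exists>z\<in>P. b \<otimes> a [^] n = b [^] n \<otimes> z" for n :: nat
    proof (induction n)
      case 0 then show ?case using bP ab by (intro bexI[of _ b]) auto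
    next
      case (Suc n)
      then obtain z where z: "z \<in> P" "b \<otimes> a [^] n = b [^] n \<otimes> z" by blast
      note c = Pc[OF z(1)] m(1)[OF z(1)] ab
      have "b \<otimes> a [^] Suc n = (b \<otimes> a [^] n) \<otimes> a" using c by (simp add: m_assoc)
      also have "\<dots> = b [^] n \<otimes> (z \<otimes> a)" unfolding z(2) using c by (simp add: m_assoc)
      also have "\<dots> = b [^] Suc n \<otimes> m z" using c m(2)[OF z(1)] by (simp add: m_assoc)
      finally show ?case using False z by blast
    qed
    have "b [^] n divides b \<otimes> a [^] n" for n :: nat
    proof -
      obtain z where "z \<in> P" "b \<otimes> a [^] n = b [^] n \<otimes> z" using ex[of n] by blast
      then show ?thesis by (intro dividesI[of z] Pc)
    qed
    then have "b divides a" by (rule completely_normal[OF ab(2,3,1,2,3)])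
    then show ?thesis using ab by blast
  qed
qed

text \<open>If \<open>t^n\<close> divided \<open>s^n y\<close> for every \<open>n\<close>, then all
  powers of \<open>s/t\<close> would have the common denominator \<open>y\<close>, so
  \<open>t\<close> would divide \<open>s\<close>, which lies outside \<open>P\<close>. The exponent
  just before the first failure leaves a cofactor outside \<open>P\<close>.\<close>

lemma uniformizing_power:
  assumes P: "primeideal P R" and ts: "uniformizing R P t s" and y: "y \<in> carrier R" "y \<noteq> \<zero>" and t0: "t \<noteq> \<zero>"
  obtains n :: nat and u where "u \<in> carrier R - P" "s [^] n \<otimes> y = t [^] n \<otimes> u"
proof -
  interpret P: primeideal P R by fact
  have c: "t \<in> carrier R" "s \<in> carrier R" "s \<notin> P" "t \<in> P" using ts P.Icarr by (auto simp: uniformizing_def)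
  have "\<exists>n::nat. \<not> t [^] n divides s [^] n \<otimes> y"
  proof (rule ccontr)
    assume "\<not> ?thesis"
    then have "\<And>n::nat. t [^] n divides y \<otimes> s [^] n" using c y by (simp add: m_comm)
    then have "t divides s" by (rule completely_normal[OF y c(2,1) t0])
    then obtain r where r: "r \<in> carrier R" "s = t \<otimes> r" by (rule dividesE)
    have "t \<otimes> r \<in> P" by (rule P.I_r_closed[OF c(4) r(1)])
    then have "s \<in> P" by (simp only: r(2))
    then show False using c by blast
  qed
  note ex = this
  define k where "k = (LEAST n::nat. \<not> t [^] n divides s [^] n \<otimes> y)"
  have k: "\<not> t [^] k divides s [^] k \<otimes> y"
    unfolding k_def by (rule LeastI_ex[OF ex])
  have k': "t [^] j divides s [^] j \<otimes> y" if "j < k" for j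
    using not_less_Least[of j "\<lambda>n. \<not> t [^] n divides s [^] n \<otimes> y"] that unfolding k_def by simp
  have "k \<noteq> 0"
  proof
    assume k0: "k = 0"
    have "t [^] (0::nat) divides s [^] (0::nat) \<otimes> y" by (rule dividesI[of y]) (use y in simp_all)
    with k show False unfolding k0 by (rule notE)
  qed
  then obtain n where n: "k = Suc n" using not0_implies_Suc by blast
  have "t [^] n divides s [^] n \<otimes> y" using k'[of n] n by simp
  then obtain u where u: "u \<in> carrier R" "s [^] n \<otimes> y = t [^] n \<otimes> u" by (rule dividesE)
  have "u \<notin> P"
  proof
    assume "u \<in> P"
    then obtain u' where u': "u' \<in> carrier R" "s \<otimes> u = t \<otimes> u'" using ts by (auto simp: uniformizing_def)
    have "s [^] k \<otimes> y = s \<otimes> (s [^] n \<otimes> y)" using c y n by (simp add: m_ac)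
    also have "\<dots> = t [^] n \<otimes> (s \<otimes> u)" unfolding u(2) using c u by (simp add: m_ac)
    also have "\<dots> = t [^] k \<otimes> u'" unfolding u'(2) using c u' n by (simp add: m_ac)
    finally have "t [^] k divides s [^] k \<otimes> y" by (intro dividesI[of u'] u'(1))
    with k show False by (rule notE)
  qed
  then show ?thesis using that u by blast
qed

text \<open>A prime strictly below \<open>P\<close> cannot contain \<open>t\<close>, as it would
  then contain \<open>s P\<close> and so \<open>P\<close>. A nonzero \<open>y\<close> in it would
  satisfy \<open>s^n y = t^n u\<close> with neither \<open>t\<close> nor \<open>u\<close> in
  it.\<close>

lemma uniformizing_height_one:
  assumes P: "primeideal P R" and ts: "uniformizing R P t s" and P0: "P \<noteq> {\<zero>}"
  shows "P \<in> height_one_primes R" "t \<noteq> \<zero>"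
proof -
  interpret P: primeideal P R by fact
  have c: "t \<in> carrier R" "s \<in> carrier R" "s \<notin> P" "t \<in> P" using ts P.Icarr by (auto simp: uniformizing_def)
  have s0: "s \<noteq> \<zero>" using c P.zero_closed by blast
  show t0: "t \<noteq> \<zero>"
  proof
    assume "t = \<zero>"
    have "y = \<zero>" if y: "y \<in> P" for y
    proof -
      obtain y' where "y' \<in> carrier R" "s \<otimes> y = t \<otimes> y'" using ts y by (auto simp: uniformizing_def)
      then have "s \<otimes> y = \<zero>" using \<open>t = \<zero>\<close> by simp
      then show ?thesis using s0 c P.Icarr[OF y] by (simp add: integral_iff)
    qed
    then show False using P0 P.zero_closed by blast
  qed
  have "Q = {\<zero>}" if Q: "primeideal Q R" "Q \<subset> P" for Q
  proof -
    interpret Q: primeideal Q R by fact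
    have tQ: "t \<notin> Q"
    proof
      assume "t \<in> Q"
      have "y \<in> Q" if y: "y \<in> P" for y
      proof -
        obtain y' where y': "y' \<in> carrier R" "s \<otimes> y = t \<otimes> y'" using ts y by (auto simp: uniformizing_def)
        then have "s \<otimes> y \<in> Q" using Q.I_r_closed[OF \<open>t \<in> Q\<close> y'(1)] by simp
        then show ?thesis using Q.I_prime[OF c(2) P.Icarr[OF y]] Q(2) c by blast
      qed
      then show False using Q(2) by blast
    qed
    have "y = \<zero>" if y: "y \<in> Q" for y
    proof (rule ccontr)
      assume y0: "y \<noteq> \<zero>"
      obtain n :: nat and u where u: "u \<in> carrier R - P" "s [^] n \<otimes> y = t [^] n \<otimes> u"
        using uniformizing_power[OF P ts Q.Icarr[OF y] y0 t0] by blast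
      have "t [^] n \<otimes> u \<in> Q" using u(2) y c Q.I_l_closed[of y "s [^] n"] by simp
      moreover have "u \<notin> Q" using u Q(2) by blast
      ultimately have "t [^] n \<in> Q" using Q.I_prime[of "t [^] n" u] c u by auto
      moreover have "t [^] m \<notin> Q" for m :: nat
      proof (induction m)
        case 0 then show ?case using Q.I_notcarr Q.one_imp_carrier by auto
      next
        case (Suc m) then show ?case using Q.I_prime[of "t [^] m" t] c tQ by auto
      qed
      ultimately show False by blast
    qed
    then show ?thesis using Q.zero_closed by blast
  qed
  then show "P \<in> height_one_primes R" using P P0 by (auto simp: height_one_iff)
qed

text \<open>If \<open>a/b\<close> is not in \<open>R_Q\<close>, the class of \<open>a\<close> is
  nonzero in the localization of \<open>R/bR\<close> at \<open>Q\<close>, and the chain condition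
  yields an associated prime. Finite generation of that prime then removes the localization, at the
  price of replacing \<open>c\<close> by a multiple.\<close>

lemma local_associated_prime:
  assumes Q: "primeideal Q R" and ab: "a \<in> carrier R" "b \<in> carrier R"
    and nd: "\<And>s. s \<in> carrier R - Q \<Longrightarrow> \<not> b divides s \<otimes> a"
  obtains P c where "primeideal P R" "P \<subseteq> Q" "c \<in> carrier R" "P = {y \<in> carrier R. b divides y \<otimes> (c \<otimes> a)}"
    "\<not> b divides (c \<otimes> a)"
proof -
  interpret Q: primeideal Q R by fact
  \<comment> \<open>The annihilator of the class of \<open>c a\<close> in the localization of
    \<open>R/bR\<close> at \<open>Q\<close>, pulled back to \<open>R\<close>.\<close>
  define I where "I c = {y \<in> carrier R. \<exists>s\<in>carrier R - Q. b divides s \<otimes> (y \<otimes> (c \<otimes> a))}" for c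
  have IE: "\<exists>s\<in>carrier R - Q. b divides s \<otimes> (y \<otimes> (c \<otimes> a))" if "y \<in> I c" for y c
    using that by (simp add: I_def)
  have II: "y \<in> I c" if "y \<in> carrier R" "s \<in> carrier R - Q" "b divides s \<otimes> (y \<otimes> (c \<otimes> a))" for y c s
    unfolding I_def using that by (intro CollectI conjI bexI[of _ s])
  have Smult: "s \<otimes> s' \<in> carrier R - Q" if "s \<in> carrier R - Q" "s' \<in> carrier R - Q" for s s'
    using that Q.I_prime by auto
  have one: "\<one> \<in> carrier R - Q" using Q.I_notcarr Q.one_imp_carrier by auto
  have Iid: "ideal (I c) R" if c: "c \<in> carrier R" for c
  proof (rule idealI[OF ring_axioms])
    have l: "r \<otimes> y \<in> I c" if y: "y \<in> I c" and r: "r \<in> carrier R" for y r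
    proof -
      obtain s where s: "y \<in> carrier R" "s \<in> carrier R - Q" "b divides s \<otimes> (y \<otimes> (c \<otimes> a))" using y by (auto simp: I_def)
      have "s \<otimes> ((r \<otimes> y) \<otimes> (c \<otimes> a)) = r \<otimes> (s \<otimes> (y \<otimes> (c \<otimes> a)))" using s r ab c by (simp add: m_ac)
      moreover have "b divides r \<otimes> (s \<otimes> (y \<otimes> (c \<otimes> a)))" by (rule divides_lmult[OF r ab(2) s(3)])
      ultimately have "b divides s \<otimes> ((r \<otimes> y) \<otimes> (c \<otimes> a))" by simp
      then show ?thesis using s r by (auto simp: I_def)
    qed
    show "subgroup (I c) (add_monoid R)"
    proof (rule subgroup.intro)
      show "I c \<subseteq> carrier (add_monoid R)" by (auto simp: I_def)
      fix x y assume "x \<in> I c" "y \<in> I c"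
      then obtain s s' where s: "x \<in> carrier R" "s \<in> carrier R - Q" "b divides s \<otimes> (x \<otimes> (c \<otimes> a))"
        and s': "y \<in> carrier R" "s' \<in> carrier R - Q" "b divides s' \<otimes> (y \<otimes> (c \<otimes> a))"  by (auto simp: I_def)
      have "(s \<otimes> s') \<otimes> ((x \<oplus> y) \<otimes> (c \<otimes> a)) = s' \<otimes> (s \<otimes> (x \<otimes> (c \<otimes> a))) \<oplus> s \<otimes> (s' \<otimes> (y \<otimes> (c \<otimes> a)))"
        using s s' ab c by (simp add: l_distr r_distr m_ac)
      moreover have "b divides (s' \<otimes> (s \<otimes> (x \<otimes> (c \<otimes> a))) \<oplus> s \<otimes> (s' \<otimes> (y \<otimes> (c \<otimes> a))))"
        by (rule divides_sum[OF ab(2) divides_lmult[OF _ ab(2) s(3)] divides_lmult[OF _ ab(2) s'(3)]])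
          (use s(2) s'(2) in auto)
      ultimately have "b divides (s \<otimes> s') \<otimes> ((x \<oplus> y) \<otimes> (c \<otimes> a))" by simp
      then show "x \<otimes>\<^bsub>add_monoid R\<^esub> y \<in> I c" using s(1) s'(1) Smult[OF s(2) s'(2)]
        by (auto simp: I_def)
    next
      have "b divides \<one> \<otimes> (\<zero> \<otimes> (c \<otimes> a))" using ab c by (auto intro!: dividesI[of \<zero>])
      then show "\<one>\<^bsub>add_monoid R\<^esub> \<in> I c" using one by (auto simp: I_def)
    next
      fix x assume x: "x \<in> I c"
      then have "x \<in> carrier R" by (auto simp: I_def)
      then have "\<ominus> x = (\<ominus> \<one>) \<otimes> x" by (simp add: l_minus)
      then show "inv\<^bsub>add_monoid R\<^esub> x \<in> I c" using l[OF x, of "\<ominus> \<one>"] by (simp flip: a_inv_def)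
    qed
    fix y r assume y: "y \<in> I c" and r: "r \<in> carrier R"
    show "r \<otimes> y \<in> I c" by (rule l[OF y r])
    moreover have "y \<in> carrier R" using y by (auto simp: I_def)
    ultimately show "y \<otimes> r \<in> I c" using r by (simp add: m_comm)
  qed
  define F where "F = {I c |c. c \<in> carrier R \<and> \<one> \<notin> I c}"
  have "\<one> \<notin> I \<one>" using nd ab by (auto simp: I_def)
  then have "F \<noteq> {}" by (auto simp: F_def)
  moreover have "ideal M R" if "M \<in> F" for M using that Iid by (auto simp: F_def)
  ultimately have "\<exists>M\<in>F. \<forall>J\<in>F. M \<subseteq> J \<longrightarrow> J = M" by (rule exists_maximal_ideal_in)
  then obtain M where M: "M \<in> F" "\<forall>J\<in>F. M \<subseteq> J \<longrightarrow> J = M" by (rule bexE)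
  obtain c where c: "c \<in> carrier R" "\<one> \<notin> I c" "M = I c" using M(1) unfolding F_def by fast
  interpret M: ideal M R using Iid c by simp
  have sub: "M \<subseteq> Q"
  proof
    fix y assume y: "y \<in> M"
    show "y \<in> Q"
    proof (rule ccontr)
      assume "y \<notin> Q"
      have yc: "y \<in> carrier R" by (rule M.Icarr[OF y])
      obtain s where s: "s \<in> carrier R - Q" "b divides s \<otimes> (y \<otimes> (c \<otimes> a))"
        using IE y unfolding c(3) by blast
      have "b divides (s \<otimes> y) \<otimes> (\<one> \<otimes> (c \<otimes> a))" using c(1) ab s yc by (simp add: m_assoc)
      then have "\<one> \<in> I c" by (intro II[OF one_closed, of "s \<otimes> y"] Smult s) (use yc \<open>y \<notin> Q\<close> in auto)
      then show False using c by blast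
    qed
  qed
  \<comment> \<open>Multiplying \<open>c\<close> by \<open>x\<close> enlarges the annihilator;
    together with maximality this identity gives primality.\<close>
  have shift: "y \<in> I (c \<otimes> x) \<longleftrightarrow> y \<otimes> x \<in> I c" if "y \<in> carrier R" "x \<in> carrier R" for x y
    using that c(1) ab by (simp add: I_def m_ac)
  have Mprime: "primeideal M R"
  proof (rule primeidealI[OF M.is_ideal is_cring])
    show "carrier R \<noteq> M" using c by auto
    fix x y assume xy: "x \<in> carrier R" "y \<in> carrier R" "x \<otimes> y \<in> M"
    show "x \<in> M \<or> y \<in> M"
    proof (rule disjCI)
      assume "y \<notin> M"
      then have "\<one> \<notin> I (c \<otimes> y)" using shift[of \<one> y] xy c by simp
      then have "I (c \<otimes> y) \<in> F" using c xy by (auto simp: F_def)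
      moreover have "M \<subseteq> I (c \<otimes> y)"
      proof
        fix z assume z: "z \<in> M"
        then have "z \<otimes> y \<in> M" by (rule M.I_r_closed) (rule xy)
        then show "z \<in> I (c \<otimes> y)" using shift[of z y] M.Icarr[OF z] xy c by simp
      qed
      ultimately have "I (c \<otimes> y) = M" using M(2)[THEN bspec] by blast
      then show "x \<in> M" using shift[of x y] xy c by simp
    qed
  qed
  obtain G where G: "G \<subseteq> carrier R" "finite G" "M = Idl G" using finetely_gen[OF M.is_ideal] by blast
  have GM: "G \<subseteq> M" using G genideal_self by blast
  \<comment> \<open>One \<open>s\<close> outside \<open>Q\<close> serves all generators at once;
    multiplying \<open>c\<close> by it makes the annihilator correct before localization.\<close>
  have fin: "\<exists>s\<in>carrier R - Q. \<forall>g\<in>H. b divides s \<otimes> (g \<otimes> (c \<otimes> a))" if "finite H" "H \<subseteq> M" for H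
    using that
  proof (induction H)
    case empty then show ?case using one by auto
  next
    case (insert g H)
    then obtain s where s: "s \<in> carrier R - Q" "\<And>h. h \<in> H \<Longrightarrow> b divides s \<otimes> (h \<otimes> (c \<otimes> a))" by blast
    obtain s' where s': "s' \<in> carrier R - Q" "b divides s' \<otimes> (g \<otimes> (c \<otimes> a))"
      using IE[of g c] insert.prems c(3) by auto
    have "b divides (s \<otimes> s') \<otimes> (h \<otimes> (c \<otimes> a))" if h: "h \<in> insert g H" for h
    proof -
      have hc: "h \<in> carrier R" using h insert M.Icarr by auto
      show ?thesis
      proof (cases "h = g")
        case True
        have "(s \<otimes> s') \<otimes> (h \<otimes> (c \<otimes> a)) = s \<otimes> (s' \<otimes> (h \<otimes> (c \<otimes> a)))" using s s' hc c ab by (simp add: m_ac)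
        moreover have "b divides s \<otimes> (s' \<otimes> (h \<otimes> (c \<otimes> a)))"
          unfolding True by (rule divides_lmult[OF _ ab(2) s'(2)]) (use s(1) in auto)
        ultimately show ?thesis by simp
      next
        case False
        have "(s \<otimes> s') \<otimes> (h \<otimes> (c \<otimes> a)) = s' \<otimes> (s \<otimes> (h \<otimes> (c \<otimes> a)))" using s s' hc c ab by (simp add: m_ac)
        moreover have hH: "h \<in> H" using h False by auto
        have "b divides s' \<otimes> (s \<otimes> (h \<otimes> (c \<otimes> a)))"
          by (rule divides_lmult[OF _ ab(2) s(2)[OF hH]]) (use s'(1) in auto)
        ultimately show ?thesis by simp
      qed
    qed
    then show ?case using Smult[OF s(1) s'(1)] by blast
  qed
  obtain s where s: "s \<in> carrier R - Q" "\<forall>g\<in>G. b divides s \<otimes> (g \<otimes> (c \<otimes> a))"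
    using fin[OF G(2) GM] by (rule bexE)
  define c' where "c' = s \<otimes> c"
  have c': "c' \<in> carrier R" using s c by (simp add: c'_def)
  have cc: "s \<otimes> (y \<otimes> (c \<otimes> a)) = y \<otimes> (c' \<otimes> a)" if "y \<in> carrier R" for y
    using that s c ab by (simp add: c'_def m_ac)
  have eq: "M = {y \<in> carrier R. b divides y \<otimes> (c' \<otimes> a)}"
  proof
    have "ideal {y \<in> carrier R. b divides y \<otimes> (c' \<otimes> a)} R" by (rule divides_ideal) (use ab c' in auto)
    moreover have "G \<subseteq> {y \<in> carrier R. b divides y \<otimes> (c' \<otimes> a)}"
    proof
      fix g assume g: "g \<in> G"
      then have gc: "g \<in> carrier R" using G(1) by blast
      have "b divides s \<otimes> (g \<otimes> (c \<otimes> a))" using s(2) g by (rule bspec)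
      then show "g \<in> {y \<in> carrier R. b divides y \<otimes> (c' \<otimes> a)}" using gc cc[OF gc] by simp
    qed
    ultimately show "M \<subseteq> {y \<in> carrier R. b divides y \<otimes> (c' \<otimes> a)}" unfolding G(3) by (rule genideal_minimal)
    show "{y \<in> carrier R. b divides y \<otimes> (c' \<otimes> a)} \<subseteq> M"
    proof
      fix y assume "y \<in> {y \<in> carrier R. b divides y \<otimes> (c' \<otimes> a)}"
      then have y: "y \<in> carrier R" "b divides y \<otimes> (c' \<otimes> a)" by auto
      then show "y \<in> M" unfolding c(3) by (intro II[OF y(1) s(1)]) (simp add: cc)
    qed
  qed
  have "\<not> b divides c' \<otimes> a"
  proof
    assume "b divides c' \<otimes> a"
    then have "\<one> \<in> M" unfolding eq using c' ab by simp
    then show False using c by simp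
  qed
  then show ?thesis using that[OF Mprime sub c' eq] by blast
qed

text \<open>Applied to \<open>1/b\<close> at \<open>Q = P\<close>,
  \<open>local_associated_prime\<close> produces an associated prime of \<open>R/bR\<close> inside
  \<open>P\<close>. It contains the nonzero \<open>b\<close>, so minimality makes it equal to
  \<open>P\<close>.\<close>

lemma height_one_quotient:
  assumes P: "P \<in> height_one_primes R" and b: "b \<in> P" "b \<noteq> \<zero>"
  obtains x where "x \<in> carrier R" "P = {y \<in> carrier R. b divides y \<otimes> x}" "\<not> b divides x"
proof -
  have P1: "primeideal P R" "\<And>Q. primeideal Q R \<Longrightarrow> Q \<subset> P \<Longrightarrow> Q = {\<zero>}" using P by (auto simp: height_one_iff)
  interpret P: primeideal P R by fact
  have bc: "b \<in> carrier R" using b P.Icarr by blast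
  have "\<not> b divides s \<otimes> \<one>" if s: "s \<in> carrier R - P" for s
  proof
    assume "b divides s \<otimes> \<one>"
    then obtain r where r: "r \<in> carrier R" "s \<otimes> \<one> = b \<otimes> r" by (rule dividesE)
    have "b \<otimes> r \<in> P" by (rule P.I_r_closed[OF b(1) r(1)])
    then have "s \<in> P" using r(2) s by simp
    then show False using s by simp
  qed
  then obtain P' c where P': "primeideal P' R" "P' \<subseteq> P" "c \<in> carrier R"
    "P' = {y \<in> carrier R. b divides y \<otimes> (c \<otimes> \<one>)}" "\<not> b divides (c \<otimes> \<one>)"
    by (rule local_associated_prime[OF P1(1) one_closed bc])
  have "b \<in> P'" unfolding P'(4) using bc P'(3) by (auto intro: dividesI)
  then have "P' = P" using P1(2)[OF P'(1)] P'(2) b(2) by blast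
  then show ?thesis using that[of "c \<otimes> \<one>"] P' by auto
qed

lemma height_one_uniformizer:
  assumes P: "P \<in> height_one_primes R"
  obtains t s where "uniformizing R P t s" "t \<noteq> \<zero>"
proof -
  have P1: "primeideal P R" "P \<noteq> {\<zero>}" using P by (auto simp: height_one_iff)
  interpret P: primeideal P R by fact
  obtain b where b: "b \<in> P" "b \<noteq> \<zero>" using P1(2) P.zero_closed by blast
  obtain x where "x \<in> carrier R" "P = {y \<in> carrier R. b divides y \<otimes> x}" "\<not> b divides x"
    using height_one_quotient[OF P b] by blast
  then obtain t s where "uniformizing R P t s"
    using uniformizer_of_quotient[OF P1(1), of b x] b P.Icarr by blast
  then show ?thesis using that uniformizing_height_one[OF P1(1) _ P1(2)] by blast
qed

text \<open>Noetherian induction: among the ideals that contain \<open>b\<close> and lie in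
  infinitely many height one primes take a maximal one. It is not prime, since a height one prime
  above a nonzero prime equals it. So it contains a product \<open>x y\<close> of elements outside
  it, and adjoining \<open>x\<close> or \<open>y\<close> would again give an ideal in infinitely
  many height one primes.\<close>

lemma finite_height_one_containing:
  assumes b: "b \<in> carrier R" "b \<noteq> \<zero>"
  shows "finite {P \<in> height_one_primes R. b \<in> P}"
proof (rule ccontr)
  assume inf: "infinite {P \<in> height_one_primes R. b \<in> P}"
  define F where "F = {I. ideal I R \<and> b \<in> I \<and> infinite {P \<in> height_one_primes R. I \<subseteq> P}}"
  have "{P \<in> height_one_primes R. PIdl b \<subseteq> P} = {P \<in> height_one_primes R. b \<in> P}"
  proof -
    have "PIdl b \<subseteq> P \<longleftrightarrow> b \<in> P" if "P \<in> height_one_primes R" for P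
      using that cgenideal_self[OF b(1)] cgenideal_minimal[of P b]
      by (auto simp: height_one_iff primeideal_def)
    then show ?thesis by blast
  qed
  then have "PIdl b \<in> F" using inf cgenideal_ideal cgenideal_self b by (auto simp: F_def)
  then have "F \<noteq> {}" by blast
  moreover have "ideal M R" if "M \<in> F" for M using that by (simp add: F_def)
  ultimately have "\<exists>M\<in>F. \<forall>J\<in>F. M \<subseteq> J \<longrightarrow> J = M" by (rule exists_maximal_ideal_in)
  then obtain M where M: "M \<in> F" "\<forall>J\<in>F. M \<subseteq> J \<longrightarrow> J = M" by (rule bexE)
  then have Mid: "ideal M R" "b \<in> M" "infinite {P \<in> height_one_primes R. M \<subseteq> P}" by (auto simp: F_def)
  interpret M: ideal M R by fact
  have "\<not> primeideal M R"
  proof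
    assume "primeideal M R"
    then have "{P \<in> height_one_primes R. M \<subseteq> P} \<subseteq> {M}" using Mid(2) b(2) by (auto simp: height_one_iff)
    then show False using Mid(3) finite_subset by blast
  qed
  moreover have "M \<noteq> carrier R"
  proof
    assume "M = carrier R"
    moreover have "\<not> carrier R \<subseteq> P" if "primeideal P R" for P
    proof -
      interpret P: primeideal P R by fact
      show ?thesis using P.I_notcarr P.a_subset by blast
    qed
    ultimately have "{P \<in> height_one_primes R. M \<subseteq> P} = {}" unfolding height_one_iff by blast
    then have "finite {P \<in> height_one_primes R. M \<subseteq> P}" by (simp only: finite.emptyI)
    then show False using Mid(3) by (rule notE[rotated])
  qed
  ultimately obtain x y where xy: "x \<in> carrier R" "y \<in> carrier R" "x \<otimes> y \<in> M" "x \<notin> M" "y \<notin> M"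
    using M.primeidealCD[OF is_cring] by blast
  have fin: "finite {P \<in> height_one_primes R. M \<subseteq> P \<and> z \<in> P}" if z: "z \<in> carrier R" "z \<notin> M" for z
  proof (rule ccontr)
    assume i: "infinite {P \<in> height_one_primes R. M \<subseteq> P \<and> z \<in> P}"
    have Mz: "insert z M \<subseteq> carrier R" using z M.Icarr by auto
    have "ideal (Idl (insert z M)) R" "insert z M \<subseteq> Idl (insert z M)"
      using genideal_ideal[OF Mz] genideal_self[OF Mz] by auto
    moreover have "{P \<in> height_one_primes R. M \<subseteq> P \<and> z \<in> P} \<subseteq> {P \<in> height_one_primes R. Idl (insert z M) \<subseteq> P}"
    proof
      fix P assume P: "P \<in> {P \<in> height_one_primes R. M \<subseteq> P \<and> z \<in> P}"
      then have "ideal P R" by (simp add: height_one_iff primeideal_def)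
      then have "Idl (insert z M) \<subseteq> P" by (rule genideal_minimal) (use P in auto)
      then show "P \<in> {P \<in> height_one_primes R. Idl (insert z M) \<subseteq> P}" using P by simp
    qed
    from infinite_super[OF this i] have "infinite {P \<in> height_one_primes R. Idl (insert z M) \<subseteq> P}" .
    ultimately have "Idl (insert z M) \<in> F"
      using Mid(2) by (auto simp: F_def)
    then show False using M(2)[THEN bspec] \<open>insert z M \<subseteq> Idl (insert z M)\<close> z by blast
  qed
  have "{P \<in> height_one_primes R. M \<subseteq> P}
    \<subseteq> {P \<in> height_one_primes R. M \<subseteq> P \<and> x \<in> P} \<union> {P \<in> height_one_primes R. M \<subseteq> P \<and> y \<in> P}"
    using xy by (auto simp: height_one_iff dest: primeideal.I_prime)
  then show False using fin[of x] fin[of y] xy Mid(3) finite_subset by blast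
qed

end

section \<open>Valuations\<close>

text \<open>\<open>order_at\<close> takes powers in the monoid of ideals; on principal ideals these
  are given by powers of the generator.\<close>

lemma (in cring) principal_ideal_power:
  assumes "a \<in> carrier R"
  shows "PIdl a [^]\<^bsub>ideals_set R\<^esub> (n::nat) = PIdl (a [^] n)"
proof (induction n)
  case 0
  have "PIdl \<one> = carrier R" using cgenideal_eq_genideal[of \<one>] genideal_one by simp
  then show ?case by (simp add: ideals_set_def)
next
  case (Suc n)
  have id: "ideal (PIdl a) R" "ideal (PIdl (a [^] n)) R" using cgenideal_ideal assms by auto
  have "PIdl a [^]\<^bsub>ideals_set R\<^esub> Suc n = (PIdl (a [^] n)) \<cdot> (PIdl a)"
    using Suc by (simp add: ideals_set_def)
  also have "\<dots> = Idl ((PIdl (a [^] n)) <#> (PIdl a))" by (rule ideal_prod_eq_genideal) (use id in auto)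
  also have "\<dots> = Idl (PIdl (a [^] Suc n))" using assms by (simp add: cgenideal_prod)
  also have "\<dots> = PIdl (a [^] Suc n)"
  proof
    have "ideal (PIdl (a [^] Suc n)) R" by (intro cgenideal_ideal nat_pow_closed assms)
    then show "Idl (PIdl (a [^] Suc n)) \<subseteq> PIdl (a [^] Suc n)" by (rule genideal_minimal) simp
    have "PIdl (a [^] Suc n) \<subseteq> carrier R" using \<open>ideal (PIdl (a [^] Suc n)) R\<close>
      by (simp add: additive_subgroup.a_subset ideal.axioms(1))
    then show "PIdl (a [^] Suc n) \<subseteq> Idl (PIdl (a [^] Suc n))" by (rule genideal_self)
  qed
  finally show ?case .
qed

section \<open>Valuations at height one primes and the Hartogs property\<close>

context normal_domain
begin

text \<open>Elementwise form of the statement that \<open>y\<close> is \<open>t^n\<close> times a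
  unit of \<open>R_P\<close>.\<close>

definition at_prime_order :: "'a set \<Rightarrow> 'a \<Rightarrow> 'a \<Rightarrow> nat \<Rightarrow> bool" where
  "at_prime_order P t y n \<longleftrightarrow> (\<exists>u\<in>carrier R - P. \<exists>w\<in>carrier R - P. w \<otimes> y = t [^] n \<otimes> u)"

text \<open>Both ideals in \<open>order_at\<close> are generated by a power of \<open>t/1\<close>,
  and distinct powers generate distinct ideals, so the definite description denotes
  \<open>n\<close>. Stating it for a set \<open>T\<close> covers valuations, with \<open>T\<close> a
  singleton, and ramification indices, with \<open>T\<close> the image of a prime.\<close>

lemma order_at_eq:
  assumes P: "primeideal P R" and ts: "uniformizing R P t s" and t0: "t \<noteq> \<zero>"
    and T: "T \<subseteq> carrier R" "\<And>x. x \<in> T \<Longrightarrow> \<exists>w\<in>carrier R - P. \<exists>z\<in>carrier R. w \<otimes> x = t [^] n \<otimes> z"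
    and x0: "x0 \<in> T" "at_prime_order P t x0 n"
  shows "order_at R P T = n"
proof -
  interpret P: primeideal P R by fact
  interpret S: mult_closed R "carrier R - P" by (rule mult_closed_prime[OF P])
  interpret L: cring S.loc by (rule S.loc_cring)
  have L: "loc_at_prime R P = S.loc" by (simp add: loc_at_prime_def)
  have c: "t \<in> carrier R" "s \<in> carrier R - P" "t \<in> P" using ts P.Icarr by (auto simp: uniformizing_def)
  have zP: "\<zero> \<in> P" by (rule P.zero_closed)
  define \<tau> where "\<tau> = S.frc t \<one>"
  have \<tau>: "\<tau> \<in> carrier S.loc" using c S.S_one by (simp add: \<tau>_def)
  have \<tau>n: "\<tau> [^]\<^bsub>S.loc\<^esub> k = S.frc (t [^] k) \<one>" for k :: nat
    unfolding \<tau>_def using c S.S_one by (simp add: S.loc_pow)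
  have \<tau>nc: "\<tau> [^]\<^bsub>S.loc\<^esub> k \<in> carrier S.loc" for k :: nat by (rule L.nat_pow_closed[OF \<tau>])
  have mem: "S.frc a w \<in> PIdl\<^bsub>S.loc\<^esub> (\<tau> [^]\<^bsub>S.loc\<^esub> k)"
    if "v \<otimes> a = t [^] k \<otimes> z" "v \<in> carrier R - P" "z \<in> carrier R" "a \<in> carrier R" "w \<in> carrier R - P" for a w v z and k :: nat
  proof -
    have "a \<otimes> (v \<otimes> w) = (v \<otimes> a) \<otimes> w" using that(2-5) by (simp add: m_ac)
    also have "\<dots> = (z \<otimes> t [^] k) \<otimes> w" unfolding that(1) using that(2-5) c by (simp add: m_ac)
    finally have "S.frc a w = S.frc (z \<otimes> t [^] k) (v \<otimes> w)"
      by (rule S.frac_eqI'[rotated -1]) (use that(2-5) c S.S_mult in auto)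
    also have "\<dots> = S.frc z (v \<otimes> w) \<otimes>\<^bsub>S.loc\<^esub> S.frc (t [^] k) \<one>"
      using that(2-5) c S.S_one S.S_mult[of v w] by (subst S.loc_mult) auto
    finally have "S.frc a w = S.frc z (v \<otimes> w) \<otimes>\<^bsub>S.loc\<^esub> S.frc (t [^] k) \<one>" .
    moreover have "S.frc z (v \<otimes> w) \<in> carrier S.loc" using that S.S_mult[of v w] by simp
    ultimately show ?thesis unfolding cgenideal_def \<tau>n by (intro CollectI exI[of _ "S.frc z (v \<otimes> w)"] conjI)
  qed
  have max: "max_ideal_at R P = PIdl\<^bsub>S.loc\<^esub> \<tau>"
  proof
    show "max_ideal_at R P \<subseteq> PIdl\<^bsub>S.loc\<^esub> \<tau>"
    proof
      fix x assume "x \<in> max_ideal_at R P"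
      then obtain a w where x: "x = S.frc a w" "a \<in> P" "w \<in> carrier R - P" by (auto simp: max_ideal_at_def)
      obtain y' where y': "y' \<in> carrier R" "s \<otimes> a = t \<otimes> y'" using ts x(2) unfolding uniformizing_def by blast
      have "s \<otimes> a = t [^] (1::nat) \<otimes> y'" using c y' by simp
      then have "x \<in> PIdl\<^bsub>S.loc\<^esub> (\<tau> [^]\<^bsub>S.loc\<^esub> (1::nat))"
        unfolding x(1) by (rule mem[OF _ c(2) y'(1) P.Icarr[OF x(2)] x(3)])
      then show "x \<in> PIdl\<^bsub>S.loc\<^esub> \<tau>" using \<tau> by simp
    qed
    show "PIdl\<^bsub>S.loc\<^esub> \<tau> \<subseteq> max_ideal_at R P"
    proof
      fix x assume "x \<in> PIdl\<^bsub>S.loc\<^esub> \<tau>"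
      then obtain r where r: "r \<in> carrier S.loc" "x = r \<otimes>\<^bsub>S.loc\<^esub> \<tau>" unfolding cgenideal_def by blast
      then obtain a w where a: "r = S.frc a w" "a \<in> carrier R" "w \<in> carrier R - P" by (elim S.loc_carrierE)
      have "x = S.frc (a \<otimes> t) (w \<otimes> \<one>)"
        unfolding r(2) a(1) \<tau>_def using a c S.S_one by (intro S.loc_mult) auto
      moreover have "a \<otimes> t \<in> P" by (rule P.I_l_closed[OF c(3) a(2)])
      moreover have "w \<otimes> \<one> \<in> carrier R - P" using a by simp
      ultimately show "x \<in> max_ideal_at R P" unfolding max_ideal_at_def by blast
    qed
  qed
  have pow: "max_ideal_at R P [^]\<^bsub>ideals_set S.loc\<^esub> k = PIdl\<^bsub>S.loc\<^esub> (\<tau> [^]\<^bsub>S.loc\<^esub> k)" for k :: nat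
    unfolding max by (rule L.principal_ideal_power[OF \<tau>])
  define \<iota> where "\<iota> = (\<lambda>a. S.frc a \<one>)"
  have gen: "genideal S.loc (\<iota> ` T) = PIdl\<^bsub>S.loc\<^esub> (\<tau> [^]\<^bsub>S.loc\<^esub> n)"
  proof
    have pid: "ideal (PIdl\<^bsub>S.loc\<^esub> (\<tau> [^]\<^bsub>S.loc\<^esub> n)) S.loc" by (rule L.cgenideal_ideal[OF \<tau>nc])
    show "genideal S.loc (\<iota> ` T) \<subseteq> PIdl\<^bsub>S.loc\<^esub> (\<tau> [^]\<^bsub>S.loc\<^esub> n)"
    proof (rule L.genideal_minimal[OF pid], rule subsetI)
      fix x assume "x \<in> \<iota> ` T"
      then obtain a where a: "x = S.frc a \<one>" "a \<in> T" by (auto simp: \<iota>_def)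
      obtain w z where wz: "w \<in> carrier R - P" "z \<in> carrier R" "w \<otimes> a = t [^] n \<otimes> z" using T(2)[OF a(2)] by blast
      show "x \<in> PIdl\<^bsub>S.loc\<^esub> (\<tau> [^]\<^bsub>S.loc\<^esub> n)"
        unfolding a(1) by (rule mem[OF wz(3) wz(1,2) _ S.S_one]) (use a T in blast)
    qed
    have sub: "\<iota> ` T \<subseteq> carrier S.loc" using T(1) S.S_one by (auto simp: \<iota>_def)
    have gid: "ideal (genideal S.loc (\<iota> ` T)) S.loc" by (rule L.genideal_ideal[OF sub])
    obtain u w where uw: "u \<in> carrier R - P" "w \<in> carrier R - P" "w \<otimes> x0 = t [^] n \<otimes> u"
      using x0 by (auto simp: at_prime_order_def)
    have x0c: "x0 \<in> carrier R" using x0 T by blast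
    have "\<iota> x0 \<in> genideal S.loc (\<iota> ` T)" using L.genideal_self[OF sub] x0 by blast
    then have "S.frc w u \<otimes>\<^bsub>S.loc\<^esub> \<iota> x0 \<in> genideal S.loc (\<iota> ` T)"
      by (rule ideal.I_l_closed[OF gid]) (use uw in auto)
    also have "S.frc w u \<otimes>\<^bsub>S.loc\<^esub> \<iota> x0 = S.frc (w \<otimes> x0) (u \<otimes> \<one>)"
      unfolding \<iota>_def using uw x0c S.S_one by (intro S.loc_mult) auto
    also have "\<dots> = \<tau> [^]\<^bsub>S.loc\<^esub> n"
      unfolding \<tau>n uw(3) using uw c S.S_one by (intro S.frac_eqI') auto
    finally show "PIdl\<^bsub>S.loc\<^esub> (\<tau> [^]\<^bsub>S.loc\<^esub> n) \<subseteq> genideal S.loc (\<iota> ` T)"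
      by (rule L.cgenideal_minimal[OF gid])
  qed
  \<comment> \<open>For \<open>i < k\<close> an equality of the two ideals would make the
    denominator \<open>w\<close> a multiple of \<open>t\<close>, hence an element of
    \<open>P\<close>.\<close>
  have inj: "False" if lt: "i < k" and eq: "PIdl\<^bsub>S.loc\<^esub> (\<tau> [^]\<^bsub>S.loc\<^esub> i) = PIdl\<^bsub>S.loc\<^esub> (\<tau> [^]\<^bsub>S.loc\<^esub> k)" for i k :: nat
  proof -
    have "\<tau> [^]\<^bsub>S.loc\<^esub> i \<in> PIdl\<^bsub>S.loc\<^esub> (\<tau> [^]\<^bsub>S.loc\<^esub> k)"
      using L.cgenideal_self[OF \<tau>nc[of i]] eq by simp
    then obtain r where r: "r \<in> carrier S.loc" "\<tau> [^]\<^bsub>S.loc\<^esub> i = r \<otimes>\<^bsub>S.loc\<^esub> \<tau> [^]\<^bsub>S.loc\<^esub> k"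
      unfolding cgenideal_def by blast
    then obtain a w where a: "r = S.frc a w" "a \<in> carrier R" "w \<in> carrier R - P" by (elim S.loc_carrierE)
    have "S.frc (t [^] i) \<one> = S.frc (a \<otimes> t [^] k) (w \<otimes> \<one>)"
      using r(2) unfolding \<tau>n a(1) using a c S.S_one by (simp add: S.loc_mult)
    then obtain v where v: "v \<in> carrier R - P" "v \<otimes> (t [^] i \<otimes> (w \<otimes> \<one>) \<ominus> (a \<otimes> t [^] k) \<otimes> \<one>) = \<zero>"
      using a c S.S_one by (subst (asm) S.frac_eq_iff) auto
    have "v \<noteq> \<zero>" using v zP by auto
    then have "t [^] i \<otimes> (w \<otimes> \<one>) \<ominus> (a \<otimes> t [^] k) \<otimes> \<one> = \<zero>" using v a c by (auto simp: integral_iff)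
    then have "t [^] i \<otimes> w = a \<otimes> t [^] k" using a c by simp
    also have "t [^] k = t [^] i \<otimes> t [^] (k - i)" using lt c by (simp add: nat_pow_mult)
    finally have "t [^] i \<otimes> w = t [^] i \<otimes> (a \<otimes> t [^] (k - i))" using a c by (simp add: m_ac)
    then have "w = a \<otimes> t [^] (k - i)" using a c pow_nonzero[OF c(1) t0] by (simp add: m_lcancel)
    also have "k - i = Suc (k - i - 1)" using lt by simp
    also have "a \<otimes> t [^] Suc (k - i - 1) = (a \<otimes> t [^] (k - i - 1)) \<otimes> t" using a c by (simp add: m_ac)
    finally have "w \<in> P" using P.I_l_closed[OF c(3), of "a \<otimes> t [^] (k - i - 1)"] a c by simp
    then show False using a by blast
  qed
  show ?thesis
    unfolding order_at_def L
  proof (rule the_equality)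
    show "genideal S.loc ((\<lambda>a. S.frc a \<one>) ` T) = max_ideal_at R P [^]\<^bsub>ideals_set S.loc\<^esub> n"
      using gen pow by (simp add: \<iota>_def)
    fix k :: nat assume "genideal S.loc ((\<lambda>a. S.frc a \<one>) ` T) = max_ideal_at R P [^]\<^bsub>ideals_set S.loc\<^esub> k"
    then have "PIdl\<^bsub>S.loc\<^esub> (\<tau> [^]\<^bsub>S.loc\<^esub> n) = PIdl\<^bsub>S.loc\<^esub> (\<tau> [^]\<^bsub>S.loc\<^esub> k)"
      using gen[unfolded \<iota>_def] pow[of k] by simp
    then show "k = n" using inj[of n k] inj[of k n] by (metis linorder_neqE_nat)
  qed
qed

definition unif :: "'a set \<Rightarrow> 'a" where
  "unif P = (SOME t. t \<noteq> \<zero> \<and> (\<exists>s. uniformizing R P t s))"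

lemma unif:
  assumes "P \<in> height_one_primes R"
  shows "unif P \<noteq> \<zero>" "\<exists>s. uniformizing R P (unif P) s" "unif P \<in> P" "unif P \<in> carrier R"
proof -
  have "\<exists>t. t \<noteq> \<zero> \<and> (\<exists>s. uniformizing R P t s)"
    by (rule height_one_uniformizer[OF assms]) blast
  from someI_ex[OF this] show *: "unif P \<noteq> \<zero>" "\<exists>s. uniformizing R P (unif P) s" by (auto simp: unif_def)
  then show uP: "unif P \<in> P" by (auto simp: uniformizing_def)
  have "ideal P R" using assms by (simp add: height_one_iff primeideal_def)
  then show "unif P \<in> carrier R" using uP by (rule ideal.Icarr)
qed

lemma ht1_prime: "P \<in> height_one_primes R \<Longrightarrow> primeideal P R"
  by (simp add: height_one_iff)

text \<open>After this, valuations are read off from equations \<open>w a = t^n u\<close> with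
  \<open>u\<close> and \<open>w\<close> outside \<open>P\<close>. Existence of the exponent is
  \<open>uniformizing_power\<close>.\<close>

lemma valuation_eq_iff:
  assumes P: "P \<in> height_one_primes R" and a: "a \<in> carrier R" "a \<noteq> \<zero>"
  shows "valuation R P a = n \<longleftrightarrow> at_prime_order P (unif P) a n"
proof -
  have val: "valuation R P a = n" if o: "at_prime_order P (unif P) a n" for n
  proof -
    obtain s where s: "uniformizing R P (unif P) s" using unif[OF P] by blast
    have T: "\<exists>w\<in>carrier R - P. \<exists>z\<in>carrier R. w \<otimes> x = unif P [^] n \<otimes> z" if "x \<in> {a}" for x
      using o that unfolding at_prime_order_def by blast
    show ?thesis unfolding valuation_def
      by (rule order_at_eq[OF ht1_prime[OF P] s unif(1)[OF P] _ T _ o]) (use a in auto)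
  qed
  obtain s where s: "uniformizing R P (unif P) s" using unif[OF P] by blast
  have P': "primeideal P R" by (rule ht1_prime[OF P])
  interpret P: primeideal P R by (rule P')
  interpret S: mult_closed R "carrier R - P" by (rule mult_closed_prime[OF P'])
  obtain k :: nat and u where u: "u \<in> carrier R - P" "s [^] k \<otimes> a = unif P [^] k \<otimes> u"
    by (rule uniformizing_power[OF P' s a unif(1)[OF P]])
  have "s [^] k \<in> carrier R - P" using s S.loc_pow(2)[of \<one> s k] by (auto simp: uniformizing_def)
  then have "at_prime_order P (unif P) a k" using u unfolding at_prime_order_def by blast
  then show ?thesis using val by metis
qed

lemma valuationE:
  assumes "P \<in> height_one_primes R" "a \<in> carrier R" "a \<noteq> \<zero>"
  obtains u w where "u \<in> carrier R - P" "w \<in> carrier R - P" "w \<otimes> a = unif P [^] valuation R P a \<otimes> u"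
  using valuation_eq_iff[OF assms, of "valuation R P a"] by (auto simp: at_prime_order_def)

lemma valuationI:
  assumes "P \<in> height_one_primes R" "a \<in> carrier R" "a \<noteq> \<zero>"
    "u \<in> carrier R - P" "w \<in> carrier R - P" "w \<otimes> a = unif P [^] n \<otimes> u"
  shows "valuation R P a = n"
  using valuation_eq_iff[OF assms(1-3), of n] assms(4-6) by (auto simp: at_prime_order_def)

lemma prime_compl_mult:
  "P \<in> height_one_primes R \<Longrightarrow> u \<in> carrier R - P \<Longrightarrow> v \<in> carrier R - P \<Longrightarrow> u \<otimes> v \<in> carrier R - P"
  using mult_closed.S_mult[OF mult_closed_prime[OF ht1_prime]] by blast

lemma valuation_mult:
  assumes P: "P \<in> height_one_primes R" and a: "a \<in> carrier R" "a \<noteq> \<zero>" and b: "b \<in> carrier R" "b \<noteq> \<zero>"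
  shows "valuation R P (a \<otimes> b) = valuation R P a + valuation R P b"
proof -
  obtain u w where u: "u \<in> carrier R - P" "w \<in> carrier R - P" "w \<otimes> a = unif P [^] valuation R P a \<otimes> u"
    by (rule valuationE[OF P a])
  obtain u' w' where u': "u' \<in> carrier R - P" "w' \<in> carrier R - P" "w' \<otimes> b = unif P [^] valuation R P b \<otimes> u'"
    by (rule valuationE[OF P b])
  note t = unif(4)[OF P]
  have c: "u \<in> carrier R" "w \<in> carrier R" "u' \<in> carrier R" "w' \<in> carrier R" using u u' by auto
  have "(w \<otimes> w') \<otimes> (a \<otimes> b) = (w \<otimes> a) \<otimes> (w' \<otimes> b)" using c a b by (simp add: m_ac)
  also have "\<dots> = (unif P [^] valuation R P a \<otimes> unif P [^] valuation R P b) \<otimes> (u \<otimes> u')"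
    unfolding u(3) u'(3) using c t by (simp add: m_ac)
  also have "\<dots> = unif P [^] (valuation R P a + valuation R P b) \<otimes> (u \<otimes> u')"
    using t by (simp add: nat_pow_mult)
  finally show ?thesis
    by (intro valuationI[OF P _ _ prime_compl_mult[OF P u(1) u'(1)] prime_compl_mult[OF P u(2) u'(2)]])
      (use a b in \<open>auto simp: integral_iff\<close>)
qed

lemma valuation_0_iff:
  assumes P: "P \<in> height_one_primes R" and a: "a \<in> carrier R" "a \<noteq> \<zero>"
  shows "valuation R P a = 0 \<longleftrightarrow> a \<notin> P"
proof
  interpret P: primeideal P R by (rule ht1_prime[OF P])
  obtain u w where u: "u \<in> carrier R - P" "w \<in> carrier R - P" "w \<otimes> a = unif P [^] valuation R P a \<otimes> u"
    by (rule valuationE[OF P a])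
  { assume "valuation R P a = 0"
    then have "w \<otimes> a = u" using u by simp
    then show "a \<notin> P" using P.I_l_closed[of a w] u by auto }
  { assume "a \<notin> P"
    then have "\<one> \<otimes> a = unif P [^] (0::nat) \<otimes> a" using a by simp
    then show "valuation R P a = 0"
      by (rule valuationI[OF P a, rotated -1])
        (use \<open>a \<notin> P\<close> a mult_closed.S_one[OF mult_closed_prime[OF ht1_prime[OF P]]] in auto) }
qed

lemma valuation_unif:
  assumes P: "P \<in> height_one_primes R" shows "valuation R P (unif P) = 1"
proof -
  have one: "\<one> \<in> carrier R - P" by (rule mult_closed.S_one[OF mult_closed_prime[OF ht1_prime[OF P]]])
  show ?thesis
    by (rule valuationI[OF P unif(4,1)[OF P] one one]) (use unif(4)[OF P] in simp)
qed

lemma valuation_pow: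
  assumes P: "P \<in> height_one_primes R" and a: "a \<in> carrier R" "a \<noteq> \<zero>"
  shows "valuation R P (a [^] (n::nat)) = n * valuation R P a"
proof (induction n)
  case 0
  have "\<one> \<notin> P" using mult_closed.S_one[OF mult_closed_prime[OF ht1_prime[OF P]]] by simp
  then show ?case using valuation_0_iff[OF P, of \<one>] by simp
next
  case (Suc n)
  then show ?case using valuation_mult[OF P _ pow_nonzero[OF a] a] a by simp
qed

text \<open>The right side says that \<open>a/b\<close> lies in \<open>R_P\<close>. This is the
  bridge from inequalities of valuations to colon ideals.\<close>

lemma valuation_le_iff:
  assumes P: "P \<in> height_one_primes R" and a: "a \<in> carrier R" "a \<noteq> \<zero>" and b: "b \<in> carrier R" "b \<noteq> \<zero>"
  shows "valuation R P b \<le> valuation R P a \<longleftrightarrow> (\<exists>s\<in>carrier R - P. b divides s \<otimes> a)"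
proof
  interpret P: primeideal P R by (rule ht1_prime[OF P])
  note t = unif(4)[OF P]
  { assume le: "valuation R P b \<le> valuation R P a"
    obtain u w where u: "u \<in> carrier R - P" "w \<in> carrier R - P" "w \<otimes> a = unif P [^] valuation R P a \<otimes> u"
      by (rule valuationE[OF P a])
    obtain u' w' where u': "u' \<in> carrier R - P" "w' \<in> carrier R - P" "w' \<otimes> b = unif P [^] valuation R P b \<otimes> u'"
      by (rule valuationE[OF P b])
    have c: "u \<in> carrier R" "w \<in> carrier R" "u' \<in> carrier R" "w' \<in> carrier R" using u u' by auto
    define d where "d = valuation R P a - valuation R P b"
    have "unif P [^] valuation R P a = unif P [^] valuation R P b \<otimes> unif P [^] d"
      using le t by (simp add: nat_pow_mult d_def)
    then have "(u' \<otimes> w) \<otimes> a = u' \<otimes> (unif P [^] valuation R P b \<otimes> unif P [^] d \<otimes> u)"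
      using u(3) c a by (simp add: m_assoc)
    also have "\<dots> = (unif P [^] valuation R P b \<otimes> u') \<otimes> (unif P [^] d \<otimes> u)" using c t by (simp add: m_ac)
    also have "\<dots> = b \<otimes> (w' \<otimes> (unif P [^] d \<otimes> u))" unfolding u'(3)[symmetric] using c t b by (simp add: m_ac)
    finally have "b divides (u' \<otimes> w) \<otimes> a" by (rule dividesI[rotated]) (use c t in auto)
    then show "\<exists>s\<in>carrier R - P. b divides s \<otimes> a" using prime_compl_mult[OF P u'(1) u(2)] by blast }
  { assume "\<exists>s\<in>carrier R - P. b divides s \<otimes> a"
    then obtain s z where s: "s \<in> carrier R" "s \<notin> P" "z \<in> carrier R" "s \<otimes> a = b \<otimes> z" by (auto elim!: dividesE)
    have s0: "s \<noteq> \<zero>" using s P.zero_closed by auto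
    have z0: "z \<noteq> \<zero>"
    proof
      assume "z = \<zero>"
      then have "s \<otimes> a = \<zero>" using s b by simp
      then show False using s s0 a by (simp add: integral_iff)
    qed
    have "valuation R P (s \<otimes> a) = valuation R P a"
      using valuation_mult[OF P s(1) s0 a] valuation_0_iff[OF P s(1) s0] s by simp
    moreover have "valuation R P (b \<otimes> z) = valuation R P b + valuation R P z"
      by (rule valuation_mult[OF P b s(3) z0])
    ultimately show "valuation R P b \<le> valuation R P a" using s(4) by simp }
qed

lemma valuation_mono_divides:
  assumes "P \<in> height_one_primes R" "a \<in> carrier R" "a \<noteq> \<zero>" "b \<in> carrier R" "b \<noteq> \<zero>" "b divides a"
  shows "valuation R P b \<le> valuation R P a"
proof -
  have one: "\<one> \<in> carrier R - P" by (rule mult_closed.S_one[OF mult_closed_prime[OF ht1_prime[OF assms(1)]]])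
  have "b divides \<one> \<otimes> a" using assms by simp
  then show ?thesis using valuation_le_iff[OF assms(1-5)] one by blast
qed

text \<open>Otherwise some \<open>c a\<close> has in \<open>R/bR\<close> a prime annihilator
  \<open>P\<close> inside \<open>Q\<close>. That prime has a uniformizer, hence height one, so the
  hypothesis puts \<open>a/b\<close> into \<open>R_P\<close>: some \<open>r\<close> outside
  \<open>P\<close> kills \<open>c a\<close> modulo \<open>b\<close>, a contradiction.\<close>

lemma local_hartogs:
  assumes Q: "primeideal Q R" and a: "a \<in> carrier R" "a \<noteq> \<zero>" and b: "b \<in> carrier R" "b \<noteq> \<zero>"
    and le: "\<And>P. P \<in> height_one_primes R \<Longrightarrow> P \<subseteq> Q \<Longrightarrow> valuation R P b \<le> valuation R P a"
  shows "\<exists>s\<in>carrier R - Q. b divides s \<otimes> a"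
proof (rule ccontr)
  assume "\<not> ?thesis"
  then have nd: "\<And>s. s \<in> carrier R - Q \<Longrightarrow> \<not> b divides s \<otimes> a" by blast
  obtain P c where P: "primeideal P R" "P \<subseteq> Q" "c \<in> carrier R" "P = {y \<in> carrier R. b divides y \<otimes> (c \<otimes> a)}"
    "\<not> b divides (c \<otimes> a)"
    by (rule local_associated_prime[OF Q a(1) b(1) nd])
  have ca: "c \<otimes> a \<in> carrier R" using P a by simp
  have bP: "b \<in> P" unfolding P(4) using b ca by (auto intro: dividesI)
  obtain t s where ts: "uniformizing R P t s"
    using uniformizer_of_quotient[OF P(1,4) ca b P(5)] by blast
  have P1: "P \<in> height_one_primes R"
    by (rule uniformizing_height_one[OF P(1) ts]) (use bP b in auto)
  obtain r where r: "r \<in> carrier R - P" "b divides r \<otimes> a"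
    using valuation_le_iff[OF P1 a b] le[OF P1 P(2)] by blast
  have "b divides c \<otimes> (r \<otimes> a)" by (rule divides_lmult[OF P(3) b(1) r(2)])
  also have "c \<otimes> (r \<otimes> a) = r \<otimes> (c \<otimes> a)" using r P a by (simp add: m_ac)
  finally have "r \<in> P" using r P(4) by simp
  then show False using r by simp
qed

text \<open>If \<open>b\<close> does not divide \<open>a\<close>, the proper ideal
  \<open>(bR : a)\<close> lies in a prime \<open>Q\<close>, at which \<open>local_hartogs\<close>
  produces an element of that ideal outside \<open>Q\<close>.\<close>

lemma hartogs:
  assumes a: "a \<in> carrier R" "a \<noteq> \<zero>" and b: "b \<in> carrier R" "b \<noteq> \<zero>"
    and le: "\<And>P. P \<in> height_one_primes R \<Longrightarrow> valuation R P b \<le> valuation R P a"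
  shows "b divides a"
proof (rule ccontr)
  assume nd: "\<not> b divides a"
  have id: "ideal {y \<in> carrier R. b divides y \<otimes> a} R" by (rule divides_ideal) (use a b in auto)
  have "\<one> \<notin> {y \<in> carrier R. b divides y \<otimes> a}" using nd a by simp
  then obtain Q where Q: "primeideal Q R" "{y \<in> carrier R. b divides y \<otimes> a} \<subseteq> Q"
    by (rule exists_prime_above[OF id])
  obtain s where "s \<in> carrier R - Q" "b divides s \<otimes> a"
    using local_hartogs[OF Q(1) a b le] by blast
  then show False using Q(2) by blast
qed

lemma finite_valuation_support:
  assumes "a \<in> carrier R" "a \<noteq> \<zero>"
  shows "finite {P \<in> height_one_primes R. valuation R P a \<noteq> 0}"
proof -
  have "{P \<in> height_one_primes R. valuation R P a \<noteq> 0} = {P \<in> height_one_primes R. a \<in> P}"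
    by (intro Collect_cong conj_cong refl) (simp add: valuation_0_iff[OF _ assms])
  then show ?thesis using finite_height_one_containing[OF assms] by simp
qed

text \<open>The bound is tested against the \<open>n\<close>-th power of \<open>unif P\<close>: by
  \<open>valuation_le_iff\<close> it divides both summands up to factors outside \<open>P\<close>,
  hence also their sum.\<close>

lemma valuation_add:
  assumes P: "P \<in> height_one_primes R" and a: "a \<in> carrier R" "a \<noteq> \<zero>" and b: "b \<in> carrier R" "b \<noteq> \<zero>"
    and ab: "a \<oplus> b \<noteq> \<zero>" and n: "n \<le> valuation R P a" "n \<le> valuation R P b"
  shows "n \<le> valuation R P (a \<oplus> b)"
proof -
  note t = unif(4)[OF P] and tn = pow_nonzero[OF unif(4,1)[OF P], of n]
  have v: "valuation R P (unif P [^] n) = n" using valuation_pow[OF P unif(4,1)[OF P]] valuation_unif[OF P] by simp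
  have "valuation R P (unif P [^] n) \<le> valuation R P a" "valuation R P (unif P [^] n) \<le> valuation R P b"
    using n v by auto
  then obtain s s' where s: "s \<in> carrier R - P" "unif P [^] n divides s \<otimes> a"
    and s': "s' \<in> carrier R - P" "unif P [^] n divides s' \<otimes> b"
    using valuation_le_iff[OF P a nat_pow_closed[OF t] tn] valuation_le_iff[OF P b nat_pow_closed[OF t] tn] by blast
  have "(s \<otimes> s') \<otimes> (a \<oplus> b) = s' \<otimes> (s \<otimes> a) \<oplus> s \<otimes> (s' \<otimes> b)" using s s' a b by (simp add: r_distr m_ac)
  moreover have "unif P [^] n divides (s' \<otimes> (s \<otimes> a) \<oplus> s \<otimes> (s' \<otimes> b))"
    by (rule divides_sum[OF _ divides_lmult[OF _ _ s(2)] divides_lmult[OF _ _ s'(2)]]) (use s s' t in auto)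
  ultimately have "unif P [^] n divides (s \<otimes> s') \<otimes> (a \<oplus> b)" by simp
  then have "\<exists>r\<in>carrier R - P. unif P [^] n divides r \<otimes> (a \<oplus> b)"
    by (intro bexI[OF _ prime_compl_mult[OF P s(1) s'(1)]])
  then have "valuation R P (unif P [^] n) \<le> valuation R P (a \<oplus> b)"
    using valuation_le_iff[OF P a_closed[OF a(1) b(1)] ab nat_pow_closed[OF t] tn] by simp
  then show ?thesis using v by simp
qed

end

section \<open>Quotients of ideals\<close>

text \<open>The quotient \<open>J/I\<close> of ideals, with cosets coded as sets of constant sequences so that it lives
  on the type over which \<^const>\<open>faithfully_flat\<close> quantifies.\<close>

definition enc :: "('a, 'm) ring_scheme \<Rightarrow> 'a set \<Rightarrow> 'a \<Rightarrow> (nat \<Rightarrow> 'a) set" where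
  "enc R I x = (\<lambda>c _. c) ` (I +>\<^bsub>R\<^esub> x)"

definition dec :: "('a, 'm) ring_scheme \<Rightarrow> 'a set \<Rightarrow> 'a set \<Rightarrow> (nat \<Rightarrow> 'a) set \<Rightarrow> 'a" where
  "dec R I J m = (SOME x. x \<in> J \<and> enc R I x = m)"

text \<open>An element of \<open>J\<close> cannot be read off from an encoded coset, so the
  operations go through representatives chosen by \<open>dec\<close>.\<close>

definition quot_mod :: "('a, 'm) ring_scheme \<Rightarrow> 'a set \<Rightarrow> 'a set \<Rightarrow> ('a, (nat \<Rightarrow> 'a) set) module" where
  "quot_mod R I J = \<lparr>carrier = enc R I ` J, monoid.mult = (\<lambda>_ _. undefined), monoid.one = undefined,
     ring.zero = enc R I \<zero>\<^bsub>R\<^esub>,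
     ring.add = (\<lambda>m n. enc R I (dec R I J m \<oplus>\<^bsub>R\<^esub> dec R I J n)),
     smult = (\<lambda>a m. enc R I (a \<otimes>\<^bsub>R\<^esub> dec R I J m))\<rparr>"

lemma (in cring) enc_eq_iff:
  assumes "ideal I R" "x \<in> carrier R" "y \<in> carrier R"
  shows "enc R I x = enc R I y \<longleftrightarrow> x \<ominus> y \<in> I"
proof -
  have "inj_on (\<lambda>c (_::nat). c) (A :: 'a set)" for A by (auto simp: inj_on_def fun_eq_iff)
  then have "enc R I x = enc R I y \<longleftrightarrow> I +> x = I +> y"
    unfolding enc_def by (metis inj_on_image_eq_iff subset_UNIV)
  also have "\<dots> \<longleftrightarrow> x \<ominus> y \<in> I" using quotient_eq_iff_same_a_r_cos[OF assms] by simp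
  finally show ?thesis .
qed

locale ideal_pair = cring R for R (structure) +
  fixes I J
  assumes I: "ideal I R" and J: "ideal J R" and IJ: "I \<subseteq> J"
begin

abbreviation "e \<equiv> enc R I"
abbreviation "M \<equiv> quot_mod R I J"

lemma Jc: "x \<in> J \<Longrightarrow> x \<in> carrier R"
  by (rule ideal.Icarr[OF J])

lemma dec: assumes "x \<in> J" shows "dec R I J (e x) \<in> J" "e (dec R I J (e x)) = e x"
proof -
  have "\<exists>y. y \<in> J \<and> e y = e x" using assms by blast
  from someI_ex[OF this] show "dec R I J (e x) \<in> J" "e (dec R I J (e x)) = e x" by (auto simp: dec_def)
qed

lemma J_add: "x \<in> J \<Longrightarrow> y \<in> J \<Longrightarrow> x \<oplus> y \<in> J"
  by (rule additive_subgroup.a_closed[OF ideal.axioms(1)[OF J]])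

lemma J_mult: "x \<in> J \<Longrightarrow> a \<in> carrier R \<Longrightarrow> a \<otimes> x \<in> J"
  by (rule ideal.I_l_closed[OF J])

lemma J_zero: "\<zero> \<in> J"
  by (rule additive_subgroup.zero_closed[OF ideal.axioms(1)[OF J]])

lemma J_neg: "x \<in> J \<Longrightarrow> \<ominus> x \<in> J"
  by (rule additive_subgroup.a_inv_closed[OF ideal.axioms(1)[OF J]])

lemma carrier_M: "carrier M = e ` J"
  and zero_M: "\<zero>\<^bsub>M\<^esub> = e \<zero>"
  by (simp_all add: quot_mod_def)

lemma e_mem: "x \<in> J \<Longrightarrow> e x \<in> carrier M"
  by (simp add: carrier_M)

lemma I_add: "x \<in> I \<Longrightarrow> y \<in> I \<Longrightarrow> x \<oplus> y \<in> I"
  by (rule additive_subgroup.a_closed[OF ideal.axioms(1)[OF I]])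

lemma add_M: assumes "x \<in> J" "y \<in> J" shows "e x \<oplus>\<^bsub>M\<^esub> e y = e (x \<oplus> y)"
proof -
  let ?x = "dec R I J (e x)" and ?y = "dec R I J (e y)"
  have d: "?x \<in> J" "?y \<in> J" "e ?x = e x" "e ?y = e y" using dec assms by auto
  note c = Jc[OF d(1)] Jc[OF d(2)] Jc[OF assms(1)] Jc[OF assms(2)]
  have "?x \<ominus> x \<in> I" "?y \<ominus> y \<in> I" using d enc_eq_iff[OF I] c by auto
  then have "(?x \<ominus> x) \<oplus> (?y \<ominus> y) \<in> I" by (rule I_add)
  moreover have "(?x \<ominus> x) \<oplus> (?y \<ominus> y) = (?x \<oplus> ?y) \<ominus> (x \<oplus> y)"
    using c by (simp add: minus_eq minus_add a_ac)
  ultimately have "e (?x \<oplus> ?y) = e (x \<oplus> y)" using c by (simp add: enc_eq_iff[OF I])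
  then show ?thesis by (simp add: quot_mod_def)
qed

lemma smult_M: assumes "a \<in> carrier R" "x \<in> J" shows "a \<odot>\<^bsub>M\<^esub> e x = e (a \<otimes> x)"
proof -
  let ?x = "dec R I J (e x)"
  have d: "?x \<in> J" "e ?x = e x" using dec assms by auto
  note c = Jc[OF d(1)] Jc[OF assms(2)] assms(1)
  have "?x \<ominus> x \<in> I" using d enc_eq_iff[OF I] c by auto
  then have "a \<otimes> (?x \<ominus> x) \<in> I" using assms(1) by (rule ideal.I_l_closed[OF I])
  moreover have "a \<otimes> (?x \<ominus> x) = a \<otimes> ?x \<ominus> a \<otimes> x" using c by (simp add: minus_eq r_distr r_minus)
  ultimately have "e (a \<otimes> ?x) = e (a \<otimes> x)" using c by (simp add: enc_eq_iff[OF I])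
  then show ?thesis by (simp add: quot_mod_def)
qed

lemma M_module: "Module.module R M"
proof (rule moduleI[OF is_cring])
  show "abelian_group M"
  proof (rule abelian_groupI)
    fix x assume "x \<in> carrier M"
    then obtain x' where x': "x = e x'" "x' \<in> J" by (auto simp: carrier_M)
    have "e (\<ominus> x') \<oplus>\<^bsub>M\<^esub> x = \<zero>\<^bsub>M\<^esub>"
      unfolding x'(1) zero_M using x' Jc[OF x'(2)] by (simp add: add_M J_neg l_neg)
    then show "\<exists>y\<in>carrier M. y \<oplus>\<^bsub>M\<^esub> x = \<zero>\<^bsub>M\<^esub>" using e_mem[OF J_neg[OF x'(2)]] by blast
  qed (auto simp: carrier_M zero_M add_M J_add J_zero Jc a_ac)
qed (auto simp: carrier_M add_M smult_M J_add J_mult Jc l_distr r_distr m_assoc)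

end

section \<open>Faithfully flat extensions\<close>

abbreviation tensor_free :: "('a, 'b, 'k) module_scheme \<Rightarrow> ('a, 'c, 'l) module_scheme \<Rightarrow> ('b \<times> 'c \<Rightarrow>\<^sub>0 int) monoid" where
  "tensor_free M N \<equiv> free_Abelian_group (carrier M \<times> carrier N)"

lemma tensor_relations_add1:
  "x \<in> carrier M \<Longrightarrow> x' \<in> carrier M \<Longrightarrow> y \<in> carrier N
    \<Longrightarrow> frag_of (x \<oplus>\<^bsub>M\<^esub> x', y) - frag_of (x, y) - frag_of (x', y) \<in> tensor_relations R M N"
  unfolding tensor_relations_def by (intro generate.incl) blast

lemma tensor_relations_add2:
  "x \<in> carrier M \<Longrightarrow> y \<in> carrier N \<Longrightarrow> y' \<in> carrier N
    \<Longrightarrow> frag_of (x, y \<oplus>\<^bsub>N\<^esub> y') - frag_of (x, y) - frag_of (x, y') \<in> tensor_relations R M N"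
  unfolding tensor_relations_def by (intro generate.incl) blast

lemma tensor_relations_smult:
  "a \<in> carrier R \<Longrightarrow> x \<in> carrier M \<Longrightarrow> y \<in> carrier N
    \<Longrightarrow> frag_of (a \<odot>\<^bsub>M\<^esub> x, y) - frag_of (x, a \<odot>\<^bsub>N\<^esub> y) \<in> tensor_relations R M N"
  unfolding tensor_relations_def by (intro generate.incl) blast

lemma keys_subset_diff: "Poly_Mapping.keys (a :: 'a \<Rightarrow>\<^sub>0 int) \<subseteq> S \<Longrightarrow> Poly_Mapping.keys b \<subseteq> S \<Longrightarrow> Poly_Mapping.keys (a - b) \<subseteq> S"
  using keys_diff[of a b] by blast

lemma free_Abelian_group_diff:
  "a \<in> carrier (free_Abelian_group S) \<Longrightarrow> b \<in> carrier (free_Abelian_group S)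
    \<Longrightarrow> a - b \<in> carrier (free_Abelian_group S)"
  using keys_subset_diff[of a S b] by simp

lemma tensor_relations_subgroup:
  assumes "Module.module R M" "Module.module R N"
  shows "subgroup (tensor_relations R M N) (tensor_free M N)"
proof -
  interpret M: Module.module R M by fact
  interpret N: Module.module R N by fact
  show ?thesis unfolding tensor_relations_def
    by (rule group.generate_is_subgroup)
      (auto intro!: free_Abelian_group_diff simp del: carrier_free_Abelian_group_iff)
qed

lemma tensor_relations_plus:
  "u \<in> tensor_relations R M N \<Longrightarrow> v \<in> tensor_relations R M N \<Longrightarrow> u + v \<in> tensor_relations R M N"
  using generate.eng[of u "tensor_free M N" _ v] unfolding tensor_relations_def by simp

lemma tensor_relations_zero: "0 \<in> tensor_relations R M N"
  using generate.one[of "tensor_free M N"] unfolding tensor_relations_def by simp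

lemma tensor_relations_uminus:
  assumes "Module.module R M" "Module.module R N" "u \<in> tensor_relations R M N"
  shows "- u \<in> tensor_relations R M N"
proof -
  interpret subgroup "tensor_relations R M N" "tensor_free M N"
    by (rule tensor_relations_subgroup[OF assms(1,2)])
  show ?thesis using m_inv_closed[OF assms(3)] mem_carrier[OF assms(3)] by simp
qed

text \<open>This makes \<open>f \<otimes> id\<close> well defined: linearity of \<open>f\<close>
  sends generating relations to generating relations.\<close>

lemma tensor_map_relations:
  assumes M: "Module.module R M" and N: "Module.module R N" and M': "Module.module R M'"
    and f: "f \<in> linear_maps R M M'" and u: "u \<in> tensor_relations R M N"
  shows "frag_extend (\<lambda>(x, y). frag_of (f x, y)) u \<in> tensor_relations R M' N"
proof -
  interpret M: Module.module R M by fact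
  interpret N: Module.module R N by fact
  interpret M': Module.module R M' by fact
  let ?E = "frag_extend (\<lambda>(x, y). frag_of (f x, y))"
  have fc: "f x \<in> carrier M'" if "x \<in> carrier M" for x
    using f that by (auto simp: linear_maps_def hom_def)
  have fa: "f (x \<oplus>\<^bsub>M\<^esub> y) = f x \<oplus>\<^bsub>M'\<^esub> f y" if "x \<in> carrier M" "y \<in> carrier M" for x y
    using f that by (auto simp: linear_maps_def hom_def)
  have fs: "f (a \<odot>\<^bsub>M\<^esub> x) = a \<odot>\<^bsub>M'\<^esub> f x" if "a \<in> carrier R" "x \<in> carrier M" for x a
    using f that by (auto simp: linear_maps_def)
  note un = tensor_relations_uminus[OF M' N]
  show ?thesis using u unfolding tensor_relations_def[of R M]
  proof (induction u rule: generate.induct)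
    case one then show ?case by (simp add: tensor_relations_zero)
  next
    case (incl h)
    then show ?case
      by (auto simp: frag_extend_diff fa fs fc intro!: tensor_relations_add1 tensor_relations_add2 tensor_relations_smult)
  next
    case (inv h)
    then have "?E h \<in> tensor_relations R M' N"
      by (auto simp: frag_extend_diff fa fs fc intro!: tensor_relations_add1 tensor_relations_add2 tensor_relations_smult)
    then have "- ?E h \<in> tensor_relations R M' N" by (rule un)
    moreover have "h \<in> carrier (tensor_free M N)"
      using inv by (auto intro!: free_Abelian_group_diff simp del: carrier_free_Abelian_group_iff)
    ultimately show ?case by (simp add: frag_extend_minus)
  next
    case (eng h1 h2)
    then show ?case by (simp add: frag_extend_add tensor_relations_plus)
  qed
qed

lemma as_module_module:
  assumes "cring A" "cring A'" "\<phi> \<in> ring_hom A A'"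
  shows "Module.module A (as_module A' \<phi>)"
proof -
  interpret A: cring A by fact
  interpret A': cring A' by fact
  note h = ring_hom_closed[OF assms(3)] ring_hom_mult[OF assms(3)] ring_hom_add[OF assms(3)] ring_hom_one[OF assms(3)]
  show ?thesis
  proof (rule moduleI[OF assms(1)])
    show "abelian_group (as_module A' \<phi>)"
    proof (rule abelian_groupI)
      fix x assume "x \<in> carrier (as_module A' \<phi>)"
      then have "\<ominus>\<^bsub>A'\<^esub> x \<in> carrier A'" "\<ominus>\<^bsub>A'\<^esub> x \<oplus>\<^bsub>A'\<^esub> x = \<zero>\<^bsub>A'\<^esub>"
        by (auto simp: as_module_def A'.l_neg)
      then show "\<exists>y\<in>carrier (as_module A' \<phi>). y \<oplus>\<^bsub>as_module A' \<phi>\<^esub> x = \<zero>\<^bsub>as_module A' \<phi>\<^esub>"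
        by (intro bexI[of _ "\<ominus>\<^bsub>A'\<^esub> x"]) (auto simp: as_module_def)
    qed (auto simp: as_module_def A'.a_ac)
  qed (auto simp: as_module_def h A'.l_distr A'.r_distr A'.m_assoc)
qed

lemma r_coset_free_iff:
  "u \<in> H #>\<^bsub>free_Abelian_group S\<^esub> v \<longleftrightarrow> u - v \<in> H"
  unfolding r_coset_def by (auto simp: algebra_simps intro!: bexI[of _ "u - v"])

text \<open>Moves exactness from cosets to formal sums, where the later arguments can evaluate
  explicitly. The tensored \<open>g\<close> is a union over the representatives of a coset; all of
  them go to relations, so the coset of \<open>u\<close> lies in the kernel.\<close>

lemma tensor_exactD:
  fixes M1 M2 M3 :: "('a, (nat \<Rightarrow> 'a) set) module"
  assumes A: "cring A" "cring A'" and ff: "faithfully_flat A A' \<phi>"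
    and M: "Module.module A M1" "Module.module A M2" "Module.module A M3"
    and fg: "f \<in> linear_maps A M1 M2" "g \<in> linear_maps A M2 M3"
    and ex: "f ` carrier M1 = a_kernel M2 M3 g"
    and u: "u \<in> carrier (tensor_free M2 (as_module A' \<phi>))"
      "frag_extend (\<lambda>(x, y). frag_of (g x, y)) u \<in> tensor_relations A M3 (as_module A' \<phi>)"
  obtains w where "w \<in> carrier (tensor_free M1 (as_module A' \<phi>))"
    "u - frag_extend (\<lambda>(x, y). frag_of (f x, y)) w \<in> tensor_relations A M2 (as_module A' \<phi>)"
proof -
  let ?N = "as_module A' \<phi>"
  let ?g = "frag_extend (\<lambda>(x, y). frag_of (g x, y))" and ?f = "frag_extend (\<lambda>(x, y). frag_of (f x, y))"
  have hom: "\<phi> \<in> ring_hom A A'" using ff by (simp add: faithfully_flat_def)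
  note N = as_module_module[OF A hom]
  have exact: "tensor_map A M2 ?N f ` carrier (tensor_product A M1 ?N) =
        kernel (tensor_product A M2 ?N) (tensor_product A M3 ?N) (tensor_map A M3 ?N g)"
    using ff M fg ex unfolding faithfully_flat_def by blast
  define C where "C = tensor_relations A M2 ?N #>\<^bsub>tensor_free M2 ?N\<^esub> u"
  have C: "C \<in> carrier (tensor_product A M2 ?N)"
    using u(1) unfolding C_def tensor_product_def FactGroup_def RCOSETS_def by auto
  have uC: "u \<in> C" unfolding C_def r_coset_free_iff by (simp add: tensor_relations_zero)
  have co: "tensor_relations A M3 ?N #>\<^bsub>tensor_free M3 ?N\<^esub> ?g x = tensor_relations A M3 ?N" if "x \<in> C" for x
  proof -
    have "x - u \<in> tensor_relations A M2 ?N" using that unfolding C_def r_coset_free_iff .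
    then have "?g (x - u) \<in> tensor_relations A M3 ?N"
      by (rule tensor_map_relations[OF M(2) N M(3) fg(2)])
    then have "?g (x - u) + ?g u \<in> tensor_relations A M3 ?N" using u(2) by (rule tensor_relations_plus)
    then have gx: "?g x \<in> tensor_relations A M3 ?N" by (simp add: frag_extend_diff)
    show ?thesis
    proof (rule Set.set_eqI)
      fix z
      have "z - ?g x \<in> tensor_relations A M3 ?N \<longleftrightarrow> z \<in> tensor_relations A M3 ?N"
        using tensor_relations_plus[OF _ gx, of "z - ?g x"] tensor_relations_plus[OF _ tensor_relations_uminus[OF M(3) N gx], of z]
        by auto
      then show "z \<in> tensor_relations A M3 ?N #>\<^bsub>tensor_free M3 ?N\<^esub> ?g x \<longleftrightarrow> z \<in> tensor_relations A M3 ?N"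
        by (simp only: r_coset_free_iff)
    qed
  qed
  have "tensor_map A M3 ?N g C = tensor_relations A M3 ?N"
    unfolding tensor_map_def coset_map_def by (rule UN_const_on) (use uC co in auto)
  then have "C \<in> kernel (tensor_product A M2 ?N) (tensor_product A M3 ?N) (tensor_map A M3 ?N g)"
    using C by (simp add: kernel_def tensor_product_def FactGroup_def)
  then obtain K where K: "K \<in> carrier (tensor_product A M1 ?N)" "C = tensor_map A M2 ?N f K"
    using exact by (metis imageE)
  have "u \<in> (\<Union>x\<in>K. tensor_relations A M2 ?N #>\<^bsub>tensor_free M2 ?N\<^esub> ?f x)"
    using uC unfolding K(2) tensor_map_def coset_map_def .
  then obtain w where w: "w \<in> K" "u - ?f w \<in> tensor_relations A M2 ?N"
    by (auto simp: r_coset_free_iff)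
  obtain v where v: "v \<in> carrier (tensor_free M1 ?N)" "K = tensor_relations A M1 ?N #>\<^bsub>tensor_free M1 ?N\<^esub> v"
    using K(1) unfolding tensor_product_def FactGroup_def RCOSETS_def by auto
  interpret sg: subgroup "tensor_relations A M1 ?N" "tensor_free M1 ?N"
    by (rule tensor_relations_subgroup[OF M(1) N])
  have "w - v \<in> carrier (tensor_free M1 ?N)"
    using w(1) sg.mem_carrier unfolding v(2) r_coset_free_iff by blast
  then have "w - v + v \<in> carrier (tensor_free M1 ?N)"
    using v(1) keys_add[of "w - v" v] unfolding carrier_free_Abelian_group_iff by blast
  then have "w \<in> carrier (tensor_free M1 ?N)" by simp
  then show ?thesis using that w(2) by blast
qed

text \<open>The ideal of \<open>A'\<close> generated by the image of \<open>J\<close>. The inductive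
  form lets statements about it be proved for single products and for sums. For empty
  \<open>J\<close> it is empty, so ideal properties are stated for nonempty
  \<open>J\<close>.\<close>

inductive_set extension :: "('b, 'n) ring_scheme \<Rightarrow> ('a \<Rightarrow> 'b) \<Rightarrow> 'a set \<Rightarrow> 'b set"
  for A' and \<phi> and J where
  prod: "j \<in> J \<Longrightarrow> c \<in> carrier A' \<Longrightarrow> \<phi> j \<otimes>\<^bsub>A'\<^esub> c \<in> extension A' \<phi> J"
| sum: "x \<in> extension A' \<phi> J \<Longrightarrow> y \<in> extension A' \<phi> J \<Longrightarrow> x \<oplus>\<^bsub>A'\<^esub> y \<in> extension A' \<phi> J"

lemma (in cring) add_eq_iff_minus:
  assumes "p \<in> carrier R" "q \<in> carrier R" "p \<oplus> q = r" shows "p = r \<ominus> q"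
  unfolding assms(3)[symmetric] using assms(1,2) by (simp add: minus_eq a_assoc r_neg)

section \<open>Extended ideals under a faithfully flat homomorphism\<close>

locale flat_ext = A: cring A + A': cring A' for A (structure) and A' (structure) +
  fixes \<phi>
  assumes hom: "\<phi> \<in> ring_hom A A'" and ff: "faithfully_flat A A' \<phi>"
begin

abbreviation "N \<equiv> as_module A' \<phi>"
abbreviation "ext \<equiv> extension A' \<phi>"

lemma h [simp]: "x \<in> carrier A \<Longrightarrow> \<phi> x \<in> carrier A'"
  "x \<in> carrier A \<Longrightarrow> y \<in> carrier A \<Longrightarrow> \<phi> (x \<otimes>\<^bsub>A\<^esub> y) = \<phi> x \<otimes>\<^bsub>A'\<^esub> \<phi> y"
  "x \<in> carrier A \<Longrightarrow> y \<in> carrier A \<Longrightarrow> \<phi> (x \<oplus>\<^bsub>A\<^esub> y) = \<phi> x \<oplus>\<^bsub>A'\<^esub> \<phi> y"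
  "\<phi> \<one>\<^bsub>A\<^esub> = \<one>\<^bsub>A'\<^esub>"
  using hom by (auto simp: ring_hom_closed ring_hom_mult ring_hom_add ring_hom_one)

lemma h_zero [simp]: "\<phi> \<zero>\<^bsub>A\<^esub> = \<zero>\<^bsub>A'\<^esub>"
  by (rule ring_hom_zero[OF hom A.ring_axioms A'.ring_axioms])

lemma h_pow [simp]: "x \<in> carrier A \<Longrightarrow> \<phi> (x [^]\<^bsub>A\<^esub> (n::nat)) = \<phi> x [^]\<^bsub>A'\<^esub> n"
  by (induction n) auto

lemma ext_carrier:
  assumes "J \<subseteq> carrier A" "x \<in> ext J" shows "x \<in> carrier A'"
  using assms(2) by induction (use assms(1) in auto)

lemma ext_scale:
  assumes "J \<subseteq> carrier A" "x \<in> ext J" "r \<in> carrier A'"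
  shows "r \<otimes>\<^bsub>A'\<^esub> x \<in> ext J"
  using assms(2)
proof (induction)
  case (prod j c)
  then have "r \<otimes>\<^bsub>A'\<^esub> (\<phi> j \<otimes>\<^bsub>A'\<^esub> c) = \<phi> j \<otimes>\<^bsub>A'\<^esub> (r \<otimes>\<^bsub>A'\<^esub> c)"
    using assms by (intro A'.m_lcomm) auto
  moreover have "\<phi> j \<otimes>\<^bsub>A'\<^esub> (r \<otimes>\<^bsub>A'\<^esub> c) \<in> ext J"
    by (rule extension.prod) (use prod assms(3) in auto)
  ultimately show ?case by simp
next
  case (sum x y)
  then have "r \<otimes>\<^bsub>A'\<^esub> (x \<oplus>\<^bsub>A'\<^esub> y) = r \<otimes>\<^bsub>A'\<^esub> x \<oplus>\<^bsub>A'\<^esub> r \<otimes>\<^bsub>A'\<^esub> y"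
    using assms ext_carrier[OF assms(1)] by (simp add: A'.r_distr)
  then show ?case using sum by (simp add: extension.sum)
qed

lemma ext_ideal:
  assumes J: "J \<subseteq> carrier A" "J \<noteq> {}"
  shows "ideal (ext J) A'"
proof (rule idealI[OF A'.ring_axioms])
  note c = ext_carrier[OF J(1)] and sc = ext_scale[OF J(1)]
  show "subgroup (ext J) (add_monoid A')"
  proof (rule subgroup.intro)
    obtain j where j: "j \<in> J" using J by blast
    have "\<phi> j \<otimes>\<^bsub>A'\<^esub> \<zero>\<^bsub>A'\<^esub> \<in> ext J" by (rule extension.prod) (use j in auto)
    then show "\<one>\<^bsub>add_monoid A'\<^esub> \<in> ext J" using j J(1) by auto
    fix x assume x: "x \<in> ext J"
    have "\<ominus>\<^bsub>A'\<^esub> x = (\<ominus>\<^bsub>A'\<^esub> \<one>\<^bsub>A'\<^esub>) \<otimes>\<^bsub>A'\<^esub> x" using c[OF x] by (simp add: A'.l_minus)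
    then show "inv\<^bsub>add_monoid A'\<^esub> x \<in> ext J" using sc[OF x, of "\<ominus>\<^bsub>A'\<^esub> \<one>\<^bsub>A'\<^esub>"] by (simp flip: a_inv_def)
  qed (auto intro: c extension.sum)
  fix x r assume x: "x \<in> ext J" and r: "r \<in> carrier A'"
  show "r \<otimes>\<^bsub>A'\<^esub> x \<in> ext J" by (rule sc[OF x r])
  then show "x \<otimes>\<^bsub>A'\<^esub> r \<in> ext J" using c[OF x] r by (simp add: A'.m_comm)
qed

lemma ext_mono:
  assumes "I \<subseteq> J" "x \<in> ext I" shows "x \<in> ext J"
  using assms(2) by induction (use assms(1) in \<open>auto intro: extension.intros\<close>)

lemma N_module: "Module.module A N"
  by (rule as_module_module[OF A.is_cring A'.is_cring hom])

lemma carrier_N [simp]: "carrier N = carrier A'"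
  and add_N [simp]: "x \<oplus>\<^bsub>N\<^esub> y = x \<oplus>\<^bsub>A'\<^esub> y"
  and smult_N [simp]: "a \<odot>\<^bsub>N\<^esub> x = \<phi> a \<otimes>\<^bsub>A'\<^esub> x"
  by (simp_all add: as_module_def)

text \<open>Multiplication by \<open>y\<close> as a map from \<open>J/I\<close> to
  \<open>J'/I'\<close>; any choice \<open>d\<close> of representatives gives the same map.
  Inclusions, multiplications and the zero map, for \<open>y\<close> equal to one, general or zero,
  are the maps to which flatness is applied.\<close>

lemma quot_mod_linear_map:
  assumes p: "ideal_pair A I J" "ideal_pair A I' J'" and y: "y \<in> carrier A"
    and JJ: "\<And>j. j \<in> J \<Longrightarrow> j \<otimes>\<^bsub>A\<^esub> y \<in> J'" and II: "\<And>i. i \<in> I \<Longrightarrow> i \<otimes>\<^bsub>A\<^esub> y \<in> I'"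
    and d: "\<And>m. m \<in> enc A I ` J \<Longrightarrow> d m \<in> J \<and> enc A I (d m) = m"
  shows "(\<lambda>m. enc A I' (d m \<otimes>\<^bsub>A\<^esub> y)) \<in> linear_maps A (quot_mod A I J) (quot_mod A I' J')"
    and "\<And>j. j \<in> J \<Longrightarrow> enc A I' (d (enc A I j) \<otimes>\<^bsub>A\<^esub> y) = enc A I' (j \<otimes>\<^bsub>A\<^esub> y)"
proof -
  interpret p: ideal_pair A I J by fact
  interpret q: ideal_pair A I' J' by fact
  show *: "enc A I' (d (enc A I j) \<otimes>\<^bsub>A\<^esub> y) = enc A I' (j \<otimes>\<^bsub>A\<^esub> y)" if j: "j \<in> J" for j
  proof -
    have dj: "d (enc A I j) \<in> J" "enc A I (d (enc A I j)) = enc A I j" using d j by auto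
    note c = p.Jc[OF j] p.Jc[OF dj(1)] y
    have "d (enc A I j) \<ominus>\<^bsub>A\<^esub> j \<in> I" using A.enc_eq_iff[OF p.I c(2,1)] dj by simp
    then have "(d (enc A I j) \<ominus>\<^bsub>A\<^esub> j) \<otimes>\<^bsub>A\<^esub> y \<in> I'" by (rule II)
    also have "(d (enc A I j) \<ominus>\<^bsub>A\<^esub> j) \<otimes>\<^bsub>A\<^esub> y = d (enc A I j) \<otimes>\<^bsub>A\<^esub> y \<ominus>\<^bsub>A\<^esub> j \<otimes>\<^bsub>A\<^esub> y"
      using c by (simp add: A.minus_eq A.l_distr A.l_minus)
    finally show ?thesis using A.enc_eq_iff[OF q.I, of "d (enc A I j) \<otimes>\<^bsub>A\<^esub> y" "j \<otimes>\<^bsub>A\<^esub> y"] c by simp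
  qed
  show "(\<lambda>m. enc A I' (d m \<otimes>\<^bsub>A\<^esub> y)) \<in> linear_maps A (quot_mod A I J) (quot_mod A I' J')"
    unfolding linear_maps_def hom_def
    using y by (auto simp: p.carrier_M q.carrier_M p.add_M q.add_M p.smult_M q.smult_M * p.J_add p.J_mult JJ
        p.Jc A.l_distr A.m_assoc)
qed

text \<open>An ideal itself is represented as its quotient by the zero ideal, so that it too lives
  on the type over which flatness quantifies.\<close>

lemma singleton_pair: "ideal J A \<Longrightarrow> ideal_pair A {\<zero>\<^bsub>A\<^esub>} J"
  by (intro ideal_pair.intro ideal_pair_axioms.intro A.is_cring A.zeroideal)
    (auto intro: additive_subgroup.zero_closed[OF ideal.axioms(1)])

text \<open>The map from \<open>J \<otimes> A'\<close> to \<open>A'\<close> that sends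
  \<open>j \<otimes> c\<close> to \<open>\<phi> j\<close> times \<open>c\<close>. It is built on the
  free group by its universal property and vanishes on relations because its kernel is a subgroup
  containing the generating ones.\<close>

lemma evaluation:
  assumes J: "ideal J A"
  obtains ev where "\<And>j c. j \<in> J \<Longrightarrow> c \<in> carrier A' \<Longrightarrow> ev (frag_of (enc A {\<zero>\<^bsub>A\<^esub>} j, c)) = \<phi> j \<otimes>\<^bsub>A'\<^esub> c"
    "ev \<in> hom (tensor_free (quot_mod A {\<zero>\<^bsub>A\<^esub>} J) N) (add_monoid A')"
    "\<And>u. u \<in> tensor_relations A (quot_mod A {\<zero>\<^bsub>A\<^esub>} J) N \<Longrightarrow> ev u = \<zero>\<^bsub>A'\<^esub>"
proof -
  interpret p: ideal_pair A "{\<zero>\<^bsub>A\<^esub>}" J by (rule singleton_pair[OF J])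
  let ?d = "dec A {\<zero>\<^bsub>A\<^esub>} J"
  have d: "?d (p.e j) = j" if j: "j \<in> J" for j
  proof -
    have "?d (p.e j) \<ominus>\<^bsub>A\<^esub> j \<in> {\<zero>\<^bsub>A\<^esub>}"
      using A.enc_eq_iff[OF p.I p.Jc p.Jc[OF j]] p.dec[OF j] by blast
    then show ?thesis using p.Jc[OF j] p.Jc[OF p.dec(1)[OF j]] by simp
  qed
  have im: "(\<lambda>(m, c). \<phi> (?d m) \<otimes>\<^bsub>A'\<^esub> c) ` (carrier p.M \<times> carrier N) \<subseteq> carrier (add_monoid A')"
    by (auto simp: p.carrier_M d p.Jc)
  have "comm_group (add_monoid A')" by (rule A'.a_comm_group)
  from comm_group.free_Abelian_group_universal[OF this im]
  obtain ev where ev: "ev \<in> hom (tensor_free p.M N) (add_monoid A')"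
    "\<And>z. z \<in> carrier p.M \<times> carrier N \<Longrightarrow> ev (frag_of z) = (case z of (m, c) \<Rightarrow> \<phi> (?d m) \<otimes>\<^bsub>A'\<^esub> c)" by blast
  have evf: "ev (frag_of (p.e j, c)) = \<phi> j \<otimes>\<^bsub>A'\<^esub> c" if "j \<in> J" "c \<in> carrier A'" for j c
    using that ev(2)[of "(p.e j, c)"] by (simp add: p.carrier_M d)
  interpret ev: group_hom "tensor_free p.M N" "add_monoid A'" ev
    by (intro group_hom.intro group_hom_axioms.intro ev(1)) (auto intro: A'.a_group)
  have fc: "frag_of (p.e j, c) \<in> carrier (tensor_free p.M N)" if "j \<in> J" "c \<in> carrier A'" for j c
    using that by (simp add: p.e_mem)
  have evd: "ev (a - b) = ev a \<ominus>\<^bsub>A'\<^esub> ev b"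
    if "a \<in> carrier (tensor_free p.M N)" "b \<in> carrier (tensor_free p.M N)" for a b
  proof -
    have "ev (a - b) \<oplus>\<^bsub>A'\<^esub> ev b = ev (a - b + b)"
      using ev.hom_mult[of "a - b" b] that keys_subset_diff[of a _ b] by simp
    moreover have "ev (a - b) \<in> carrier A'" "ev b \<in> carrier A'"
      using that ev.hom_closed[of "a - b"] ev.hom_closed[of b] keys_subset_diff[of a _ b] by auto
    ultimately show ?thesis using A'.add_eq_iff_minus by simp
  qed
  have sg: "subgroup (kernel (tensor_free p.M N) (add_monoid A') ev) (tensor_free p.M N)"
    by (rule ev.subgroup_kernel)
  have "tensor_relations A p.M N \<subseteq> kernel (tensor_free p.M N) (add_monoid A') ev"
    unfolding tensor_relations_def
  proof (rule group.generate_subgroup_incl[OF _ _ sg])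
    show "group (tensor_free p.M N)" by simp
    have 1: "frag_of (p.e j \<oplus>\<^bsub>p.M\<^esub> p.e j', c) - frag_of (p.e j, c) - frag_of (p.e j', c) \<in> kernel (tensor_free p.M N) (add_monoid A') ev"
      if "j \<in> J" "j' \<in> J" "c \<in> carrier A'" for j j' c
    proof -
      have "ev (frag_of (p.e (j \<oplus>\<^bsub>A\<^esub> j'), c) - frag_of (p.e j, c) - frag_of (p.e j', c))
        = (\<phi> j \<oplus>\<^bsub>A'\<^esub> \<phi> j') \<otimes>\<^bsub>A'\<^esub> c \<ominus>\<^bsub>A'\<^esub> \<phi> j \<otimes>\<^bsub>A'\<^esub> c \<ominus>\<^bsub>A'\<^esub> \<phi> j' \<otimes>\<^bsub>A'\<^esub> c"
        using that fc p.J_add p.Jc by (simp add: evd evf keys_subset_diff p.e_mem)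
      also have "\<dots> = \<zero>\<^bsub>A'\<^esub>"
        using that p.Jc by (simp add: A'.l_distr A'.minus_eq A'.a_ac A'.r_neg A'.r_neg1 A'.r_neg2)
      finally show ?thesis using that p.e_mem by (simp add: kernel_def p.add_M p.J_add keys_subset_diff)
    qed
    have 2: "frag_of (p.e j, c \<oplus>\<^bsub>N\<^esub> c') - frag_of (p.e j, c) - frag_of (p.e j, c') \<in> kernel (tensor_free p.M N) (add_monoid A') ev"
      if "j \<in> J" "c' \<in> carrier A'" "c \<in> carrier A'" for j c' c
    proof -
      have "ev (frag_of (p.e j, c \<oplus>\<^bsub>A'\<^esub> c') - frag_of (p.e j, c) - frag_of (p.e j, c'))
        = \<phi> j \<otimes>\<^bsub>A'\<^esub> (c \<oplus>\<^bsub>A'\<^esub> c') \<ominus>\<^bsub>A'\<^esub> \<phi> j \<otimes>\<^bsub>A'\<^esub> c \<ominus>\<^bsub>A'\<^esub> \<phi> j \<otimes>\<^bsub>A'\<^esub> c'"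
        using that fc p.J_add p.Jc by (simp add: evd evf keys_subset_diff p.e_mem)
      also have "\<dots> = \<zero>\<^bsub>A'\<^esub>"
        using that p.Jc by (simp add: A'.r_distr A'.minus_eq A'.a_ac A'.r_neg A'.r_neg1 A'.r_neg2)
      finally show ?thesis using that p.e_mem by (simp add: kernel_def p.add_M p.J_add keys_subset_diff)
    qed
    have 3: "frag_of (a \<odot>\<^bsub>p.M\<^esub> p.e j, c) - frag_of (p.e j, a \<odot>\<^bsub>N\<^esub> c) \<in> kernel (tensor_free p.M N) (add_monoid A') ev"
      if "j \<in> J" "a \<in> carrier A" "c \<in> carrier A'" for j a c
    proof -
      have "ev (frag_of (p.e (a \<otimes>\<^bsub>A\<^esub> j), c) - frag_of (p.e j, \<phi> a \<otimes>\<^bsub>A'\<^esub> c))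
        = (\<phi> a \<otimes>\<^bsub>A'\<^esub> \<phi> j) \<otimes>\<^bsub>A'\<^esub> c \<ominus>\<^bsub>A'\<^esub> \<phi> j \<otimes>\<^bsub>A'\<^esub> (\<phi> a \<otimes>\<^bsub>A'\<^esub> c)"
        using that fc p.J_mult p.Jc by (simp add: evd evf keys_subset_diff p.e_mem)
      also have "\<dots> = \<zero>\<^bsub>A'\<^esub>"
        using that p.Jc by (simp add: A'.m_ac A'.minus_eq A'.r_neg)
      finally show ?thesis using that p.e_mem by (simp add: kernel_def p.smult_M p.J_mult keys_subset_diff)
    qed
    have e: "\<exists>j\<in>J. m = p.e j" if "m \<in> carrier p.M" for m using that by (auto simp: p.carrier_M)
    show "{frag_of (x \<oplus>\<^bsub>p.M\<^esub> x', y) - frag_of (x, y) - frag_of (x', y) |x x' y.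
         x \<in> carrier p.M \<and> x' \<in> carrier p.M \<and> y \<in> carrier N} \<union>
      {frag_of (x, y \<oplus>\<^bsub>N\<^esub> y') - frag_of (x, y) - frag_of (x, y') |x y y'.
         x \<in> carrier p.M \<and> y \<in> carrier N \<and> y' \<in> carrier N} \<union>
      {frag_of (a \<odot>\<^bsub>p.M\<^esub> x, y) - frag_of (x, a \<odot>\<^bsub>N\<^esub> y) |a x y.
         a \<in> carrier A \<and> x \<in> carrier p.M \<and> y \<in> carrier N} \<subseteq> kernel (tensor_free p.M N) (add_monoid A') ev"
      (is "?S1 \<union> ?S2 \<union> ?S3 \<subseteq> ?K")
    proof (intro Un_least subsetI)
      fix z assume "z \<in> ?S1"
      then obtain x x' y where z: "z = frag_of (x \<oplus>\<^bsub>p.M\<^esub> x', y) - frag_of (x, y) - frag_of (x', y)"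
        "x \<in> carrier p.M" "x' \<in> carrier p.M" "y \<in> carrier A'" by auto
      obtain j j' where "j \<in> J" "x = p.e j" "j' \<in> J" "x' = p.e j'" using e z(2,3) by metis
      then show "z \<in> ?K" unfolding z(1) using 1[of j j' y] z(4) by (simp only:)
    next
      fix z assume "z \<in> ?S2"
      then obtain x y y' where z: "z = frag_of (x, y \<oplus>\<^bsub>N\<^esub> y') - frag_of (x, y) - frag_of (x, y')"
        "x \<in> carrier p.M" "y \<in> carrier A'" "y' \<in> carrier A'" by auto
      obtain j where "j \<in> J" "x = p.e j" using e z(2) by metis
      then show "z \<in> ?K" unfolding z(1) using 2[of j y' y] z(3,4) by (simp only:)
    next
      fix z assume "z \<in> ?S3"
      then obtain x y a where z: "z = frag_of (a \<odot>\<^bsub>p.M\<^esub> x, y) - frag_of (x, a \<odot>\<^bsub>N\<^esub> y)"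
        "x \<in> carrier p.M" "y \<in> carrier A'" "a \<in> carrier A" by auto
      obtain j where "j \<in> J" "x = p.e j" using e z(2) by metis
      then show "z \<in> ?K" unfolding z(1) using 3[of j a y] z(3,4) by (simp only:)
    qed
  qed
  then have "ev u = \<zero>\<^bsub>A'\<^esub>" if "u \<in> tensor_relations A p.M N" for u
    using that by (auto simp: kernel_def)
  then show ?thesis using that evf ev(1) by blast
qed

lemma frag_zero_relation:
  assumes p: "ideal_pair A I J" and c: "c \<in> carrier A'"
  shows "frag_of (enc A I \<zero>\<^bsub>A\<^esub>, c) \<in> tensor_relations A (quot_mod A I J) N"
proof -
  interpret p: ideal_pair A I J by fact
  have "frag_of (p.e \<zero>\<^bsub>A\<^esub> \<oplus>\<^bsub>p.M\<^esub> p.e \<zero>\<^bsub>A\<^esub>, c) - frag_of (p.e \<zero>\<^bsub>A\<^esub>, c) - frag_of (p.e \<zero>\<^bsub>A\<^esub>, c) \<in> tensor_relations A p.M N"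
    by (rule tensor_relations_add1) (use c p.e_mem p.J_zero in auto)
  then have "- frag_of (p.e \<zero>\<^bsub>A\<^esub>, c) \<in> tensor_relations A p.M N" by (simp add: p.add_M p.J_zero)
  from tensor_relations_uminus[OF p.M_module N_module this] show ?thesis by simp
qed

lemma frag_sum_relation:
  assumes p: "ideal_pair A I J" and j: "j \<in> J" and c: "c \<in> carrier A'" "c' \<in> carrier A'"
    and m: "u - frag_of (enc A I j, c) \<in> tensor_relations A (quot_mod A I J) N"
      "u' - frag_of (enc A I j, c') \<in> tensor_relations A (quot_mod A I J) N"
  shows "u + u' - frag_of (enc A I j, c \<oplus>\<^bsub>A'\<^esub> c') \<in> tensor_relations A (quot_mod A I J) N"
proof -
  interpret p: ideal_pair A I J by fact
  have "frag_of (p.e j, c \<oplus>\<^bsub>N\<^esub> c') - frag_of (p.e j, c) - frag_of (p.e j, c') \<in> tensor_relations A p.M N"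
    by (rule tensor_relations_add2) (use c p.e_mem[OF j] in auto)
  from tensor_relations_plus[OF tensor_relations_plus[OF m] tensor_relations_uminus[OF p.M_module N_module this]]
  show ?thesis by (simp add: algebra_simps)
qed

text \<open>In \<open>A/I \<otimes> A'\<close> the factor \<open>i\<close> of
  \<open>\<phi> i c\<close> moves to the left, where it annihilates \<open>a\<close>.\<close>

lemma frag_extension_relation:
  assumes p: "ideal_pair A I (carrier A)" and a: "a \<in> carrier A" and c: "c \<in> ext I"
  shows "frag_of (enc A I a, c) \<in> tensor_relations A (quot_mod A I (carrier A)) N"
proof -
  interpret p: ideal_pair A I "carrier A" by fact
  have Ic: "I \<subseteq> carrier A" by (rule p.IJ)
  have "0 - frag_of (p.e a, c) \<in> tensor_relations A p.M N"
    using c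
  proof (induction)
    case (prod i c)
    have ic: "i \<in> carrier A" using prod Ic by blast
    have "i \<otimes>\<^bsub>A\<^esub> a \<in> I" using prod a by (simp add: ideal.I_r_closed[OF p.I])
    then have z: "p.e (i \<otimes>\<^bsub>A\<^esub> a) = p.e \<zero>\<^bsub>A\<^esub>" using A.enc_eq_iff[OF p.I] ic a by (simp add: A.minus_eq)
    have "frag_of (i \<odot>\<^bsub>p.M\<^esub> p.e a, c) - frag_of (p.e a, i \<odot>\<^bsub>N\<^esub> c) \<in> tensor_relations A p.M N"
      by (rule tensor_relations_smult) (use ic prod a p.e_mem in auto)
    then have *: "frag_of (p.e \<zero>\<^bsub>A\<^esub>, c) - frag_of (p.e a, \<phi> i \<otimes>\<^bsub>A'\<^esub> c) \<in> tensor_relations A p.M N"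
      using ic a z by (simp add: p.smult_M)
    have "- frag_of (p.e \<zero>\<^bsub>A\<^esub>, c) \<in> tensor_relations A p.M N"
      by (rule tensor_relations_uminus[OF p.M_module N_module frag_zero_relation[OF p prod(2)]])
    from tensor_relations_plus[OF * this] show ?case by simp
  next
    case (sum x y)
    show ?case using frag_sum_relation[OF p a ext_carrier[OF Ic sum(1)] ext_carrier[OF Ic sum(2)] sum(3,4)] by simp
  qed
  from tensor_relations_uminus[OF p.M_module N_module this] show ?thesis by simp
qed

text \<open>The sequence from \<open>{j \<in> J. j y \<in> I}\<close> through \<open>J\<close> to
  \<open>A/I\<close> stays exact after tensoring with \<open>A'\<close>. A preimage of
  \<open>x\<close> in \<open>J \<otimes> A'\<close> is sent to \<open>1 \<otimes> y x\<close>, which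
  vanishes; so it comes from the kernel ideal, and evaluating the resulting formal sum exhibits
  \<open>x\<close>.\<close>

lemma extension_colon:
  assumes I: "ideal I A" and J: "ideal J A" and y: "y \<in> carrier A"
    and x: "x \<in> ext J" "\<phi> y \<otimes>\<^bsub>A'\<^esub> x \<in> ext I"
  shows "x \<in> ext {j \<in> J. j \<otimes>\<^bsub>A\<^esub> y \<in> I}"
proof -
  define J' where "J' = {j \<in> J. j \<otimes>\<^bsub>A\<^esub> y \<in> I}"
  have Jc: "J \<subseteq> carrier A" using ideal.Icarr[OF J] by blast
  have Ic: "I \<subseteq> carrier A" using ideal.Icarr[OF I] by blast
  have "ideal {j \<in> carrier A. y \<otimes>\<^bsub>A\<^esub> j \<in> I} A" by (rule ideal.helper_max_prime[OF I A.is_cring y])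
  then have "ideal (J \<inter> {j \<in> carrier A. y \<otimes>\<^bsub>A\<^esub> j \<in> I}) A" by (rule A.i_intersect[OF J])
  moreover have "J \<inter> {j \<in> carrier A. y \<otimes>\<^bsub>A\<^esub> j \<in> I} = J'"
    using Jc y by (auto simp: J'_def A.m_comm)
  ultimately have J': "ideal J' A" by simp
  interpret p1: ideal_pair A "{\<zero>\<^bsub>A\<^esub>}" J' by (rule singleton_pair[OF J'])
  interpret p2: ideal_pair A "{\<zero>\<^bsub>A\<^esub>}" J by (rule singleton_pair[OF J])
  interpret p3: ideal_pair A I "carrier A"
    by (intro ideal_pair.intro ideal_pair_axioms.intro A.is_cring I A.oneideal Ic)
  define f where "f = (\<lambda>m. enc A {\<zero>\<^bsub>A\<^esub>} (dec A {\<zero>\<^bsub>A\<^esub>} J' m \<otimes>\<^bsub>A\<^esub> \<one>\<^bsub>A\<^esub>))"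
  define g where "g = (\<lambda>m. enc A I (dec A {\<zero>\<^bsub>A\<^esub>} J m \<otimes>\<^bsub>A\<^esub> y))"
  have f: "f \<in> linear_maps A p1.M p2.M" "\<And>j. j \<in> J' \<Longrightarrow> f (p1.e j) = p1.e j"
  proof -
    note * = quot_mod_linear_map[OF p1.ideal_pair_axioms p2.ideal_pair_axioms A.one_closed, of "dec A {\<zero>\<^bsub>A\<^esub>} J'"]
    show "f \<in> linear_maps A p1.M p2.M" unfolding f_def
      by (rule *) (use p1.Jc p1.dec in \<open>auto simp: J'_def\<close>)
    show "f (p1.e j) = p1.e j" if "j \<in> J'" for j
    proof -
      have "f (p1.e j) = p1.e (j \<otimes>\<^bsub>A\<^esub> \<one>\<^bsub>A\<^esub>)" unfolding f_def
        by (rule *) (use p1.Jc p1.dec that in \<open>auto simp: J'_def\<close>)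
      then show ?thesis using p1.Jc[OF that] by simp
    qed
  qed
  have g: "g \<in> linear_maps A p2.M p3.M" "\<And>j. j \<in> J \<Longrightarrow> g (p2.e j) = p3.e (j \<otimes>\<^bsub>A\<^esub> y)"
  proof -
    note * = quot_mod_linear_map[OF p2.ideal_pair_axioms p3.ideal_pair_axioms y, of "dec A {\<zero>\<^bsub>A\<^esub>} J"]
    have zi: "\<zero>\<^bsub>A\<^esub> \<in> I" by (rule additive_subgroup.zero_closed[OF ideal.axioms(1)[OF I]])
    show "g \<in> linear_maps A p2.M p3.M" unfolding g_def
      by (rule *) (use p2.Jc p2.dec y zi in auto)
    show "g (p2.e j) = p3.e (j \<otimes>\<^bsub>A\<^esub> y)" if "j \<in> J" for j unfolding g_def
      by (rule *) (use p2.Jc p2.dec y zi that in auto)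
  qed
  have exact: "f ` carrier p1.M = a_kernel p2.M p3.M g"
  proof -
    have "g (p2.e j) = \<zero>\<^bsub>p3.M\<^esub> \<longleftrightarrow> j \<otimes>\<^bsub>A\<^esub> y \<in> I" if "j \<in> J" for j
      using A.enc_eq_iff[OF I, of "j \<otimes>\<^bsub>A\<^esub> y" "\<zero>\<^bsub>A\<^esub>"] p2.Jc[OF that] y
      by (simp add: g(2)[OF that] p3.zero_M A.minus_eq)
    moreover have "f ` carrier p1.M = p1.e ` J'"
      unfolding p1.carrier_M image_image by (rule image_cong[OF refl f(2)])
    ultimately show ?thesis
      unfolding a_kernel_def' p2.carrier_M J'_def by auto
  qed
  let ?g = "frag_extend (\<lambda>(x, y). frag_of (g x, y))" and ?f = "frag_extend (\<lambda>(x, y). frag_of (f x, y))"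
  obtain ev where ev: "\<And>j c. j \<in> J \<Longrightarrow> c \<in> carrier A' \<Longrightarrow> ev (frag_of (p2.e j, c)) = \<phi> j \<otimes>\<^bsub>A'\<^esub> c"
    "ev \<in> hom (tensor_free p2.M N) (add_monoid A')"
    "\<And>u. u \<in> tensor_relations A p2.M N \<Longrightarrow> ev u = \<zero>\<^bsub>A'\<^esub>"
    by (rule evaluation[OF J]) blast
  have eva: "ev (a + b) = ev a \<oplus>\<^bsub>A'\<^esub> ev b" if "a \<in> carrier (tensor_free p2.M N)" "b \<in> carrier (tensor_free p2.M N)" for a b
    using hom_mult[OF ev(2) that] by simp
  have evc: "ev a \<in> carrier A'" if "a \<in> carrier (tensor_free p2.M N)" for a
    using ev(2) that unfolding hom_def by auto
  \<comment> \<open>A formal sum with value \<open>x\<close>, built together with its image: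
    \<open>g \<otimes> id\<close> sends it to \<open>1 \<otimes> y x\<close> up to
    relations.\<close>
  have "\<exists>u\<in>carrier (tensor_free p2.M N). ev u = x \<and>
      ?g u - frag_of (p3.e \<one>\<^bsub>A\<^esub>, \<phi> y \<otimes>\<^bsub>A'\<^esub> x) \<in> tensor_relations A p3.M N"
    using x(1)
  proof (induction)
    case (prod j c)
    have jc: "j \<in> carrier A" using prod Jc by blast
    have "frag_of ((j \<otimes>\<^bsub>A\<^esub> y) \<odot>\<^bsub>p3.M\<^esub> p3.e \<one>\<^bsub>A\<^esub>, c) - frag_of (p3.e \<one>\<^bsub>A\<^esub>, (j \<otimes>\<^bsub>A\<^esub> y) \<odot>\<^bsub>N\<^esub> c) \<in> tensor_relations A p3.M N"
      by (rule tensor_relations_smult) (use jc y prod p3.e_mem in auto)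
    moreover have "(\<phi> j \<otimes>\<^bsub>A'\<^esub> \<phi> y) \<otimes>\<^bsub>A'\<^esub> c = \<phi> y \<otimes>\<^bsub>A'\<^esub> (\<phi> j \<otimes>\<^bsub>A'\<^esub> c)"
      using jc y prod by (simp add: A'.m_ac)
    ultimately have "?g (frag_of (p2.e j, c)) - frag_of (p3.e \<one>\<^bsub>A\<^esub>, \<phi> y \<otimes>\<^bsub>A'\<^esub> (\<phi> j \<otimes>\<^bsub>A'\<^esub> c)) \<in> tensor_relations A p3.M N"
      using jc y prod by (simp add: p3.smult_M g(2))
    then show ?case using prod ev(1) p2.e_mem by (intro bexI[of _ "frag_of (p2.e j, c)"]) auto
  next
    case (sum x x')
    then obtain u u' where u: "u \<in> carrier (tensor_free p2.M N)" "ev u = x"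
      "?g u - frag_of (p3.e \<one>\<^bsub>A\<^esub>, \<phi> y \<otimes>\<^bsub>A'\<^esub> x) \<in> tensor_relations A p3.M N"
      and u': "u' \<in> carrier (tensor_free p2.M N)" "ev u' = x'"
      "?g u' - frag_of (p3.e \<one>\<^bsub>A\<^esub>, \<phi> y \<otimes>\<^bsub>A'\<^esub> x') \<in> tensor_relations A p3.M N" by blast
    have xc: "x \<in> carrier A'" "x' \<in> carrier A'" using sum ext_carrier[OF Jc] by auto
    have "u + u' \<in> carrier (tensor_free p2.M N)"
      using u(1) u'(1) keys_add[of u u'] unfolding carrier_free_Abelian_group_iff by blast
    moreover have "ev (u + u') = x \<oplus>\<^bsub>A'\<^esub> x'" using eva u u' by simp
    moreover have "?g (u + u') - frag_of (p3.e \<one>\<^bsub>A\<^esub>, \<phi> y \<otimes>\<^bsub>A'\<^esub> (x \<oplus>\<^bsub>A'\<^esub> x')) \<in> tensor_relations A p3.M N"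
      using frag_sum_relation[OF p3.ideal_pair_axioms A.one_closed _ _ u(3) u'(3)] xc y
      by (simp add: frag_extend_add A'.r_distr)
    ultimately show ?case by blast
  qed
  then obtain u where u: "u \<in> carrier (tensor_free p2.M N)" "ev u = x"
      "?g u - frag_of (p3.e \<one>\<^bsub>A\<^esub>, \<phi> y \<otimes>\<^bsub>A'\<^esub> x) \<in> tensor_relations A p3.M N" by blast
  have gu: "?g u \<in> tensor_relations A p3.M N"
    using tensor_relations_plus[OF u(3) frag_extension_relation[OF p3.ideal_pair_axioms A.one_closed x(2)]] by simp
  obtain w where w: "w \<in> carrier (tensor_free p1.M N)" "u - ?f w \<in> tensor_relations A p2.M N"
    by (rule tensor_exactD[OF A.is_cring A'.is_cring ff p1.M_module p2.M_module p3.M_module f(1) g(1) exact u(1) gu])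
  interpret E: ideal "ext J'" A' by (rule ext_ideal) (use p1.Jc p1.J_zero in auto)
  have J'J: "J' \<subseteq> J" by (auto simp: J'_def)
  \<comment> \<open>Evaluation of sums supported on the kernel ideal stays in its extension;
    relations do not change the value.\<close>
  have "?f w \<in> carrier (tensor_free p2.M N) \<and> ev (?f w) \<in> ext J'"
  proof -
    have "Poly_Mapping.keys w \<subseteq> carrier p1.M \<times> carrier N" using w(1) by simp
    then show ?thesis
    proof (induction rule: free_Abelian_group_induct[consumes 1, case_names zero diff gen])
      case zero
      have "ev 0 \<oplus>\<^bsub>A'\<^esub> ev 0 = ev 0" using eva[of 0 0] by simp
      then have "ev 0 = \<zero>\<^bsub>A'\<^esub>" using evc[of 0] by (simp add: A'.add.l_cancel_one)
      then show ?case by simp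
    next
      case (diff a b)
      then have ab: "?f a \<in> carrier (tensor_free p2.M N)" "?f b \<in> carrier (tensor_free p2.M N)"
        "ev (?f a) \<in> ext J'" "ev (?f b) \<in> ext J'" by auto
      have k: "?f (a - b) \<in> carrier (tensor_free p2.M N)"
        using keys_subset_diff[of "?f a" _ "?f b"] ab(1,2) by (simp add: frag_extend_diff)
      have "ev (?f (a - b)) \<oplus>\<^bsub>A'\<^esub> ev (?f b) = ev (?f (a - b) + ?f b)" by (rule eva[OF k ab(2), symmetric])
      also have "\<dots> = ev (?f a)" by (simp add: frag_extend_diff)
      finally have "ev (?f (a - b)) = ev (?f a) \<ominus>\<^bsub>A'\<^esub> ev (?f b)"
        by (rule A'.add_eq_iff_minus[OF evc[OF k] evc[OF ab(2)]])
      moreover have "ev (?f a) \<ominus>\<^bsub>A'\<^esub> ev (?f b) \<in> ext J'"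
        unfolding A'.minus_eq by (intro E.a_closed E.a_inv_closed ab)
      ultimately show ?case using k by simp
    next
      case (gen z)
      then obtain j c where z: "z = (p1.e j, c)" "j \<in> J'" "c \<in> carrier A'" by (auto simp: p1.carrier_M)
      have jJ: "j \<in> J" using J'J z(2) by blast
      have "?f (frag_of z) = frag_of (p2.e j, c)" using z f(2)[OF z(2)] by simp
      moreover have "\<phi> j \<otimes>\<^bsub>A'\<^esub> c \<in> ext J'" by (rule extension.prod[OF z(2,3)])
      ultimately show ?case using ev(1)[OF jJ z(3)] p2.e_mem[OF jJ] z(3) by simp
    qed
  qed
  then have fw: "?f w \<in> carrier (tensor_free p2.M N)" "ev (?f w) \<in> ext J'" by auto
  have k: "u - ?f w \<in> carrier (tensor_free p2.M N)" using u(1) fw(1) keys_subset_diff[of u _ "?f w"] by simp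
  have "x = ev (u - ?f w) \<oplus>\<^bsub>A'\<^esub> ev (?f w)" using eva[OF k fw(1)] u(2) by simp
  also have "\<dots> = ev (?f w)" using ev(3)[OF w(2)] evc[OF fw(1)] by simp
  finally show ?thesis using fw(2) by (simp add: J'_def)
qed

text \<open>Consider the zero map of \<open>A/J\<close> to itself, twice. If
  \<open>J A' = A'\<close>, all symbols vanish in \<open>A/J \<otimes> A'\<close>, so the tensored
  sequence is exact. Faithfulness makes the original one exact, and then the image of zero is all of
  \<open>A/J\<close>.\<close>

lemma extension_proper:
  assumes J: "ideal J A" and one: "\<one>\<^bsub>A'\<^esub> \<in> ext J"
  shows "\<one>\<^bsub>A\<^esub> \<in> J"
proof -
  have Jc: "J \<subseteq> carrier A" using ideal.Icarr[OF J] by blast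
  interpret p: ideal_pair A J "carrier A"
    by (intro ideal_pair.intro ideal_pair_axioms.intro A.is_cring J A.oneideal Jc)
  interpret E: ideal "ext J" A'
    by (rule ext_ideal) (use Jc additive_subgroup.zero_closed[OF ideal.axioms(1)[OF J]] in auto)
  have E: "ext J = carrier A'" using E.one_imp_carrier[OF one] .
  define f where "f = (\<lambda>m. enc A J (dec A J (carrier A) m \<otimes>\<^bsub>A\<^esub> \<zero>\<^bsub>A\<^esub>))"
  note * = quot_mod_linear_map[OF p.ideal_pair_axioms p.ideal_pair_axioms A.zero_closed, of "dec A J (carrier A)"]
  have Jz: "\<zero>\<^bsub>A\<^esub> \<in> J" by (rule additive_subgroup.zero_closed[OF ideal.axioms(1)[OF J]])
  have f: "f \<in> linear_maps A p.M p.M" unfolding f_def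
    by (rule *) (use p.Jc p.dec Jz Jc in auto)
  have f0: "f (p.e j) = p.e \<zero>\<^bsub>A\<^esub>" if "j \<in> carrier A" for j
  proof -
    have "f (p.e j) = p.e (j \<otimes>\<^bsub>A\<^esub> \<zero>\<^bsub>A\<^esub>)" unfolding f_def
      by (rule *) (use p.Jc p.dec that Jz Jc in auto)
    then show ?thesis using that by simp
  qed
  let ?f = "frag_extend (\<lambda>(x, y). frag_of (f x, y))"
  interpret rel: subgroup "tensor_relations A p.M N" "tensor_free p.M N"
    by (rule tensor_relations_subgroup[OF p.M_module N_module])
  have triv: "u \<in> tensor_relations A p.M N" if "u \<in> carrier (tensor_free p.M N)" for u
  proof -
    have "Poly_Mapping.keys u \<subseteq> carrier p.M \<times> carrier N" using that by simp
    then show ?thesis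
    proof (induction rule: free_Abelian_group_induct[consumes 1, case_names zero diff gen])
      case zero show ?case by (rule tensor_relations_zero)
    next
      case (diff a b)
      from tensor_relations_plus[OF diff(3) tensor_relations_uminus[OF p.M_module N_module diff(4)]] show ?case by simp
    next
      case (gen z)
      then obtain j c where z: "z = (p.e j, c)" "j \<in> carrier A" "c \<in> carrier A'" by (auto simp: p.carrier_M)
      show ?case unfolding z(1) by (rule frag_extension_relation[OF p.ideal_pair_axioms z(2)]) (simp add: E z)
    qed
  qed
  have rel: "tensor_relations A p.M N = carrier (tensor_free p.M N)"
  proof (rule subset_antisym)
    show "carrier (tensor_free p.M N) \<subseteq> tensor_relations A p.M N" by (rule subsetI) (rule triv)
    show "tensor_relations A p.M N \<subseteq> carrier (tensor_free p.M N)" by (rule subsetI) (rule rel.mem_carrier)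
  qed
  have carr: "carrier (tensor_product A p.M N) = {tensor_relations A p.M N}"
  proof -
    have "tensor_relations A p.M N #>\<^bsub>tensor_free p.M N\<^esub> u = tensor_relations A p.M N"
      if "u \<in> carrier (tensor_free p.M N)" for u
      by (rule rel.rcos_const[OF group_free_Abelian_group triv[OF that]])
    moreover have "0 \<in> carrier (tensor_free p.M N)" by simp
    ultimately show ?thesis unfolding tensor_product_def FactGroup_def RCOSETS_def by (auto simp del: carrier_free_Abelian_group_iff)
  qed
  have tm: "tensor_map A p.M N f (tensor_relations A p.M N) = tensor_relations A p.M N"
    unfolding tensor_map_def coset_map_def
  proof (rule UN_const_on)
    show "tensor_relations A p.M N \<noteq> {}" using tensor_relations_zero by blast
    fix x assume "x \<in> tensor_relations A p.M N"
    then have "?f x \<in> tensor_relations A p.M N" by (rule tensor_map_relations[OF p.M_module N_module p.M_module f])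
    then show "tensor_relations A p.M N #>\<^bsub>tensor_free p.M N\<^esub> ?f x = tensor_relations A p.M N"
      by (rule rel.rcos_const[OF group_free_Abelian_group])
  qed
  have "tensor_map A p.M N f ` carrier (tensor_product A p.M N) =
        kernel (tensor_product A p.M N) (tensor_product A p.M N) (tensor_map A p.M N f)"
  proof -
    have "\<one>\<^bsub>tensor_product A p.M N\<^esub> = tensor_relations A p.M N" by (simp add: tensor_product_def FactGroup_def)
    then show ?thesis unfolding carr kernel_def using tm by auto
  qed
  then have "f ` carrier p.M = a_kernel p.M p.M f"
    using ff f p.M_module unfolding faithfully_flat_def by blast
  moreover have "p.e \<one>\<^bsub>A\<^esub> \<in> a_kernel p.M p.M f"
    unfolding a_kernel_def' using f0[OF A.one_closed] p.e_mem by (simp add: p.zero_M)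
  ultimately have "p.e \<one>\<^bsub>A\<^esub> \<in> f ` carrier p.M" by simp
  then have "p.e \<one>\<^bsub>A\<^esub> = p.e \<zero>\<^bsub>A\<^esub>" using f0 by (auto simp: p.carrier_M)
  then show ?thesis using A.enc_eq_iff[OF J] by (simp add: A.minus_eq)
qed

text \<open>The element one of \<open>A'\<close> has its product with \<open>\<phi> x\<close> in
  \<open>I A'\<close>, so by \<open>extension_colon\<close> it lies in the extension of
  \<open>(I : x)\<close>; by faithfulness this colon ideal contains one.\<close>

lemma extension_contract:
  assumes I: "ideal I A" and x: "x \<in> carrier A" "\<phi> x \<in> ext I"
  shows "x \<in> I"
proof -
  have "\<phi> \<one>\<^bsub>A\<^esub> \<otimes>\<^bsub>A'\<^esub> \<one>\<^bsub>A'\<^esub> \<in> ext (carrier A)" by (rule extension.prod) auto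
  then have "\<one>\<^bsub>A'\<^esub> \<in> ext (carrier A)" by simp
  then have "\<one>\<^bsub>A'\<^esub> \<in> ext {j \<in> carrier A. j \<otimes>\<^bsub>A\<^esub> x \<in> I}"
    by (rule extension_colon[OF I A.oneideal x(1)]) (use x in simp)
  moreover have "{j \<in> carrier A. j \<otimes>\<^bsub>A\<^esub> x \<in> I} = {j \<in> carrier A. x \<otimes>\<^bsub>A\<^esub> j \<in> I}"
    using x by (auto simp: A.m_comm)
  moreover have "ideal {j \<in> carrier A. x \<otimes>\<^bsub>A\<^esub> j \<in> I} A" by (rule ideal.helper_max_prime[OF I A.is_cring x(1)])
  ultimately have "\<one>\<^bsub>A\<^esub> \<in> {j \<in> carrier A. j \<otimes>\<^bsub>A\<^esub> x \<in> I}" by (intro extension_proper) simp_all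
  then show ?thesis using x by simp
qed

lemma injective:
  assumes "x \<in> carrier A" "\<phi> x = \<zero>\<^bsub>A'\<^esub>" shows "x = \<zero>\<^bsub>A\<^esub>"
proof -
  have "\<phi> \<zero>\<^bsub>A\<^esub> \<otimes>\<^bsub>A'\<^esub> \<zero>\<^bsub>A'\<^esub> \<in> ext {\<zero>\<^bsub>A\<^esub>}" by (rule extension.prod) auto
  then have "\<phi> x \<in> ext {\<zero>\<^bsub>A\<^esub>}" using assms by simp
  then have "x \<in> {\<zero>\<^bsub>A\<^esub>}" by (rule extension_contract[OF A.zeroideal assms(1)])
  then show ?thesis by simp
qed

text \<open>Each element of \<open>Y\<close> imposes one colon condition; they are added one at a
  time, the intersection of the earlier ones playing the role of \<open>J\<close> in
  \<open>extension_colon\<close>.\<close>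

lemma extension_finite_colon:
  assumes Y: "finite Y" "Y \<subseteq> carrier A" and a: "a \<in> carrier A" and x: "x \<in> carrier A'"
    and d: "\<And>y. y \<in> Y \<Longrightarrow> \<phi> a divides\<^bsub>A'\<^esub> x \<otimes>\<^bsub>A'\<^esub> \<phi> y"
  shows "x \<in> ext {j \<in> carrier A. \<forall>y\<in>Y. a divides\<^bsub>A\<^esub> j \<otimes>\<^bsub>A\<^esub> y}"
    and "ideal {j \<in> carrier A. \<forall>y\<in>Y. a divides\<^bsub>A\<^esub> j \<otimes>\<^bsub>A\<^esub> y} A"
proof -
  have "x \<in> ext {j \<in> carrier A. \<forall>y\<in>Y. a divides\<^bsub>A\<^esub> j \<otimes>\<^bsub>A\<^esub> y} \<and>
     ideal {j \<in> carrier A. \<forall>y\<in>Y. a divides\<^bsub>A\<^esub> j \<otimes>\<^bsub>A\<^esub> y} A"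
    using Y d
  proof (induction Y)
    case empty
    have "\<phi> \<one>\<^bsub>A\<^esub> \<otimes>\<^bsub>A'\<^esub> x \<in> ext (carrier A)" by (rule extension.prod) (use x in auto)
    then show ?case using x A.oneideal by simp
  next
    case (insert y Y)
    let ?J = "{j \<in> carrier A. \<forall>y\<in>Y. a divides\<^bsub>A\<^esub> j \<otimes>\<^bsub>A\<^esub> y}"
    have J: "x \<in> ext ?J" "ideal ?J A" using insert by auto
    have y: "y \<in> carrier A" using insert by simp
    have pa: "z \<in> PIdl\<^bsub>A\<^esub> a \<longleftrightarrow> a divides\<^bsub>A\<^esub> z" if "z \<in> carrier A" for z
      using a by (auto simp: cgenideal_def factor_def A.m_comm)
    obtain c where c: "c \<in> carrier A'" "x \<otimes>\<^bsub>A'\<^esub> \<phi> y = \<phi> a \<otimes>\<^bsub>A'\<^esub> c"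
      using insert.prems(2)[of y] by (auto simp: factor_def)
    have "\<phi> a \<otimes>\<^bsub>A'\<^esub> c \<in> ext (PIdl\<^bsub>A\<^esub> a)" by (rule extension.prod) (use a c A.cgenideal_self in auto)
    then have "\<phi> y \<otimes>\<^bsub>A'\<^esub> x \<in> ext (PIdl\<^bsub>A\<^esub> a)" using c x y by (simp add: A'.m_comm)
    then have "x \<in> ext {j \<in> ?J. j \<otimes>\<^bsub>A\<^esub> y \<in> PIdl\<^bsub>A\<^esub> a}"
      by (rule extension_colon[OF A.cgenideal_ideal[OF a] J(2) y J(1)])
    moreover have "{j \<in> ?J. j \<otimes>\<^bsub>A\<^esub> y \<in> PIdl\<^bsub>A\<^esub> a} = {j \<in> carrier A. \<forall>y\<in>insert y Y. a divides\<^bsub>A\<^esub> j \<otimes>\<^bsub>A\<^esub> y}"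
      using pa y by auto
    moreover have "ideal (?J \<inter> {j \<in> carrier A. a divides\<^bsub>A\<^esub> j \<otimes>\<^bsub>A\<^esub> y}) A"
      by (rule A.i_intersect[OF J(2) A.divides_ideal[OF a y]])
    moreover have "?J \<inter> {j \<in> carrier A. a divides\<^bsub>A\<^esub> j \<otimes>\<^bsub>A\<^esub> y} = {j \<in> carrier A. \<forall>y\<in>insert y Y. a divides\<^bsub>A\<^esub> j \<otimes>\<^bsub>A\<^esub> y}"
      by auto
    ultimately show ?case by simp
  qed
  then show "x \<in> ext {j \<in> carrier A. \<forall>y\<in>Y. a divides\<^bsub>A\<^esub> j \<otimes>\<^bsub>A\<^esub> y}"
    "ideal {j \<in> carrier A. \<forall>y\<in>Y. a divides\<^bsub>A\<^esub> j \<otimes>\<^bsub>A\<^esub> y} A" by auto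
qed

end

section \<open>Sections of the structure sheaf\<close>

text \<open>The fraction \<open>x/y\<close> as a section over \<open>V\<close>; \<open>is_reg\<close> says that it lies in all local rings
  of points of \<open>V\<close>.\<close>

definition frac_sec :: "('a, 'm) ring_scheme \<Rightarrow> 'a set set \<Rightarrow> 'a \<Rightarrow> 'a \<Rightarrow> 'a set \<Rightarrow> ('a \<times> 'a) set" where
  "frac_sec R V x y = (\<lambda>P\<in>V. {(b, t). b \<in> carrier R \<and> t \<in> carrier R - P \<and> x \<otimes>\<^bsub>R\<^esub> t = b \<otimes>\<^bsub>R\<^esub> y})"

definition is_reg :: "('a, 'm) ring_scheme \<Rightarrow> 'a set set \<Rightarrow> 'a \<Rightarrow> 'a \<Rightarrow> bool" where
  "is_reg R V x y \<longleftrightarrow> x \<in> carrier R \<and> y \<in> carrier R \<and> y \<noteq> \<zero>\<^bsub>R\<^esub> \<and>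
     (\<forall>P\<in>V. \<exists>t\<in>carrier R - P. \<exists>b\<in>carrier R. x \<otimes>\<^bsub>R\<^esub> t = b \<otimes>\<^bsub>R\<^esub> y)"

lemma topspace_zariski [simp]: "topspace (zariski R) = prime_spectrum R"
proof -
  have "zariski_open R {P \<in> prime_spectrum R. \<not> {\<one>\<^bsub>R\<^esub>} \<inter> carrier R \<subseteq> P}"
    unfolding zariski_open_def by blast
  moreover have "\<not> {\<one>\<^bsub>R\<^esub>} \<inter> carrier R \<subseteq> P" if "P \<in> prime_spectrum R" for P
  proof -
    interpret primeideal P R using that by (simp add: prime_spectrum_def)
    show ?thesis using I_notcarr one_imp_carrier by auto
  qed
  ultimately have "zariski_open R (prime_spectrum R)" by (metis (mono_tags, lifting) Collect_cong Collect_mem_eq)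
  moreover have "U \<subseteq> prime_spectrum R" if "zariski_open R U" for U using that by (auto simp: zariski_open_def)
  ultimately show ?thesis unfolding topspace_def openin_zariski by blast
qed

lemma openin_zariski_basic:
  "f \<in> carrier R \<Longrightarrow> openin (zariski R) {P \<in> prime_spectrum R. f \<notin> P}"
  unfolding openin_zariski zariski_open_def by (intro exI[of _ "{f}"]) auto

section \<open>Sections on the spectrum of a domain as single fractions\<close>

context domain
begin

lemma loc_prime:
  assumes "P \<in> prime_spectrum R"
  shows "primeideal P R" "mult_closed R (carrier R - P)" "loc_at_prime R P = localization R (carrier R - P)" "\<zero> \<in> P"
proof -
  show "primeideal P R" using assms by (simp add: prime_spectrum_def)
  then show "mult_closed R (carrier R - P)" by (rule mult_closed_prime)
  show "loc_at_prime R P = localization R (carrier R - P)" by (simp add: loc_at_prime_def)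
  show "\<zero> \<in> P" using \<open>primeideal P R\<close>
    by (simp add: additive_subgroup.zero_closed ideal.axioms(1) primeideal.axioms(1))
qed

text \<open>In a domain the factor \<open>u\<close> in \<open>ring_frac\<close> cancels, so the
  class of \<open>b/t\<close> consists of all pairs proportional to \<open>x/y\<close>, whatever
  local expression \<open>b/t\<close> is used.\<close>

lemma frac_sec_value:
  assumes P: "P \<in> prime_spectrum R" "P \<in> V" and y: "y \<in> carrier R" "y \<noteq> \<zero>" and x: "x \<in> carrier R"
    and b: "b \<in> carrier R" "t \<in> carrier R - P" "x \<otimes> t = b \<otimes> y"
  shows "frac_sec R V x y P = ring_frac R (carrier R - P) b t"
proof -
  interpret mult_closed R "carrier R - P" by (rule loc_prime[OF P(1)])
  have t0: "t \<noteq> \<zero>" using b loc_prime(4)[OF P(1)] by auto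
  have "x \<otimes> t' = b' \<otimes> y \<longleftrightarrow> (\<exists>u\<in>carrier R - P. u \<otimes> (b \<otimes> t' \<ominus> b' \<otimes> t) = \<zero>)"
    if c: "b' \<in> carrier R" "t' \<in> carrier R - P" for b' t'
  proof -
    have "x \<otimes> t' = b' \<otimes> y \<longleftrightarrow> t \<otimes> (x \<otimes> t') = t \<otimes> (b' \<otimes> y)"
      using c b x y t0 by (simp add: m_lcancel)
    also have "t \<otimes> (x \<otimes> t') = (x \<otimes> t) \<otimes> t'" using c b(2) x by (simp add: m_ac)
    also have "\<dots> = y \<otimes> (b \<otimes> t')" unfolding b(3) using c b(1,2) y by (simp add: m_ac)
    also have "t \<otimes> (b' \<otimes> y) = y \<otimes> (b' \<otimes> t)" using c b y by (simp add: m_ac)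
    also have "y \<otimes> (b \<otimes> t') = y \<otimes> (b' \<otimes> t) \<longleftrightarrow> b \<otimes> t' = b' \<otimes> t" using c b y by (simp add: m_lcancel)
    also have "\<dots> \<longleftrightarrow> b \<otimes> t' \<ominus> b' \<otimes> t = \<zero>" using c b by simp
    also have "\<dots> \<longleftrightarrow> (\<exists>u\<in>carrier R - P. u \<otimes> (b \<otimes> t' \<ominus> b' \<otimes> t) = \<zero>)"
      using c b loc_prime(4)[OF P(1)] S_one by (auto simp: integral_iff intro!: bexI[of _ \<one>])
    finally show ?thesis .
  qed
  then show ?thesis using P(2) unfolding frac_sec_def ring_frac_def by auto
qed

lemma is_reg_value:
  assumes V: "V \<subseteq> prime_spectrum R" and r: "is_reg R V x y" and P: "P \<in> V"
  obtains b t where "b \<in> carrier R" "t \<in> carrier R - P" "x \<otimes> t = b \<otimes> y"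
    "frac_sec R V x y P = ring_frac R (carrier R - P) b t"
proof -
  obtain t b where tb: "t \<in> carrier R - P" "b \<in> carrier R" "x \<otimes> t = b \<otimes> y"
    using r P unfolding is_reg_def by blast
  have "frac_sec R V x y P = ring_frac R (carrier R - P) b t"
    by (rule frac_sec_value) (use V P r tb in \<open>auto simp: is_reg_def\<close>)
  then show ?thesis using that tb by blast
qed

text \<open>The zero ideal is the generic point. Comparison at this common point is what turns local
  expressions into one fraction.\<close>

lemma zero_in_open:
  assumes "openin (zariski R) V" "V \<noteq> {}" shows "{\<zero>} \<in> V"
proof -
  obtain T where T: "T \<subseteq> carrier R" "V = {P \<in> prime_spectrum R. \<not> T \<subseteq> P}"
    using assms(1) unfolding openin_zariski zariski_open_def by blast
  obtain P where P: "P \<in> prime_spectrum R" "\<not> T \<subseteq> P" using assms(2) T by blast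
  have "\<not> T \<subseteq> {\<zero>}" using P loc_prime(4)[OF P(1)] by blast
  then show ?thesis unfolding T(2) using zeroprimeideal by (simp add: prime_spectrum_def)
qed

lemma open_sub: "openin (zariski R) V \<Longrightarrow> V \<subseteq> prime_spectrum R"
  using openin_subset[of "zariski R" V] by simp

text \<open>The expression of \<open>s\<close> near the generic point gives \<open>x/y\<close>;
  every other local expression agrees with it there, and in a domain this already means
  cross-multiplied equality.\<close>

lemma section_is_frac_sec:
  assumes V: "openin (zariski R) V" and s: "s \<in> carrier (structure_sheaf R V)"
  obtains x y where "is_reg R V x y" "s = frac_sec R V x y"
proof (cases "V = {}")
  case True
  have "is_reg R V \<zero> \<one>" by (simp add: is_reg_def True)
  moreover have "s = frac_sec R V \<zero> \<one>" using s True by (auto simp: structure_sheaf_def frac_sec_def)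
  ultimately show ?thesis by (rule that)
next
  case False
  note zV = zero_in_open[OF V False] and Vs = open_sub[OF V]
  have loc: "\<exists>V' a f. openin (zariski R) V' \<and> P \<in> V' \<and> V' \<subseteq> V \<and> a \<in> carrier R \<and> f \<in> carrier R \<and>
         (\<forall>Q\<in>V'. f \<notin> Q \<and> s Q = ring_frac R (carrier R - Q) a f)" if "P \<in> V" for P
    using s that by (simp add: structure_sheaf_def)
  obtain V0 x y where xy: "{\<zero>} \<in> V0" "x \<in> carrier R" "y \<in> carrier R"
    "\<forall>Q\<in>V0. y \<notin> Q \<and> s Q = ring_frac R (carrier R - Q) x y" using loc[OF zV] by blast
  have y0: "y \<noteq> \<zero>" "s {\<zero>} = ring_frac R (carrier R - {\<zero>}) x y" using xy by auto
  interpret Z: mult_closed R "carrier R - {\<zero>}" by (rule mult_closed_nonzero)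
  have pt: "\<exists>t\<in>carrier R - P. \<exists>b\<in>carrier R. x \<otimes> t = b \<otimes> y \<and> s P = ring_frac R (carrier R - P) b t" if P: "P \<in> V" for P
  proof -
    obtain V' a f where af: "openin (zariski R) V'" "P \<in> V'" "a \<in> carrier R" "f \<in> carrier R"
      "\<forall>Q\<in>V'. f \<notin> Q \<and> s Q = ring_frac R (carrier R - Q) a f" using loc[OF P] by blast
    have "{\<zero>} \<in> V'" by (rule zero_in_open[OF af(1)]) (use af(2) in blast)
    then have f0: "f \<noteq> \<zero>" "s {\<zero>} = ring_frac R (carrier R - {\<zero>}) a f" using af(5) by auto
    then have "ring_frac R (carrier R - {\<zero>}) x y = ring_frac R (carrier R - {\<zero>}) a f" using y0 by simp
    then obtain u where u: "u \<in> carrier R - {\<zero>}" "u \<otimes> (x \<otimes> f \<ominus> a \<otimes> y) = \<zero>"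
      using Z.frac_eq_iff[of x y a f] xy(2,3) y0 f0 af(3,4) by auto
    then have "x \<otimes> f \<ominus> a \<otimes> y = \<zero>" using xy(2,3) af(3,4) by (auto simp: integral_iff)
    then have "x \<otimes> f = a \<otimes> y" using xy(2,3) af(3,4) by simp
    then show ?thesis using af by blast
  qed
  have r: "is_reg R V x y" unfolding is_reg_def using xy(2,3) y0 pt by blast
  have "s = frac_sec R V x y"
  proof
    fix P
    show "s P = frac_sec R V x y P"
    proof (cases "P \<in> V")
      case True
      obtain t b where tb: "t \<in> carrier R - P" "b \<in> carrier R" "x \<otimes> t = b \<otimes> y" "s P = ring_frac R (carrier R - P) b t"
        using pt[OF True] by blast
      have "frac_sec R V x y P = ring_frac R (carrier R - P) b t"
        by (rule frac_sec_value) (use Vs True xy(2,3) y0 tb in auto)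
      then show ?thesis using tb by simp
    next
      case False
      have "s \<in> extensional V" using s by (auto simp: structure_sheaf_def PiE_def)
      then show ?thesis using False by (simp add: frac_sec_def extensional_def)
    qed
  qed
  then show ?thesis by (rule that[OF r])
qed

lemma frac_sec_section:
  assumes V: "openin (zariski R) V" and r: "is_reg R V x y"
  shows "frac_sec R V x y \<in> carrier (structure_sheaf R V)"
proof -
  note Vs = open_sub[OF V]
  have xy: "x \<in> carrier R" "y \<in> carrier R" "y \<noteq> \<zero>" using r by (auto simp: is_reg_def)
  have "frac_sec R V x y P \<in> carrier (loc_at_prime R P)" if P: "P \<in> V" for P
  proof -
    have P': "P \<in> prime_spectrum R" using P Vs by blast
    interpret mult_closed R "carrier R - P" by (rule loc_prime[OF P'])
    obtain b t where "b \<in> carrier R" "t \<in> carrier R - P" "frac_sec R V x y P = ring_frac R (carrier R - P) b t"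
      by (rule is_reg_value[OF Vs r P])
    then show ?thesis by (simp add: loc_at_prime_def)
  qed
  moreover have "\<exists>V' a f. openin (zariski R) V' \<and> P \<in> V' \<and> V' \<subseteq> V \<and> a \<in> carrier R \<and> f \<in> carrier R \<and>
         (\<forall>Q\<in>V'. f \<notin> Q \<and> frac_sec R V x y Q = ring_frac R (carrier R - Q) a f)" if P: "P \<in> V" for P
  proof -
    obtain b t where bt: "b \<in> carrier R" "t \<in> carrier R - P" "x \<otimes> t = b \<otimes> y"
      by (rule is_reg_value[OF Vs r P])
    have o: "openin (zariski R) (V \<inter> {Q \<in> prime_spectrum R. t \<notin> Q})"
      by (intro openin_Int V openin_zariski_basic) (use bt in auto)
    have "frac_sec R V x y Q = ring_frac R (carrier R - Q) b t" if "Q \<in> V \<inter> {Q \<in> prime_spectrum R. t \<notin> Q}" for Q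
      by (rule frac_sec_value) (use that bt xy in auto)
    then show ?thesis using o P Vs bt
      by (intro exI[of _ "V \<inter> {Q \<in> prime_spectrum R. t \<notin> Q}"] exI[of _ b] exI[of _ t]) auto
  qed
  moreover have "frac_sec R V x y \<in> extensional V" by (simp add: frac_sec_def)
  ultimately show ?thesis by (auto simp: structure_sheaf_def PiE_def)
qed

lemma frac_sec_eqI:
  assumes V: "V \<subseteq> prime_spectrum R" and r: "is_reg R V x y" "is_reg R V x' y'" and eq: "x \<otimes> y' = x' \<otimes> y"
  shows "frac_sec R V x y = frac_sec R V x' y'"
proof
  fix P
  have c: "x \<in> carrier R" "y \<in> carrier R" "y \<noteq> \<zero>" "x' \<in> carrier R" "y' \<in> carrier R" "y' \<noteq> \<zero>"
    using r by (auto simp: is_reg_def)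
  show "frac_sec R V x y P = frac_sec R V x' y' P"
  proof (cases "P \<in> V")
    case True
    then have P: "P \<in> prime_spectrum R" using V by blast
    obtain b t where bt: "b \<in> carrier R" "t \<in> carrier R - P" "x \<otimes> t = b \<otimes> y"
      "frac_sec R V x y P = ring_frac R (carrier R - P) b t" by (rule is_reg_value[OF V r(1) True])
    have "y \<otimes> (x' \<otimes> t) = (x' \<otimes> y) \<otimes> t" using c bt(2) by (simp add: m_ac)
    also have "\<dots> = (x \<otimes> t) \<otimes> y'" unfolding eq[symmetric] using c bt(2) by (simp add: m_ac)
    also have "\<dots> = y \<otimes> (b \<otimes> y')" unfolding bt(3) using c bt(1) by (simp add: m_ac)
    finally have "x' \<otimes> t = b \<otimes> y'" using c bt(1,2) by (simp add: m_lcancel)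
    then show ?thesis using frac_sec_value[OF P True c(5,6,4) bt(1,2)] bt(4) by simp
  qed (simp add: frac_sec_def)
qed

text \<open>Equality at one point is enough, since the local rings of a domain all sit in its
  quotient field.\<close>

lemma frac_sec_eqD:
  assumes V: "V \<subseteq> prime_spectrum R" and r: "is_reg R V x y" "is_reg R V x' y'" and ne: "P \<in> V"
    and eq: "frac_sec R V x y P = frac_sec R V x' y' P"
  shows "x \<otimes> y' = x' \<otimes> y"
proof -
  have c: "x \<in> carrier R" "y \<in> carrier R" "y \<noteq> \<zero>" "x' \<in> carrier R" "y' \<in> carrier R" "y' \<noteq> \<zero>"
    using r by (auto simp: is_reg_def)
  obtain b t where bt: "b \<in> carrier R" "t \<in> carrier R - P" "x \<otimes> t = b \<otimes> y"
    by (rule is_reg_value[OF V r(1) ne])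
  have "(b, t) \<in> frac_sec R V x y P" using bt ne by (simp add: frac_sec_def)
  then have bt': "x' \<otimes> t = b \<otimes> y'" unfolding eq using ne by (simp add: frac_sec_def)
  have t0: "t \<noteq> \<zero>" using bt(2) loc_prime(4) V ne by auto
  have "t \<otimes> (x \<otimes> y') = (x \<otimes> t) \<otimes> y'" using c bt(2) by (simp add: m_ac)
  also have "\<dots> = (b \<otimes> y') \<otimes> y" unfolding bt(3) using c bt(1) by (simp add: m_ac)
  also have "\<dots> = t \<otimes> (x' \<otimes> y)" unfolding bt'[symmetric] using c bt(2) by (simp add: m_ac)
  finally show ?thesis using c bt(2) t0 by (simp add: m_lcancel)
qed

lemma is_reg_mult:
  assumes V: "V \<subseteq> prime_spectrum R" and r: "is_reg R V x y" "is_reg R V x' y'"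
  shows "is_reg R V (x \<otimes> x') (y \<otimes> y')"
    and "frac_sec R V x y \<otimes>\<^bsub>structure_sheaf R V\<^esub> frac_sec R V x' y' = frac_sec R V (x \<otimes> x') (y \<otimes> y')"
    and "is_reg R V (x \<otimes> y' \<oplus> x' \<otimes> y) (y \<otimes> y')"
    and "frac_sec R V x y \<oplus>\<^bsub>structure_sheaf R V\<^esub> frac_sec R V x' y' = frac_sec R V (x \<otimes> y' \<oplus> x' \<otimes> y) (y \<otimes> y')"
proof -
  have c: "x \<in> carrier R" "y \<in> carrier R" "y \<noteq> \<zero>" "x' \<in> carrier R" "y' \<in> carrier R" "y' \<noteq> \<zero>"
    using r by (auto simp: is_reg_def)
  have yy: "y \<otimes> y' \<in> carrier R" "y \<otimes> y' \<noteq> \<zero>" using c by (auto simp: integral_iff)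
  have key: "\<exists>t\<in>carrier R - P. (\<exists>b\<in>carrier R. (x \<otimes> x') \<otimes> t = b \<otimes> (y \<otimes> y') \<and>
      frac_sec R V x y P \<otimes>\<^bsub>loc_at_prime R P\<^esub> frac_sec R V x' y' P = ring_frac R (carrier R - P) b t) \<and>
     (\<exists>b\<in>carrier R. (x \<otimes> y' \<oplus> x' \<otimes> y) \<otimes> t = b \<otimes> (y \<otimes> y') \<and>
      frac_sec R V x y P \<oplus>\<^bsub>loc_at_prime R P\<^esub> frac_sec R V x' y' P = ring_frac R (carrier R - P) b t)" if P: "P \<in> V" for P
  proof -
    have P': "P \<in> prime_spectrum R" using P V by blast
    interpret S: mult_closed R "carrier R - P" by (rule loc_prime[OF P'])
    obtain b t where bt: "b \<in> carrier R" "t \<in> carrier R - P" "x \<otimes> t = b \<otimes> y"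
      "frac_sec R V x y P = S.frc b t" by (rule is_reg_value[OF V r(1) P])
    obtain b' t' where bt': "b' \<in> carrier R" "t' \<in> carrier R - P" "x' \<otimes> t' = b' \<otimes> y'"
      "frac_sec R V x' y' P = S.frc b' t'" by (rule is_reg_value[OF V r(2) P])
    have tc: "t \<in> carrier R" "t' \<in> carrier R" using bt(2) bt'(2) by auto
    have m: "frac_sec R V x y P \<otimes>\<^bsub>loc_at_prime R P\<^esub> frac_sec R V x' y' P = S.frc (b \<otimes> b') (t \<otimes> t')"
      unfolding bt(4) bt'(4) loc_prime(3)[OF P'] by (rule S.loc_mult[OF bt(1,2) bt'(1,2)])
    have a: "frac_sec R V x y P \<oplus>\<^bsub>loc_at_prime R P\<^esub> frac_sec R V x' y' P = S.frc (b \<otimes> t' \<oplus> b' \<otimes> t) (t \<otimes> t')"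
      unfolding bt(4) bt'(4) loc_prime(3)[OF P'] by (rule S.loc_add[OF bt(1,2) bt'(1,2)])
    have "(x \<otimes> x') \<otimes> (t \<otimes> t') = (x \<otimes> t) \<otimes> (x' \<otimes> t')" using c tc by (simp add: m_ac)
    also have "\<dots> = (b \<otimes> b') \<otimes> (y \<otimes> y')" unfolding bt(3) bt'(3) using c bt(1) bt'(1) by (simp add: m_ac)
    finally have 1: "(x \<otimes> x') \<otimes> (t \<otimes> t') = (b \<otimes> b') \<otimes> (y \<otimes> y')" .
    have "(x \<otimes> y' \<oplus> x' \<otimes> y) \<otimes> (t \<otimes> t') = (x \<otimes> t) \<otimes> (t' \<otimes> y') \<oplus> (x' \<otimes> t') \<otimes> (t \<otimes> y)"
      using c tc by (simp add: l_distr r_distr m_ac)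
    also have "\<dots> = (b \<otimes> t' \<oplus> b' \<otimes> t) \<otimes> (y \<otimes> y')" unfolding bt(3) bt'(3) using c tc bt(1) bt'(1) by (simp add: l_distr r_distr m_ac)
    finally have 2: "(x \<otimes> y' \<oplus> x' \<otimes> y) \<otimes> (t \<otimes> t') = (b \<otimes> t' \<oplus> b' \<otimes> t) \<otimes> (y \<otimes> y')" .
    show ?thesis
      by (rule bexI[OF _ S.S_mult[OF bt(2) bt'(2)]], rule conjI)
        (use 1 2 m a bt(1) bt'(1) tc in \<open>intro bexI[of _ "b \<otimes> b'"]; simp\<close>,
         use 1 2 m a bt(1) bt'(1) tc in \<open>intro bexI[of _ "b \<otimes> t' \<oplus> b' \<otimes> t"]; simp\<close>)
  qed
  have xx: "x \<otimes> x' \<in> carrier R" "x \<otimes> y' \<oplus> x' \<otimes> y \<in> carrier R" using c by auto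
  show "is_reg R V (x \<otimes> x') (y \<otimes> y')" "is_reg R V (x \<otimes> y' \<oplus> x' \<otimes> y) (y \<otimes> y')"
    unfolding is_reg_def using xx yy key by blast+
  have "frac_sec R V x y P \<otimes>\<^bsub>loc_at_prime R P\<^esub> frac_sec R V x' y' P = frac_sec R V (x \<otimes> x') (y \<otimes> y') P"
    "frac_sec R V x y P \<oplus>\<^bsub>loc_at_prime R P\<^esub> frac_sec R V x' y' P = frac_sec R V (x \<otimes> y' \<oplus> x' \<otimes> y) (y \<otimes> y') P"
    if P: "P \<in> V" for P
  proof -
    have P': "P \<in> prime_spectrum R" using P V by blast
    show "frac_sec R V x y P \<otimes>\<^bsub>loc_at_prime R P\<^esub> frac_sec R V x' y' P = frac_sec R V (x \<otimes> x') (y \<otimes> y') P"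
      "frac_sec R V x y P \<oplus>\<^bsub>loc_at_prime R P\<^esub> frac_sec R V x' y' P = frac_sec R V (x \<otimes> y' \<oplus> x' \<otimes> y) (y \<otimes> y') P"
      using key[OF P] frac_sec_value[OF P' P yy xx(1)] frac_sec_value[OF P' P yy xx(2)] by metis+
  qed
  then show "frac_sec R V x y \<otimes>\<^bsub>structure_sheaf R V\<^esub> frac_sec R V x' y' = frac_sec R V (x \<otimes> x') (y \<otimes> y')"
    "frac_sec R V x y \<oplus>\<^bsub>structure_sheaf R V\<^esub> frac_sec R V x' y' = frac_sec R V (x \<otimes> y' \<oplus> x' \<otimes> y) (y \<otimes> y')"
    by (auto simp: structure_sheaf_def fun_eq_iff frac_sec_def[of R V "x \<otimes> x'"] frac_sec_def[of R V "x \<otimes> y' \<oplus> x' \<otimes> y"])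
qed

lemma is_reg_const:
  assumes "V \<subseteq> prime_spectrum R" "a \<in> carrier R" shows "is_reg R V a \<one>"
  unfolding is_reg_def
proof (intro conjI ballI)
  fix P assume "P \<in> V"
  then have "P \<in> prime_spectrum R" using assms by blast
  then interpret mult_closed R "carrier R - P" by (rule loc_prime)
  show "\<exists>t\<in>carrier R - P. \<exists>b\<in>carrier R. a \<otimes> t = b \<otimes> \<one>"
    using S_one assms(2) by (intro bexI[of _ \<one>] bexI[of _ a]) auto
qed (use assms in auto)

lemma sheaf_one_zero:
  assumes V: "V \<subseteq> prime_spectrum R"
  shows "\<one>\<^bsub>structure_sheaf R V\<^esub> = frac_sec R V \<one> \<one>" "\<zero>\<^bsub>structure_sheaf R V\<^esub> = frac_sec R V \<zero> \<one>"
proof -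
  have "\<one>\<^bsub>loc_at_prime R P\<^esub> = frac_sec R V \<one> \<one> P \<and> \<zero>\<^bsub>loc_at_prime R P\<^esub> = frac_sec R V \<zero> \<one> P" if P: "P \<in> V" for P
  proof -
    have P': "P \<in> prime_spectrum R" using P V by blast
    interpret S: mult_closed R "carrier R - P" by (rule loc_prime[OF P'])
    show ?thesis unfolding loc_prime(3)[OF P'] S.loc_one S.loc_zero
      using frac_sec_value[OF P' P, of \<one> \<one> \<one> \<one>] frac_sec_value[OF P' P, of \<one> \<zero> \<zero> \<one>] S.S_one by auto
  qed
  then show "\<one>\<^bsub>structure_sheaf R V\<^esub> = frac_sec R V \<one> \<one>" "\<zero>\<^bsub>structure_sheaf R V\<^esub> = frac_sec R V \<zero> \<one>"
    by (auto simp: structure_sheaf_def fun_eq_iff frac_sec_def[of R V \<one>] frac_sec_def[of R V \<zero>])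
qed

lemma sheaf_cring:
  assumes V: "openin (zariski R) V"
  shows "cring (structure_sheaf R V)"
proof -
  note Vs = open_sub[OF V]
  let ?O = "structure_sheaf R V"
  have E: "\<exists>x y. is_reg R V x y \<and> s = frac_sec R V x y" if "s \<in> carrier ?O" for s
    by (rule section_is_frac_sec[OF V that]) blast
  note reg = is_reg_mult[OF Vs] and C = frac_sec_section[OF V] and Q = frac_sec_eqI[OF Vs]
  note oz = sheaf_one_zero[OF Vs] and k = is_reg_const[OF Vs]
  have cc: "x \<in> carrier R" "y \<in> carrier R" "y \<noteq> \<zero>" if "is_reg R V x y" for x y
    using that by (auto simp: is_reg_def)
  show ?thesis
  proof (rule cringI)
    show "abelian_group ?O"
    proof (rule abelian_groupI)
      fix s s' assume "s \<in> carrier ?O" "s' \<in> carrier ?O"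
      then obtain x y x' y' where r: "is_reg R V x y" "s = frac_sec R V x y" "is_reg R V x' y'" "s' = frac_sec R V x' y'"
        using E by metis
      show "s \<oplus>\<^bsub>?O\<^esub> s' \<in> carrier ?O" unfolding r reg(4)[OF r(1,3)] by (rule C[OF reg(3)[OF r(1,3)]])
      show "s \<oplus>\<^bsub>?O\<^esub> s' = s' \<oplus>\<^bsub>?O\<^esub> s"
        unfolding r reg(4)[OF r(1,3)] reg(4)[OF r(3,1)]
        by (rule Q[OF reg(3)[OF r(1,3)] reg(3)[OF r(3,1)]]) (use cc[OF r(1)] cc[OF r(3)] in \<open>simp add: m_comm a_comm\<close>)
      fix s'' assume "s'' \<in> carrier ?O"
      then obtain x'' y'' where r'': "is_reg R V x'' y''" "s'' = frac_sec R V x'' y''" using E by metis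
      note rr = reg(3)[OF r(1,3)] reg(3)[OF r(3) r''(1)]
      show "s \<oplus>\<^bsub>?O\<^esub> s' \<oplus>\<^bsub>?O\<^esub> s'' = s \<oplus>\<^bsub>?O\<^esub> (s' \<oplus>\<^bsub>?O\<^esub> s'')"
        unfolding r r'' reg(4)[OF r(1,3)] reg(4)[OF r(3) r''(1)] reg(4)[OF rr(1) r''(1)] reg(4)[OF r(1) rr(2)]
        by (rule Q[OF reg(3)[OF rr(1) r''(1)] reg(3)[OF r(1) rr(2)]])
          (use cc[OF r(1)] cc[OF r(3)] cc[OF r''(1)] in \<open>simp add: l_distr r_distr m_ac a_ac\<close>)
    next
      show "\<zero>\<^bsub>?O\<^esub> \<in> carrier ?O" unfolding oz by (rule C[OF k]) simp
    next
      fix s assume "s \<in> carrier ?O"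
      then obtain x y where r: "is_reg R V x y" "s = frac_sec R V x y" using E by metis
      have z: "is_reg R V \<zero> \<one>" by (rule k) simp
      show "\<zero>\<^bsub>?O\<^esub> \<oplus>\<^bsub>?O\<^esub> s = s" unfolding r oz reg(4)[OF z r(1)]
        by (rule Q[OF reg(3)[OF z r(1)] r(1)]) (use cc[OF r(1)] in simp)
      have m: "is_reg R V (\<ominus> \<one>) \<one>" by (rule k) simp
      note mr = reg(1)[OF m r(1)]
      have "frac_sec R V (\<ominus> \<one> \<otimes> x) (\<one> \<otimes> y) \<oplus>\<^bsub>?O\<^esub> s = \<zero>\<^bsub>?O\<^esub>"
        unfolding r oz reg(4)[OF mr r(1)]
        by (rule Q[OF reg(3)[OF mr r(1)] z]) (use cc[OF r(1)] in \<open>simp add: l_minus l_neg\<close>)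
      then show "\<exists>y\<in>carrier ?O. y \<oplus>\<^bsub>?O\<^esub> s = \<zero>\<^bsub>?O\<^esub>" using C[OF mr] by blast
    qed
    show "comm_monoid ?O"
    proof (rule comm_monoidI)
      fix s s' assume "s \<in> carrier ?O" "s' \<in> carrier ?O"
      then obtain x y x' y' where r: "is_reg R V x y" "s = frac_sec R V x y" "is_reg R V x' y'" "s' = frac_sec R V x' y'"
        using E by metis
      show "s \<otimes>\<^bsub>?O\<^esub> s' \<in> carrier ?O" unfolding r reg(2)[OF r(1,3)] by (rule C[OF reg(1)[OF r(1,3)]])
      show "s \<otimes>\<^bsub>?O\<^esub> s' = s' \<otimes>\<^bsub>?O\<^esub> s"
        unfolding r reg(2)[OF r(1,3)] reg(2)[OF r(3,1)]
        by (rule Q[OF reg(1)[OF r(1,3)] reg(1)[OF r(3,1)]]) (use cc[OF r(1)] cc[OF r(3)] in \<open>simp add: m_comm\<close>)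
      fix s'' assume "s'' \<in> carrier ?O"
      then obtain x'' y'' where r'': "is_reg R V x'' y''" "s'' = frac_sec R V x'' y''" using E by metis
      note rr = reg(1)[OF r(1,3)] reg(1)[OF r(3) r''(1)]
      show "s \<otimes>\<^bsub>?O\<^esub> s' \<otimes>\<^bsub>?O\<^esub> s'' = s \<otimes>\<^bsub>?O\<^esub> (s' \<otimes>\<^bsub>?O\<^esub> s'')"
        unfolding r r'' reg(2)[OF r(1,3)] reg(2)[OF r(3) r''(1)] reg(2)[OF rr(1) r''(1)] reg(2)[OF r(1) rr(2)]
        by (rule Q[OF reg(1)[OF rr(1) r''(1)] reg(1)[OF r(1) rr(2)]])
          (use cc[OF r(1)] cc[OF r(3)] cc[OF r''(1)] in \<open>simp add: m_ac\<close>)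
    next
      show "\<one>\<^bsub>?O\<^esub> \<in> carrier ?O" unfolding oz by (rule C[OF k]) simp
    next
      fix s assume "s \<in> carrier ?O"
      then obtain x y where r: "is_reg R V x y" "s = frac_sec R V x y" using E by metis
      have z: "is_reg R V \<one> \<one>" by (rule k) simp
      show "\<one>\<^bsub>?O\<^esub> \<otimes>\<^bsub>?O\<^esub> s = s" unfolding r oz reg(2)[OF z r(1)]
        by (rule Q[OF reg(1)[OF z r(1)] r(1)]) (use cc[OF r(1)] in simp)
    qed
    fix s s' s'' assume "s \<in> carrier ?O" "s' \<in> carrier ?O" "s'' \<in> carrier ?O"
    then obtain x y x' y' x'' y'' where r: "is_reg R V x y" "s = frac_sec R V x y" "is_reg R V x' y'" "s' = frac_sec R V x' y'"
      and r'': "is_reg R V x'' y''" "s'' = frac_sec R V x'' y''"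
      using E by metis
    note rr = reg(3)[OF r(1,3)] reg(1)[OF r(1) r''(1)] reg(1)[OF r(3) r''(1)]
    show "(s \<oplus>\<^bsub>?O\<^esub> s') \<otimes>\<^bsub>?O\<^esub> s'' = s \<otimes>\<^bsub>?O\<^esub> s'' \<oplus>\<^bsub>?O\<^esub> s' \<otimes>\<^bsub>?O\<^esub> s''"
      unfolding r r'' reg(4)[OF r(1,3)] reg(2)[OF r(1) r''(1)] reg(2)[OF r(3) r''(1)] reg(2)[OF rr(1) r''(1)] reg(4)[OF rr(2,3)]
      by (rule Q[OF reg(1)[OF rr(1) r''(1)] reg(3)[OF rr(2,3)]])
        (use cc[OF r(1)] cc[OF r(3)] cc[OF r''(1)] in \<open>simp add: l_distr r_distr m_ac a_ac\<close>)
  qed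
qed

lemma sheaf_domain:
  assumes V: "openin (zariski R) V" and ne: "V \<noteq> {}"
  shows "domain (structure_sheaf R V)"
proof -
  note Vs = open_sub[OF V]
  let ?O = "structure_sheaf R V"
  interpret O: cring ?O by (rule sheaf_cring[OF V])
  note k = is_reg_const[OF Vs] and oz = sheaf_one_zero[OF Vs] and reg = is_reg_mult[OF Vs]
  obtain P where P: "P \<in> V" using ne by blast
  show ?thesis
  proof unfold_locales
    show "\<one>\<^bsub>?O\<^esub> \<noteq> \<zero>\<^bsub>?O\<^esub>"
    proof
      assume "\<one>\<^bsub>?O\<^esub> = \<zero>\<^bsub>?O\<^esub>"
      then have "\<one> \<otimes> \<one> = \<zero> \<otimes> \<one>" unfolding oz
        by (intro frac_sec_eqD[OF Vs k k P]) auto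
      then show False by simp
    qed
    fix s s' assume p: "s \<otimes>\<^bsub>?O\<^esub> s' = \<zero>\<^bsub>?O\<^esub>" and s: "s \<in> carrier ?O" "s' \<in> carrier ?O"
    obtain x y where r: "is_reg R V x y" "s = frac_sec R V x y" by (rule section_is_frac_sec[OF V s(1)])
    obtain x' y' where r': "is_reg R V x' y'" "s' = frac_sec R V x' y'" by (rule section_is_frac_sec[OF V s(2)])
    have c: "x \<in> carrier R" "y \<in> carrier R" "x' \<in> carrier R" "y' \<in> carrier R" using r r' by (auto simp: is_reg_def)
    have z: "is_reg R V \<zero> \<one>" by (rule k) simp
    have "(x \<otimes> x') \<otimes> \<one> = \<zero> \<otimes> (y \<otimes> y')"
      by (rule frac_sec_eqD[OF Vs reg(1)[OF r(1) r'(1)] z P]) (use p r r' reg(2)[OF r(1) r'(1)] oz in simp)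
    then have "x = \<zero> \<or> x' = \<zero>" using c by (simp add: integral_iff)
    moreover have "s = \<zero>\<^bsub>?O\<^esub>" if "x = \<zero>" unfolding r oz by (rule frac_sec_eqI[OF Vs r(1) z]) (use c that in simp)
    moreover have "s' = \<zero>\<^bsub>?O\<^esub>" if "x' = \<zero>" unfolding r' oz by (rule frac_sec_eqI[OF Vs r'(1) z]) (use c that in simp)
    ultimately show "s = \<zero>\<^bsub>?O\<^esub> \<or> s' = \<zero>\<^bsub>?O\<^esub>" by blast
  qed
qed

end

section \<open>Global sections of affine schemes\<close>

text \<open>A local to global principle: a statement depending on an element holds for one as soon
  as the elements for which it holds form an ideal contained in no prime.\<close>

lemma (in cring) one_in_idealI:
  assumes I: "ideal I R" and np: "\<And>P. primeideal P R \<Longrightarrow> \<not> I \<subseteq> P"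
  shows "\<one> \<in> I"
  using exists_prime_above[OF I] np by metis

text \<open>Multiplying numerator and denominator by an element \<open>k\<close> that cuts out a
  smaller neighbourhood makes the denominator itself define the neighbourhood.\<close>

lemma (in cring) section_locally_frac:
  assumes s: "s \<in> carrier (structure_sheaf R V)" and P: "P \<in> V"
  obtains g a where "g \<in> carrier R - P" "a \<in> carrier R" "{Q \<in> prime_spectrum R. g \<notin> Q} \<subseteq> V"
    "\<And>Q. Q \<in> prime_spectrum R \<Longrightarrow> g \<notin> Q \<Longrightarrow> s Q = ring_frac R (carrier R - Q) a g"
proof -
  obtain V' c d where V': "openin (zariski R) V'" "P \<in> V'" "V' \<subseteq> V" "c \<in> carrier R" "d \<in> carrier R"
    "\<forall>Q\<in>V'. d \<notin> Q \<and> s Q = ring_frac R (carrier R - Q) c d"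
    using s P unfolding structure_sheaf_def by auto
  obtain T where T: "T \<subseteq> carrier R" "V' = {Q \<in> prime_spectrum R. \<not> T \<subseteq> Q}"
    using V'(1) unfolding openin_zariski zariski_open_def by blast
  obtain k where k: "k \<in> T" "k \<notin> P" using V'(2) T by blast
  have kc: "k \<in> carrier R" using k T by blast
  have Pp: "primeideal P R" using V'(2) T by (auto simp: prime_spectrum_def)
  have kd: "k \<otimes> d \<notin> Q \<longleftrightarrow> k \<notin> Q \<and> d \<notin> Q" if "primeideal Q R" for Q
  proof -
    interpret Q: primeideal Q R by fact
    show ?thesis using Q.I_prime[OF kc V'(5)] Q.I_l_closed[of d k] Q.I_r_closed[of k d] kc V'(5) by blast
  qed
  have sub: "{Q \<in> prime_spectrum R. k \<otimes> d \<notin> Q} \<subseteq> V'"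
    using kd k(1) unfolding T(2) by (auto simp: prime_spectrum_def)
  have val: "s Q = ring_frac R (carrier R - Q) (k \<otimes> c) (k \<otimes> d)" if Q: "Q \<in> prime_spectrum R" "k \<otimes> d \<notin> Q" for Q
  proof -
    have Qp: "primeideal Q R" using Q by (simp add: prime_spectrum_def)
    interpret S: mult_closed R "carrier R - Q" by (rule mult_closed_prime[OF Qp])
    have "s Q = S.frc c d" using V'(6) sub Q by blast
    also have "\<dots> = S.frc (k \<otimes> c) (k \<otimes> d)"
      by (rule S.frac_eqI') (use kd[OF Qp] Q V' kc in \<open>auto simp: m_ac\<close>)
    finally show ?thesis .
  qed
  have "k \<otimes> d \<in> carrier R - P" using kd[OF Pp] k(2) V'(2,5,6) kc by auto
  then show ?thesis using that[of "k \<otimes> d" "k \<otimes> c"] sub V'(3,4) val kc by blast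
qed

text \<open>If no power of \<open>k\<close> annihilated \<open>x\<close>, some prime above the
  annihilator of \<open>x\<close> would avoid \<open>k\<close>, although \<open>x\<close> vanishes
  in the local rings at all such primes.\<close>

lemma (in cring) frac_agree_power:
  assumes c: "x \<in> carrier R" "k \<in> carrier R"
    and eq: "\<And>Q. primeideal Q R \<Longrightarrow> k \<notin> Q \<Longrightarrow> \<exists>u\<in>carrier R - Q. u \<otimes> x = \<zero>"
  shows "\<exists>n::nat. k [^] n \<otimes> x = \<zero>"
proof (rule ccontr)
  assume neg: "\<not> ?thesis"
  have id: "ideal {u \<in> carrier R. u \<otimes> x = \<zero>} R"
  proof -
    have "{u \<in> carrier R. u \<otimes> x = \<zero>} = {u \<in> carrier R. \<zero> divides u \<otimes> x}"
      by (auto simp: factor_def)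
    then show ?thesis using divides_ideal[OF zero_closed c(1)] by simp
  qed
  obtain P where "primeideal P R" "{u \<in> carrier R. u \<otimes> x = \<zero>} \<subseteq> P" "k \<notin> P"
    by (rule exists_prime_avoiding_powers[OF id c(2)]) (use neg in auto)
  then show False using eq by blast
qed

lemma (in cring) pow_not_in_prime:
  assumes "primeideal P R" "f \<in> carrier R - P" shows "f [^] (n::nat) \<in> carrier R - P"
  using mult_closed.loc_pow(2)[OF mult_closed_prime[OF assms(1)] one_closed assms(2)] .

text \<open>The \<open>k\<close> for which the assertion holds outside \<open>V(k)\<close> form an ideal; this replaces quasi-compactness.\<close>

lemma (in cring) section_clear_denominator:
  assumes s: "s \<in> carrier (structure_sheaf R (prime_spectrum R))" and g: "g \<in> carrier R" "a \<in> carrier R"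
    and sg: "\<And>Q. Q \<in> prime_spectrum R \<Longrightarrow> g \<notin> Q \<Longrightarrow> s Q = ring_frac R (carrier R - Q) a g"
  shows "\<exists>N::nat. \<forall>Q\<in>prime_spectrum R. ring_frac R (carrier R - Q) (g [^] Suc N) \<one> \<otimes>\<^bsub>loc_at_prime R Q\<^esub> s Q
    = ring_frac R (carrier R - Q) (g [^] N \<otimes> a) \<one>"
proof -
  let ?E = "\<lambda>N Q. ring_frac R (carrier R - Q) (g [^] Suc N) \<one> \<otimes>\<^bsub>loc_at_prime R Q\<^esub> s Q
    = ring_frac R (carrier R - Q) (g [^] N \<otimes> a) \<one>"
  \<comment> \<open>Cross-multiplied form of the claim at \<open>Q\<close> for a local expression
    \<open>c/d\<close> of \<open>s\<close>. It survives multiplication by further powers of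
    \<open>g\<close>, which is \<open>mono\<close>.\<close>
  have iff: "?E N Q \<longleftrightarrow> (\<exists>u\<in>carrier R - Q. u \<otimes> (g [^] N \<otimes> (g \<otimes> c \<ominus> a \<otimes> d)) = \<zero>)"
    if Q: "Q \<in> prime_spectrum R" and sQ: "s Q = ring_frac R (carrier R - Q) c d" "c \<in> carrier R" "d \<in> carrier R - Q"
    for N :: nat and Q c d
  proof -
    have Qp: "primeideal Q R" using Q by (simp add: prime_spectrum_def)
    interpret S: mult_closed R "carrier R - Q" by (rule mult_closed_prime[OF Qp])
    have dc: "d \<in> carrier R" using sQ by simp
    have "ring_frac R (carrier R - Q) (g [^] Suc N) \<one> \<otimes>\<^bsub>loc_at_prime R Q\<^esub> s Q = S.frc (g [^] Suc N \<otimes> c) (\<one> \<otimes> d)"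
      unfolding sQ loc_at_prime_def by (rule S.loc_mult) (use g sQ S.S_one in auto)
    then have "?E N Q \<longleftrightarrow> (\<exists>u\<in>carrier R - Q. u \<otimes> ((g [^] Suc N \<otimes> c) \<otimes> \<one> \<ominus> (g [^] N \<otimes> a) \<otimes> (\<one> \<otimes> d)) = \<zero>)"
      using S.frac_eq_iff[of "g [^] Suc N \<otimes> c" "\<one> \<otimes> d" "g [^] N \<otimes> a" \<one>] g sQ S.S_one by simp
    also have "(g [^] Suc N \<otimes> c) \<otimes> \<one> \<ominus> (g [^] N \<otimes> a) \<otimes> (\<one> \<otimes> d) = g [^] N \<otimes> (g \<otimes> c \<ominus> a \<otimes> d)"
      using g sQ(2) dc by (simp add: minus_eq r_distr r_minus m_assoc)
    finally show ?thesis .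
  qed
  have rep: "\<exists>c\<in>carrier R. \<exists>d\<in>carrier R - Q. s Q = ring_frac R (carrier R - Q) c d" if Q: "Q \<in> prime_spectrum R" for Q
    using section_locally_frac[OF s Q] Q by (metis DiffD2)
  have mono: "?E (N + m) Q" if Q: "Q \<in> prime_spectrum R" and e: "?E N Q" for N m :: nat and Q
  proof -
    obtain c d where cd: "c \<in> carrier R" "d \<in> carrier R - Q" "s Q = ring_frac R (carrier R - Q) c d" using rep[OF Q] by blast
    obtain u where u: "u \<in> carrier R - Q" "u \<otimes> (g [^] N \<otimes> (g \<otimes> c \<ominus> a \<otimes> d)) = \<zero>"
      using e iff[OF Q cd(3,1,2)] by blast
    have "u \<otimes> (g [^] (N + m) \<otimes> (g \<otimes> c \<ominus> a \<otimes> d)) = g [^] m \<otimes> (u \<otimes> (g [^] N \<otimes> (g \<otimes> c \<ominus> a \<otimes> d)))"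
      using g cd u(1) by (simp add: nat_pow_mult[symmetric] m_ac)
    then have "u \<otimes> (g [^] (N + m) \<otimes> (g \<otimes> c \<ominus> a \<otimes> d)) = \<zero>" using u(2) g by simp
    then show ?thesis using iff[OF Q cd(3,1,2)] u(1) by blast
  qed
  define K where "K = {k \<in> carrier R. \<exists>N::nat. \<forall>Q\<in>prime_spectrum R. k \<notin> Q \<longrightarrow> ?E N Q}"
  have id: "ideal K R"
  proof (rule idealI[OF ring_axioms])
    have l: "r \<otimes> k \<in> K" if k: "k \<in> K" and r: "r \<in> carrier R" for r k
    proof -
      obtain N :: nat where N: "k \<in> carrier R" "\<forall>Q\<in>prime_spectrum R. k \<notin> Q \<longrightarrow> ?E N Q" using k unfolding K_def by blast
      have "k \<notin> Q" if "Q \<in> prime_spectrum R" "r \<otimes> k \<notin> Q" for Q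
      proof -
        interpret primeideal Q R using that by (simp add: prime_spectrum_def)
        show ?thesis using that(2) I_l_closed[OF _ r, of k] by auto
      qed
      then have "\<forall>Q\<in>prime_spectrum R. r \<otimes> k \<notin> Q \<longrightarrow> ?E N Q" using N(2) by blast
      then show ?thesis unfolding K_def using N(1) r by blast
    qed
    show "subgroup K (add_monoid R)"
    proof (rule subgroup.intro)
      show "K \<subseteq> carrier (add_monoid R)" by (auto simp: K_def)
      fix k k' assume "k \<in> K" "k' \<in> K"
      then obtain N N' :: nat where N: "k \<in> carrier R" "\<forall>Q\<in>prime_spectrum R. k \<notin> Q \<longrightarrow> ?E N Q"
        and N': "k' \<in> carrier R" "\<forall>Q\<in>prime_spectrum R. k' \<notin> Q \<longrightarrow> ?E N' Q" unfolding K_def by blast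
      have "?E (N + N') Q" if Q: "Q \<in> prime_spectrum R" "k \<oplus> k' \<notin> Q" for Q
      proof -
        interpret primeideal Q R using Q by (simp add: prime_spectrum_def)
        have "k \<notin> Q \<or> k' \<notin> Q" using Q(2) a_closed by blast
        then show ?thesis
        proof
          assume "k \<notin> Q" then show ?thesis using mono[OF Q(1), of N N'] N(2) Q(1) by blast
        next
          assume "k' \<notin> Q" then have "?E (N' + N) Q" using mono[OF Q(1), of N' N] N'(2) Q(1) by blast
          then show ?thesis by (simp only: add.commute[of N'])
        qed
      qed
      then show "k \<otimes>\<^bsub>add_monoid R\<^esub> k' \<in> K" using N(1) N'(1) unfolding K_def by simp blast
    next
      have "\<zero> \<in> Q" if "Q \<in> prime_spectrum R" for Q
        using that by (simp add: prime_spectrum_def additive_subgroup.zero_closed ideal.axioms(1) primeideal.axioms(1))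
      then show "\<one>\<^bsub>add_monoid R\<^esub> \<in> K" unfolding K_def by simp
    next
      fix k assume k: "k \<in> K"
      then have "\<ominus> k = (\<ominus> \<one>) \<otimes> k" by (simp add: K_def l_minus)
      then show "inv\<^bsub>add_monoid R\<^esub> k \<in> K" using l[OF k, of "\<ominus> \<one>"] by (simp flip: a_inv_def)
    qed
    fix k r assume k: "k \<in> K" and r: "r \<in> carrier R"
    show "r \<otimes> k \<in> K" by (rule l[OF k r])
    then show "k \<otimes> r \<in> K" using k r by (simp add: K_def m_comm)
  qed
  have "\<one> \<in> K"
  proof (rule one_in_idealI[OF id])
    fix P assume P: "primeideal P R"
    then have P': "P \<in> prime_spectrum R" by (simp add: prime_spectrum_def)
    obtain k c where kc: "k \<in> carrier R - P" "c \<in> carrier R"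
      "\<And>Q. Q \<in> prime_spectrum R \<Longrightarrow> k \<notin> Q \<Longrightarrow> s Q = ring_frac R (carrier R - Q) c k"
      by (rule section_locally_frac[OF s P']) blast
    have kk: "k \<in> carrier R" using kc by simp
    define z where "z = g \<otimes> c \<ominus> a \<otimes> k"
    have z: "z \<in> carrier R" using g kc kk by (simp add: z_def)
    \<comment> \<open>On \<open>D(k g)\<close> both \<open>c/k\<close> and \<open>a/g\<close>
      represent \<open>s\<close>, so the numerator \<open>z\<close> of their difference is killed by
      a power of \<open>k g\<close>.\<close>
    have "\<exists>n::nat. (k \<otimes> g) [^] n \<otimes> z = \<zero>"
    proof (rule frac_agree_power[OF z])
      show "k \<otimes> g \<in> carrier R" using kk g by simp
      fix Q assume Q: "primeideal Q R" "k \<otimes> g \<notin> Q"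
      interpret Q: primeideal Q R by (rule Q)
      have Q': "Q \<in> prime_spectrum R" using Q by (simp add: prime_spectrum_def)
      have n: "k \<notin> Q" "g \<notin> Q" using Q(2) Q.I_r_closed[of k g] Q.I_l_closed[of g k] kk g by auto
      interpret S: mult_closed R "carrier R - Q" by (rule mult_closed_prime[OF Q(1)])
      have "S.frc c k = S.frc a g" using kc(3)[OF Q' n(1)] sg[OF Q' n(2)] by simp
      then obtain u where "u \<in> carrier R - Q" "u \<otimes> (c \<otimes> g \<ominus> a \<otimes> k) = \<zero>"
        using S.frac_eq_iff[of c k a g] kc(2) kk g n by auto
      then show "\<exists>u\<in>carrier R - Q. u \<otimes> z = \<zero>" unfolding z_def using g kc(2) by (auto simp: m_comm)
    qed
    then obtain n :: nat where n: "(k \<otimes> g) [^] n \<otimes> z = \<zero>" by blast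
    have "?E n Q" if Q: "Q \<in> prime_spectrum R" "k \<notin> Q" for Q
    proof -
      have Qp: "primeideal Q R" using Q by (simp add: prime_spectrum_def)
      have "k [^] n \<otimes> (g [^] n \<otimes> z) = \<zero>" using n g kk z by (simp add: nat_pow_distrib m_assoc)
      moreover have "k [^] n \<in> carrier R - Q" using pow_not_in_prime[OF Qp] kk Q(2) by simp
      ultimately show ?thesis
        using iff[OF Q(1) kc(3)[OF Q] kc(2)] kk Q(2) unfolding z_def by blast
    qed
    then have "k \<in> K" unfolding K_def using kk by blast
    then show "\<not> K \<subseteq> P" using kc(1) by blast
  qed
  then obtain N :: nat where N: "\<forall>Q\<in>prime_spectrum R. \<one> \<notin> Q \<longrightarrow> ?E N Q" unfolding K_def by blast
  have "\<one> \<notin> Q" if "Q \<in> prime_spectrum R" for Q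
    using mult_closed.S_one[OF mult_closed_prime, of Q R] that by (simp add: prime_spectrum_def)
  then show ?thesis using N by blast
qed

text \<open>The elements \<open>k\<close> for which \<open>k s\<close> comes from \<open>R\<close>
  form an ideal. Near each prime \<open>s\<close> is a fraction \<open>a/g\<close>, and
  \<open>section_clear_denominator\<close> puts a power of \<open>g\<close> into this ideal, which
  is therefore the whole ring.\<close>

lemma (in cring) global_section:
  assumes s: "s \<in> carrier (structure_sheaf R (prime_spectrum R))"
  shows "\<exists>b\<in>carrier R. \<forall>Q\<in>prime_spectrum R. s Q = ring_frac R (carrier R - Q) b \<one>"
proof -
  let ?E = "\<lambda>k b Q. ring_frac R (carrier R - Q) k \<one> \<otimes>\<^bsub>loc_at_prime R Q\<^esub> s Q = ring_frac R (carrier R - Q) b \<one>"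
  define L where "L = {k \<in> carrier R. \<exists>b\<in>carrier R. \<forall>Q\<in>prime_spectrum R. ?E k b Q}"
  have sc: "s Q \<in> carrier (loc_at_prime R Q)" if "Q \<in> prime_spectrum R" for Q
    using s that by (auto simp: structure_sheaf_def PiE_def)
  have id: "ideal L R"
  proof (rule idealI[OF ring_axioms])
    have l: "r \<otimes> k \<in> L" if k: "k \<in> L" and r: "r \<in> carrier R" for r k
    proof -
      obtain b where b: "k \<in> carrier R" "b \<in> carrier R" "\<forall>Q\<in>prime_spectrum R. ?E k b Q" using k unfolding L_def by blast
      have "?E (r \<otimes> k) (r \<otimes> b) Q" if Q: "Q \<in> prime_spectrum R" for Q
      proof -
        interpret S: mult_closed R "carrier R - Q" by (rule mult_closed_prime) (use Q in \<open>simp add: prime_spectrum_def\<close>)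
        interpret L: cring S.loc by (rule S.loc_cring)
        have "S.frc (r \<otimes> k) \<one> = S.frc r \<one> \<otimes>\<^bsub>S.loc\<^esub> S.frc k \<one>" "S.frc (r \<otimes> b) \<one> = S.frc r \<one> \<otimes>\<^bsub>S.loc\<^esub> S.frc b \<one>"
          using r b S.S_one S.loc_mult[of _ \<one> _ \<one>] by simp_all
        then show ?thesis using b(3) Q sc[OF Q] r b(1) S.S_one by (simp add: loc_at_prime_def L.m_assoc)
      qed
      then show ?thesis unfolding L_def using b r by (auto intro!: bexI[of _ "r \<otimes> b"])
    qed
    show "subgroup L (add_monoid R)"
    proof (rule subgroup.intro)
      show "L \<subseteq> carrier (add_monoid R)" by (auto simp: L_def)
      fix k k' assume "k \<in> L" "k' \<in> L"
      then obtain b b' where b: "k \<in> carrier R" "b \<in> carrier R" "\<forall>Q\<in>prime_spectrum R. ?E k b Q"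
        and b': "k' \<in> carrier R" "b' \<in> carrier R" "\<forall>Q\<in>prime_spectrum R. ?E k' b' Q" unfolding L_def by blast
      have "?E (k \<oplus> k') (b \<oplus> b') Q" if Q: "Q \<in> prime_spectrum R" for Q
      proof -
        interpret S: mult_closed R "carrier R - Q" by (rule mult_closed_prime) (use Q in \<open>simp add: prime_spectrum_def\<close>)
        interpret L: cring S.loc by (rule S.loc_cring)
        have "S.frc (k \<oplus> k') \<one> = S.frc k \<one> \<oplus>\<^bsub>S.loc\<^esub> S.frc k' \<one>" "S.frc (b \<oplus> b') \<one> = S.frc b \<one> \<oplus>\<^bsub>S.loc\<^esub> S.frc b' \<one>"
          using b b' S.S_one S.loc_add[of _ \<one> _ \<one>] by simp_all
        then show ?thesis using b b' Q sc[OF Q] S.S_one by (simp add: loc_at_prime_def L.l_distr)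
      qed
      then show "k \<otimes>\<^bsub>add_monoid R\<^esub> k' \<in> L" unfolding L_def using b b' by (auto intro!: bexI[of _ "b \<oplus> b'"])
    next
      have "?E \<zero> \<zero> Q" if Q: "Q \<in> prime_spectrum R" for Q
      proof -
        interpret S: mult_closed R "carrier R - Q" by (rule mult_closed_prime) (use Q in \<open>simp add: prime_spectrum_def\<close>)
        interpret L: cring S.loc by (rule S.loc_cring)
        show ?thesis using sc[OF Q] by (simp add: loc_at_prime_def S.loc_zero[symmetric])
      qed
      then show "\<one>\<^bsub>add_monoid R\<^esub> \<in> L" unfolding L_def by auto
    next
      fix k assume k: "k \<in> L"
      then have "\<ominus> k = (\<ominus> \<one>) \<otimes> k" by (simp add: L_def l_minus)
      then show "inv\<^bsub>add_monoid R\<^esub> k \<in> L" using l[OF k, of "\<ominus> \<one>"] by (simp flip: a_inv_def)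
    qed
    fix k r assume k: "k \<in> L" and r: "r \<in> carrier R"
    show "r \<otimes> k \<in> L" by (rule l[OF k r])
    then show "k \<otimes> r \<in> L" using k r by (simp add: L_def m_comm)
  qed
  have "\<one> \<in> L"
  proof (rule one_in_idealI[OF id])
    fix P assume P: "primeideal P R"
    then have P': "P \<in> prime_spectrum R" by (simp add: prime_spectrum_def)
    obtain g a where ga: "g \<in> carrier R - P" "a \<in> carrier R"
      "\<And>Q. Q \<in> prime_spectrum R \<Longrightarrow> g \<notin> Q \<Longrightarrow> s Q = ring_frac R (carrier R - Q) a g"
      by (rule section_locally_frac[OF s P']) blast
    have gc: "g \<in> carrier R" using ga by simp
    obtain N :: nat where "\<forall>Q\<in>prime_spectrum R. ?E (g [^] Suc N) (g [^] N \<otimes> a) Q"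
      using section_clear_denominator[OF s gc ga(2,3)] by blast
    then have "g [^] Suc N \<in> L" unfolding L_def using gc ga(2) by (auto intro!: bexI[of _ "g [^] N \<otimes> a"])
    moreover have "g [^] Suc N \<notin> P" using pow_not_in_prime[OF P ga(1), of "Suc N"] by simp
    ultimately show "\<not> L \<subseteq> P" by blast
  qed
  then obtain b where b: "b \<in> carrier R" "\<forall>Q\<in>prime_spectrum R. ?E \<one> b Q" unfolding L_def by blast
  have "s Q = ring_frac R (carrier R - Q) b \<one>" if Q: "Q \<in> prime_spectrum R" for Q
  proof -
    interpret S: mult_closed R "carrier R - Q" by (rule mult_closed_prime) (use Q in \<open>simp add: prime_spectrum_def\<close>)
    interpret L: cring S.loc by (rule S.loc_cring)
    have "S.frc \<one> \<one> \<otimes>\<^bsub>S.loc\<^esub> s Q = S.frc b \<one>" using b(2) Q unfolding loc_at_prime_def by (rule bspec)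
    then show ?thesis using sc[OF Q] unfolding loc_at_prime_def S.loc_one[symmetric] by simp
  qed
  then show ?thesis using b(1) by blast
qed

lemma (in cring) const_section:
  assumes b: "b \<in> carrier R" and W: "openin (zariski R) W"
  shows "(\<lambda>Q\<in>W. ring_frac R (carrier R - Q) b \<one>) \<in> carrier (structure_sheaf R W)"
proof -
  have Ws: "W \<subseteq> prime_spectrum R" using openin_subset[OF W] by simp
  have one: "\<one> \<in> carrier R - Q" if "Q \<in> W" for Q
    by (rule mult_closed.S_one[OF mult_closed_prime]) (use that Ws in \<open>auto simp: prime_spectrum_def\<close>)
  have "ring_frac R (carrier R - Q) b \<one> \<in> carrier (loc_at_prime R Q)" if "Q \<in> W" for Q
    using b one[OF that] by (auto simp: loc_at_prime_def localization_def)
  moreover have "\<exists>V a f. openin (zariski R) V \<and> P \<in> V \<and> V \<subseteq> W \<and> a \<in> carrier R \<and> f \<in> carrier R \<and>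
         (\<forall>Q\<in>V. f \<notin> Q \<and> (\<lambda>Q\<in>W. ring_frac R (carrier R - Q) b \<one>) Q = ring_frac R (carrier R - Q) a f)" if "P \<in> W" for P
    by (rule exI[of _ W], rule exI[of _ b], rule exI[of _ \<one>]) (use W that b one in auto)
  ultimately show ?thesis by (simp add: structure_sheaf_def)
qed

text \<open>Stated over an arbitrary commutative ring, because the ring of an affine scheme is not
  known to be a domain, the case treated by \<open>sheaf_cring\<close>.\<close>

lemma (in cring) sheaf_mult_closed:
  assumes W: "openin (zariski R) W" and s: "s \<in> carrier (structure_sheaf R W)" "s' \<in> carrier (structure_sheaf R W)"
  shows "s \<otimes>\<^bsub>structure_sheaf R W\<^esub> s' \<in> carrier (structure_sheaf R W)"
proof -
  have Ws: "W \<subseteq> prime_spectrum R" using openin_subset[OF W] by simp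
  have e: "s \<otimes>\<^bsub>structure_sheaf R W\<^esub> s' = (\<lambda>P\<in>W. s P \<otimes>\<^bsub>loc_at_prime R P\<^esub> s' P)" by (simp add: structure_sheaf_def)
  have c: "s P \<in> carrier (loc_at_prime R P)" "s' P \<in> carrier (loc_at_prime R P)" if "P \<in> W" for P
    using s that by (auto simp: structure_sheaf_def PiE_def)
  have "s P \<otimes>\<^bsub>loc_at_prime R P\<^esub> s' P \<in> carrier (loc_at_prime R P)" if P: "P \<in> W" for P
  proof -
    interpret S: mult_closed R "carrier R - P" by (rule mult_closed_prime) (use P Ws in \<open>auto simp: prime_spectrum_def\<close>)
    interpret L: cring S.loc by (rule S.loc_cring)
    show ?thesis using c[OF P] unfolding loc_at_prime_def by (rule L.m_closed)
  qed
  moreover have "\<exists>V a f. openin (zariski R) V \<and> P \<in> V \<and> V \<subseteq> W \<and> a \<in> carrier R \<and> f \<in> carrier R \<and>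
         (\<forall>Q\<in>V. f \<notin> Q \<and> (\<lambda>P\<in>W. s P \<otimes>\<^bsub>loc_at_prime R P\<^esub> s' P) Q = ring_frac R (carrier R - Q) a f)" if P: "P \<in> W" for P
  proof -
    obtain g a where ga: "g \<in> carrier R - P" "a \<in> carrier R" "{Q \<in> prime_spectrum R. g \<notin> Q} \<subseteq> W"
      "\<And>Q. Q \<in> prime_spectrum R \<Longrightarrow> g \<notin> Q \<Longrightarrow> s Q = ring_frac R (carrier R - Q) a g"
      by (rule section_locally_frac[OF s(1) P]) blast
    obtain g' a' where ga': "g' \<in> carrier R - P" "a' \<in> carrier R" "{Q \<in> prime_spectrum R. g' \<notin> Q} \<subseteq> W"
      "\<And>Q. Q \<in> prime_spectrum R \<Longrightarrow> g' \<notin> Q \<Longrightarrow> s' Q = ring_frac R (carrier R - Q) a' g'"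
      by (rule section_locally_frac[OF s(2) P]) blast
    let ?V = "{Q \<in> prime_spectrum R. g \<notin> Q} \<inter> {Q \<in> prime_spectrum R. g' \<notin> Q}"
    have f1: "openin (zariski R) ?V" by (intro openin_Int openin_zariski_basic) (use ga ga' in auto)
    have f2: "P \<in> ?V" "?V \<subseteq> W" using ga ga' P Ws by auto
    have f3: "g \<otimes> g' \<notin> Q \<and> (\<lambda>P\<in>W. s P \<otimes>\<^bsub>loc_at_prime R P\<^esub> s' P) Q = ring_frac R (carrier R - Q) (a \<otimes> a') (g \<otimes> g')"
      if Q: "Q \<in> ?V" for Q
    proof -
      have Qp: "primeideal Q R" using Q by (simp add: prime_spectrum_def)
      interpret S: mult_closed R "carrier R - Q" by (rule mult_closed_prime[OF Qp])
      have gg: "g \<in> carrier R - Q" "g' \<in> carrier R - Q" using ga ga' Q by auto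
      have "Q \<in> W" using ga(3) Q by blast
      moreover have "s Q = S.frc a g" "s' Q = S.frc a' g'" using ga(4)[of Q] ga'(4)[of Q] Q by auto
      ultimately show ?thesis using S.S_mult[OF gg] S.loc_mult[OF ga(2) gg(1) ga'(2) gg(2)] by (simp add: loc_at_prime_def)
    qed
    have f4: "a \<otimes> a' \<in> carrier R" "g \<otimes> g' \<in> carrier R" using ga ga' by auto
    show ?thesis
      by (rule exI[of _ ?V], rule exI[of _ "a \<otimes> a'"], rule exI[of _ "g \<otimes> g'"], intro conjI ballI f1 f2 f4
          f3[THEN conjunct1] f3[THEN conjunct2])
  qed
  ultimately show ?thesis unfolding e by (simp add: structure_sheaf_def)
qed

section \<open>Affine open subschemes\<close>

locale open_complement = domain R for R (structure) +
  fixes J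
  assumes J: "ideal J R" and J0: "J \<noteq> {\<zero>}"
begin

definition U where "U = {P \<in> prime_spectrum R. \<not> J \<subseteq> P}"

text \<open>Numerators of the sections over \<open>U\<close> with denominator \<open>y\<close>. Thus
  \<open>y \<in> J \<cdot> D y\<close> for a nonzero \<open>y\<close> says, without leaving
  \<open>R\<close>, that \<open>J\<close> generates the unit ideal in the ring of sections.\<close>

definition D where "D y = {x. is_reg R U x y}"

abbreviation "\<O> \<equiv> structure_sheaf R U"

lemma Jc: "x \<in> J \<Longrightarrow> x \<in> carrier R"
  by (rule ideal.Icarr[OF J])

lemma U_open: "openin (zariski R) U"
  unfolding openin_zariski zariski_open_def U_def using Jc by blast

lemma U_sub: "U \<subseteq> prime_spectrum R"
  by (auto simp: U_def)

lemma zero_U: "{\<zero>} \<in> U"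
proof -
  have "\<not> J \<subseteq> {\<zero>}" using J0 additive_subgroup.zero_closed[OF ideal.axioms(1)[OF J]] by blast
  then show ?thesis using zeroprimeideal by (simp add: U_def prime_spectrum_def)
qed

lemma U_prime: "P \<in> U \<Longrightarrow> primeideal P R"
  by (simp add: U_def prime_spectrum_def)

sublocale O: domain \<O>
  by (rule sheaf_domain[OF U_open]) (use zero_U in blast)

abbreviation "fs \<equiv> frac_sec R U"

lemmas fs_mult = is_reg_mult[OF U_sub]
lemmas fs_carrier = frac_sec_section[OF U_open]
lemmas fs_const = is_reg_const[OF U_sub]
lemmas fs_one_zero = sheaf_one_zero[OF U_sub]

lemma fs_eq_iff: "is_reg R U x y \<Longrightarrow> is_reg R U x' y' \<Longrightarrow> fs x y = fs x' y' \<longleftrightarrow> x \<otimes> y' = x' \<otimes> y"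
  using frac_sec_eqI[OF U_sub] frac_sec_eqD[OF U_sub _ _ zero_U] by metis

lemma fsE:
  assumes "s \<in> carrier \<O>" obtains x y where "is_reg R U x y" "s = fs x y"
  using section_is_frac_sec[OF U_open assms] by blast

lemma regD: "is_reg R U x y \<Longrightarrow> x \<in> carrier R" "is_reg R U x y \<Longrightarrow> y \<in> carrier R" "is_reg R U x y \<Longrightarrow> y \<noteq> \<zero>"
  by (auto simp: is_reg_def)

lemma reg_self: "y \<in> carrier R \<Longrightarrow> y \<noteq> \<zero> \<Longrightarrow> is_reg R U y y"
proof -
  assume y: "y \<in> carrier R" "y \<noteq> \<zero>"
  have "\<exists>t\<in>carrier R - P. \<exists>b\<in>carrier R. y \<otimes> t = b \<otimes> y" if "P \<in> U" for P
    using mult_closed.S_one[OF mult_closed_prime[OF U_prime[OF that]]] y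
    by (intro bexI[of _ \<one>] bexI[of _ \<one>]) auto
  then show ?thesis using y unfolding is_reg_def by blast
qed

text \<open>Passing from denominator \<open>y\<close> to \<open>y'\<close> multiplies numerators by
  \<open>c\<close>; sums with different denominators are brought together in this way.\<close>

lemma prod_scale:
  assumes "z \<in> J \<cdot> D y" "c \<in> carrier R" and d: "\<And>d. is_reg R U d y \<Longrightarrow> is_reg R U (d \<otimes> c) y'"
  shows "z \<otimes> c \<in> J \<cdot> D y' \<and> z \<in> carrier R"
  using assms(1)
proof (induction)
  case (prod i j)
  then have j: "is_reg R U j y" by (simp add: D_def)
  have "i \<otimes> (j \<otimes> c) \<in> J \<cdot> D y'" by (rule ideal_prod.prod) (use prod(1) d[OF j] in \<open>auto simp: D_def\<close>)
  then show ?case using Jc[OF prod(1)] regD(1)[OF j] assms(2) by (simp add: m_assoc)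
next
  case (sum s1 s2)
  then have "s1 \<otimes> c \<oplus> s2 \<otimes> c \<in> J \<cdot> D y'" by (intro ideal_prod.sum) auto
  then show ?case using sum assms(2) by (simp add: l_distr)
qed

lemma prod_reg: "z \<in> J \<cdot> D y \<Longrightarrow> y \<in> carrier R \<Longrightarrow> y \<noteq> \<zero> \<Longrightarrow> is_reg R U z y"
proof (induction rule: ideal_prod.induct)
  case (prod i j)
  then have j: "is_reg R U j y" by (simp add: D_def)
  show ?case using fs_mult(1)[OF fs_const[OF Jc[OF prod(1)]] j] prod by (simp add: D_def)
next
  case (sum s1 s2)
  then have s: "is_reg R U s1 y" "is_reg R U s2 y" by auto
  have "\<exists>t\<in>carrier R - P. \<exists>b\<in>carrier R. (s1 \<oplus> s2) \<otimes> t = b \<otimes> y" if P: "P \<in> U" for P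
  proof -
    obtain t b where 1: "t \<in> carrier R - P" "b \<in> carrier R" "s1 \<otimes> t = b \<otimes> y" using s(1) P unfolding is_reg_def by blast
    obtain t' b' where 2: "t' \<in> carrier R - P" "b' \<in> carrier R" "s2 \<otimes> t' = b' \<otimes> y" using s(2) P unfolding is_reg_def by blast
    have c: "t \<in> carrier R" "t' \<in> carrier R" "s1 \<in> carrier R" "s2 \<in> carrier R" using 1 2 regD(1)[OF s(1)] regD(1)[OF s(2)] by auto
    have "(s1 \<oplus> s2) \<otimes> (t \<otimes> t') = (s1 \<otimes> t) \<otimes> t' \<oplus> (s2 \<otimes> t') \<otimes> t" using c by (simp add: l_distr r_distr m_ac)
    also have "\<dots> = (b \<otimes> t' \<oplus> b' \<otimes> t) \<otimes> y" unfolding 1(3) 2(3) using c 1(2) 2(2) sum by (simp add: l_distr r_distr m_ac)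
    finally have e: "(s1 \<oplus> s2) \<otimes> (t \<otimes> t') = (b \<otimes> t' \<oplus> b' \<otimes> t) \<otimes> y" .
    have "t \<otimes> t' \<in> carrier R - P" by (rule mult_closed.S_mult[OF mult_closed_prime[OF U_prime[OF P]] 1(1) 2(1)])
    moreover have "b \<otimes> t' \<oplus> b' \<otimes> t \<in> carrier R" using c 1(2) 2(2) by simp
    ultimately show ?thesis using e by blast
  qed
  then show ?case using sum regD(1)[OF s(1)] regD(1)[OF s(2)] unfolding is_reg_def by simp
qed

text \<open>The ideal generated by \<open>J\<close> in the ring of sections over \<open>U\<close>,
  with all sections occurring in one sum brought to a common denominator.\<close>

definition T where "T = {fs x y |x y. y \<in> carrier R \<and> y \<noteq> \<zero> \<and> x \<in> J \<cdot> D y}"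

lemma T_carrier: "s \<in> T \<Longrightarrow> s \<in> carrier \<O>"
  unfolding T_def using prod_reg fs_carrier by blast

lemma T_mult:
  assumes "s \<in> T" "r \<in> carrier \<O>" shows "r \<otimes>\<^bsub>\<O>\<^esub> s \<in> T"
proof -
  obtain x y where s: "s = fs x y" "y \<in> carrier R" "y \<noteq> \<zero>" "x \<in> J \<cdot> D y" using assms(1) unfolding T_def by blast
  obtain a b where r: "is_reg R U a b" "r = fs a b" by (rule fsE[OF assms(2)])
  have x: "is_reg R U x y" by (rule prod_reg) (use s in auto)
  have "is_reg R U (d \<otimes> a) (b \<otimes> y)" if "is_reg R U d y" for d
    using fs_mult(1)[OF that r(1)] regD[OF that] regD[OF r(1)] by (simp add: m_comm)
  then have "x \<otimes> a \<in> J \<cdot> D (b \<otimes> y)" using prod_scale[OF s(4) regD(1)[OF r(1)]] by blast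
  then have "a \<otimes> x \<in> J \<cdot> D (b \<otimes> y)" using regD(1)[OF x] regD(1)[OF r(1)] by (simp add: m_comm)
  moreover have "b \<otimes> y \<in> carrier R" "b \<otimes> y \<noteq> \<zero>" using s regD[OF r(1)] by (auto simp: integral_iff)
  ultimately show ?thesis unfolding s(1) r(2) fs_mult(2)[OF r(1) x] T_def by blast
qed

lemma T_add:
  assumes "s \<in> T" "s' \<in> T" shows "s \<oplus>\<^bsub>\<O>\<^esub> s' \<in> T"
proof -
  obtain x y where s: "s = fs x y" "y \<in> carrier R" "y \<noteq> \<zero>" "x \<in> J \<cdot> D y" using assms(1) unfolding T_def by blast
  obtain x' y' where s': "s' = fs x' y'" "y' \<in> carrier R" "y' \<noteq> \<zero>" "x' \<in> J \<cdot> D y'" using assms(2) unfolding T_def by blast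
  have x: "is_reg R U x y" by (rule prod_reg) (use s in auto)
  have x': "is_reg R U x' y'" by (rule prod_reg) (use s' in auto)
  have "x \<otimes> y' \<in> J \<cdot> D (y \<otimes> y')"
    using prod_scale[OF s(4) s'(2)] fs_mult(1)[OF _ reg_self[OF s'(2,3)]] by blast
  moreover have "is_reg R U (d \<otimes> y) (y \<otimes> y')" if "is_reg R U d y'" for d
    using fs_mult(1)[OF that reg_self[OF s(2,3)]] s(2) s'(2) by (simp add: m_comm)
  then have "x' \<otimes> y \<in> J \<cdot> D (y \<otimes> y')" using prod_scale[OF s'(4) s(2)] by blast
  ultimately have "x \<otimes> y' \<oplus> x' \<otimes> y \<in> J \<cdot> D (y \<otimes> y')" by (rule ideal_prod.sum)
  moreover have "y \<otimes> y' \<in> carrier R" "y \<otimes> y' \<noteq> \<zero>" using s s' by (auto simp: integral_iff)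
  ultimately show ?thesis unfolding s(1) s'(1) fs_mult(4)[OF x x'] T_def by blast
qed

lemma T_J: "f \<in> J \<Longrightarrow> fs f \<one> \<in> T"
proof -
  assume f: "f \<in> J"
  have "f \<otimes> \<one> \<in> J \<cdot> D \<one>" by (rule ideal_prod.prod) (use f fs_const[of \<one>] in \<open>auto simp: D_def\<close>)
  then have "f \<in> J \<cdot> D \<one>" using Jc[OF f] by simp
  then show ?thesis unfolding T_def by (intro CollectI exI[of _ f] exI[of _ \<one>]) simp
qed

text \<open>Let \<open>U\<close> be the spectrum of \<open>B\<close>, so that \<open>B\<close> is
  the ring of sections over \<open>U\<close>. If \<open>J\<close> generated a proper ideal there, a
  prime \<open>Q\<close> of \<open>B\<close> would contain it, and \<open>Q\<close> is the image of
  some \<open>P\<close> in \<open>U\<close>. But some \<open>j\<close> in \<open>J\<close> is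
  outside \<open>P\<close>, so it is invertible near \<open>P\<close> and its counterpart in
  \<open>B\<close> cannot lie in \<open>Q\<close>.\<close>

lemma affine_imp:
  assumes aff: "affine_ringed_space (open_subspace (Spec R) U)"
  obtains y where "y \<in> carrier R" "y \<noteq> \<zero>" "y \<in> J \<cdot> D y"
proof -
  obtain B :: "('a set \<Rightarrow> ('a \<times> 'a) set) ring" where B: "cring B" and iso: "ringed_space_isomorphic (open_subspace (Spec R) U) (Spec B)"
    using aff unfolding affine_ringed_space_def by blast
  interpret B: cring B by (rule B)
  let ?Z = "subtopology (zariski R) U"
  have topZ: "topspace ?Z = U" using U_sub by auto
  have simps: "rs_top (open_subspace (Spec R) U) = ?Z" "rs_sections (open_subspace (Spec R) U) = structure_sheaf R"
    "rs_res (open_subspace (Spec R) U) = (\<lambda>U V s. restrict s V)"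
    "rs_top (Spec B) = zariski B" "rs_sections (Spec B) = structure_sheaf B" "rs_res (Spec B) = (\<lambda>U V s. restrict s V)"
    by (simp_all add: open_subspace_def Spec_def)
  obtain f h where fh: "homeomorphic_map ?Z (zariski B) f \<and>
     (\<forall>V. openin (zariski B) V \<longrightarrow> h V \<in> ring_iso (structure_sheaf B V) (structure_sheaf R {x \<in> U. f x \<in> V})) \<and>
     (\<forall>V W. openin (zariski B) V \<and> openin (zariski B) W \<and> W \<subseteq> V \<longrightarrow>
        (\<forall>s\<in>carrier (structure_sheaf B V). h W (restrict s W) = restrict (h V s) {x \<in> U. f x \<in> W}))"
    using iso unfolding ringed_space_isomorphic_def simps topZ by (elim exE) (rule that)
  have f: "homeomorphic_map ?Z (zariski B) f"
    and h: "\<And>V. openin (zariski B) V \<Longrightarrow> h V \<in> ring_iso (structure_sheaf B V) (structure_sheaf R {x \<in> U. f x \<in> V})"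
    and res: "\<And>V W s. openin (zariski B) V \<Longrightarrow> openin (zariski B) W \<Longrightarrow> W \<subseteq> V \<Longrightarrow> s \<in> carrier (structure_sheaf B V)
      \<Longrightarrow> h W (restrict s W) = restrict (h V s) {x \<in> U. f x \<in> W}"
    using fh by blast+
  let ?SB = "prime_spectrum B"
  have SB: "openin (zariski B) ?SB" using openin_topspace[of "zariski B"] by simp
  have fim: "f ` U = ?SB" using homeomorphic_imp_surjective_map[OF f] unfolding topZ by simp
  have pre: "{x \<in> U. f x \<in> ?SB} = U" using fim by blast
  let ?h = "h ?SB"
  have hiso: "?h \<in> ring_iso (structure_sheaf B ?SB) \<O>" using h[OF SB] unfolding pre .
  then have hh: "?h \<in> ring_hom (structure_sheaf B ?SB) \<O>" and hb: "bij_betw ?h (carrier (structure_sheaf B ?SB)) (carrier \<O>)"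
    by (auto simp: ring_iso_def)
  define \<beta> where "\<beta> b = (\<lambda>Q\<in>?SB. ring_frac B (carrier B - Q) b \<one>\<^bsub>B\<^esub>)" for b
  have \<beta>: "\<beta> b \<in> carrier (structure_sheaf B ?SB)" if "b \<in> carrier B" for b
    unfolding \<beta>_def by (rule B.const_section[OF that SB])
  have \<beta>_ops: "\<beta> (a \<otimes>\<^bsub>B\<^esub> b) = \<beta> a \<otimes>\<^bsub>structure_sheaf B ?SB\<^esub> \<beta> b" "\<beta> (a \<oplus>\<^bsub>B\<^esub> b) = \<beta> a \<oplus>\<^bsub>structure_sheaf B ?SB\<^esub> \<beta> b"
    if ab: "a \<in> carrier B" "b \<in> carrier B" for a b
  proof -
    have "ring_frac B (carrier B - Q) (a \<otimes>\<^bsub>B\<^esub> b) \<one>\<^bsub>B\<^esub> = ring_frac B (carrier B - Q) a \<one>\<^bsub>B\<^esub> \<otimes>\<^bsub>loc_at_prime B Q\<^esub> ring_frac B (carrier B - Q) b \<one>\<^bsub>B\<^esub>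
       \<and> ring_frac B (carrier B - Q) (a \<oplus>\<^bsub>B\<^esub> b) \<one>\<^bsub>B\<^esub> = ring_frac B (carrier B - Q) a \<one>\<^bsub>B\<^esub> \<oplus>\<^bsub>loc_at_prime B Q\<^esub> ring_frac B (carrier B - Q) b \<one>\<^bsub>B\<^esub>"
      if Q: "Q \<in> ?SB" for Q
    proof -
      interpret S: mult_closed B "carrier B - Q" by (rule mult_closed_prime) (use Q in \<open>simp add: prime_spectrum_def\<close>)
      show ?thesis using ab S.S_one S.loc_mult[of a "\<one>\<^bsub>B\<^esub>" b "\<one>\<^bsub>B\<^esub>"] S.loc_add[of a "\<one>\<^bsub>B\<^esub>" b "\<one>\<^bsub>B\<^esub>"]
        by (simp add: loc_at_prime_def)
    qed
    then show "\<beta> (a \<otimes>\<^bsub>B\<^esub> b) = \<beta> a \<otimes>\<^bsub>structure_sheaf B ?SB\<^esub> \<beta> b" "\<beta> (a \<oplus>\<^bsub>B\<^esub> b) = \<beta> a \<oplus>\<^bsub>structure_sheaf B ?SB\<^esub> \<beta> b"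
      unfolding \<beta>_def structure_sheaf_def by (auto simp: fun_eq_iff)
  qed
  have \<beta>_one: "\<beta> \<one>\<^bsub>B\<^esub> = \<one>\<^bsub>structure_sheaf B ?SB\<^esub>"
    unfolding \<beta>_def structure_sheaf_def by (simp add: loc_at_prime_def localization_def)
  \<comment> \<open>Every global section of the spectrum of \<open>B\<close> comes from
    \<open>B\<close>, so the ideal generated by \<open>J\<close> can be viewed in
    \<open>B\<close>.\<close>
  have \<beta>_surj: "\<exists>b\<in>carrier B. s = \<beta> b" if s: "s \<in> carrier (structure_sheaf B ?SB)" for s
  proof -
    obtain b where b: "b \<in> carrier B" "\<forall>Q\<in>?SB. s Q = ring_frac B (carrier B - Q) b \<one>\<^bsub>B\<^esub>"
      using B.global_section[OF s] by blast
    have "s \<in> extensional ?SB" using s by (auto simp: structure_sheaf_def PiE_def)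
    then have "s = \<beta> b" unfolding \<beta>_def using b(2) by (auto simp: fun_eq_iff extensional_def)
    then show ?thesis using b by blast
  qed
  define \<bb> where "\<bb> = {b \<in> carrier B. ?h (\<beta> b) \<in> T}"
  have hm1: "?h (\<beta> (a \<otimes>\<^bsub>B\<^esub> b)) = ?h (\<beta> a) \<otimes>\<^bsub>\<O>\<^esub> ?h (\<beta> b)" if "a \<in> carrier B" "b \<in> carrier B" for a b
    unfolding \<beta>_ops[OF that] by (rule ring_hom_mult[OF hh \<beta>[OF that(1)] \<beta>[OF that(2)]])
  have hm2: "?h (\<beta> (a \<oplus>\<^bsub>B\<^esub> b)) = ?h (\<beta> a) \<oplus>\<^bsub>\<O>\<^esub> ?h (\<beta> b)" if "a \<in> carrier B" "b \<in> carrier B" for a b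
    unfolding \<beta>_ops[OF that] by (rule ring_hom_add[OF hh \<beta>[OF that(1)] \<beta>[OF that(2)]])
  have hm3: "?h (\<beta> a) \<in> carrier \<O>" if "a \<in> carrier B" for a
    by (rule ring_hom_closed[OF hh \<beta>[OF that]])
  have hJ: "\<exists>b\<in>\<bb>. ?h (\<beta> b) = fs j \<one>" if j: "j \<in> J" for j
  proof -
    have "fs j \<one> \<in> carrier \<O>" by (rule T_carrier[OF T_J[OF j]])
    then have "fs j \<one> \<in> ?h ` carrier (structure_sheaf B ?SB)" using bij_betw_imp_surj_on[OF hb] by (simp only:)
    then obtain s where s: "?h s = fs j \<one>" "s \<in> carrier (structure_sheaf B ?SB)"
      by (elim imageE) (erule that[OF sym])
    obtain b where b: "b \<in> carrier B" "s = \<beta> b" using \<beta>_surj[OF s(2)] by blast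
    then have "b \<in> \<bb>" using s T_J[OF j] by (simp add: \<bb>_def)
    then show ?thesis using s b by blast
  qed
  have id: "ideal \<bb> B"
  proof (rule idealI[OF B.ring_axioms])
    have l: "r \<otimes>\<^bsub>B\<^esub> b \<in> \<bb>" if "b \<in> \<bb>" "r \<in> carrier B" for r b
      using that T_mult[of "?h (\<beta> b)" "?h (\<beta> r)"] hm1[of r b] hm3[of r] by (simp add: \<bb>_def)
    obtain j where "j \<in> J" using additive_subgroup.zero_closed[OF ideal.axioms(1)[OF J]] by blast
    then obtain b0 where b0: "b0 \<in> \<bb>" using hJ by blast
    show "subgroup \<bb> (add_monoid B)"
    proof (rule subgroup.intro)
      show "\<bb> \<subseteq> carrier (add_monoid B)" by (auto simp: \<bb>_def)
      show "x \<otimes>\<^bsub>add_monoid B\<^esub> y \<in> \<bb>" if "x \<in> \<bb>" "y \<in> \<bb>" for x y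
        using that T_add[of "?h (\<beta> x)" "?h (\<beta> y)"] hm2[of x y] by (simp add: \<bb>_def)
      show "\<one>\<^bsub>add_monoid B\<^esub> \<in> \<bb>" using l[OF b0 B.zero_closed] b0 by (simp add: \<bb>_def)
      show "inv\<^bsub>add_monoid B\<^esub> x \<in> \<bb>" if x: "x \<in> \<bb>" for x
      proof -
        have "\<ominus>\<^bsub>B\<^esub> x = (\<ominus>\<^bsub>B\<^esub> \<one>\<^bsub>B\<^esub>) \<otimes>\<^bsub>B\<^esub> x" using x by (simp add: \<bb>_def B.l_minus)
        then have "\<ominus>\<^bsub>B\<^esub> x \<in> \<bb>" using l[OF x, of "\<ominus>\<^bsub>B\<^esub> \<one>\<^bsub>B\<^esub>"] by simp
        then show ?thesis by (simp only: a_inv_def)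
      qed
    qed
    fix k r assume k: "k \<in> \<bb>" and r: "r \<in> carrier B"
    show "r \<otimes>\<^bsub>B\<^esub> k \<in> \<bb>" by (rule l[OF k r])
    then show "k \<otimes>\<^bsub>B\<^esub> r \<in> \<bb>" using k r by (simp add: \<bb>_def B.m_comm)
  qed
  have "\<one>\<^bsub>B\<^esub> \<in> \<bb>"
  proof (rule B.one_in_idealI[OF id], rule notI)
    fix Q assume Q: "primeideal Q B" "\<bb> \<subseteq> Q"
    then have QS: "Q \<in> ?SB" by (simp add: prime_spectrum_def)
    then obtain P where P: "P \<in> U" "f P = Q" using fim by (metis imageE)
    obtain j where j: "j \<in> J" "j \<notin> P" using P(1) by (auto simp: U_def)
    have jc: "j \<in> carrier R" by (rule Jc[OF j(1)])
    have j0: "j \<noteq> \<zero>" using j(2) loc_prime(4) P(1) U_sub by auto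
    define V where "V = {P \<in> prime_spectrum R. j \<notin> P}"
    have V: "openin (zariski R) V" unfolding V_def by (rule openin_zariski_basic[OF jc])
    have VU: "V \<subseteq> U" using j(1) by (auto simp: V_def U_def)
    note Vs = open_sub[OF V]
    define W where "W = f ` V"
    have "openin ?Z V" using V VU by (simp add: openin_subtopology_alt image_iff) blast
    then have W: "openin (zariski B) W"
      unfolding W_def using homeomorphic_imp_open_map[OF f] by (simp add: open_map_def)
    have inj: "inj_on f U" using homeomorphic_imp_injective_map[OF f] unfolding topZ .
    have preW: "{x \<in> U. f x \<in> W} = V" unfolding W_def using inj VU by (auto simp: inj_on_def)
    have WS: "W \<subseteq> ?SB" using openin_subset[OF W] by simp
    have QW: "Q \<in> W" unfolding W_def using P j VU by (auto simp: V_def U_def)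
    obtain b where b: "b \<in> \<bb>" "?h (\<beta> b) = fs j \<one>" using hJ[OF j(1)] by blast
    have bc: "b \<in> carrier B" using b by (simp add: \<bb>_def)
    define \<beta>' where "\<beta>' = restrict (\<beta> b) W"
    have "h W \<beta>' = restrict (fs j \<one>) V"
      unfolding \<beta>'_def using res[OF SB W WS \<beta>[OF bc]] b(2) unfolding preW by simp
    also have "\<dots> = frac_sec R V j \<one>" using VU by (auto simp: frac_sec_def fun_eq_iff)
    finally have h\<beta>: "h W \<beta>' = frac_sec R V j \<one>" .
    have \<beta>': "\<beta>' = (\<lambda>Q\<in>W. ring_frac B (carrier B - Q) b \<one>\<^bsub>B\<^esub>)"
      using WS unfolding \<beta>'_def \<beta>_def by (auto simp: fun_eq_iff)
    have \<beta>'c: "\<beta>' \<in> carrier (structure_sheaf B W)" unfolding \<beta>' by (rule B.const_section[OF bc W])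
    have hW: "h W \<in> ring_hom (structure_sheaf B W) (structure_sheaf R V)"
      "bij_betw (h W) (carrier (structure_sheaf B W)) (carrier (structure_sheaf R V))"
      using h[OF W] unfolding preW ring_iso_def by auto
    \<comment> \<open>On \<open>V = D(j)\<close> the section \<open>j\<close> has the inverse
      \<open>1/j\<close>; the isomorphism over \<open>W\<close> turns it into an inverse of
      \<open>\<beta>'\<close>.\<close>
    have r1: "is_reg R V \<one> j" unfolding is_reg_def
    proof (intro conjI ballI jc j0 one_closed)
      fix P assume "P \<in> V"
      then show "\<exists>t\<in>carrier R - P. \<exists>b\<in>carrier R. \<one> \<otimes> t = b \<otimes> j"
        using jc by (intro bexI[of _ j] bexI[of _ \<one>]) (auto simp: V_def)
    qed
    have rj: "is_reg R V j \<one>" by (rule is_reg_const[OF Vs jc])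
    have "frac_sec R V \<one> j \<in> h W ` carrier (structure_sheaf B W)"
      using bij_betw_imp_surj_on[OF hW(2)] frac_sec_section[OF V r1] by (simp only:)
    then obtain \<sigma> where \<sigma>': "h W \<sigma> = frac_sec R V \<one> j" "\<sigma> \<in> carrier (structure_sheaf B W)"
      by (elim imageE) (erule that[OF sym])
    note \<sigma> = \<sigma>'(2,1)
    have "h W (\<beta>' \<otimes>\<^bsub>structure_sheaf B W\<^esub> \<sigma>) = frac_sec R V (j \<otimes> \<one>) (\<one> \<otimes> j)"
      using ring_hom_mult[OF hW(1) \<beta>'c \<sigma>(1)] h\<beta> \<sigma>(2) is_reg_mult(2)[OF Vs rj r1] by simp
    also have "\<dots> = frac_sec R V \<one> \<one>"
      by (rule frac_sec_eqI[OF Vs is_reg_mult(1)[OF Vs rj r1] is_reg_const[OF Vs one_closed]]) (use jc in simp)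
    also have "\<dots> = h W \<one>\<^bsub>structure_sheaf B W\<^esub>"
      using sheaf_one_zero(1)[OF Vs] ring_hom_one[OF hW(1)] by simp
    finally have "h W (\<beta>' \<otimes>\<^bsub>structure_sheaf B W\<^esub> \<sigma>) = h W \<one>\<^bsub>structure_sheaf B W\<^esub>" .
    moreover have "\<beta>' \<otimes>\<^bsub>structure_sheaf B W\<^esub> \<sigma> \<in> carrier (structure_sheaf B W)" by (rule B.sheaf_mult_closed[OF W \<beta>'c \<sigma>(1)])
    moreover have "\<one>\<^bsub>structure_sheaf B W\<^esub> \<in> carrier (structure_sheaf B W)"
    proof -
      have "\<one>\<^bsub>structure_sheaf B W\<^esub> = (\<lambda>Q\<in>W. ring_frac B (carrier B - Q) \<one>\<^bsub>B\<^esub> \<one>\<^bsub>B\<^esub>)"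
        by (simp add: structure_sheaf_def loc_at_prime_def localization_def)
      then show ?thesis using B.const_section[OF B.one_closed W] by simp
    qed
    ultimately have eq: "\<beta>' \<otimes>\<^bsub>structure_sheaf B W\<^esub> \<sigma> = \<one>\<^bsub>structure_sheaf B W\<^esub>"
      using hW(2) unfolding bij_betw_def inj_on_def by blast
    \<comment> \<open>At \<open>Q\<close> itself the inverse yields \<open>u d = u b c\<close> with
      \<open>u\<close> and \<open>d\<close> outside \<open>Q\<close> but \<open>b\<close>
      inside.\<close>
    interpret Q: primeideal Q B by (rule Q(1))
    interpret S: mult_closed B "carrier B - Q" by (rule mult_closed_prime[OF Q(1)])
    have "\<sigma> Q \<in> carrier (loc_at_prime B Q)" using \<sigma>(1) QW by (auto simp: structure_sheaf_def PiE_def)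
    then have "\<sigma> Q \<in> carrier S.loc" by (simp add: loc_at_prime_def)
    then obtain c d where cd: "\<sigma> Q = S.frc c d" "c \<in> carrier B" "d \<in> carrier B - Q" by (rule S.loc_carrierE)
    have "(\<beta>' \<otimes>\<^bsub>structure_sheaf B W\<^esub> \<sigma>) Q = \<one>\<^bsub>structure_sheaf B W\<^esub> Q" using eq by simp
    then have "S.frc b \<one>\<^bsub>B\<^esub> \<otimes>\<^bsub>S.loc\<^esub> S.frc c d = S.frc \<one>\<^bsub>B\<^esub> \<one>\<^bsub>B\<^esub>"
      using QW cd(1) \<beta>' by (simp add: structure_sheaf_def loc_at_prime_def S.loc_one)
    then have "S.frc (b \<otimes>\<^bsub>B\<^esub> c) (\<one>\<^bsub>B\<^esub> \<otimes>\<^bsub>B\<^esub> d) = S.frc \<one>\<^bsub>B\<^esub> \<one>\<^bsub>B\<^esub>"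
      using S.loc_mult[OF bc S.S_one cd(2,3)] by simp
    then obtain u where u: "u \<in> carrier B - Q" "u \<otimes>\<^bsub>B\<^esub> ((b \<otimes>\<^bsub>B\<^esub> c) \<otimes>\<^bsub>B\<^esub> \<one>\<^bsub>B\<^esub> \<ominus>\<^bsub>B\<^esub> \<one>\<^bsub>B\<^esub> \<otimes>\<^bsub>B\<^esub> (\<one>\<^bsub>B\<^esub> \<otimes>\<^bsub>B\<^esub> d)) = \<zero>\<^bsub>B\<^esub>"
      using S.frac_eq_iff[of "b \<otimes>\<^bsub>B\<^esub> c" "\<one>\<^bsub>B\<^esub> \<otimes>\<^bsub>B\<^esub> d" "\<one>\<^bsub>B\<^esub>" "\<one>\<^bsub>B\<^esub>"] bc cd S.S_one by auto
    have uc: "u \<in> carrier B" "d \<in> carrier B" using u cd by auto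
    have "u \<otimes>\<^bsub>B\<^esub> (b \<otimes>\<^bsub>B\<^esub> c) \<ominus>\<^bsub>B\<^esub> u \<otimes>\<^bsub>B\<^esub> d = \<zero>\<^bsub>B\<^esub>"
      using u(2) uc bc cd(2) by (simp add: B.minus_eq B.r_distr B.r_minus)
    then have ud: "u \<otimes>\<^bsub>B\<^esub> d = u \<otimes>\<^bsub>B\<^esub> (b \<otimes>\<^bsub>B\<^esub> c)" using uc bc cd(2) by simp
    have "b \<in> Q" using b(1) Q(2) by blast
    then have "b \<otimes>\<^bsub>B\<^esub> c \<in> Q" using cd(2) by (rule Q.I_r_closed)
    then have "u \<otimes>\<^bsub>B\<^esub> d \<in> Q" unfolding ud using uc(1) by (rule Q.I_l_closed)
    then show False using Q.I_prime[OF uc] u cd by blast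
  qed
  then have "?h (\<beta> \<one>\<^bsub>B\<^esub>) \<in> T" by (simp add: \<bb>_def)
  then have "fs \<one> \<one> \<in> T" using \<beta>_one ring_hom_one[OF hh] fs_one_zero by simp
  then obtain x y where xy: "fs \<one> \<one> = fs x y" "y \<in> carrier R" "y \<noteq> \<zero>" "x \<in> J \<cdot> D y" unfolding T_def by blast
  have x: "is_reg R U x y" by (rule prod_reg) (use xy in auto)
  have "\<one> \<otimes> y = x \<otimes> \<one>" using xy(1) fs_eq_iff[OF fs_const[OF one_closed] x] by simp
  then have "y = x" using xy(2) regD(1)[OF x] by simp
  then show ?thesis using that xy by simp
qed

end

section \<open>Points of the spectrum of the ring of sections\<close>

context open_complement
begin

lemma fs_mem_iff:
  "P \<in> U \<Longrightarrow> (b, t) \<in> fs x y P \<longleftrightarrow> b \<in> carrier R \<and> t \<in> carrier R - P \<and> x \<otimes> t = b \<otimes> y"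
  by (simp add: frac_sec_def)

text \<open>The sections vanishing at \<open>P\<close>, that is, the contraction of the maximal
  ideal of \<open>R_P\<close> to the ring of sections.\<close>

definition Qp where "Qp P = {s \<in> carrier \<O>. \<exists>b\<in>P. \<exists>t\<in>carrier R - P. (b, t) \<in> s P}"

lemma fs_Qp_iff:
  assumes P: "P \<in> U" and r: "is_reg R U x y"
  shows "fs x y \<in> Qp P \<longleftrightarrow> (\<exists>b\<in>P. \<exists>t\<in>carrier R - P. x \<otimes> t = b \<otimes> y)"
proof -
  interpret P: primeideal P R by (rule U_prime[OF P])
  show ?thesis unfolding Qp_def using fs_carrier[OF r] fs_mem_iff[OF P] P.Icarr by auto
qed

text \<open>Any expression \<open>b/t\<close> of the fraction near \<open>P\<close> may be used,
  because two of them are proportional by factors outside \<open>P\<close>.\<close>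

lemma fs_Qp_rep:
  assumes P: "P \<in> U" and r: "is_reg R U x y" and b: "b \<in> carrier R" "t \<in> carrier R - P" "x \<otimes> t = b \<otimes> y"
  shows "fs x y \<in> Qp P \<longleftrightarrow> b \<in> P"
proof
  interpret P: primeideal P R by (rule U_prime[OF P])
  assume "fs x y \<in> Qp P"
  then obtain c u where c: "c \<in> P" "u \<in> carrier R - P" "x \<otimes> u = c \<otimes> y" using fs_Qp_iff[OF P r] by blast
  note k = regD[OF r] b(1) P.Icarr[OF c(1)]
  have tu: "t \<in> carrier R" "u \<in> carrier R" using b c by auto
  have "y \<otimes> (b \<otimes> u) = (x \<otimes> t) \<otimes> u" unfolding b(3) using k tu by (simp add: m_ac)
  also have "\<dots> = (x \<otimes> u) \<otimes> t" using k tu by (simp add: m_ac)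
  also have "\<dots> = y \<otimes> (c \<otimes> t)" unfolding c(3) using k tu by (simp add: m_ac)
  finally have "b \<otimes> u = c \<otimes> t" using k tu by (simp add: m_lcancel)
  then have "b \<otimes> u \<in> P" using P.I_r_closed[OF c(1) tu(1)] by simp
  then show "b \<in> P" using P.I_prime[OF b(1) tu(2)] c by blast
next
  assume "b \<in> P" then show "fs x y \<in> Qp P" using fs_Qp_iff[OF P r] b by blast
qed

lemma fs_repE:
  assumes P: "P \<in> U" and r: "is_reg R U x y"
  obtains b t where "b \<in> carrier R" "t \<in> carrier R - P" "x \<otimes> t = b \<otimes> y" "fs x y \<in> Qp P \<longleftrightarrow> b \<in> P"
proof -
  obtain b t where bt: "t \<in> carrier R - P" "b \<in> carrier R" "x \<otimes> t = b \<otimes> y" using r P unfolding is_reg_def by blast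
  show ?thesis by (rule that[OF bt(2,1,3) fs_Qp_rep[OF P r bt(2,1,3)]])
qed

lemma const_Qp_iff:
  assumes P: "P \<in> U" and a: "a \<in> carrier R" shows "fs a \<one> \<in> Qp P \<longleftrightarrow> a \<in> P"
  by (rule fs_Qp_rep[OF P fs_const[OF a], of a \<one>])
    (use a mult_closed.S_one[OF mult_closed_prime[OF U_prime[OF P]]] in auto)

lemma Qp_prime:
  assumes P: "P \<in> U" shows "primeideal (Qp P) \<O>"
proof -
  interpret P: primeideal P R by (rule U_prime[OF P])
  interpret S: mult_closed R "carrier R - P" by (rule mult_closed_prime[OF U_prime[OF P]])
  have Qc: "s \<in> carrier \<O>" if "s \<in> Qp P" for s using that by (simp add: Qp_def)
  have prod: "fs x y \<otimes>\<^bsub>\<O>\<^esub> fs x' y' \<in> Qp P \<longleftrightarrow> fs x y \<in> Qp P \<or> fs x' y' \<in> Qp P"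
    if r: "is_reg R U x y" "is_reg R U x' y'" for x y x' y'
  proof -
    obtain b t where b: "b \<in> carrier R" "t \<in> carrier R - P" "x \<otimes> t = b \<otimes> y" "fs x y \<in> Qp P \<longleftrightarrow> b \<in> P"
      by (rule fs_repE[OF P r(1)])
    obtain b' t' where b': "b' \<in> carrier R" "t' \<in> carrier R - P" "x' \<otimes> t' = b' \<otimes> y'" "fs x' y' \<in> Qp P \<longleftrightarrow> b' \<in> P"
      by (rule fs_repE[OF P r(2)])
    note k = regD[OF r(1)] regD[OF r(2)] b(1) b'(1)
    have tt: "t \<in> carrier R" "t' \<in> carrier R" using b b' by auto
    have "(x \<otimes> x') \<otimes> (t \<otimes> t') = (x \<otimes> t) \<otimes> (x' \<otimes> t')" using k tt by (simp add: m_ac)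
    also have "\<dots> = (b \<otimes> b') \<otimes> (y \<otimes> y')" unfolding b(3) b'(3) using k by (simp add: m_ac)
    finally have "fs (x \<otimes> x') (y \<otimes> y') \<in> Qp P \<longleftrightarrow> b \<otimes> b' \<in> P"
      by (intro fs_Qp_rep[OF P fs_mult(1)[OF r] _ S.S_mult[OF b(2) b'(2)]]) (use k in auto)
    also have "\<dots> \<longleftrightarrow> b \<in> P \<or> b' \<in> P"
      using P.I_prime[OF b(1) b'(1)] P.I_l_closed[OF _ b(1)] P.I_r_closed[OF _ b'(1)] by blast
    finally show ?thesis using b(4) b'(4) fs_mult(2)[OF r] by simp
  qed
  have prod': "s \<otimes>\<^bsub>\<O>\<^esub> s' \<in> Qp P \<longleftrightarrow> s \<in> Qp P \<or> s' \<in> Qp P" if s: "s \<in> carrier \<O>" "s' \<in> carrier \<O>" for s s'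
  proof -
    obtain x y where r: "is_reg R U x y" "s = fs x y" by (rule fsE[OF s(1)])
    obtain x' y' where r': "is_reg R U x' y'" "s' = fs x' y'" by (rule fsE[OF s(2)])
    show ?thesis unfolding r(2) r'(2) by (rule prod[OF r(1) r'(1)])
  qed
  have add: "s \<oplus>\<^bsub>\<O>\<^esub> s' \<in> Qp P" if s: "s \<in> Qp P" "s' \<in> Qp P" for s s'
  proof -
    obtain x y where r: "is_reg R U x y" "s = fs x y" by (rule fsE[OF Qc[OF s(1)]])
    obtain x' y' where r': "is_reg R U x' y'" "s' = fs x' y'" by (rule fsE[OF Qc[OF s(2)]])
    obtain b t where b: "b \<in> carrier R" "t \<in> carrier R - P" "x \<otimes> t = b \<otimes> y" "fs x y \<in> Qp P \<longleftrightarrow> b \<in> P"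
      by (rule fs_repE[OF P r(1)])
    obtain b' t' where b': "b' \<in> carrier R" "t' \<in> carrier R - P" "x' \<otimes> t' = b' \<otimes> y'" "fs x' y' \<in> Qp P \<longleftrightarrow> b' \<in> P"
      by (rule fs_repE[OF P r'(1)])
    note k = regD[OF r(1)] regD[OF r'(1)] b(1) b'(1)
    have tt: "t \<in> carrier R" "t' \<in> carrier R" using b b' by auto
    have bP: "b \<in> P" "b' \<in> P" using b(4) b'(4) s r r' by auto
    have "(x \<otimes> y' \<oplus> x' \<otimes> y) \<otimes> (t \<otimes> t') = (x \<otimes> t) \<otimes> (t' \<otimes> y') \<oplus> (x' \<otimes> t') \<otimes> (t \<otimes> y)"
      using k tt by (simp add: l_distr r_distr m_ac)
    also have "\<dots> = (b \<otimes> t' \<oplus> b' \<otimes> t) \<otimes> (y \<otimes> y')" unfolding b(3) b'(3) using k tt by (simp add: l_distr r_distr m_ac)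
    finally have "fs (x \<otimes> y' \<oplus> x' \<otimes> y) (y \<otimes> y') \<in> Qp P \<longleftrightarrow> b \<otimes> t' \<oplus> b' \<otimes> t \<in> P"
      by (intro fs_Qp_rep[OF P fs_mult(3)[OF r(1) r'(1)] _ S.S_mult[OF b(2) b'(2)]]) (use k tt in auto)
    moreover have "b \<otimes> t' \<oplus> b' \<otimes> t \<in> P" using bP tt by (intro P.a_closed P.I_r_closed) auto
    ultimately show ?thesis unfolding r(2) r'(2) using fs_mult(4)[OF r(1) r'(1)] by simp
  qed
  have one: "\<one>\<^bsub>\<O>\<^esub> \<notin> Qp P"
    unfolding fs_one_zero const_Qp_iff[OF P one_closed] using S.S_one by simp
  have zero: "\<zero>\<^bsub>\<O>\<^esub> \<in> Qp P"
    unfolding fs_one_zero const_Qp_iff[OF P zero_closed] by (rule P.zero_closed)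
  show ?thesis
  proof (rule primeidealI)
    show "cring \<O>" by (rule O.is_cring)
    show "ideal (Qp P) \<O>"
    proof (rule idealI[OF O.ring_axioms])
      show "subgroup (Qp P) (add_monoid \<O>)"
      proof (rule subgroup.intro)
        show "Qp P \<subseteq> carrier (add_monoid \<O>)" using Qc by auto
        show "x \<otimes>\<^bsub>add_monoid \<O>\<^esub> y \<in> Qp P" if "x \<in> Qp P" "y \<in> Qp P" for x y using add[OF that] by simp
        show "\<one>\<^bsub>add_monoid \<O>\<^esub> \<in> Qp P" using zero by simp
        show "inv\<^bsub>add_monoid \<O>\<^esub> x \<in> Qp P" if x: "x \<in> Qp P" for x
        proof -
          have "\<ominus>\<^bsub>\<O>\<^esub> x = (\<ominus>\<^bsub>\<O>\<^esub> \<one>\<^bsub>\<O>\<^esub>) \<otimes>\<^bsub>\<O>\<^esub> x" using Qc[OF x] by (simp add: O.l_minus)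
          then have "\<ominus>\<^bsub>\<O>\<^esub> x \<in> Qp P" using prod'[OF _ Qc[OF x], of "\<ominus>\<^bsub>\<O>\<^esub> \<one>\<^bsub>\<O>\<^esub>"] x by simp
          then show ?thesis by (simp only: a_inv_def)
        qed
      qed
    qed (use prod' Qc in auto)
    show "carrier \<O> \<noteq> Qp P" using one O.one_closed by blast
    show "a \<in> Qp P \<or> b \<in> Qp P" if "a \<in> carrier \<O>" "b \<in> carrier \<O>" "a \<otimes>\<^bsub>\<O>\<^esub> b \<in> Qp P" for a b
      using prod'[OF that(1,2)] that(3) by blast
  qed
qed

text \<open>The denominators of \<open>x/y\<close> form an ideal lying in no prime of
  \<open>U\<close>, while primes avoiding \<open>f\<close> belong to \<open>U\<close>; so some power
  of \<open>f\<close> is a denominator.\<close>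

lemma clear_denominator:
  assumes r: "is_reg R U x y" and f: "f \<in> J"
  obtains n :: nat and a where "a \<in> carrier R" "x \<otimes> f [^] n = a \<otimes> y"
proof -
  note k = regD[OF r]
  have id: "ideal {c \<in> carrier R. y divides c \<otimes> x} R" by (rule divides_ideal) (use k in auto)
  have "\<exists>n::nat. f [^] n \<in> {c \<in> carrier R. y divides c \<otimes> x}"
  proof (rule ccontr)
    assume neg: "\<not> ?thesis"
    obtain P where P: "primeideal P R" "{c \<in> carrier R. y divides c \<otimes> x} \<subseteq> P" "f \<notin> P"
      by (rule exists_prime_avoiding_powers[OF id Jc[OF f]]) (use neg in auto)
    then have "P \<in> U" using f by (auto simp: U_def prime_spectrum_def)
    then obtain t b where tb: "t \<in> carrier R - P" "b \<in> carrier R" "x \<otimes> t = b \<otimes> y" using r unfolding is_reg_def by blast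
    then have "t \<otimes> x = y \<otimes> b" using k by (simp add: m_comm)
    then have "y divides t \<otimes> x" using tb(2) by (auto intro: dividesI)
    then show False using tb(1) P(2) by blast
  qed
  then obtain n :: nat where "y divides f [^] n \<otimes> x" by blast
  then obtain a where a: "a \<in> carrier R" "f [^] n \<otimes> x = y \<otimes> a" by (rule dividesE)
  then have "x \<otimes> f [^] n = a \<otimes> y" using k Jc[OF f] by (simp add: m_comm)
  then show ?thesis using that a(1) by blast
qed

lemma clear_denominator_Qp:
  assumes P: "P \<in> U" and r: "is_reg R U x y" and f: "f \<in> J" "f \<notin> P" and a: "a \<in> carrier R" "x \<otimes> f [^] (n::nat) = a \<otimes> y"
  shows "fs x y \<in> Qp P \<longleftrightarrow> a \<in> P"
  by (rule fs_Qp_rep[OF P r a(1) _ a(2)]) (rule pow_not_in_prime[OF U_prime[OF P]], use f Jc in auto)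

lemma const_hom: "a \<in> carrier R \<Longrightarrow> b \<in> carrier R \<Longrightarrow> fs a \<one> \<otimes>\<^bsub>\<O>\<^esub> fs b \<one> = fs (a \<otimes> b) \<one>"
  "a \<in> carrier R \<Longrightarrow> b \<in> carrier R \<Longrightarrow> fs a \<one> \<oplus>\<^bsub>\<O>\<^esub> fs b \<one> = fs (a \<oplus> b) \<one>"
  using fs_mult(2,4)[OF fs_const fs_const] by simp_all

section \<open>Recovering the open set from its ring of sections\<close>

context
  fixes y0
  assumes y0: "y0 \<in> carrier R" "y0 \<noteq> \<zero>" "y0 \<in> J \<cdot> D y0"
begin

text \<open>The hypothesis on \<open>y0\<close> writes one as a sum of products of elements of
  \<open>J\<close> with sections, so a prime containing all of \<open>J\<close> would contain
  one.\<close>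

lemma prime_avoids_J:
  assumes Q: "primeideal Q \<O>" shows "\<exists>f\<in>J. fs f \<one> \<notin> Q"
proof (rule ccontr)
  interpret Q: primeideal Q \<O> by (rule Q)
  assume neg: "\<not> ?thesis"
  have "fs z y0 \<in> Q" if "z \<in> J \<cdot> D y0" for z
    using that
  proof (induction)
    case (prod i j)
    then have j: "is_reg R U j y0" by (simp add: D_def)
    have "fs i \<one> \<otimes>\<^bsub>\<O>\<^esub> fs j y0 \<in> Q" using neg prod(1) fs_carrier[OF j] by (intro Q.I_r_closed) auto
    then show ?case using fs_mult(2)[OF fs_const[OF Jc[OF prod(1)]] j] y0(1) by simp
  next
    case (sum s1 s2)
    have s: "is_reg R U s1 y0" "is_reg R U s2 y0" using prod_reg sum y0 by auto
    have sr: "is_reg R U (s1 \<oplus> s2) y0" by (rule prod_reg[OF ideal_prod.sum[OF sum(1,2)] y0(1,2)])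
    have "fs (s1 \<oplus> s2) y0 = fs s1 y0 \<oplus>\<^bsub>\<O>\<^esub> fs s2 y0"
      unfolding fs_mult(4)[OF s] fs_eq_iff[OF sr fs_mult(3)[OF s]]
      using regD(1)[OF s(1)] regD(1)[OF s(2)] y0 by (simp add: l_distr r_distr m_ac)
    then show ?case using Q.a_closed[OF sum(3,4)] by simp
  qed
  then have "fs y0 y0 \<in> Q" using y0 by blast
  also have "fs y0 y0 = \<one>\<^bsub>\<O>\<^esub>"
    unfolding fs_one_zero using fs_eq_iff[OF reg_self[OF y0(1,2)] fs_const[OF one_closed]] y0 by simp
  finally show False using Q.I_notcarr Q.one_imp_carrier by blast
qed

text \<open>The prime \<open>P\<close> is the contraction of \<open>Q\<close> to \<open>R\<close>;
  it is in \<open>U\<close> because some \<open>f\<close> in \<open>J\<close> stays outside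
  \<open>Q\<close>. Membership of a section \<open>s\<close> in \<open>Q\<close> and in
  \<open>Qp P\<close> is decided by \<open>f^n s\<close>, an element of \<open>R\<close>, since
  \<open>f\<close> lies in neither.\<close>

lemma Qp_surj:
  assumes Q: "primeideal Q \<O>" obtains P where "P \<in> U" "Qp P = Q"
proof -
  interpret Q: primeideal Q \<O> by (rule Q)
  define P where "P = {a \<in> carrier R. fs a \<one> \<in> Q}"
  have cc: "fs a \<one> \<in> carrier \<O>" if "a \<in> carrier R" for a by (rule fs_carrier[OF fs_const[OF that]])
  have l: "r \<otimes> a \<in> P" if "a \<in> P" "r \<in> carrier R" for a r
    using that Q.I_l_closed[of "fs a \<one>" "fs r \<one>"] const_hom(1)[of r a] cc[of r] by (simp add: P_def)
  have Pp: "primeideal P R"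
  proof (rule primeidealI[OF _ is_cring])
    show "ideal P R"
    proof (rule idealI[OF ring_axioms])
      show "subgroup P (add_monoid R)"
      proof (rule subgroup.intro)
        show "P \<subseteq> carrier (add_monoid R)" by (auto simp: P_def)
        show "x \<otimes>\<^bsub>add_monoid R\<^esub> y \<in> P" if "x \<in> P" "y \<in> P" for x y
          using that Q.a_closed[of "fs x \<one>" "fs y \<one>"] const_hom(2)[of x y] by (simp add: P_def)
        show "\<one>\<^bsub>add_monoid R\<^esub> \<in> P" using Q.zero_closed fs_one_zero by (simp add: P_def)
        show "inv\<^bsub>add_monoid R\<^esub> x \<in> P" if x: "x \<in> P" for x
        proof -
          have "\<ominus> x = (\<ominus> \<one>) \<otimes> x" using x by (simp add: P_def l_minus)
          then have "\<ominus> x \<in> P" using l[OF x, of "\<ominus> \<one>"] by simp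
          then show ?thesis by (simp only: a_inv_def)
        qed
      qed
      fix a r assume a: "a \<in> P" and r: "r \<in> carrier R"
      show "r \<otimes> a \<in> P" by (rule l[OF a r])
      then show "a \<otimes> r \<in> P" using a r by (simp add: P_def m_comm)
    qed
    show "carrier R \<noteq> P"
    proof
      assume "carrier R = P"
      then have "fs \<one> \<one> \<in> Q" using one_closed unfolding P_def by blast
      then show False using fs_one_zero Q.I_notcarr Q.one_imp_carrier by simp
    qed
    show "a \<in> P \<or> b \<in> P" if "a \<in> carrier R" "b \<in> carrier R" "a \<otimes> b \<in> P" for a b
      using that const_hom(1)[of a b] Q.I_prime[OF cc cc, of a b] by (simp add: P_def)
  qed
  obtain f where f: "f \<in> J" "fs f \<one> \<notin> Q" using prime_avoids_J[OF Q] by blast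
  have fP: "f \<notin> P" using f by (simp add: P_def)
  have PU: "P \<in> U" using Pp f fP by (auto simp: U_def prime_spectrum_def)
  have "s \<in> Qp P \<longleftrightarrow> s \<in> Q" if s: "s \<in> carrier \<O>" for s
  proof -
    obtain x y where r: "is_reg R U x y" "s = fs x y" by (rule fsE[OF s])
    obtain n :: nat and a where a: "a \<in> carrier R" "x \<otimes> f [^] n = a \<otimes> y" by (rule clear_denominator[OF r(1) f(1)])
    note k = regD[OF r(1)] Jc[OF f(1)] a(1)
    have fn: "f [^] n \<in> carrier R" using k by simp
    have "s \<otimes>\<^bsub>\<O>\<^esub> fs (f [^] n) \<one> = fs (x \<otimes> f [^] n) (y \<otimes> \<one>)"
      unfolding r(2) by (rule fs_mult(2)[OF r(1) fs_const[OF fn]])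
    also have "\<dots> = fs a \<one>"
      using fs_eq_iff[OF fs_mult(1)[OF r(1) fs_const[OF fn]] fs_const[OF a(1)]] k a(2) by simp
    finally have e: "s \<otimes>\<^bsub>\<O>\<^esub> fs (f [^] n) \<one> = fs a \<one>" .
    have "f [^] n \<notin> P" using pow_not_in_prime[OF Pp, of f n] k fP by simp
    then have "fs (f [^] n) \<one> \<notin> Q" using fn by (simp add: P_def)
    then have "s \<in> Q \<longleftrightarrow> fs a \<one> \<in> Q"
      using Q.I_prime[OF s cc[OF fn]] Q.I_r_closed[OF _ cc[OF fn], of s] unfolding e by blast
    also have "\<dots> \<longleftrightarrow> a \<in> P" using a by (simp add: P_def)
    also have "\<dots> \<longleftrightarrow> s \<in> Qp P" unfolding r(2) using clear_denominator_Qp[OF PU r(1) f(1) fP a] by blast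
    finally show ?thesis by blast
  qed
  moreover have "Qp P \<subseteq> carrier \<O>" "Q \<subseteq> carrier \<O>" using Q.Icarr by (auto simp: Qp_def)
  ultimately have "Qp P = Q" by blast
  then show ?thesis by (rule that[OF PU])
qed

lemma Qp_inj: "P \<in> U \<Longrightarrow> P' \<in> U \<Longrightarrow> Qp P = Qp P' \<Longrightarrow> P = P'"
proof -
  assume P: "P \<in> U" "P' \<in> U" "Qp P = Qp P'"
  have "P \<subseteq> carrier R" "P' \<subseteq> carrier R"
    using U_prime[OF P(1)] U_prime[OF P(2)] by (auto simp: primeideal_def dest: ideal.Icarr)
  then show ?thesis using const_Qp_iff[OF P(1)] const_Qp_iff[OF P(2)] P(3) by blast
qed

lemma Qp_image: "Qp ` U = prime_spectrum \<O>"
  using Qp_prime Qp_surj by (auto simp: prime_spectrum_def) (metis imageI)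

lemma Qp_homeomorphic: "homeomorphic_map (subtopology (zariski R) U) (zariski \<O>) Qp"
proof (rule bijective_open_imp_homeomorphic_map)
  have top: "topspace (subtopology (zariski R) U) = U" using U_sub by auto
  show "continuous_map (subtopology (zariski R) U) (zariski \<O>) Qp"
    unfolding continuous_map_def top
  proof (intro conjI allI impI)
    show "Qp \<in> U \<rightarrow> topspace (zariski \<O>)" using Qp_image by auto
    fix W assume "openin (zariski \<O>) W"
    then obtain S where S: "S \<subseteq> carrier \<O>" "W = {Q \<in> prime_spectrum \<O>. \<not> S \<subseteq> Q}"
      unfolding openin_zariski zariski_open_def by blast
    \<comment> \<open>For \<open>s = x/y\<close> the preimage of \<open>D(s)\<close> is the union of
      the \<open>D(f a)\<close> with \<open>f^n s = a\<close>; the factor \<open>f\<close> keeps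
      these sets inside \<open>U\<close>.\<close>
    define S' where "S' = {f \<otimes> a |f a n x y. f \<in> J \<and> a \<in> carrier R \<and> is_reg R U x y \<and> fs x y \<in> S \<and> x \<otimes> f [^] (n::nat) = a \<otimes> y}"
    have "{P \<in> U. Qp P \<in> W} = {P \<in> prime_spectrum R. \<not> S' \<subseteq> P}"
    proof (intro subset_antisym subsetI)
      fix P assume P: "P \<in> {P \<in> U. Qp P \<in> W}"
      then have PU: "P \<in> U" by simp
      interpret P: primeideal P R by (rule U_prime[OF PU])
      obtain s where s: "s \<in> S" "s \<notin> Qp P" using P S by blast
      obtain x y where r: "is_reg R U x y" "s = fs x y" using fsE s S(1) by blast
      obtain f where f: "f \<in> J" "f \<notin> P" using PU by (auto simp: U_def)
      obtain n :: nat and a where a: "a \<in> carrier R" "x \<otimes> f [^] n = a \<otimes> y" by (rule clear_denominator[OF r(1) f(1)])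
      have "a \<notin> P" using clear_denominator_Qp[OF PU r(1) f a] s r by blast
      then have "f \<otimes> a \<notin> P" using P.I_prime[OF Jc[OF f(1)] a(1)] f by blast
      moreover have "f \<otimes> a \<in> S'" unfolding S'_def using f a r s by blast
      ultimately show "P \<in> {P \<in> prime_spectrum R. \<not> S' \<subseteq> P}" using PU U_sub by blast
    next
      fix P assume P: "P \<in> {P \<in> prime_spectrum R. \<not> S' \<subseteq> P}"
      then obtain f a x y and n :: nat where fa: "f \<in> J" "a \<in> carrier R" "is_reg R U x y" "fs x y \<in> S" "x \<otimes> f [^] n = a \<otimes> y" "f \<otimes> a \<notin> P"
        unfolding S'_def by blast
      interpret P: primeideal P R using P by (simp add: prime_spectrum_def)
      have n: "f \<notin> P" "a \<notin> P" using fa(6) P.I_r_closed[OF _ fa(2), of f] P.I_l_closed[OF _ Jc[OF fa(1)], of a] by auto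
      have PU: "P \<in> U" using P fa(1) n by (auto simp: U_def)
      have "fs x y \<notin> Qp P" using clear_denominator_Qp[OF PU fa(3,1) n(1) fa(2,5)] n(2) by blast
      then show "P \<in> {P \<in> U. Qp P \<in> W}" using PU fa(4) Qp_image unfolding S(2) by blast
    qed
    moreover have "S' \<subseteq> carrier R" unfolding S'_def using Jc by auto
    ultimately have "openin (zariski R) {P \<in> U. Qp P \<in> W}" unfolding openin_zariski zariski_open_def by blast
    then show "openin (subtopology (zariski R) U) {P \<in> U. Qp P \<in> W}"
      by (simp add: openin_open_subtopology[OF U_open] Collect_mono_iff)
  qed
  show "open_map (subtopology (zariski R) U) (zariski \<O>) Qp"
    unfolding open_map_def
  proof (intro allI impI)
    fix V assume "openin (subtopology (zariski R) U) V"
    then have V: "openin (zariski R) V" "V \<subseteq> U" using openin_open_subtopology[OF U_open] by auto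
    obtain S where S: "S \<subseteq> carrier R" "V = {P \<in> prime_spectrum R. \<not> S \<subseteq> P}"
      using V(1) unfolding openin_zariski zariski_open_def by blast
    have "Qp ` V = {Q \<in> prime_spectrum \<O>. \<not> (\<lambda>a. fs a \<one>) ` S \<subseteq> Q}"
    proof -
      have "P \<in> V \<longleftrightarrow> \<not> (\<lambda>a. fs a \<one>) ` S \<subseteq> Qp P" if "P \<in> U" for P
        using const_Qp_iff[OF that] S U_sub that by blast
      then show ?thesis unfolding Qp_image[symmetric] using V(2) by blast
    qed
    moreover have "(\<lambda>a. fs a \<one>) ` S \<subseteq> carrier \<O>" using S(1) fs_carrier[OF fs_const] by blast
    ultimately show "openin (zariski \<O>) (Qp ` V)" unfolding openin_zariski zariski_open_def by blast
  qed
  show "Qp ` topspace (subtopology (zariski R) U) = topspace (zariski \<O>)" unfolding top using Qp_image by simp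
  show "inj_on Qp (topspace (subtopology (zariski R) U))" unfolding top inj_on_def using Qp_inj by blast
qed

text \<open>The quotient of \<open>x/y\<close> by \<open>x'/y'\<close> is
  \<open>x y' / (y x')\<close>, and the local ring of the ring of sections at \<open>Qp P\<close>
  agrees with \<open>R_P\<close>: fractions of sections can be rewritten with elements of
  \<open>R\<close>, and conversely.\<close>

lemma reg_transfer:
  assumes W: "W \<subseteq> prime_spectrum \<O>" and r: "is_reg R U x y" "is_reg R U x' y'" and x0: "x' \<noteq> \<zero>"
  shows "is_reg \<O> W (fs x y) (fs x' y') \<longleftrightarrow> is_reg R {P \<in> U. Qp P \<in> W} (x \<otimes> y') (y \<otimes> x')"
proof -
  note k = regD[OF r(1)] regD[OF r(2)]
  have nz: "y \<otimes> x' \<noteq> \<zero>" using k x0 by (simp add: integral_iff)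
  have nz': "fs x' y' \<noteq> \<zero>\<^bsub>\<O>\<^esub>"
    unfolding fs_one_zero using fs_eq_iff[OF r(2) fs_const[OF zero_closed]] k x0 by simp
  have loc: "(\<exists>T\<in>carrier \<O> - Qp P. \<exists>C\<in>carrier \<O>. fs x y \<otimes>\<^bsub>\<O>\<^esub> T = C \<otimes>\<^bsub>\<O>\<^esub> fs x' y')
    \<longleftrightarrow> (\<exists>t\<in>carrier R - P. \<exists>b\<in>carrier R. (x \<otimes> y') \<otimes> t = b \<otimes> (y \<otimes> x'))" if P: "P \<in> U" for P
  proof
    interpret S: mult_closed R "carrier R - P" by (rule mult_closed_prime[OF U_prime[OF P]])
    {
      assume "\<exists>T\<in>carrier \<O> - Qp P. \<exists>C\<in>carrier \<O>. fs x y \<otimes>\<^bsub>\<O>\<^esub> T = C \<otimes>\<^bsub>\<O>\<^esub> fs x' y'"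
      then obtain T C where TC: "T \<in> carrier \<O>" "T \<notin> Qp P" "C \<in> carrier \<O>" "fs x y \<otimes>\<^bsub>\<O>\<^esub> T = C \<otimes>\<^bsub>\<O>\<^esub> fs x' y'" by blast
      obtain p q where p: "is_reg R U p q" "T = fs p q" by (rule fsE[OF TC(1)])
      obtain c d where c: "is_reg R U c d" "C = fs c d" by (rule fsE[OF TC(3)])
      have e: "(x \<otimes> p) \<otimes> (d \<otimes> y') = (c \<otimes> x') \<otimes> (y \<otimes> q)"
        using TC(4) unfolding p(2) c(2) fs_mult(2)[OF r(1) p(1)] fs_mult(2)[OF c(1) r(2)]
          fs_eq_iff[OF fs_mult(1)[OF r(1) p(1)] fs_mult(1)[OF c(1) r(2)]] .
      obtain p0 t0 where p0: "p0 \<in> carrier R" "t0 \<in> carrier R - P" "p \<otimes> t0 = p0 \<otimes> q" "fs p q \<in> Qp P \<longleftrightarrow> p0 \<in> P"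
        by (rule fs_repE[OF P p(1)])
      obtain c1 t1 where c1: "c1 \<in> carrier R" "t1 \<in> carrier R - P" "c \<otimes> t1 = c1 \<otimes> d"
        by (rule fs_repE[OF P c(1)])
      have p0P: "p0 \<in> carrier R - P" using p0 TC p by auto
      note kk = k regD[OF p(1)] regD[OF c(1)] p0(1) c1(1)
      have tt: "t0 \<in> carrier R" "t1 \<in> carrier R" using p0 c1 by auto
      have qd: "q \<otimes> d \<noteq> \<zero>" "q \<otimes> d \<in> carrier R" using kk by (auto simp: integral_iff)
      have "(q \<otimes> d) \<otimes> ((x \<otimes> y') \<otimes> (p0 \<otimes> t1)) = ((x \<otimes> (p0 \<otimes> q)) \<otimes> (d \<otimes> y')) \<otimes> t1" using kk tt by (simp add: m_ac)
      also have "\<dots> = ((x \<otimes> p) \<otimes> (d \<otimes> y')) \<otimes> (t0 \<otimes> t1)" unfolding p0(3)[symmetric] using kk tt by (simp add: m_ac)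
      also have "\<dots> = ((c \<otimes> t1) \<otimes> x') \<otimes> ((y \<otimes> q) \<otimes> t0)" unfolding e using kk tt by (simp add: m_ac)
      also have "\<dots> = (q \<otimes> d) \<otimes> ((c1 \<otimes> t0) \<otimes> (y \<otimes> x'))" unfolding c1(3) using kk tt by (simp add: m_ac)
      finally have "(x \<otimes> y') \<otimes> (p0 \<otimes> t1) = (c1 \<otimes> t0) \<otimes> (y \<otimes> x')" using kk tt qd by (simp add: m_lcancel)
      then show "\<exists>t\<in>carrier R - P. \<exists>b\<in>carrier R. (x \<otimes> y') \<otimes> t = b \<otimes> (y \<otimes> x')"
        using S.S_mult[OF p0P c1(2)] c1(1) tt by blast
    }
    {
      assume "\<exists>t\<in>carrier R - P. \<exists>b\<in>carrier R. (x \<otimes> y') \<otimes> t = b \<otimes> (y \<otimes> x')"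
      then obtain t b where t: "t \<in> carrier R" "t \<notin> P" "b \<in> carrier R" "(x \<otimes> y') \<otimes> t = b \<otimes> (y \<otimes> x')" by blast
      note ft = fs_const[OF t(1)] and fb = fs_const[OF t(3)]
      have "fs x y \<otimes>\<^bsub>\<O>\<^esub> fs t \<one> = fs b \<one> \<otimes>\<^bsub>\<O>\<^esub> fs x' y'"
        unfolding fs_mult(2)[OF r(1) ft] fs_mult(2)[OF fb r(2)] fs_eq_iff[OF fs_mult(1)[OF r(1) ft] fs_mult(1)[OF fb r(2)]]
      proof -
        have "(x \<otimes> t) \<otimes> (\<one> \<otimes> y') = (x \<otimes> y') \<otimes> t" using k t by (simp add: m_ac)
        also have "\<dots> = (b \<otimes> x') \<otimes> (y \<otimes> \<one>)" unfolding t(4) using k t(3) by (simp add: m_ac)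
        finally show "(x \<otimes> t) \<otimes> (\<one> \<otimes> y') = (b \<otimes> x') \<otimes> (y \<otimes> \<one>)" .
      qed
      moreover have "fs t \<one> \<in> carrier \<O> - Qp P" using fs_carrier[OF ft] const_Qp_iff[OF P t(1)] t(2) by blast
      ultimately show "\<exists>T\<in>carrier \<O> - Qp P. \<exists>C\<in>carrier \<O>. fs x y \<otimes>\<^bsub>\<O>\<^esub> T = C \<otimes>\<^bsub>\<O>\<^esub> fs x' y'"
        using fs_carrier[OF fb] by blast
    }
  qed
  have WE: "\<exists>P\<in>U. Q = Qp P" if "Q \<in> W" for Q
  proof -
    have "Q \<in> Qp ` U" using that W Qp_image by auto
    then show ?thesis by blast
  qed
  have "(\<forall>Q\<in>W. F Q) \<longleftrightarrow> (\<forall>P\<in>{P \<in> U. Qp P \<in> W}. F (Qp P))" for F using WE by blast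
  then have "(\<forall>Q\<in>W. \<exists>T\<in>carrier \<O> - Q. \<exists>C\<in>carrier \<O>. fs x y \<otimes>\<^bsub>\<O>\<^esub> T = C \<otimes>\<^bsub>\<O>\<^esub> fs x' y') \<longleftrightarrow>
     (\<forall>P\<in>{P \<in> U. Qp P \<in> W}. \<exists>T\<in>carrier \<O> - Qp P. \<exists>C\<in>carrier \<O>. fs x y \<otimes>\<^bsub>\<O>\<^esub> T = C \<otimes>\<^bsub>\<O>\<^esub> fs x' y')" .
  also have "\<dots> \<longleftrightarrow> (\<forall>P\<in>{P \<in> U. Qp P \<in> W}. \<exists>t\<in>carrier R - P. \<exists>b\<in>carrier R. (x \<otimes> y') \<otimes> t = b \<otimes> (y \<otimes> x'))"
    using loc by (intro ball_cong refl) simp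
  finally show ?thesis
    unfolding is_reg_def using k nz nz' fs_carrier[OF r(1)] fs_carrier[OF r(2)] by simp
qed

text \<open>The comparison of structure sheaves rewrites a fraction of sections as a fraction of
  elements of \<open>R\<close>. A section has many such expressions; \<open>h_eq\<close> shows that
  the value does not depend on the one selected.\<close>

definition h where
  "h W s = (SOME v. \<exists>x y x' y'. is_reg R U x y \<and> is_reg R U x' y' \<and> x' \<noteq> \<zero> \<and> is_reg \<O> W (fs x y) (fs x' y') \<and>
     s = frac_sec \<O> W (fs x y) (fs x' y') \<and> v = frac_sec R {P \<in> U. Qp P \<in> W} (x \<otimes> y') (y \<otimes> x'))"

lemma h_eq:
  assumes W: "W \<subseteq> prime_spectrum \<O>" and r: "is_reg R U x y" "is_reg R U x' y'" "x' \<noteq> \<zero>"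
    and R: "is_reg \<O> W (fs x y) (fs x' y')"
  shows "h W (frac_sec \<O> W (fs x y) (fs x' y')) = frac_sec R {P \<in> U. Qp P \<in> W} (x \<otimes> y') (y \<otimes> x')"
  unfolding h_def
proof (rule some_equality)
  fix v assume "\<exists>a b a' b'. is_reg R U a b \<and> is_reg R U a' b' \<and> a' \<noteq> \<zero> \<and> is_reg \<O> W (fs a b) (fs a' b') \<and>
     frac_sec \<O> W (fs x y) (fs x' y') = frac_sec \<O> W (fs a b) (fs a' b') \<and> v = frac_sec R {P \<in> U. Qp P \<in> W} (a \<otimes> b') (b \<otimes> a')"
  then obtain a b a' b' where a: "is_reg R U a b" "is_reg R U a' b'" "a' \<noteq> \<zero>" "is_reg \<O> W (fs a b) (fs a' b')"
     "frac_sec \<O> W (fs x y) (fs x' y') = frac_sec \<O> W (fs a b) (fs a' b')" "v = frac_sec R {P \<in> U. Qp P \<in> W} (a \<otimes> b') (b \<otimes> a')" by blast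
  show "v = frac_sec R {P \<in> U. Qp P \<in> W} (x \<otimes> y') (y \<otimes> x')"
  proof (cases "W = {}")
    case True then show ?thesis unfolding a(6) by (auto simp: frac_sec_def fun_eq_iff restrict_def)
  next
    case False
    then obtain Q where Q: "Q \<in> W" by blast
    note k = regD[OF r(1)] regD[OF r(2)] regD[OF a(1)] regD[OF a(2)]
    have "fs x y \<otimes>\<^bsub>\<O>\<^esub> fs a' b' = fs a b \<otimes>\<^bsub>\<O>\<^esub> fs x' y'"
      by (rule O.frac_sec_eqD[OF W R a(4) Q]) (use a(5) in simp)
    then have e: "(x \<otimes> a') \<otimes> (b \<otimes> y') = (a \<otimes> x') \<otimes> (y \<otimes> b')"
      unfolding fs_mult(2)[OF r(1) a(2)] fs_mult(2)[OF a(1) r(2)] fs_eq_iff[OF fs_mult(1)[OF r(1) a(2)] fs_mult(1)[OF a(1) r(2)]] .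
    show ?thesis unfolding a(6)
    proof (rule frac_sec_eqI)
      show "{P \<in> U. Qp P \<in> W} \<subseteq> prime_spectrum R" using U_sub by blast
      show "is_reg R {P \<in> U. Qp P \<in> W} (a \<otimes> b') (b \<otimes> a')" using reg_transfer[OF W a(1-3)] a(4) by blast
      show "is_reg R {P \<in> U. Qp P \<in> W} (x \<otimes> y') (y \<otimes> x')" using reg_transfer[OF W r] R by blast
      have "(a \<otimes> b') \<otimes> (y \<otimes> x') = (a \<otimes> x') \<otimes> (y \<otimes> b')" using k by (simp add: m_ac)
      also have "\<dots> = (x \<otimes> y') \<otimes> (b \<otimes> a')" unfolding e[symmetric] using k by (simp add: m_ac)
      finally show "(a \<otimes> b') \<otimes> (y \<otimes> x') = (x \<otimes> y') \<otimes> (b \<otimes> a')" .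
    qed
  qed
qed (use assms in blast)

end

end

section \<open>The affineness criterion\<close>

context open_complement
begin

text \<open>For the converse of \<open>affine_imp\<close>: if \<open>J\<close> generates the unit
  ideal of sections, the points of \<open>U\<close> correspond to the primes of the ring of
  sections, and both structure sheaves consist of fractions from one quotient field. So
  \<open>U\<close> is the spectrum of its ring of sections.\<close>

lemma affine_iff:
  "affine_ringed_space (open_subspace (Spec R) U) \<longleftrightarrow> (\<exists>y\<in>carrier R. y \<noteq> \<zero> \<and> y \<in> J \<cdot> D y)"
proof
  assume "affine_ringed_space (open_subspace (Spec R) U)"
  then show "\<exists>y\<in>carrier R. y \<noteq> \<zero> \<and> y \<in> J \<cdot> D y" by (rule affine_imp) blast
next
  assume "\<exists>y\<in>carrier R. y \<noteq> \<zero> \<and> y \<in> J \<cdot> D y"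
  then obtain y0 where y0: "y0 \<in> carrier R" "y0 \<noteq> \<zero>" "y0 \<in> J \<cdot> D y0" by blast
  note Qim = Qp_image[OF y0] and hom = Qp_homeomorphic[OF y0] and rt = reg_transfer[OF y0] and heq = h_eq[OF y0]
  let ?Z = "subtopology (zariski R) U"
  have topZ: "topspace ?Z = U" using U_sub by auto
  define V where "V W = {P \<in> U. Qp P \<in> W}" for W
  have V: "openin (zariski R) (V W)" if "openin (zariski \<O>) W" for W
  proof -
    have "openin ?Z {P \<in> topspace ?Z. Qp P \<in> W}"
      using homeomorphic_imp_continuous_map[OF hom] that by (simp only: continuous_map_def)
    then show ?thesis unfolding topZ V_def using openin_open_subtopology[OF U_open] by blast
  qed
  have sect: "\<exists>x y x' y'. is_reg R U x y \<and> is_reg R U x' y' \<and> x' \<noteq> \<zero> \<and> is_reg \<O> W (fs x y) (fs x' y') \<and>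
      is_reg R (V W) (x \<otimes> y') (y \<otimes> x') \<and> s = frac_sec \<O> W (fs x y) (fs x' y') \<and> h W s = frac_sec R (V W) (x \<otimes> y') (y \<otimes> x')"
    if W: "openin (zariski \<O>) W" and s: "s \<in> carrier (structure_sheaf \<O> W)" for W s
  proof -
    have Ws: "W \<subseteq> prime_spectrum \<O>" by (rule O.open_sub[OF W])
    obtain s1 s2 where XY: "is_reg \<O> W s1 s2" "s = frac_sec \<O> W s1 s2" by (rule O.section_is_frac_sec[OF W s])
    have XYc: "s1 \<in> carrier \<O>" "s2 \<in> carrier \<O>" "s2 \<noteq> \<zero>\<^bsub>\<O>\<^esub>" using XY(1) by (auto simp: is_reg_def)
    obtain x y where r: "is_reg R U x y" "s1 = fs x y" by (rule fsE[OF XYc(1)])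
    obtain x' y' where r': "is_reg R U x' y'" "s2 = fs x' y'" by (rule fsE[OF XYc(2)])
    have x0: "x' \<noteq> \<zero>"
    proof
      assume "x' = \<zero>"
      then have "s2 = \<zero>\<^bsub>\<O>\<^esub>" unfolding r'(2) fs_one_zero fs_eq_iff[OF r'(1) fs_const[OF zero_closed]]
        using regD(2)[OF r'(1)] by simp
      then show False using XYc by simp
    qed
    have R: "is_reg \<O> W (fs x y) (fs x' y')" using XY(1) r r' by simp
    have "is_reg R (V W) (x \<otimes> y') (y \<otimes> x')" using rt[OF Ws r(1) r'(1) x0] R unfolding V_def by blast
    then show ?thesis using r r' x0 R XY heq[OF Ws r(1) r'(1) x0 R] unfolding V_def by blast
  qed
  have h_iso: "h W \<in> ring_iso (structure_sheaf \<O> W) (structure_sheaf R (V W))" if W: "openin (zariski \<O>) W" for W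
  proof -
    note VW = V[OF W] and Vs = open_sub[OF V[OF W]] and Ws = O.open_sub[OF W]
    have hc: "h W s \<in> carrier (structure_sheaf R (V W))" if "s \<in> carrier (structure_sheaf \<O> W)" for s
      using sect[OF W that] frac_sec_section[OF VW] by auto
    have VW_empty: "V W = {} \<longleftrightarrow> W = {}"
    proof
      assume e: "V W = {}"
      show "W = {}"
      proof (rule ccontr)
        assume "W \<noteq> {}"
        then obtain Q where Q: "Q \<in> W" by blast
        then have "Q \<in> Qp ` U" using Ws Qim by auto
        then show False using e Q by (auto simp: V_def)
      qed
    qed (simp add: V_def)
    have ops: "h W (s \<otimes>\<^bsub>structure_sheaf \<O> W\<^esub> t) = h W s \<otimes>\<^bsub>structure_sheaf R (V W)\<^esub> h W t \<and>
        h W (s \<oplus>\<^bsub>structure_sheaf \<O> W\<^esub> t) = h W s \<oplus>\<^bsub>structure_sheaf R (V W)\<^esub> h W t"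
      if s: "s \<in> carrier (structure_sheaf \<O> W)" and t: "t \<in> carrier (structure_sheaf \<O> W)" for s t
    proof -
      obtain x y x' y' where s': "is_reg R U x y" "is_reg R U x' y'" "x' \<noteq> \<zero>" "is_reg \<O> W (fs x y) (fs x' y')"
        "is_reg R (V W) (x \<otimes> y') (y \<otimes> x')" "s = frac_sec \<O> W (fs x y) (fs x' y')" "h W s = frac_sec R (V W) (x \<otimes> y') (y \<otimes> x')"
        using sect[OF W s] by blast
      obtain a b a' b' where t': "is_reg R U a b" "is_reg R U a' b'" "a' \<noteq> \<zero>" "is_reg \<O> W (fs a b) (fs a' b')"
        "is_reg R (V W) (a \<otimes> b') (b \<otimes> a')" "t = frac_sec \<O> W (fs a b) (fs a' b')" "h W t = frac_sec R (V W) (a \<otimes> b') (b \<otimes> a')"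
        using sect[OF W t] by blast
      note k = regD[OF s'(1)] regD[OF s'(2)] regD[OF t'(1)] regD[OF t'(2)]
      note Om = O.is_reg_mult[OF Ws s'(4) t'(4)] and Rm = is_reg_mult[OF Vs s'(5) t'(5)]
      have dd: "x' \<otimes> a' \<noteq> \<zero>" using k s' t' by (simp add: integral_iff)
      have den: "fs x' y' \<otimes>\<^bsub>\<O>\<^esub> fs a' b' = fs (x' \<otimes> a') (y' \<otimes> b')" "is_reg R U (x' \<otimes> a') (y' \<otimes> b')"
        using fs_mult(1,2)[OF s'(2) t'(2)] by auto
      have num: "fs x y \<otimes>\<^bsub>\<O>\<^esub> fs a b = fs (x \<otimes> a) (y \<otimes> b)" "is_reg R U (x \<otimes> a) (y \<otimes> b)"
        using fs_mult(1,2)[OF s'(1) t'(1)] by auto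
      have m1: "is_reg R U (x \<otimes> a') (y \<otimes> b')" "is_reg R U (a \<otimes> x') (b \<otimes> y')"
        using fs_mult(1)[OF s'(1) t'(2)] fs_mult(1)[OF t'(1) s'(2)] by auto
      let ?n = "(x \<otimes> a') \<otimes> (b \<otimes> y') \<oplus> (a \<otimes> x') \<otimes> (y \<otimes> b')" and ?d = "(y \<otimes> b') \<otimes> (b \<otimes> y')"
      have numa: "(fs x y \<otimes>\<^bsub>\<O>\<^esub> fs a' b') \<oplus>\<^bsub>\<O>\<^esub> (fs a b \<otimes>\<^bsub>\<O>\<^esub> fs x' y') = fs ?n ?d" "is_reg R U ?n ?d"
        using fs_mult(2)[OF s'(1) t'(2)] fs_mult(2)[OF t'(1) s'(2)] fs_mult(3,4)[OF m1] by auto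
      have Rr: "is_reg \<O> W (fs (x \<otimes> a) (y \<otimes> b)) (fs (x' \<otimes> a') (y' \<otimes> b'))" "is_reg \<O> W (fs ?n ?d) (fs (x' \<otimes> a') (y' \<otimes> b'))"
        using Om(1,3) unfolding den(1) num(1) numa(1) by auto
      have mm: "h W (s \<otimes>\<^bsub>structure_sheaf \<O> W\<^esub> t) = frac_sec R (V W) ((x \<otimes> a) \<otimes> (y' \<otimes> b')) ((y \<otimes> b) \<otimes> (x' \<otimes> a'))"
        unfolding s'(6) t'(6) Om(2) den(1) num(1) V_def by (rule heq[OF Ws num(2) den(2) dd Rr(1)])
      have aa: "h W (s \<oplus>\<^bsub>structure_sheaf \<O> W\<^esub> t) = frac_sec R (V W) (?n \<otimes> (y' \<otimes> b')) (?d \<otimes> (x' \<otimes> a'))"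
        unfolding s'(6) t'(6) Om(4) den(1) numa(1) V_def by (rule heq[OF Ws numa(2) den(2) dd Rr(2)])
      have r1: "is_reg R (V W) ((x \<otimes> a) \<otimes> (y' \<otimes> b')) ((y \<otimes> b) \<otimes> (x' \<otimes> a'))"
        using rt[OF Ws num(2) den(2) dd] Rr(1) unfolding V_def by blast
      have r2: "is_reg R (V W) (?n \<otimes> (y' \<otimes> b')) (?d \<otimes> (x' \<otimes> a'))"
        using rt[OF Ws numa(2) den(2) dd] Rr(2) unfolding V_def by blast
      show ?thesis unfolding mm aa s'(7) t'(7) Rm(2) Rm(4)
      proof (intro conjI)
        show "frac_sec R (V W) ((x \<otimes> a) \<otimes> (y' \<otimes> b')) ((y \<otimes> b) \<otimes> (x' \<otimes> a'))
          = frac_sec R (V W) ((x \<otimes> y') \<otimes> (a \<otimes> b')) ((y \<otimes> x') \<otimes> (b \<otimes> a'))"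
          by (rule frac_sec_eqI[OF Vs r1 Rm(1)]) (use k in \<open>simp add: m_ac\<close>)
        show "frac_sec R (V W) (?n \<otimes> (y' \<otimes> b')) (?d \<otimes> (x' \<otimes> a'))
          = frac_sec R (V W) ((x \<otimes> y') \<otimes> (b \<otimes> a') \<oplus> (a \<otimes> b') \<otimes> (y \<otimes> x')) ((y \<otimes> x') \<otimes> (b \<otimes> a'))"
          by (rule frac_sec_eqI[OF Vs r2 Rm(3)]) (use k in \<open>simp add: l_distr r_distr m_ac\<close>)
      qed
    qed
    have one: "h W \<one>\<^bsub>structure_sheaf \<O> W\<^esub> = \<one>\<^bsub>structure_sheaf R (V W)\<^esub>"
    proof -
      have r: "is_reg R U \<one> \<one>" by (rule fs_const) simp
      have R: "is_reg \<O> W (fs \<one> \<one>) (fs \<one> \<one>)" unfolding fs_one_zero[symmetric] by (rule O.is_reg_const[OF Ws O.one_closed])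
      have "\<one>\<^bsub>structure_sheaf \<O> W\<^esub> = frac_sec \<O> W (fs \<one> \<one>) (fs \<one> \<one>)"
        using O.sheaf_one_zero(1)[OF Ws] fs_one_zero by simp
      then show ?thesis using heq[OF Ws r r one_not_zero R] sheaf_one_zero(1)[OF Vs] by (simp add: V_def)
    qed
    have inj: "s = t" if s: "s \<in> carrier (structure_sheaf \<O> W)" and t: "t \<in> carrier (structure_sheaf \<O> W)"
      and e: "h W s = h W t" for s t
    proof -
      obtain x y x' y' where s': "is_reg R U x y" "is_reg R U x' y'" "x' \<noteq> \<zero>" "is_reg \<O> W (fs x y) (fs x' y')"
        "is_reg R (V W) (x \<otimes> y') (y \<otimes> x')" "s = frac_sec \<O> W (fs x y) (fs x' y')" "h W s = frac_sec R (V W) (x \<otimes> y') (y \<otimes> x')"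
        using sect[OF W s] by blast
      obtain a b a' b' where t': "is_reg R U a b" "is_reg R U a' b'" "a' \<noteq> \<zero>" "is_reg \<O> W (fs a b) (fs a' b')"
        "is_reg R (V W) (a \<otimes> b') (b \<otimes> a')" "t = frac_sec \<O> W (fs a b) (fs a' b')" "h W t = frac_sec R (V W) (a \<otimes> b') (b \<otimes> a')"
        using sect[OF W t] by blast
      note k = regD[OF s'(1)] regD[OF s'(2)] regD[OF t'(1)] regD[OF t'(2)]
      show ?thesis
      proof (cases "W = {}")
        case True then show ?thesis unfolding s'(6) t'(6) by (auto simp: frac_sec_def fun_eq_iff restrict_def)
      next
        case False
        then obtain P where P: "P \<in> V W" using VW_empty by blast
        have "(x \<otimes> y') \<otimes> (b \<otimes> a') = (a \<otimes> b') \<otimes> (y \<otimes> x')"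
          by (rule frac_sec_eqD[OF Vs s'(5) t'(5) P]) (use e s'(7) t'(7) in simp)
        then have "(x \<otimes> a') \<otimes> (b \<otimes> y') = (a \<otimes> x') \<otimes> (y \<otimes> b')" using k by (simp add: m_ac)
        then have "fs x y \<otimes>\<^bsub>\<O>\<^esub> fs a' b' = fs a b \<otimes>\<^bsub>\<O>\<^esub> fs x' y'"
          unfolding fs_mult(2)[OF s'(1) t'(2)] fs_mult(2)[OF t'(1) s'(2)]
          by (subst fs_eq_iff[OF fs_mult(1)[OF s'(1) t'(2)] fs_mult(1)[OF t'(1) s'(2)]])
        then show ?thesis unfolding s'(6) t'(6) by (rule O.frac_sec_eqI[OF Ws s'(4) t'(4)])
      qed
    qed
    \<comment> \<open>A fraction \<open>a/b\<close> of elements of \<open>R\<close> is also a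
      fraction of the sections \<open>a/1\<close> and \<open>b/1\<close>.\<close>
    have surj: "\<exists>s\<in>carrier (structure_sheaf \<O> W). h W s = v" if v: "v \<in> carrier (structure_sheaf R (V W))" for v
    proof -
      obtain a b where ab: "is_reg R (V W) a b" "v = frac_sec R (V W) a b" by (rule section_is_frac_sec[OF VW v])
      note k = regD(1) ab(1)[unfolded is_reg_def]
      have k: "a \<in> carrier R" "b \<in> carrier R" "b \<noteq> \<zero>" using ab(1) by (auto simp: is_reg_def)
      note ra = fs_const[OF k(1)] and rb = fs_const[OF k(2)]
      have R: "is_reg \<O> W (fs a \<one>) (fs b \<one>)" using rt[OF Ws ra rb k(3)] ab(1) k unfolding V_def by simp
      have "h W (frac_sec \<O> W (fs a \<one>) (fs b \<one>)) = v"
        using heq[OF Ws ra rb k(3) R] k ab(2) by (simp add: V_def)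
      then show ?thesis using O.frac_sec_section[OF W R] by blast
    qed
    have "h W \<in> ring_hom (structure_sheaf \<O> W) (structure_sheaf R (V W))"
      by (rule ring_hom_memI) (use hc ops one in auto)
    moreover have "bij_betw (h W) (carrier (structure_sheaf \<O> W)) (carrier (structure_sheaf R (V W)))"
    proof (rule bij_betw_imageI)
      show "inj_on (h W) (carrier (structure_sheaf \<O> W))" by (rule inj_onI) (rule inj)
      show "h W ` carrier (structure_sheaf \<O> W) = carrier (structure_sheaf R (V W))" using hc surj by blast
    qed
    ultimately show ?thesis by (simp add: ring_iso_def)
  qed
  have res: "h W' (restrict s W') = restrict (h W s) (V W')"
    if W: "openin (zariski \<O>) W" "openin (zariski \<O>) W'" "W' \<subseteq> W" and s: "s \<in> carrier (structure_sheaf \<O> W)" for W W' s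
  proof -
    obtain x y x' y' where s': "is_reg R U x y" "is_reg R U x' y'" "x' \<noteq> \<zero>" "is_reg \<O> W (fs x y) (fs x' y')"
        "s = frac_sec \<O> W (fs x y) (fs x' y')" "h W s = frac_sec R (V W) (x \<otimes> y') (y \<otimes> x')"
      using sect[OF W(1) s] by blast
    have R: "is_reg \<O> W' (fs x y) (fs x' y')" using s'(4) W(3) unfolding is_reg_def by blast
    have "restrict s W' = frac_sec \<O> W' (fs x y) (fs x' y')"
      unfolding s'(5) using W(3) by (auto simp: frac_sec_def fun_eq_iff restrict_def)
    then have "h W' (restrict s W') = frac_sec R (V W') (x \<otimes> y') (y \<otimes> x')"
      using heq[OF O.open_sub[OF W(2)] s'(1-3) R] by (simp add: V_def)
    moreover have "V W' \<subseteq> V W" using W(3) by (auto simp: V_def)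
    then have "restrict (h W s) (V W') = frac_sec R (V W') (x \<otimes> y') (y \<otimes> x')"
      unfolding s'(6) by (auto simp: frac_sec_def fun_eq_iff restrict_def)
    ultimately show ?thesis by simp
  qed
  have "ringed_space_isomorphic (open_subspace (Spec R) U) (Spec \<O>)"
    unfolding ringed_space_isomorphic_def
  proof (intro exI[of _ Qp] exI[of _ "h"] conjI allI impI ballI)
    have simps: "rs_top (open_subspace (Spec R) U) = ?Z" "rs_sections (open_subspace (Spec R) U) = structure_sheaf R"
      "rs_res (open_subspace (Spec R) U) = (\<lambda>U V s. restrict s V)"
      "rs_top (Spec \<O>) = zariski \<O>" "rs_sections (Spec \<O>) = structure_sheaf \<O>" "rs_res (Spec \<O>) = (\<lambda>U V s. restrict s V)"
      by (simp_all add: open_subspace_def Spec_def)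
    show "homeomorphic_map (rs_top (open_subspace (Spec R) U)) (rs_top (Spec \<O>)) Qp" unfolding simps by (rule hom)
    show "h W \<in> ring_iso (rs_sections (Spec \<O>) W)
        (rs_sections (open_subspace (Spec R) U) {x \<in> topspace (rs_top (open_subspace (Spec R) U)). Qp x \<in> W})"
      if "openin (rs_top (Spec \<O>)) W" for W
      using h_iso[of W] that unfolding simps topZ V_def by blast
    show "h W' (rs_res (Spec \<O>) W W' s) = rs_res (open_subspace (Spec R) U)
           {x \<in> topspace (rs_top (open_subspace (Spec R) U)). Qp x \<in> W} {x \<in> topspace (rs_top (open_subspace (Spec R) U)). Qp x \<in> W'} (h W s)"
      if "openin (rs_top (Spec \<O>)) W \<and> openin (rs_top (Spec \<O>)) W' \<and> W' \<subseteq> W" "s \<in> carrier (rs_sections (Spec \<O>) W)" for W W' s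
      using res[of W W' s] that unfolding simps topZ V_def by blast
  qed
  then show "affine_ringed_space (open_subspace (Spec R) U)"
    unfolding affine_ringed_space_def using O.is_cring by blast
qed

end

section \<open>Divisorial ideals\<close>

text \<open>This is \<open>L(-N)\<close> when \<open>N\<close> is effective. Zero is included
  explicitly, because \<open>valuation\<close> carries no meaning at zero.\<close>

definition divisorial_ideal :: "('a, 'm) ring_scheme \<Rightarrow> ('a set \<Rightarrow>\<^sub>0 int) \<Rightarrow> 'a set" where
  "divisorial_ideal R N = {x \<in> carrier R. x = \<zero>\<^bsub>R\<^esub> \<or>
     (\<forall>P\<in>height_one_primes R. Poly_Mapping.lookup N P \<le> int (valuation R P x))}"

definition div_of :: "('a, 'm) ring_scheme \<Rightarrow> 'a \<Rightarrow> ('a set \<Rightarrow>\<^sub>0 int)" where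
  "div_of R a = Abs_poly_mapping (\<lambda>P. if P \<in> height_one_primes R then int (valuation R P a) else 0)"

lemma carrier_Div: "D \<in> carrier (Div R) \<longleftrightarrow> Poly_Mapping.keys D \<subseteq> height_one_primes R"
  by (simp add: Div_def)

lemma Div_lookup_outside: "D \<in> carrier (Div R) \<Longrightarrow> P \<notin> height_one_primes R \<Longrightarrow> Poly_Mapping.lookup D P = 0"
  unfolding carrier_Div by (auto simp: in_keys_iff)

lemma Div_eqI:
  assumes "D \<in> carrier (Div R)" "D' \<in> carrier (Div R)"
    "\<And>P. P \<in> height_one_primes R \<Longrightarrow> Poly_Mapping.lookup D P = Poly_Mapping.lookup D' P"
  shows "D = D'"
proof (rule poly_mapping_eqI)
  fix P show "Poly_Mapping.lookup D P = Poly_Mapping.lookup D' P"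
    using assms(3) Div_lookup_outside[OF assms(1)] Div_lookup_outside[OF assms(2)] by (cases "P \<in> height_one_primes R") auto
qed

lemma Div_closed:
  "D \<in> carrier (Div R) \<Longrightarrow> D' \<in> carrier (Div R) \<Longrightarrow> D + D' \<in> carrier (Div R)"
  "D \<in> carrier (Div R) \<Longrightarrow> D' \<in> carrier (Div R) \<Longrightarrow> D - D' \<in> carrier (Div R)"
  "D \<in> carrier (Div R) \<Longrightarrow> frag_cmul n D \<in> carrier (Div R)"
  "D \<in> carrier (Div R) \<Longrightarrow> - D \<in> carrier (Div R)"
  "0 \<in> carrier (Div R)"
  unfolding carrier_Div using keys_add[of D D'] keys_diff[of D D'] keys_cmul[of n D] by auto

section \<open>Arithmetic of divisors and divisorial ideals\<close>

context normal_domain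
begin

abbreviation "HP \<equiv> height_one_primes R"
abbreviation "dvi \<equiv> divisorial_ideal R"
abbreviation "lk \<equiv> Poly_Mapping.lookup"
abbreviation "dv \<equiv> div_of R"
abbreviation "eff D \<equiv> effective_divisor R D"

lemma lookup_div_of:
  assumes "a \<in> carrier R" "a \<noteq> \<zero>"
  shows "lk (dv a) P = (if P \<in> HP then int (valuation R P a) else 0)"
proof -
  have "finite {P. (if P \<in> HP then int (valuation R P a) else 0) \<noteq> 0}"
    by (rule finite_subset[OF _ finite_valuation_support[OF assms]]) auto
  then show ?thesis unfolding div_of_def by (simp add: lookup_Abs_poly_mapping)
qed

lemma div_of_Div: "a \<in> carrier R \<Longrightarrow> a \<noteq> \<zero> \<Longrightarrow> dv a \<in> carrier (Div R)"
  unfolding carrier_Div by (auto simp: in_keys_iff lookup_div_of split: if_splits)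

lemma div_of_mult:
  assumes "a \<in> carrier R" "a \<noteq> \<zero>" "b \<in> carrier R" "b \<noteq> \<zero>" shows "dv (a \<otimes> b) = dv a + dv b"
  by (rule poly_mapping_eqI)
    (use assms in \<open>auto simp: lookup_add lookup_div_of valuation_mult integral_iff\<close>)

lemma principal_iff:
  "D \<in> principal_divisors R \<longleftrightarrow> (\<exists>a\<in>carrier R - {\<zero>}. \<exists>b\<in>carrier R - {\<zero>}. D = dv a - dv b)"
proof
  assume "D \<in> principal_divisors R"
  then obtain a b where ab: "D \<in> carrier (Div R)" "a \<in> carrier R - {\<zero>}" "b \<in> carrier R - {\<zero>}"
    "\<forall>P\<in>HP. lk D P = int (valuation R P a) - int (valuation R P b)" unfolding principal_divisors_def by blast
  have "D = dv a - dv b"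
    by (rule Div_eqI[OF ab(1)]) (use ab in \<open>auto intro!: Div_closed div_of_Div simp: lookup_minus lookup_div_of\<close>)
  then show "\<exists>a\<in>carrier R - {\<zero>}. \<exists>b\<in>carrier R - {\<zero>}. D = dv a - dv b" using ab by blast
next
  assume "\<exists>a\<in>carrier R - {\<zero>}. \<exists>b\<in>carrier R - {\<zero>}. D = dv a - dv b"
  then obtain a b where ab: "a \<in> carrier R - {\<zero>}" "b \<in> carrier R - {\<zero>}" "D = dv a - dv b" by blast
  have "D \<in> carrier (Div R)" unfolding ab(3) using ab(1,2) by (auto intro!: Div_closed div_of_Div)
  moreover have "\<forall>P\<in>HP. lk D P = int (valuation R P a) - int (valuation R P b)"
    using ab by (auto simp: lookup_minus lookup_div_of)
  ultimately show "D \<in> principal_divisors R" unfolding principal_divisors_def using ab(1,2) by blast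
qed

lemma div_of_one: "dv \<one> = 0"
proof (rule poly_mapping_eqI)
  fix P
  have "valuation R P \<one> = 0" if P: "P \<in> HP"
    using valuation_0_iff[OF P one_closed one_not_zero] mult_closed.S_one[OF mult_closed_prime[OF ht1_prime[OF P]]] by simp
  then show "lk (dv \<one>) P = lk 0 P" by (simp add: lookup_div_of)
qed

lemma principal_closed:
  assumes "D \<in> principal_divisors R"
  shows "- D \<in> principal_divisors R" "D \<in> carrier (Div R)"
    "D' \<in> principal_divisors R \<Longrightarrow> D + D' \<in> principal_divisors R"
    "frag_cmul n D \<in> principal_divisors R"
proof -
  have P: "x - y \<in> principal_divisors R" if "x = dv a" "y = dv b" "a \<in> carrier R - {\<zero>}" "b \<in> carrier R - {\<zero>}" for a b x y
    using that principal_iff by blast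
  have plus: "D + D' \<in> principal_divisors R" if D: "D \<in> principal_divisors R" "D' \<in> principal_divisors R" for D D'
  proof -
    obtain a b where ab: "a \<in> carrier R - {\<zero>}" "b \<in> carrier R - {\<zero>}" "D = dv a - dv b" using D(1) principal_iff by blast
    obtain a' b' where ab': "a' \<in> carrier R - {\<zero>}" "b' \<in> carrier R - {\<zero>}" "D' = dv a' - dv b'" using D(2) principal_iff by blast
    have "D + D' = dv (a \<otimes> a') - dv (b \<otimes> b')" using ab ab' by (simp add: div_of_mult)
    then show ?thesis using P[OF refl refl, of "a \<otimes> a'" "b \<otimes> b'"] ab ab' by (auto simp: integral_iff)
  qed
  have uminus: "- D \<in> principal_divisors R" if D: "D \<in> principal_divisors R" for D
  proof -
    obtain a b where ab: "a \<in> carrier R - {\<zero>}" "b \<in> carrier R - {\<zero>}" "D = dv a - dv b" using D principal_iff by blast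
    then have "- D = dv b - dv a" by simp
    then show ?thesis using P[OF refl refl ab(2,1)] by simp
  qed
  have zero: "0 \<in> principal_divisors R" using P[OF refl refl, of \<one> \<one>] by simp
  show "- D \<in> principal_divisors R" by (rule uminus[OF assms])
  show "D \<in> carrier (Div R)" using assms by (simp add: principal_divisors_def)
  show "D' \<in> principal_divisors R \<Longrightarrow> D + D' \<in> principal_divisors R" by (rule plus[OF assms])
  have nat: "frag_cmul (int k) D \<in> principal_divisors R" for k
  proof (induction k)
    case (Suc k)
    have "frag_cmul (int (Suc k)) D = D + frag_cmul (int k) D" by (simp add: frag_cmul_distrib)
    then show ?case using plus[OF assms Suc] by simp
  qed (simp add: zero)
  show "frag_cmul n D \<in> principal_divisors R"
  proof (cases n)
    case (nonneg k) then show ?thesis using nat by simp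
  next
    case (neg k)
    have e: "frag_cmul n D = - frag_cmul (int (Suc k)) D" unfolding neg by (rule poly_mapping_eqI) simp
    show ?thesis unfolding e by (rule uminus[OF nat])
  qed
qed

lemma zero_principal: "0 \<in> principal_divisors R"
  using principal_iff[of 0] div_of_one by (auto intro!: bexI[of _ \<one>])

lemma dviD: "x \<in> dvi N \<Longrightarrow> x \<in> carrier R"
  "x \<in> dvi N \<Longrightarrow> x \<noteq> \<zero> \<Longrightarrow> P \<in> HP \<Longrightarrow> lk N P \<le> int (valuation R P x)"
  by (auto simp: divisorial_ideal_def)

lemma dviI: "x \<in> carrier R \<Longrightarrow> (\<And>P. x \<noteq> \<zero> \<Longrightarrow> P \<in> HP \<Longrightarrow> lk N P \<le> int (valuation R P x)) \<Longrightarrow> x \<in> dvi N"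
  by (auto simp: divisorial_ideal_def)

lemma dvi_mult:
  assumes "x \<in> dvi N" "y \<in> dvi M" shows "x \<otimes> y \<in> dvi (N + M)"
proof (rule dviI)
  show "x \<otimes> y \<in> carrier R" using assms dviD by simp
  fix P assume *: "x \<otimes> y \<noteq> \<zero>" "P \<in> HP"
  then have "x \<noteq> \<zero>" "y \<noteq> \<zero>" using assms dviD(1) by auto
  then show "lk (N + M) P \<le> int (valuation R P (x \<otimes> y))"
    using dviD[OF assms(1)] dviD[OF assms(2)] *(2) by (fastforce simp: lookup_add valuation_mult)
qed

lemma dvi_one: "\<one> \<in> dvi 0"
  by (rule dviI) auto

lemma dvi_self: "a \<in> carrier R \<Longrightarrow> a \<noteq> \<zero> \<Longrightarrow> a \<in> dvi (dv a)"
  by (rule dviI) (auto simp: lookup_div_of)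

lemma dvi_mono: "x \<in> dvi N \<Longrightarrow> (\<And>P. P \<in> HP \<Longrightarrow> lk M P \<le> lk N P) \<Longrightarrow> x \<in> dvi M"
  by (rule dviI) (use dviD in \<open>force+\<close>)

lemma dvi_ideal: "ideal (dvi N) R"
proof (rule idealI[OF ring_axioms])
  have l: "r \<otimes> x \<in> dvi N" if x: "x \<in> dvi N" and r: "r \<in> carrier R" for x r
  proof (rule dviI)
    show "r \<otimes> x \<in> carrier R" using x r dviD by simp
    fix P assume *: "r \<otimes> x \<noteq> \<zero>" "P \<in> HP"
    then have "x \<noteq> \<zero>" "r \<noteq> \<zero>" using x r dviD(1) by auto
    then show "lk N P \<le> int (valuation R P (r \<otimes> x))"
      using dviD[OF x] *(2) r by (fastforce simp: valuation_mult)
  qed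
  show "subgroup (dvi N) (add_monoid R)"
  proof (rule subgroup.intro)
    show "dvi N \<subseteq> carrier (add_monoid R)" using dviD by auto
    fix x y assume xy: "x \<in> dvi N" "y \<in> dvi N"
    have "x \<oplus> y \<in> dvi N"
    proof (cases "x = \<zero> \<or> y = \<zero>")
      case True then show ?thesis using xy dviD(1)[OF xy(1)] dviD(1)[OF xy(2)] by auto
    next
      case False
      note c = dviD(1)[OF xy(1)] dviD(1)[OF xy(2)]
      show ?thesis
      proof (rule dviI)
        fix P assume P: "x \<oplus> y \<noteq> \<zero>" "P \<in> HP"
        \<comment> \<open>A negative coefficient imposes no condition on elements of
          \<open>R\<close>, so it may be cut off at zero.\<close>
        define n where "n = nat (lk N P)"
        have "n \<le> valuation R P x" "n \<le> valuation R P y"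
          using dviD(2)[OF xy(1) _ P(2)] dviD(2)[OF xy(2) _ P(2)] False by (auto simp: n_def)
        then have "n \<le> valuation R P (x \<oplus> y)" using False by (intro valuation_add[OF P(2) c(1) _ c(2) _ P(1)]) auto
        then show "lk N P \<le> int (valuation R P (x \<oplus> y))" by (simp add: n_def)
      qed (use c in simp)
    qed
    then show "x \<otimes>\<^bsub>add_monoid R\<^esub> y \<in> dvi N" by simp
  next
    show "\<one>\<^bsub>add_monoid R\<^esub> \<in> dvi N" by (simp add: divisorial_ideal_def)
    fix x assume x: "x \<in> dvi N"
    have "\<ominus> x = (\<ominus> \<one>) \<otimes> x" using dviD(1)[OF x] by (simp add: l_minus)
    then have "\<ominus> x \<in> dvi N" using l[OF x, of "\<ominus> \<one>"] by simp
    then show "inv\<^bsub>add_monoid R\<^esub> x \<in> dvi N" by (simp only: a_inv_def)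
  qed
  fix x r assume x: "x \<in> dvi N" and r: "r \<in> carrier R"
  show "r \<otimes> x \<in> dvi N" by (rule l[OF x r])
  then show "x \<otimes> r \<in> dvi N" using dviD(1)[OF x] r by (simp add: m_comm)
qed

text \<open>Divisibility by \<open>a\<close> can be tested at height one primes, where effectivity
  of \<open>M\<close> guarantees it; hence \<open>L(-(div a + M)) = a L(-M)\<close>.\<close>

lemma dvi_divide:
  assumes a: "a \<in> carrier R" "a \<noteq> \<zero>" and x: "x \<in> dvi (dv a + M)" and M: "\<And>P. P \<in> HP \<Longrightarrow> 0 \<le> lk M P"
  obtains z where "z \<in> dvi M" "x = a \<otimes> z"
proof (cases "x = \<zero>")
  case True
  then show ?thesis using that[of \<zero>] a by (simp add: divisorial_ideal_def)
next
  case False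
  note xc = dviD(1)[OF x]
  have v: "int (valuation R P a) + lk M P \<le> int (valuation R P x)" if "P \<in> HP" for P
    using dviD(2)[OF x False that] that by (simp add: lookup_add lookup_div_of[OF a])
  have "a divides x"
  proof (rule hartogs[OF xc False a])
    fix P assume "P \<in> HP"
    then show "valuation R P a \<le> valuation R P x" using v[of P] M[of P] by simp
  qed
  then obtain z where z: "z \<in> carrier R" "x = a \<otimes> z" by (rule dividesE)
  have "z \<in> dvi M"
  proof (rule dviI[OF z(1)])
    fix P assume "z \<noteq> \<zero>" "P \<in> HP"
    then show "lk M P \<le> int (valuation R P z)"
      using v[of P] valuation_mult[OF _ a z(1)] unfolding z(2) by simp
  qed
  then show ?thesis using that z by blast
qed

lemma effD: "eff D \<Longrightarrow> D \<in> carrier (Div R)" "eff D \<Longrightarrow> 0 \<le> lk D P"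
  by (auto simp: effective_divisor_def)

lemma effI: "D \<in> carrier (Div R) \<Longrightarrow> (\<And>P. P \<in> HP \<Longrightarrow> 0 \<le> lk D P) \<Longrightarrow> eff D"
  using Div_lookup_outside unfolding effective_divisor_def by (metis order_refl)

lemma effective_complement:
  assumes N: "eff N" and a: "a \<in> dvi N" "a \<noteq> \<zero>" shows "eff (dv a - N)"
proof (rule effI)
  note ac = dviD(1)[OF a(1)]
  show "dv a - N \<in> carrier (Div R)" by (rule Div_closed(2)[OF div_of_Div[OF ac a(2)] effD(1)[OF N]])
  show "0 \<le> lk (dv a - N) P" if P: "P \<in> HP" for P
    using dviD(2)[OF a P] P by (simp add: lookup_minus lookup_div_of[OF ac a(2)])
qed

text \<open>For each of the finitely many \<open>P\<close> in the support of \<open>M\<close> choose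
  an element of \<open>P\<close> outside \<open>Q\<close>; the product of suitable powers lies in
  \<open>L(-M)\<close> and, \<open>Q\<close> being prime, outside \<open>Q\<close>.\<close>

lemma dvi_avoid_prime:
  assumes Q: "primeideal Q R" and M: "eff M" and avoid: "\<And>P. P \<in> Poly_Mapping.keys M \<Longrightarrow> \<not> P \<subseteq> Q"
  obtains y where "y \<in> dvi M" "y \<notin> Q"
proof -
  interpret Q: primeideal Q R by fact
  have "\<exists>y\<in>carrier R - Q. \<forall>P\<in>F. lk M P \<le> int (valuation R P y)" if "finite F" "F \<subseteq> Poly_Mapping.keys M" for F
    using that
  proof (induction F)
    case empty show ?case using mult_closed.S_one[OF mult_closed_prime[OF Q]] by blast
  next
    case (insert P F)
    then obtain y where y: "y \<in> carrier R - Q" "\<forall>P\<in>F. lk M P \<le> int (valuation R P y)" by auto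
    have P: "P \<in> HP" using insert.prems effD(1)[OF M] unfolding carrier_Div by blast
    obtain t where t: "t \<in> P" "t \<notin> Q" using avoid insert.prems by blast
    interpret P: primeideal P R by (rule ht1_prime[OF P])
    have tc: "t \<in> carrier R" "t \<noteq> \<zero>" using t P.Icarr Q.zero_closed by auto
    have yc: "y \<in> carrier R" "y \<noteq> \<zero>" using y(1) Q.zero_closed by auto
    define k where "k = nat (lk M P)"
    have tk: "t [^] k \<in> carrier R - Q" using pow_not_in_prime[OF Q] tc t by blast
    have tk0: "t [^] k \<noteq> \<zero>" by (rule pow_nonzero[OF tc])
    have z: "y \<otimes> t [^] k \<in> carrier R - Q" by (rule mult_closed.S_mult[OF mult_closed_prime[OF Q] y(1) tk])
    have val: "valuation R P' (y \<otimes> t [^] k) = valuation R P' y + k * valuation R P' t" if "P' \<in> HP" for P'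
      using valuation_mult[OF that yc _ tk0] valuation_pow[OF that tc] tc by simp
    have "valuation R P t \<noteq> 0" using valuation_0_iff[OF P tc] t by simp
    then have "k \<le> k * valuation R P t" by (cases "valuation R P t") auto
    then have "k \<le> valuation R P y + k * valuation R P t" by (rule trans_le_add2)
    then have "k \<le> valuation R P (y \<otimes> t [^] k)" by (simp only: val[OF P])
    then have 1: "lk M P \<le> int (valuation R P (y \<otimes> t [^] k))" by (simp add: k_def)
    have 2: "lk M P' \<le> int (valuation R P' (y \<otimes> t [^] k))" if "P' \<in> F" for P'
    proof -
      have "P' \<in> HP" using that insert.prems effD(1)[OF M] unfolding carrier_Div by blast
      then have "valuation R P' y \<le> valuation R P' (y \<otimes> t [^] k)" using val by simp
      moreover have "lk M P' \<le> int (valuation R P' y)" using y(2) that by (rule bspec)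
      ultimately show ?thesis by linarith
    qed
    show ?case using z 1 2 by blast
  qed
  from this[OF finite_keys subset_refl] obtain y where y: "y \<in> carrier R - Q" "\<forall>P\<in>Poly_Mapping.keys M. lk M P \<le> int (valuation R P y)" by blast
  have "y \<in> dvi M"
  proof (rule dviI)
    fix P show "lk M P \<le> int (valuation R P y)"
      using y(2) by (cases "P \<in> Poly_Mapping.keys M") (auto simp: in_keys_iff)
  qed (use y in simp)
  then show ?thesis using that y by blast
qed

lemma ht1_not_zero: "P \<in> HP \<Longrightarrow> \<not> P \<subseteq> {\<zero>}"
proof -
  assume "P \<in> HP"
  then have "primeideal P R" "P \<noteq> {\<zero>}" by (auto simp: height_one_iff)
  then show ?thesis by (auto simp: primeideal_def dest: additive_subgroup.zero_closed[OF ideal.axioms(1)])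
qed

lemma ht1_incomparable: "P \<in> HP \<Longrightarrow> Q \<in> HP \<Longrightarrow> P \<subseteq> Q \<Longrightarrow> P = Q"
  by (auto simp: height_one_iff)

lemma dvi_nonzero:
  assumes "eff M" obtains y where "y \<in> dvi M" "y \<noteq> \<zero>"
proof -
  obtain y where "y \<in> dvi M" "y \<notin> {\<zero>}"
    by (rule dvi_avoid_prime[OF zeroprimeideal assms]) (use ht1_not_zero effD(1)[OF assms] in \<open>auto simp: carrier_Div\<close>)
  then show ?thesis using that by blast
qed

text \<open>\<open>dvi_avoid_prime\<close>, applied with \<open>Q = p\<close> to \<open>M\<close>
  without its component \<open>p\<close>, gives an element of order zero at \<open>p\<close>; a
  power of the uniformizer then adds exactly the required order. Such elements detect single
  coefficients when \<open>L(-N)\<close> is written as a colon ideal.\<close>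

lemma dvi_exact:
  assumes M: "eff M" and p: "p \<in> HP"
  obtains y where "y \<in> dvi M" "y \<noteq> \<zero>" "int (valuation R p y) = lk M p"
proof -
  define k where "k = nat (lk M p)"
  define M0 where "M0 = M - frag_cmul (int k) (frag_of p)"
  have lM0: "lk M0 P = (if P = p then 0 else lk M P)" for P
    using effD(2)[OF M, of p] by (simp add: M0_def lookup_minus k_def lookup_frag_of)
  have M0: "eff M0"
  proof (rule effI)
    show "M0 \<in> carrier (Div R)" unfolding carrier_Div using lM0 effD(1)[OF M]
      by (auto simp: in_keys_iff carrier_Div split: if_splits)
    show "0 \<le> lk M0 P" for P using effD(2)[OF M] lM0 by simp
  qed
  have "\<not> P \<subseteq> p" if "P \<in> Poly_Mapping.keys M0" for P
  proof
    assume "P \<subseteq> p"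
    moreover have "P \<in> HP" using that effD(1)[OF M0] by (auto simp: carrier_Div)
    ultimately have "P = p" using ht1_incomparable p by blast
    then show False using that lM0[of P] by (simp add: in_keys_iff)
  qed
  then obtain y where y: "y \<in> dvi M0" "y \<notin> p" by (rule dvi_avoid_prime[OF ht1_prime[OF p] M0])
  interpret p: primeideal p R by (rule ht1_prime[OF p])
  have yc: "y \<in> carrier R" "y \<noteq> \<zero>" using dviD(1)[OF y(1)] y(2) p.zero_closed by auto
  note t = unif(4,1)[OF p]
  have tk: "unif p [^] k \<in> carrier R" "unif p [^] k \<noteq> \<zero>" using t pow_nonzero by auto
  have vp: "valuation R p (unif p [^] k) = k" using valuation_pow[OF p t] valuation_unif[OF p] by simp
  have tkM: "unif p [^] k \<in> dvi (frag_cmul (int k) (frag_of p))"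
    by (rule dviI[OF tk(1)]) (use vp in \<open>auto simp: lookup_frag_of\<close>)
  have "y \<otimes> unif p [^] k \<in> dvi (M0 + frag_cmul (int k) (frag_of p))" by (rule dvi_mult[OF y(1) tkM])
  moreover have "M0 + frag_cmul (int k) (frag_of p) = M" by (simp add: M0_def)
  moreover have "valuation R p (y \<otimes> unif p [^] k) = k"
    using valuation_mult[OF p yc tk] vp valuation_0_iff[OF p yc] y(2) by simp
  moreover have "int k = lk M p" using effD(2)[OF M, of p] by (simp add: k_def)
  moreover have "y \<otimes> unif p [^] k \<noteq> \<zero>" using yc tk by (simp add: integral_iff)
  ultimately show ?thesis using that[of "y \<otimes> unif p [^] k"] by simp
qed

text \<open>The support of \<open>D\<close> is the zero set of \<open>L(-D)\<close>: a prime
  containing no component of \<open>D\<close> is avoided by an element of \<open>L(-D)\<close>, and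
  each component contains \<open>L(-D)\<close>.\<close>

lemma support_complement:
  assumes D: "eff D"
  shows "prime_spectrum R - divisor_support R D = {P \<in> prime_spectrum R. \<not> dvi D \<subseteq> P}"
proof -
  have "dvi D \<subseteq> Q \<longleftrightarrow> (\<exists>P\<in>Poly_Mapping.keys D. P \<subseteq> Q)" if Q: "primeideal Q R" for Q
  proof
    assume sub: "dvi D \<subseteq> Q"
    show "\<exists>P\<in>Poly_Mapping.keys D. P \<subseteq> Q"
    proof (rule ccontr)
      assume neg: "\<not> ?thesis"
      obtain y where "y \<in> dvi D" "y \<notin> Q" by (rule dvi_avoid_prime[OF Q D]) (use neg in auto)
      then show False using sub by blast
    qed
  next
    assume "\<exists>P\<in>Poly_Mapping.keys D. P \<subseteq> Q"
    then obtain P where P: "P \<in> Poly_Mapping.keys D" "P \<subseteq> Q" by blast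
    have PH: "P \<in> HP" using P effD(1)[OF D] by (auto simp: carrier_Div)
    interpret P: primeideal P R by (rule ht1_prime[OF PH])
    have "lk D P > 0" using P(1) effD(2)[OF D, of P] by (simp add: in_keys_iff order_less_le)
    have "x \<in> P" if x: "x \<in> dvi D" for x
    proof (cases "x = \<zero>")
      case False
      then have "valuation R P x \<noteq> 0" using dviD(2)[OF x False PH] \<open>lk D P > 0\<close> by simp
      then show ?thesis using valuation_0_iff[OF PH dviD(1)[OF x] False] by simp
    qed (use P.zero_closed in simp)
    then show "dvi D \<subseteq> Q" using P(2) by blast
  qed
  then show ?thesis unfolding divisor_support_def prime_spectrum_def by blast
qed

text \<open>If \<open>D' - D = div (x/y)\<close>, then \<open>x b / y\<close> has divisor
  \<open>N + D' \<ge> 0\<close>, so it lies in the ring; it is the required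
  \<open>g\<close>.\<close>

lemma effective_equivalent_iff:
  assumes D: "D \<in> carrier (Div R)" and b: "b \<in> carrier R" "b \<noteq> \<zero>" and N: "N = dv b - D" "eff N"
  shows "eff D' \<and> linearly_equivalent R D' D \<longleftrightarrow> (\<exists>g\<in>dvi N. g \<noteq> \<zero> \<and> D' = dv g - N)"
proof
  assume D': "eff D' \<and> linearly_equivalent R D' D"
  then obtain x y where xy: "x \<in> carrier R" "x \<noteq> \<zero>" "y \<in> carrier R" "y \<noteq> \<zero>" "D' - D = dv x - dv y"
    by (auto simp: linearly_equivalent_def principal_iff)
  have xb: "x \<otimes> b \<in> carrier R" "x \<otimes> b \<noteq> \<zero>" using xy b by (auto simp: integral_iff)
  have D'_eq: "D' = (dv x - dv y) + D" using xy(5) by (metis diff_add_cancel)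
  have e: "dv (x \<otimes> b) = dv y + (N + D')" unfolding D'_eq N(1) div_of_mult[OF xy(1,2) b] by simp
  have pos: "0 \<le> lk (N + D') P" for P using effD(2)[OF N(2)] effD(2) D' by (simp add: lookup_add)
  obtain g where g: "g \<in> dvi (N + D')" "x \<otimes> b = y \<otimes> g"
    by (rule dvi_divide[OF xy(3,4), of "x \<otimes> b" "N + D'"]) (use dvi_self[OF xb] e pos in auto)
  have g0: "g \<noteq> \<zero>" using g(2) xb(2) xy(3) by auto
  have "dv y + dv g = dv y + (N + D')" using div_of_mult[OF xy(3,4) dviD(1)[OF g(1)] g0] g(2) e by simp
  then have "D' = dv g - N" by simp
  moreover have "g \<in> dvi N" by (rule dvi_mono[OF g(1)]) (use effD(2) D' in \<open>simp add: lookup_add\<close>)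
  ultimately show "\<exists>g\<in>dvi N. g \<noteq> \<zero> \<and> D' = dv g - N" using g0 by blast
next
  assume "\<exists>g\<in>dvi N. g \<noteq> \<zero> \<and> D' = dv g - N"
  then obtain g where g: "g \<in> dvi N" "g \<noteq> \<zero>" "D' = dv g - N" by blast
  note gc = dviD(1)[OF g(1)]
  have "eff D'" unfolding g(3)
    by (rule effI) (use div_of_Div[OF gc g(2)] effD(1)[OF N(2)] dviD(2)[OF g(1,2)] in
        \<open>auto intro: Div_closed simp: lookup_minus lookup_div_of[OF gc g(2)]\<close>)
  moreover have "D' - D = dv g - dv b" unfolding g(3) N(1) by simp
  then have "linearly_equivalent R D' D" unfolding linearly_equivalent_def principal_iff using gc g(2) b by auto
  ultimately show "eff D' \<and> linearly_equivalent R D' D" by blast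
qed

text \<open>For \<open>D' = div g - N\<close> and \<open>M = div a - N\<close> one has
  \<open>L(-D') = (g/a) L(-M)\<close>, and fractions with poles bounded by \<open>(m+1) D'\<close>
  become elements of \<open>L(-(m+1) N)\<close> after multiplication by \<open>g^(m+1)\<close>. One
  factor \<open>g\<close> cancels, which explains \<open>m\<close> in \<open>a g^m\<close> against
  \<open>m + 1\<close> here.\<close>

definition prod_ideal :: "('a set \<Rightarrow>\<^sub>0 int) \<Rightarrow> ('a set \<Rightarrow>\<^sub>0 int) \<Rightarrow> nat \<Rightarrow> 'a set" where
  "prod_ideal M N m = dvi M \<cdot> dvi (frag_cmul (int m + 1) N)"

lemma prod_ideal_ideal: "ideal (prod_ideal M N m) R"
  unfolding prod_ideal_def by (rule ideal_prod_is_ideal[OF dvi_ideal dvi_ideal])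

text \<open>With \<open>a \<in> L(-N)\<close> and \<open>M = div a - N\<close>, the condition on \<open>g\<close> reads \<open>1 \<in> L(-D') L(m D')\<close>,
  cleared of denominators, for the divisor \<open>D' = div g - N\<close>.\<close>

lemma affine_complement_iff:
  assumes N: "eff N" and a: "a \<in> dvi N" "a \<noteq> \<zero>" and M: "M = dv a - N" and g: "g \<in> dvi N" "g \<noteq> \<zero>"
  shows "affine_ringed_space (open_subspace (Spec R) (prime_spectrum R - divisor_support R (dv g - N)))
    \<longleftrightarrow> (\<exists>m::nat. a \<otimes> g [^] m \<in> prod_ideal M N m)"
proof -
  define D' where "D' = dv g - N"
  note ac = dviD(1)[OF a(1)] and gc = dviD(1)[OF g(1)]
  have D': "eff D'" unfolding D'_def
    by (rule effI) (use div_of_Div[OF gc g(2)] effD(1)[OF N] dviD(2)[OF g] in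
        \<open>auto intro: Div_closed simp: lookup_minus lookup_div_of[OF gc g(2)]\<close>)
  have Mpos: "0 \<le> lk M P" if "P \<in> HP" for P
    unfolding M using dviD(2)[OF a that] by (simp add: lookup_minus lookup_div_of[OF ac a(2)] that)
  obtain j where j: "j \<in> dvi D'" "j \<noteq> \<zero>" by (rule dvi_nonzero[OF D'])
  interpret oc: open_complement R "dvi D'"
    by (intro open_complement.intro open_complement_axioms.intro domain_axioms dvi_ideal) (use j in blast)
  have U: "prime_spectrum R - divisor_support R (dv g - N) = oc.U"
    unfolding oc.U_def D'_def[symmetric] by (rule support_complement[OF D'])
  \<comment> \<open>Height one primes are incomparable, so only the coefficient at \<open>P\<close>
    itself matters.\<close>
  have inU: "P \<in> oc.U \<longleftrightarrow> lk D' P = 0" if P: "P \<in> HP" for P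
  proof -
    have Pp: "P \<in> prime_spectrum R" using ht1_prime[OF P] by (simp add: prime_spectrum_def)
    have "P \<in> oc.U \<longleftrightarrow> \<not> (\<exists>P'\<in>Poly_Mapping.keys D'. P' \<subseteq> P)"
      unfolding U[symmetric] D'_def[symmetric] divisor_support_def using Pp by blast
    also have "\<dots> \<longleftrightarrow> P \<notin> Poly_Mapping.keys D'"
      using ht1_incomparable[OF _ P] effD(1)[OF D'] unfolding carrier_Div by blast
    finally show ?thesis by (simp add: in_keys_iff)
  qed
  \<comment> \<open>Regularity on an open set is a condition at its height one primes, by the local
    Hartogs property.\<close>
  have reg: "is_reg R oc.U x y \<longleftrightarrow> (\<forall>P\<in>HP. P \<in> oc.U \<longrightarrow> valuation R P y \<le> valuation R P x)"
    if x: "x \<in> carrier R" "x \<noteq> \<zero>" and y: "y \<in> carrier R" "y \<noteq> \<zero>" for x y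
  proof
    assume r: "is_reg R oc.U x y"
    show "\<forall>P\<in>HP. P \<in> oc.U \<longrightarrow> valuation R P y \<le> valuation R P x"
    proof (intro ballI impI)
      fix P assume P: "P \<in> HP" "P \<in> oc.U"
      obtain t b where t: "t \<in> carrier R - P" "b \<in> carrier R" "x \<otimes> t = b \<otimes> y" using r P(2) unfolding is_reg_def by blast
      have "t \<otimes> x = y \<otimes> b" using t x y by (simp add: m_comm)
      then have "y divides t \<otimes> x" using t(2) by (auto intro: dividesI)
      then show "valuation R P y \<le> valuation R P x" using valuation_le_iff[OF P(1) x y] t(1) by blast
    qed
  next
    assume le: "\<forall>P\<in>HP. P \<in> oc.U \<longrightarrow> valuation R P y \<le> valuation R P x"
    have "\<exists>t\<in>carrier R - Q. \<exists>b\<in>carrier R. x \<otimes> t = b \<otimes> y" if Q: "Q \<in> oc.U" for Q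
    proof -
      have "\<exists>s\<in>carrier R - Q. y divides s \<otimes> x"
      proof (rule local_hartogs[OF oc.U_prime[OF Q] x y])
        fix P assume P: "P \<in> HP" "P \<subseteq> Q"
        have "P \<in> prime_spectrum R" using ht1_prime[OF P(1)] by (simp add: prime_spectrum_def)
        then have "P \<in> oc.U" using Q P(2) by (auto simp: oc.U_def)
        then show "valuation R P y \<le> valuation R P x" using le P(1) by blast
      qed
      then obtain s where s: "s \<in> carrier R - Q" "y divides s \<otimes> x" by blast
      obtain b where b: "b \<in> carrier R" "s \<otimes> x = y \<otimes> b" using s(2) by (rule dividesE)
      then have "x \<otimes> s = b \<otimes> y" using s(1) x y by (simp add: m_comm)
      then show ?thesis using s(1) b(1) by blast
    qed
    then show "is_reg R oc.U x y" unfolding is_reg_def using x y by blast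
  qed
  have reg0: "is_reg R oc.U \<zero> y" if "y \<in> carrier R" "y \<noteq> \<zero>" for y
  proof -
    have "\<exists>t\<in>carrier R - P. \<exists>b\<in>carrier R. \<zero> \<otimes> t = b \<otimes> y" if "P \<in> oc.U" for P
      using mult_closed.S_one[OF mult_closed_prime[OF oc.U_prime[OF that]]] \<open>y \<in> carrier R\<close>
      by (intro bexI[of _ \<one>] bexI[of _ \<zero>]) auto
    then show ?thesis using that by (simp add: is_reg_def)
  qed
  \<comment> \<open>This identity drives both directions: it matches \<open>f\<close> in
    \<open>L(-D')\<close> with \<open>p\<close> in \<open>L(-M)\<close> through
    \<open>g p = a f\<close>.\<close>
  have MgD: "M + dv g = dv a + D'" unfolding M D'_def by simp
  have cgN: "lk (frag_cmul (int m + 1) N) P = (int m + 1) * lk N P" for m P by simp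
  have gpow: "g [^] m \<in> carrier R" "g [^] m \<noteq> \<zero>" for m :: nat using gc pow_nonzero[OF gc g(2)] by auto
  show ?thesis unfolding U oc.affine_iff
  proof
    assume "\<exists>m::nat. a \<otimes> g [^] m \<in> prod_ideal M N m"
    then obtain m :: nat where m: "a \<otimes> g [^] m \<in> prod_ideal M N m" by blast
    \<comment> \<open>The common denominator of all sections \<open>q / g^(m+1)\<close>; these are
      regular on \<open>U\<close>, where the order of \<open>g\<close> is the coefficient of
      \<open>N\<close>.\<close>
    define y where "y = g [^] Suc m"
    have y: "y \<in> carrier R" "y \<noteq> \<zero>" unfolding y_def by (rule gpow)+
    have "\<exists>z. z \<in> dvi D' \<cdot> oc.D y \<and> z \<in> carrier R \<and> w \<otimes> g = a \<otimes> z" if "w \<in> prod_ideal M N m" for w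
      using that unfolding prod_ideal_def
    proof (induction)
      case (prod p q)
      have "p \<otimes> g \<in> dvi (dv a + D')" using dvi_mult[OF prod(1) dvi_self[OF gc g(2)]] MgD by simp
      then obtain f where f: "f \<in> dvi D'" "p \<otimes> g = a \<otimes> f" by (rule dvi_divide[OF ac a(2) _ effD(2)[OF D']])
      note qc = dviD(1)[OF prod(2)] and pc = dviD(1)[OF prod(1)] and fc = dviD(1)[OF f(1)]
      have "q \<in> oc.D y"
      proof (cases "q = \<zero>")
        case True then show ?thesis using reg0[OF y] by (simp add: oc.D_def)
      next
        case False
        have "valuation R P y \<le> valuation R P q" if P: "P \<in> HP" "P \<in> oc.U" for P
        proof -
          have "int (valuation R P g) = lk N P"
            using inU[OF P(1)] P by (simp add: D'_def lookup_minus lookup_div_of[OF gc g(2)])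
          then have "int (valuation R P y) = (int m + 1) * lk N P"
            unfolding y_def valuation_pow[OF P(1) gc g(2)] by (simp add: distrib_right)
          then show ?thesis using dviD(2)[OF prod(2) False P(1)] cgN by simp
        qed
        then show ?thesis using reg[OF qc False y] by (simp add: oc.D_def)
      qed
      then have "f \<otimes> q \<in> dvi D' \<cdot> oc.D y" by (rule ideal_prod.prod[OF f(1)])
      moreover have "(p \<otimes> q) \<otimes> g = (p \<otimes> g) \<otimes> q" using pc qc gc by (simp add: m_ac)
      then have "(p \<otimes> q) \<otimes> g = a \<otimes> (f \<otimes> q)" unfolding f(2) using ac fc qc by (simp add: m_assoc)
      ultimately show ?case using fc qc by blast
    next
      case (sum s1 s2)
      then obtain z1 z2 where z: "z1 \<in> dvi D' \<cdot> oc.D y" "z1 \<in> carrier R" "s1 \<otimes> g = a \<otimes> z1"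
        "z2 \<in> dvi D' \<cdot> oc.D y" "z2 \<in> carrier R" "s2 \<otimes> g = a \<otimes> z2" by blast
      have "s1 \<in> carrier R" "s2 \<in> carrier R"
        using sum(1,2) ideal.Icarr[OF prod_ideal_ideal[of M N m]] unfolding prod_ideal_def by auto
      then have "(s1 \<oplus> s2) \<otimes> g = a \<otimes> (z1 \<oplus> z2)" using z gc ac by (simp add: l_distr r_distr)
      then show ?case using ideal_prod.sum[OF z(1,4)] z by blast
    qed
    then obtain z where z: "z \<in> dvi D' \<cdot> oc.D y" "z \<in> carrier R" "(a \<otimes> g [^] m) \<otimes> g = a \<otimes> z" using m by blast
    have "a \<otimes> y = a \<otimes> z" unfolding y_def z(3)[symmetric] using ac gc by (simp add: m_assoc)
    then have "y = z" using ac a(2) y z(2) by (simp add: m_lcancel)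
    then show "\<exists>y\<in>carrier R. y \<noteq> \<zero> \<and> y \<in> dvi D' \<cdot> oc.D y" using y z(1) by blast
  next
    assume "\<exists>y\<in>carrier R. y \<noteq> \<zero> \<and> y \<in> dvi D' \<cdot> oc.D y"
    then obtain y where y: "y \<in> carrier R" "y \<noteq> \<zero>" "y \<in> dvi D' \<cdot> oc.D y" by blast
    \<comment> \<open>At least the order of \<open>y\<close> at every component of
      \<open>D'\<close>, so that the poles of \<open>x/y\<close> are bounded by
      \<open>(m+1) D'\<close>.\<close>
    define m where "m = (\<Sum>P\<in>Poly_Mapping.keys D'. valuation R P y)"
    have mge: "valuation R P y \<le> m" if "P \<in> Poly_Mapping.keys D'" for P
      unfolding m_def by (rule member_le_sum) (use that in auto)
    have "\<exists>z. z \<in> prod_ideal M N m \<and> z \<in> carrier R \<and> a \<otimes> (w \<otimes> g [^] Suc m) = (y \<otimes> g) \<otimes> z" if "w \<in> dvi D' \<cdot> oc.D y" for w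
      using that
    proof (induction)
      case (prod f x)
      note fc = dviD(1)[OF prod(1)]
      have xr: "is_reg R oc.U x y" using prod(2) by (simp add: oc.D_def)
      note xc = oc.regD(1)[OF xr]
      have "a \<otimes> f \<in> dvi (dv g + M)" using dvi_mult[OF dvi_self[OF ac a(2)] prod(1)] MgD by (simp add: add.commute)
      then obtain p where p: "p \<in> dvi M" "a \<otimes> f = g \<otimes> p" by (rule dvi_divide[OF gc g(2) _ Mpos])
      have "x \<otimes> g [^] Suc m \<in> dvi (dv y + frag_cmul (int m + 1) N)"
      proof (rule dviI)
        show "x \<otimes> g [^] Suc m \<in> carrier R" using xc gc by simp
        fix P assume P: "x \<otimes> g [^] Suc m \<noteq> \<zero>" "P \<in> HP"
        have x0: "x \<noteq> \<zero>" using P(1) gc by auto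
        have vx: "valuation R P (x \<otimes> g [^] Suc m) = valuation R P x + Suc m * valuation R P g"
          unfolding valuation_mult[OF P(2) xc x0 gpow(1,2)[of "Suc m"]] valuation_pow[OF P(2) gc g(2)] ..
        have vg: "int (valuation R P g) = lk N P + lk D' P"
          using P(2) by (simp add: D'_def lookup_minus lookup_div_of[OF gc g(2)])
        have "int (valuation R P y) \<le> int (valuation R P x) + (int m + 1) * lk D' P"
        \<comment> \<open>Off the support \<open>x/y\<close> is regular; on it the coefficient of
          \<open>D'\<close> is at least one, and its multiple by \<open>m + 1\<close> absorbs the
          order of \<open>y\<close>.\<close>
        proof (cases "lk D' P = 0")
          case True
          then show ?thesis using inU[OF P(2)] reg[OF xc x0 y(1,2)] xr P(2) by simp
        next
          case False
          then have "valuation R P y \<le> m" using mge by (simp add: in_keys_iff)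
          have "1 \<le> lk D' P" using False effD(2)[OF D', of P] by simp
          then have "(int m + 1) * 1 \<le> (int m + 1) * lk D' P" by (intro mult_left_mono) auto
          then have "int m + 1 \<le> (int m + 1) * lk D' P" by (simp only: mult_1_right)
          moreover have "int (valuation R P y) \<le> int m + 1" using \<open>valuation R P y \<le> m\<close> by simp
          ultimately have "int (valuation R P y) \<le> (int m + 1) * lk D' P" by (rule order_trans[rotated])
          then show ?thesis by (rule add_increasing[rotated]) simp
        qed
        moreover have "int (Suc m * valuation R P g) = (int m + 1) * lk N P + (int m + 1) * lk D' P"
          using vg by (simp add: algebra_simps)
        ultimately show "lk (dv y + frag_cmul (int m + 1) N) P \<le> int (valuation R P (x \<otimes> g [^] Suc m))"
          unfolding vx using P(2) by (simp add: lookup_add lookup_div_of[OF y(1,2)])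
      qed
      moreover have "0 \<le> lk (frag_cmul (int m + 1) N) P" for P using effD(2)[OF N, of P] by simp
      ultimately obtain q where q: "q \<in> dvi (frag_cmul (int m + 1) N)" "x \<otimes> g [^] Suc m = y \<otimes> q"
        using dvi_divide[OF y(1,2)] by metis
      note pc = dviD(1)[OF p(1)] and qc = dviD(1)[OF q(1)]
      have "a \<otimes> ((f \<otimes> x) \<otimes> g [^] Suc m) = (a \<otimes> f) \<otimes> (x \<otimes> g [^] Suc m)"
        using ac fc xc gpow(1)[of "Suc m"] by (simp add: m_assoc del: nat_pow_Suc)
      also have "\<dots> = (y \<otimes> g) \<otimes> (p \<otimes> q)" unfolding p(2) q(2) using gc pc qc y(1) by (simp add: m_ac)
      finally have "a \<otimes> ((f \<otimes> x) \<otimes> g [^] Suc m) = (y \<otimes> g) \<otimes> (p \<otimes> q)" .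
      moreover have "p \<otimes> q \<in> prod_ideal M N m" unfolding prod_ideal_def by (rule ideal_prod.prod[OF p(1) q(1)])
      ultimately show ?case using pc qc by blast
    next
      case (sum s1 s2)
      then obtain z1 z2 where z: "z1 \<in> prod_ideal M N m" "z1 \<in> carrier R" "a \<otimes> (s1 \<otimes> g [^] Suc m) = (y \<otimes> g) \<otimes> z1"
        "z2 \<in> prod_ideal M N m" "z2 \<in> carrier R" "a \<otimes> (s2 \<otimes> g [^] Suc m) = (y \<otimes> g) \<otimes> z2" by blast
      have sc: "s1 \<in> carrier R" "s2 \<in> carrier R"
        using oc.regD(1)[OF oc.prod_reg[OF sum(1) y(1,2)]] oc.regD(1)[OF oc.prod_reg[OF sum(2) y(1,2)]] by auto
      have "a \<otimes> ((s1 \<oplus> s2) \<otimes> g [^] Suc m) = a \<otimes> (s1 \<otimes> g [^] Suc m) \<oplus> a \<otimes> (s2 \<otimes> g [^] Suc m)"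
        using sc ac gpow(1)[of "Suc m"] by (simp add: l_distr r_distr del: nat_pow_Suc)
      also have "\<dots> = (y \<otimes> g) \<otimes> (z1 \<oplus> z2)" unfolding z(3,6) using y(1) gc z(2,5) by (simp add: r_distr)
      finally have "a \<otimes> ((s1 \<oplus> s2) \<otimes> g [^] Suc m) = (y \<otimes> g) \<otimes> (z1 \<oplus> z2)" .
      moreover have "z1 \<oplus> z2 \<in> prod_ideal M N m"
        using z(1,4) unfolding prod_ideal_def by (rule ideal_prod.sum)
      ultimately show ?case using z(2,5) by blast
    qed
    then obtain z where z: "z \<in> prod_ideal M N m" "z \<in> carrier R" "a \<otimes> (y \<otimes> g [^] Suc m) = (y \<otimes> g) \<otimes> z" using y(3) by blast
    have "(y \<otimes> g) \<otimes> (a \<otimes> g [^] m) = a \<otimes> (y \<otimes> g [^] Suc m)" using ac y(1) gc by (simp add: m_ac)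
    also note z(3)
    finally have "a \<otimes> g [^] m = z" using y(1,2) gc g(2) ac z(2) by (subst (asm) m_lcancel) (auto simp: integral_iff)
    then show "\<exists>m::nat. a \<otimes> g [^] m \<in> prod_ideal M N m" using z(1) by blast
  qed
qed

lemma coaffine_iff:
  assumes D: "D \<in> carrier (Div R)" and b: "b \<in> carrier R" "b \<noteq> \<zero>" and N: "N = dv b - D" "eff N"
    and a: "a \<in> dvi N" "a \<noteq> \<zero>" and M: "M = dv a - N"
  shows "coaffine R D \<longleftrightarrow> (\<forall>g\<in>dvi N. \<exists>m::nat. a \<otimes> g [^] m \<in> prod_ideal M N m)"
proof -
  have "coaffine R D \<longleftrightarrow> (\<forall>g\<in>dvi N. g \<noteq> \<zero> \<longrightarrow>
     affine_ringed_space (open_subspace (Spec R) (prime_spectrum R - divisor_support R (dv g - N))))"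
    unfolding coaffine_def effective_equivalent_iff[OF D b N] using D by blast
  also have "\<dots> \<longleftrightarrow> (\<forall>g\<in>dvi N. g \<noteq> \<zero> \<longrightarrow> (\<exists>m::nat. a \<otimes> g [^] m \<in> prod_ideal M N m))"
    using affine_complement_iff[OF N(2) a M] by (intro ball_cong refl) blast
  also have "\<dots> \<longleftrightarrow> (\<forall>g\<in>dvi N. \<exists>m::nat. a \<otimes> g [^] m \<in> prod_ideal M N m)"
  proof -
    have "a \<otimes> \<zero> [^] (1::nat) = \<zero>" using dviD(1)[OF a(1)] by simp
    \<comment> \<open>Zero does not correspond to a divisor; it satisfies the condition with
      \<open>m = 1\<close>, whereas its power with \<open>m = 0\<close> would be one. The condition
      can thus range over the whole ideal.\<close>
    then have "\<exists>m::nat. a \<otimes> \<zero> [^] m \<in> prod_ideal M N m"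
      using additive_subgroup.zero_closed[OF ideal.axioms(1)[OF prod_ideal_ideal[of M N 1]]] by metis
    then show ?thesis by metis
  qed
  finally show ?thesis .
qed

text \<open>\<open>b\<close> is taken from the divisorial ideal of the positive part of
  \<open>D\<close>, which makes \<open>div b - D\<close> effective.\<close>

lemma exists_clearing:
  assumes D: "D \<in> carrier (Div R)"
  obtains b a where "b \<in> carrier R" "b \<noteq> \<zero>" "eff (dv b - D)" "a \<in> dvi (dv b - D)" "a \<noteq> \<zero>"
proof -
  have fin: "finite {P. max (lk D P) 0 \<noteq> 0}"
    by (rule finite_subset[OF _ finite_keys[of D]]) (auto simp: in_keys_iff max_def split: if_splits)
  define D' where "D' = Abs_poly_mapping (\<lambda>P. max (lk D P) 0)"
  have lD': "lk D' P = max (lk D P) 0" for P unfolding D'_def using fin by (simp add: lookup_Abs_poly_mapping)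
  have "eff D'"
    by (rule effI) (use D lD' in \<open>auto simp: carrier_Div in_keys_iff max_def split: if_splits\<close>)
  then obtain b where b: "b \<in> dvi D'" "b \<noteq> \<zero>" by (rule dvi_nonzero)
  note bc = dviD(1)[OF b(1)]
  have e: "eff (dv b - D)"
  proof (rule effI)
    show "dv b - D \<in> carrier (Div R)" by (intro Div_closed div_of_Div bc b(2) D)
    fix P assume P: "P \<in> HP"
    show "0 \<le> lk (dv b - D) P" using dviD(2)[OF b P] P by (simp add: lookup_minus lookup_div_of[OF bc b(2)] lD')
  qed
  obtain a where "a \<in> dvi (dv b - D)" "a \<noteq> \<zero>" by (rule dvi_nonzero[OF e])
  then show ?thesis using that bc b(2) e by blast
qed

text \<open>Taking one for \<open>a\<close> and \<open>b\<close> makes all ideals in the criterion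
  contain one. Geometrically, the effective divisors equivalent to zero are the
  \<open>div f\<close>, with complement \<open>D(f)\<close>.\<close>

lemma coaffine_zero: "coaffine R 0"
proof -
  have z: "dv \<one> - 0 = 0" "eff 0" using div_of_one by (auto simp: effective_divisor_def Div_closed)
  have "coaffine R 0 \<longleftrightarrow> (\<forall>g\<in>dvi 0. \<exists>m::nat. \<one> \<otimes> g [^] m \<in> prod_ideal 0 0 m)"
    by (rule coaffine_iff[of 0 \<one> 0 \<one> 0]) (use z dvi_one in \<open>auto simp: Div_closed\<close>)
  moreover have "\<one> \<otimes> g [^] (0::nat) \<in> prod_ideal 0 0 0" if "g \<in> dvi 0" for g
  proof -
    have "\<one> \<otimes> \<one> \<in> prod_ideal 0 0 0" unfolding prod_ideal_def by (rule ideal_prod.prod) (use dvi_one in auto)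
    then show ?thesis by simp
  qed
  ultimately show ?thesis by blast
qed

section \<open>Linear equivalence, property (K) and affine triviality\<close>

lemma coaffine_equivalent:
  assumes D: "D \<in> carrier (Div R)" "D' \<in> carrier (Div R)" and e: "D - D' \<in> principal_divisors R"
  shows "coaffine R D \<longleftrightarrow> coaffine R D'"
proof -
  have "linearly_equivalent R E D \<longleftrightarrow> linearly_equivalent R E D'" for E
  proof -
    have "E - D' = (E - D) + (D - D')" "E - D = (E - D') + - (D - D')" by simp_all
    then show ?thesis unfolding linearly_equivalent_def using principal_closed(1,3) e by metis
  qed
  then show ?thesis unfolding coaffine_def using D by simp
qed

lemma principal_coaffine: "D \<in> principal_divisors R \<Longrightarrow> coaffine R D"
  using coaffine_equivalent[of D 0] coaffine_zero principal_closed(2) by (auto simp: Div_closed)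

lemma property_K_iff: "property_K R E \<longleftrightarrow> E \<in> carrier (Div R) \<and> (\<forall>n::int. coaffine R (frag_cmul n E))"
  unfolding property_K_def using principal_coaffine by blast

lemma property_K_equivalent:
  assumes E: "E \<in> carrier (Div R)" "E' \<in> carrier (Div R)" and e: "E - E' \<in> principal_divisors R"
  shows "property_K R E \<longleftrightarrow> property_K R E'"
proof -
  have "frag_cmul n E - frag_cmul n E' \<in> principal_divisors R" for n
  proof -
    have "frag_cmul n E - frag_cmul n E' = frag_cmul n (E - E')"
      by (rule poly_mapping_eqI) (simp add: lookup_minus right_diff_distrib)
    then show ?thesis using principal_closed(4)[OF e, of n] by simp
  qed
  then have "coaffine R (frag_cmul n E) \<longleftrightarrow> coaffine R (frag_cmul n E')" for n
    by (rule coaffine_equivalent[OF Div_closed(3)[OF E(1)] Div_closed(3)[OF E(2)]])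
  then show ?thesis unfolding property_K_iff using E by simp
qed

text \<open>Property (K) is symmetric under \<open>E \<mapsto> - E\<close>, so for the inverse one
  writes \<open>- D + E\<close> as \<open>- (D + (- E))\<close>.\<close>

lemma affinely_trivial_closed:
  assumes "affinely_trivial R D"
  shows "D \<in> carrier (Div R)" "affinely_trivial R (- D)" "affinely_trivial R D' \<Longrightarrow> affinely_trivial R (D + D')"
proof -
  have K: "property_K R (- E)" if "property_K R E" for E
  proof -
    have "frag_cmul n (- E) = frag_cmul (- n) E" for n by (rule poly_mapping_eqI) simp
    then show ?thesis using that Div_closed(4)[of E R] unfolding property_K_iff by simp
  qed
  have at: "\<And>E. property_K R E \<Longrightarrow> property_K R (D + E)" using assms by (simp add: affinely_trivial_def)
  show D: "D \<in> carrier (Div R)" using assms by (simp add: affinely_trivial_def)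
  have "property_K R (- D + E)" if "property_K R E" for E using K[OF at[OF K[OF that]]] by (simp add: algebra_simps)
  then show "affinely_trivial R (- D)" using D by (simp add: affinely_trivial_def Div_closed)
  show "affinely_trivial R (D + D')" if D': "affinely_trivial R D'"
  proof -
    have "property_K R (D + D' + E)" if "property_K R E" for E
      using at[of "D' + E"] D' that by (simp add: affinely_trivial_def add.assoc)
    then show ?thesis using D D' by (simp add: affinely_trivial_def Div_closed)
  qed
qed

lemma principal_affinely_trivial:
  assumes "D \<in> principal_divisors R" shows "affinely_trivial R D"
proof -
  note D = principal_closed(2)[OF assms]
  have "property_K R (D + E)" if E: "property_K R E" for E
  proof -
    have Ec: "E \<in> carrier (Div R)" using E by (simp add: property_K_iff)
    have "D + E - E \<in> principal_divisors R" using assms by simp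
    then show ?thesis using property_K_equivalent[OF Div_closed(1)[OF D Ec] Ec] E by blast
  qed
  then show ?thesis using D by (simp add: affinely_trivial_def)
qed

text \<open>Each monomial of degree \<open>i0 + j0\<close> in \<open>f\<close> and \<open>g\<close>
  contains \<open>f^i0\<close> or \<open>g^j0\<close>, and multiplying by elements of
  \<open>L(-N)\<close> raises the index of the product ideal in step with the exponent. Together
  with closure under scaling this makes the admissible elements an ideal.\<close>

lemma coaffine_condition_sum:
  assumes f: "f \<in> dvi N" "a \<otimes> f [^] (i0::nat) \<in> prod_ideal M N i0" and g: "g \<in> dvi N" "a \<otimes> g [^] (j0::nat) \<in> prod_ideal M N j0"
    and a: "a \<in> carrier R"
  shows "a \<otimes> (f \<oplus> g) [^] (i0 + j0) \<in> prod_ideal M N (i0 + j0)"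
proof -
  note fc = dviD(1)[OF f(1)] and gc = dviD(1)[OF g(1)]
  have step: "h \<otimes> z \<in> prod_ideal M N (Suc m)" if "h \<in> dvi N" "z \<in> prod_ideal M N m" for h z m
    using that(2) unfolding prod_ideal_def
  proof (induction)
    case (prod p q)
    note c = dviD(1)[OF that(1)] dviD(1)[OF prod(1)] dviD(1)[OF prod(2)]
    have "frag_cmul (int (Suc m) + 1) N = N + frag_cmul (int m + 1) N" by (rule poly_mapping_eqI) (simp add: lookup_add algebra_simps)
    then have "h \<otimes> q \<in> dvi (frag_cmul (int (Suc m) + 1) N)" using dvi_mult[OF that(1) prod(2)] by simp
    then have "p \<otimes> (h \<otimes> q) \<in> dvi M \<cdot> dvi (frag_cmul (int (Suc m) + 1) N)" by (rule ideal_prod.prod[OF prod(1)])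
    then show ?case using c by (simp add: m_lcomm)
  next
    case (sum s1 s2)
    have "s1 \<in> carrier R" "s2 \<in> carrier R"
      using sum(1,2) ideal.Icarr[OF prod_ideal_ideal[of M N m]] unfolding prod_ideal_def by auto
    then have "h \<otimes> (s1 \<oplus> s2) = h \<otimes> s1 \<oplus> h \<otimes> s2" using dviD(1)[OF that(1)] by (simp add: r_distr)
    then show ?case using ideal_prod.sum[OF sum(3,4)] by simp
  qed
  have steps: "h [^] k \<otimes> z \<in> prod_ideal M N (k + m)" if h: "h \<in> dvi N" and z: "z \<in> prod_ideal M N m" for h z m and k :: nat
  proof (induction k)
    case 0 then show ?case using z ideal.Icarr[OF prod_ideal_ideal z] by simp
  next
    case (Suc k)
    have "h [^] Suc k \<otimes> z = h \<otimes> (h [^] k \<otimes> z)" using dviD(1)[OF h] ideal.Icarr[OF prod_ideal_ideal z] by (simp add: m_ac)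
    then show ?case using step[OF h Suc] by simp
  qed
  \<comment> \<open>Binomial coefficients are avoided by splitting off one factor
    \<open>f \<oplus> g\<close> at a time; the powers already split off are carried along in
    \<open>i\<close> and \<open>j\<close>.\<close>
  have "a \<otimes> ((f \<oplus> g) [^] n \<otimes> (f [^] i \<otimes> g [^] j)) \<in> prod_ideal M N (n + i + j)" if "i0 + j0 \<le> n + i + j" for n i j :: nat
    using that
  proof (induction n arbitrary: i j)
    case 0
    then have "i0 \<le> i \<or> j0 \<le> j" by auto
    then show ?case
    proof
      assume le: "i0 \<le> i"
      have "f [^] (i - i0) \<otimes> (a \<otimes> f [^] i0) = a \<otimes> f [^] i" using fc a le
        by (metis le_add_diff_inverse2 m_lcomm nat_pow_closed nat_pow_mult)
      then have "a \<otimes> f [^] i \<in> prod_ideal M N i" using steps[OF f, of "i - i0"] le by simp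
      from steps[OF g(1) this, of j] show ?case using fc gc a by (simp add: m_ac add.commute)
    next
      assume le: "j0 \<le> j"
      have "g [^] (j - j0) \<otimes> (a \<otimes> g [^] j0) = a \<otimes> g [^] j" using gc a le
        by (metis le_add_diff_inverse2 m_lcomm nat_pow_closed nat_pow_mult)
      then have "a \<otimes> g [^] j \<in> prod_ideal M N j" using steps[OF g, of "j - j0"] le by simp
      from steps[OF f(1) this, of i] show ?case using fc gc a by (simp add: m_ac)
    qed
  next
    case (Suc n)
    have 1: "a \<otimes> ((f \<oplus> g) [^] n \<otimes> (f [^] Suc i \<otimes> g [^] j)) \<in> prod_ideal M N (Suc n + i + j)"
      using Suc.IH[of "Suc i" j] Suc.prems by simp
    have 2: "a \<otimes> ((f \<oplus> g) [^] n \<otimes> (f [^] i \<otimes> g [^] Suc j)) \<in> prod_ideal M N (Suc n + i + j)"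
      using Suc.IH[of i "Suc j"] Suc.prems by simp
    have "a \<otimes> ((f \<oplus> g) [^] Suc n \<otimes> (f [^] i \<otimes> g [^] j)) =
       a \<otimes> ((f \<oplus> g) [^] n \<otimes> (f [^] Suc i \<otimes> g [^] j)) \<oplus> a \<otimes> ((f \<oplus> g) [^] n \<otimes> (f [^] i \<otimes> g [^] Suc j))"
    proof -
      define w where "w = (f \<oplus> g) [^] n"
      have "w \<in> carrier R" using fc gc by (simp add: w_def)
      then have "a \<otimes> ((w \<otimes> (f \<oplus> g)) \<otimes> (f [^] i \<otimes> g [^] j)) =
         a \<otimes> (w \<otimes> ((f [^] i \<otimes> f) \<otimes> g [^] j)) \<oplus> a \<otimes> (w \<otimes> (f [^] i \<otimes> (g [^] j \<otimes> g)))"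
        using fc gc a by (simp add: l_distr r_distr m_ac)
      then show ?thesis by (simp add: w_def)
    qed
    then show ?case using 1 2 additive_subgroup.a_closed[OF ideal.axioms(1)[OF prod_ideal_ideal]] by simp
  qed
  from this[of "i0 + j0" 0 0] show ?thesis using fc gc a by simp
qed

end

section \<open>Pull-back along a faithfully flat extension\<close>

locale normal_flat_ext = flat_ext A A' \<phi> + A: normal_domain A + A': normal_domain A'
  for A (structure) and A' (structure) and \<phi>
begin

section \<open>Contraction of height one primes\<close>

definition contr where
  "contr P' = {a \<in> carrier A. \<phi> a \<in> P'}"

abbreviation "pb \<equiv> pullback_divisor A A' \<phi>"

lemma contr_prime:
  assumes "primeideal P' A'" shows "primeideal (contr P') A"
proof -
  interpret P': primeideal P' A' by fact
  have l: "r \<otimes>\<^bsub>A\<^esub> x \<in> contr P'" if "x \<in> contr P'" "r \<in> carrier A" for x r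
    using that P'.I_l_closed[of "\<phi> x" "\<phi> r"] by (simp add: contr_def)
  show ?thesis
  proof (rule primeidealI[OF _ A.is_cring])
    show "ideal (contr P') A"
    proof (rule idealI[OF A.ring_axioms])
      show "subgroup (contr P') (add_monoid A)"
      proof (rule subgroup.intro)
        show "contr P' \<subseteq> carrier (add_monoid A)" by (auto simp: contr_def)
        show "x \<otimes>\<^bsub>add_monoid A\<^esub> y \<in> contr P'" if "x \<in> contr P'" "y \<in> contr P'" for x y
          using that P'.a_closed[of "\<phi> x" "\<phi> y"] by (simp add: contr_def)
        show "\<one>\<^bsub>add_monoid A\<^esub> \<in> contr P'" by (simp add: contr_def P'.zero_closed)
        show "inv\<^bsub>add_monoid A\<^esub> x \<in> contr P'" if x: "x \<in> contr P'" for x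
        proof -
          have "\<ominus>\<^bsub>A\<^esub> x = (\<ominus>\<^bsub>A\<^esub> \<one>\<^bsub>A\<^esub>) \<otimes>\<^bsub>A\<^esub> x" using x by (simp add: contr_def A.l_minus)
          then have "\<ominus>\<^bsub>A\<^esub> x \<in> contr P'" using l[OF x, of "\<ominus>\<^bsub>A\<^esub> \<one>\<^bsub>A\<^esub>"] by simp
          then show ?thesis by (simp only: a_inv_def)
        qed
      qed
      fix x r assume x: "x \<in> contr P'" and r: "r \<in> carrier A"
      show "r \<otimes>\<^bsub>A\<^esub> x \<in> contr P'" by (rule l[OF x r])
      then show "x \<otimes>\<^bsub>A\<^esub> r \<in> contr P'" using x r by (simp add: contr_def A.m_comm)
    qed
    have "\<one>\<^bsub>A\<^esub> \<notin> contr P'" using P'.I_notcarr P'.one_imp_carrier by (auto simp: contr_def)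
    then show "carrier A \<noteq> contr P'" using A.one_closed by blast
    show "a \<in> contr P' \<or> b \<in> contr P'" if "a \<in> carrier A" "b \<in> carrier A" "a \<otimes>\<^bsub>A\<^esub> b \<in> contr P'" for a b
      using that P'.I_prime[of "\<phi> a" "\<phi> b"] by (simp add: contr_def)
  qed
qed

lemma nonzero: "a \<in> carrier A \<Longrightarrow> a \<noteq> \<zero>\<^bsub>A\<^esub> \<Longrightarrow> \<phi> a \<noteq> \<zero>\<^bsub>A'\<^esub>"
  using injective by blast

lemma ext_principal:
  assumes a: "a \<in> carrier A" and x: "x \<in> ext {j \<in> carrier A. a divides\<^bsub>A\<^esub> j}"
  shows "\<phi> a divides\<^bsub>A'\<^esub> x"
  using x
proof (induction)
  case (prod j c)
  then obtain r where r: "r \<in> carrier A" "j = a \<otimes>\<^bsub>A\<^esub> r" by (auto simp: factor_def)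
  have "\<phi> j \<otimes>\<^bsub>A'\<^esub> c = \<phi> a \<otimes>\<^bsub>A'\<^esub> (\<phi> r \<otimes>\<^bsub>A'\<^esub> c)" using r a prod by (simp add: A'.m_assoc)
  then show ?case using r prod by (intro dividesI[of "\<phi> r \<otimes>\<^bsub>A'\<^esub> c"]) auto
next
  case (sum x y)
  show ?case by (rule A'.divides_sum[OF _ sum(3,4)]) (use a in simp)
qed

text \<open>If the contraction \<open>q\<close> had height at least two, then \<open>(aA : q) = aA\<close> and hence \<open>(aA' : qA') = aA'\<close>,
  whereas \<open>P'\<close> is the annihilator of an element of \<open>A'/aA'\<close>.\<close>

lemma contr_height_one:
  assumes P': "P' \<in> A'.HP" shows "contr P' = {\<zero>\<^bsub>A\<^esub>} \<or> contr P' \<in> A.HP"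
proof (rule ccontr)
  assume neg: "\<not> ?thesis"
  define q where "q = contr P'"
  have q: "primeideal q A" unfolding q_def by (rule contr_prime[OF A'.ht1_prime[OF P']])
  interpret q: primeideal q A by (rule q)
  have "q \<noteq> {\<zero>\<^bsub>A\<^esub>}" "q \<notin> A.HP" using neg by (simp_all add: q_def)
  moreover have "\<zero>\<^bsub>A\<^esub> \<in> q" by simp
  ultimately have "\<exists>a\<in>q. a \<noteq> \<zero>\<^bsub>A\<^esub>" by auto
  then obtain a where a: "a \<in> q" "a \<noteq> \<zero>\<^bsub>A\<^esub>" by (elim bexE)
  have ac: "a \<in> carrier A" by (rule q.Icarr[OF a(1)])
  have aP: "\<phi> a \<in> P'" "\<phi> a \<noteq> \<zero>\<^bsub>A'\<^esub>" using a(1) nonzero[OF ac a(2)] unfolding q_def contr_def by simp_all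
  \<comment> \<open>This is where height at least two enters: \<open>q\<close> is nonzero and not of
    height one, so no height one prime can contain it.\<close>
  have nsub: "\<not> q \<subseteq> p" if p: "p \<in> A.HP" for p
  proof
    assume s: "q \<subseteq> p"
    have "q = p \<or> q = {\<zero>\<^bsub>A\<^esub>}" using p q s unfolding A.height_one_iff by blast
    then show False using \<open>q \<noteq> {\<zero>\<^bsub>A\<^esub>}\<close> \<open>q \<notin> A.HP\<close> p by blast
  qed
  obtain G where G: "G \<subseteq> carrier A" "finite G" "q = Idl\<^bsub>A\<^esub> G" using A.finetely_gen[OF q.is_ideal] by blast
  have Gq: "G \<subseteq> q" unfolding G(3) by (rule A.genideal_self[OF G(1)])
  obtain x where x: "x \<in> carrier A'" "P' = {y \<in> carrier A'. \<phi> a divides\<^bsub>A'\<^esub> y \<otimes>\<^bsub>A'\<^esub> x}" "\<not> \<phi> a divides\<^bsub>A'\<^esub> x"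
    by (rule A'.height_one_quotient[OF P' aP])
  have d: "\<phi> a divides\<^bsub>A'\<^esub> x \<otimes>\<^bsub>A'\<^esub> \<phi> y" if y: "y \<in> G" for y
  proof -
    have "y \<in> q" by (rule subsetD[OF Gq y])
    then have "\<phi> y \<in> P'" "y \<in> carrier A" unfolding q_def contr_def by simp_all
    then have "\<phi> a divides\<^bsub>A'\<^esub> \<phi> y \<otimes>\<^bsub>A'\<^esub> x" unfolding x(2) by simp
    then show ?thesis using \<open>y \<in> carrier A\<close> x(1) by (simp add: A'.m_comm)
  qed
  \<comment> \<open>At each height one prime some generator of \<open>q\<close> is a local unit, so
    divisibility of all \<open>j y\<close> by \<open>a\<close> already gives divisibility of
    \<open>j\<close>.\<close>
  have "{j \<in> carrier A. \<forall>y\<in>G. a divides\<^bsub>A\<^esub> j \<otimes>\<^bsub>A\<^esub> y} \<subseteq> {j \<in> carrier A. a divides\<^bsub>A\<^esub> j}"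
  proof
    fix j assume "j \<in> {j \<in> carrier A. \<forall>y\<in>G. a divides\<^bsub>A\<^esub> j \<otimes>\<^bsub>A\<^esub> y}"
    then have j: "j \<in> carrier A" "\<And>y. y \<in> G \<Longrightarrow> a divides\<^bsub>A\<^esub> j \<otimes>\<^bsub>A\<^esub> y" by auto
    have "a divides\<^bsub>A\<^esub> j"
    proof (cases "j = \<zero>\<^bsub>A\<^esub>")
      case True then show ?thesis using ac by (auto intro!: dividesI[of "\<zero>\<^bsub>A\<^esub>"])
    next
      case False
      show ?thesis
      proof (rule A.hartogs[OF j(1) False ac a(2)])
        fix p assume p: "p \<in> A.HP"
        interpret p: primeideal p A by (rule A.ht1_prime[OF p])
        have "\<not> G \<subseteq> p" using nsub[OF p] A.genideal_minimal[OF p.is_ideal] unfolding G(3) by blast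
        then obtain y where y: "y \<in> G" "y \<notin> p" by blast
        have yc: "y \<in> carrier A" using y G(1) by blast
        have "a divides\<^bsub>A\<^esub> y \<otimes>\<^bsub>A\<^esub> j" using j(2)[OF y(1)] j(1) yc by (simp add: A.m_comm)
        then show "valuation A p a \<le> valuation A p j"
          using A.valuation_le_iff[OF p j(1) False ac a(2)] y(2) yc by blast
      qed
    qed
    then show "j \<in> {j \<in> carrier A. a divides\<^bsub>A\<^esub> j}" using j(1) by simp
  qed
  then have "x \<in> ext {j \<in> carrier A. a divides\<^bsub>A\<^esub> j}"
    by (rule ext_mono[OF _ extension_finite_colon(1)[OF G(2,1) ac x(1) d]])
  then show False using ext_principal[OF ac] x(3) by blast
qed

section \<open>Ramification indices and coefficients of the pull-back\<close>

lemma valuation_pullback_zero: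
  assumes P': "P' \<in> A'.HP" and a: "a \<in> carrier A" "a \<noteq> \<zero>\<^bsub>A\<^esub>" and n: "a \<notin> contr P'"
  shows "valuation A' P' (\<phi> a) = 0"
  using A'.valuation_0_iff[OF P' _ nonzero[OF a]] n a by (simp add: contr_def)

text \<open>Up to the factor \<open>s\<close>, whose image stays outside \<open>P'\<close>, the
  contraction consists of multiples of its uniformizer; so its image generates locally the same
  ideal as the image of the uniformizer.\<close>

lemma ramification:
  assumes P': "P' \<in> A'.HP" and p: "contr P' \<in> A.HP"
  shows "ramification_index A' \<phi> P' (contr P') = valuation A' P' (\<phi> (A.unif (contr P')))"
proof -
  define t where "t = A.unif (contr P')"
  have t: "t \<noteq> \<zero>\<^bsub>A\<^esub>" "t \<in> contr P'" "t \<in> carrier A" using A.unif[OF p] by (auto simp: t_def)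
  obtain s where s: "uniformizing A (contr P') t s" using A.unif(2)[OF p] by (auto simp: t_def)
  have ht: "\<phi> t \<in> carrier A'" "\<phi> t \<noteq> \<zero>\<^bsub>A'\<^esub>" using t nonzero by auto
  obtain u w where uw: "u \<in> carrier A' - P'" "w \<in> carrier A' - P'"
    "w \<otimes>\<^bsub>A'\<^esub> \<phi> t = A'.unif P' [^]\<^bsub>A'\<^esub> valuation A' P' (\<phi> t) \<otimes>\<^bsub>A'\<^esub> u"
    by (rule A'.valuationE[OF P' ht])
  obtain s' where s': "uniformizing A' P' (A'.unif P') s'" using A'.unif(2)[OF P'] by blast
  have sc: "s \<in> carrier A" "\<phi> s \<in> carrier A' - P'" using s by (auto simp: uniformizing_def contr_def)
  note tc = A'.unif(4)[OF P']
  have T: "\<exists>w\<in>carrier A' - P'. \<exists>z\<in>carrier A'. w \<otimes>\<^bsub>A'\<^esub> x = A'.unif P' [^]\<^bsub>A'\<^esub> valuation A' P' (\<phi> t) \<otimes>\<^bsub>A'\<^esub> z"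
    if x: "x \<in> \<phi> ` contr P'" for x
  proof -
    obtain y where y: "y \<in> contr P'" "x = \<phi> y" using x by blast
    obtain y' where y': "y' \<in> carrier A" "s \<otimes>\<^bsub>A\<^esub> y = t \<otimes>\<^bsub>A\<^esub> y'" using s y(1) unfolding uniformizing_def by blast
    have yc: "y \<in> carrier A" using y by (simp add: contr_def)
    have "\<phi> s \<otimes>\<^bsub>A'\<^esub> x = \<phi> t \<otimes>\<^bsub>A'\<^esub> \<phi> y'" using arg_cong[OF y'(2), of \<phi>] sc yc t(3) y'(1) by (simp add: y(2))
    then have "(w \<otimes>\<^bsub>A'\<^esub> \<phi> s) \<otimes>\<^bsub>A'\<^esub> x = w \<otimes>\<^bsub>A'\<^esub> (\<phi> t \<otimes>\<^bsub>A'\<^esub> \<phi> y')"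
      using uw(2) sc(2) yc by (simp add: A'.m_assoc y(2))
    also have "\<dots> = (w \<otimes>\<^bsub>A'\<^esub> \<phi> t) \<otimes>\<^bsub>A'\<^esub> \<phi> y'" using uw(2) ht y'(1) by (simp add: A'.m_assoc)
    also have "\<dots> = A'.unif P' [^]\<^bsub>A'\<^esub> valuation A' P' (\<phi> t) \<otimes>\<^bsub>A'\<^esub> (u \<otimes>\<^bsub>A'\<^esub> \<phi> y')"
      unfolding uw(3) using uw(1) tc y'(1) by (simp add: A'.m_assoc)
    finally have e: "(w \<otimes>\<^bsub>A'\<^esub> \<phi> s) \<otimes>\<^bsub>A'\<^esub> x = A'.unif P' [^]\<^bsub>A'\<^esub> valuation A' P' (\<phi> t) \<otimes>\<^bsub>A'\<^esub> (u \<otimes>\<^bsub>A'\<^esub> \<phi> y')" .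
    have "u \<otimes>\<^bsub>A'\<^esub> \<phi> y' \<in> carrier A'" using uw(1) y'(1) by simp
    then show ?thesis using e A'.prime_compl_mult[OF P' uw(2) sc(2)] by blast
  qed
  have "A'.at_prime_order P' (A'.unif P') (\<phi> t) (valuation A' P' (\<phi> t))"
    using A'.valuation_eq_iff[OF P' ht] by blast
  moreover have "\<phi> t \<in> \<phi> ` contr P'" "\<phi> ` contr P' \<subseteq> carrier A'" using t by (auto simp: contr_def)
  ultimately show ?thesis unfolding ramification_index_def t_def[symmetric]
    by (intro A'.order_at_eq[OF A'.ht1_prime[OF P'] s' A'.unif(1)[OF P'] _ T])
qed

text \<open>In \<open>w a = t^k u\<close> the images of \<open>u\<close> and \<open>w\<close> are
  outside \<open>P'\<close>, so only the power of \<open>t\<close> contributes.\<close>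

lemma valuation_pullback:
  assumes P': "P' \<in> A'.HP" and p: "contr P' \<in> A.HP" and a: "a \<in> carrier A" "a \<noteq> \<zero>\<^bsub>A\<^esub>"
  shows "valuation A' P' (\<phi> a) = ramification_index A' \<phi> P' (contr P') * valuation A (contr P') a"
proof -
  define t where "t = A.unif (contr P')"
  define k where "k = valuation A (contr P') a"
  have t: "t \<noteq> \<zero>\<^bsub>A\<^esub>" "t \<in> carrier A" using A.unif[OF p] by (auto simp: t_def)
  obtain u w where uw: "u \<in> carrier A - contr P'" "w \<in> carrier A - contr P'" "w \<otimes>\<^bsub>A\<^esub> a = t [^]\<^bsub>A\<^esub> k \<otimes>\<^bsub>A\<^esub> u"
    unfolding t_def k_def by (rule A.valuationE[OF p a])
  interpret p: primeideal "contr P'" A by (rule A.ht1_prime[OF p])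
  have c: "u \<in> carrier A" "u \<noteq> \<zero>\<^bsub>A\<^esub>" "w \<in> carrier A" "w \<noteq> \<zero>\<^bsub>A\<^esub>" using uw p.zero_closed by auto
  have v0: "valuation A' P' (\<phi> u) = 0" "valuation A' P' (\<phi> w) = 0"
    using valuation_pullback_zero[OF P'] c uw by auto
  have hc: "\<phi> u \<in> carrier A'" "\<phi> w \<in> carrier A'" "\<phi> a \<in> carrier A'" "\<phi> t \<in> carrier A'" using c a t by auto
  note hn = nonzero[OF c(1,2)] nonzero[OF c(3,4)] nonzero[OF a] nonzero[OF t(2,1)]
  have tk: "\<phi> t [^]\<^bsub>A'\<^esub> k \<in> carrier A'" "\<phi> t [^]\<^bsub>A'\<^esub> k \<noteq> \<zero>\<^bsub>A'\<^esub>" using hc hn A'.pow_nonzero by auto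
  have "\<phi> w \<otimes>\<^bsub>A'\<^esub> \<phi> a = \<phi> t [^]\<^bsub>A'\<^esub> k \<otimes>\<^bsub>A'\<^esub> \<phi> u" using arg_cong[OF uw(3), of \<phi>] c a t by simp
  then have "valuation A' P' (\<phi> a) = k * valuation A' P' (\<phi> t)"
    using A'.valuation_mult[OF P' hc(2) hn(2) hc(3) hn(3)] A'.valuation_mult[OF P' tk hc(1) hn(1)]
      A'.valuation_pow[OF P' hc(4) hn(4)] v0 by simp
  then show ?thesis using ramification[OF P' p] by (simp add: t_def k_def mult.commute)
qed

text \<open>All primes over \<open>p\<close> contain the image of its uniformizer, which is nonzero.
  Over an infinite set the sum in \<open>pullback_divisor\<close> would take the default value
  zero.\<close>

lemma finite_primes_over:
  assumes p: "p \<in> A.HP" shows "finite (height_one_primes_over A A' \<phi> p)"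
proof (rule finite_subset)
  note t = A.unif[OF p]
  show "finite {P \<in> A'.HP. \<phi> (A.unif p) \<in> P}"
    by (rule A'.finite_height_one_containing) (use t nonzero in auto)
  show "height_one_primes_over A A' \<phi> p \<subseteq> {P \<in> A'.HP. \<phi> (A.unif p) \<in> P}"
    using t(3) by (auto simp: height_one_primes_over_def)
qed

text \<open>A prime \<open>P'\<close> lies over one prime only, so at most one summand contributes.
  When the contraction is not of height one, \<open>D\<close> has coefficient zero there.\<close>

lemma lookup_pb:
  assumes D: "D \<in> carrier (Div A)"
  shows "Poly_Mapping.lookup (pb D) P' =
    (if P' \<in> A'.HP then int (ramification_index A' \<phi> P' (contr P')) * Poly_Mapping.lookup D (contr P') else 0)"
proof -
  let ?over = "height_one_primes_over A A' \<phi>" and ?r = "ramification_index A' \<phi>"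
  have in_over: "P' \<in> ?over p \<longleftrightarrow> P' \<in> A'.HP \<and> contr P' = p" for p
    by (simp add: height_one_primes_over_def contr_def)
  have b: "Poly_Mapping.lookup (\<Sum>P\<in>?over p. frag_cmul (int (?r P p)) (frag_of P)) P' =
     (if P' \<in> ?over p then int (?r P' p) else 0)" if p: "p \<in> A.HP" for p
  proof -
    have "Poly_Mapping.lookup (\<Sum>P\<in>?over p. frag_cmul (int (?r P p)) (frag_of P)) P' =
      (\<Sum>P\<in>?over p. if P = P' then int (?r P' p) else 0)"
      by (auto simp: lookup_sum lookup_frag_of intro!: sum.cong)
    then show ?thesis using finite_primes_over[OF p] by simp
  qed
  have "Poly_Mapping.lookup (pb D) P' = (\<Sum>p\<in>Poly_Mapping.keys D. Poly_Mapping.lookup D p *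
     Poly_Mapping.lookup (\<Sum>P\<in>?over p. frag_cmul (int (?r P p)) (frag_of P)) P')"
    by (simp add: pullback_divisor_def frag_extend_def lookup_sum)
  also have "\<dots> = (\<Sum>p\<in>Poly_Mapping.keys D. if contr P' = p then
     (if P' \<in> A'.HP then int (?r P' (contr P')) * Poly_Mapping.lookup D (contr P') else 0) else 0)"
    by (rule sum.cong[OF refl], subst b) (use D in \<open>auto simp: carrier_Div in_over\<close>)
  also have "\<dots> = (if P' \<in> A'.HP then int (?r P' (contr P')) * Poly_Mapping.lookup D (contr P') else 0)"
    by (simp add: in_keys_iff)
  finally show ?thesis .
qed

lemma pb_Div: "D \<in> carrier (Div A) \<Longrightarrow> pb D \<in> carrier (Div A')"
  unfolding carrier_Div[of "pb D"] by (auto simp: in_keys_iff lookup_pb split: if_splits)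

lemma pb_add: "pb (D + E) = pb D + pb E"
  and pb_diff: "pb (D - E) = pb D - pb E"
  by (simp_all add: pullback_divisor_def frag_extend_add frag_extend_diff)

lemma pb_cmul: "D \<in> carrier (Div A) \<Longrightarrow> pb (frag_cmul n D) = frag_cmul n (pb D)"
  by (rule poly_mapping_eqI) (simp add: lookup_pb Div_closed)

text \<open>Orders match by \<open>valuation_pullback\<close> when the contraction has height one.
  By \<open>contr_height_one\<close> the only other contraction is zero, and then the image of
  \<open>a\<close> has order zero.\<close>

lemma pb_div_of:
  assumes a: "a \<in> carrier A" "a \<noteq> \<zero>\<^bsub>A\<^esub>" shows "pb (div_of A a) = div_of A' (\<phi> a)"
proof (rule poly_mapping_eqI)
  fix P'
  have ha: "\<phi> a \<in> carrier A'" "\<phi> a \<noteq> \<zero>\<^bsub>A'\<^esub>" using a nonzero by auto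
  show "Poly_Mapping.lookup (pb (div_of A a)) P' = Poly_Mapping.lookup (div_of A' (\<phi> a)) P'"
  proof (cases "P' \<in> A'.HP")
    case True
    show ?thesis
    proof (cases "contr P' \<in> A.HP")
      case c: True
      then show ?thesis using True valuation_pullback[OF True c a]
        by (simp add: lookup_pb A.div_of_Div a A.lookup_div_of A'.lookup_div_of ha)
    next
      case c: False
      then have "contr P' = {\<zero>\<^bsub>A\<^esub>}" using contr_height_one[OF True] by blast
      then have "valuation A' P' (\<phi> a) = 0" by (intro valuation_pullback_zero True a) (use a in simp)
      then show ?thesis using c by (simp add: lookup_pb A.div_of_Div a A.lookup_div_of A'.lookup_div_of ha)
    qed
  next
    case False
    then show ?thesis by (simp add: lookup_pb A.div_of_Div a A'.lookup_div_of ha)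
  qed
qed

section \<open>Pull-back of divisorial ideals and of coaffineness\<close>

lemma pb_eff: "effective_divisor A NN \<Longrightarrow> effective_divisor A' (pb NN)"
  by (rule A'.effI) (auto simp: A.effD pb_Div lookup_pb)

lemma dvi_pullback_mem:
  assumes NN: "effective_divisor A NN" and x: "x \<in> A.dvi NN" shows "\<phi> x \<in> A'.dvi (pb NN)"
proof (rule A'.dviI)
  note xc = A.dviD(1)[OF x]
  show "\<phi> x \<in> carrier A'" using xc by simp
  fix P' assume P': "\<phi> x \<noteq> \<zero>\<^bsub>A'\<^esub>" "P' \<in> A'.HP"
  have x0: "x \<noteq> \<zero>\<^bsub>A\<^esub>" using P'(1) by auto
  show "Poly_Mapping.lookup (pb NN) P' \<le> int (valuation A' P' (\<phi> x))"
  proof (cases "contr P' \<in> A.HP")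
    case c: True
    have "Poly_Mapping.lookup NN (contr P') \<le> int (valuation A (contr P') x)" by (rule A.dviD(2)[OF x x0 c])
    then show ?thesis using P'(2) valuation_pullback[OF P'(2) c xc x0] A.effD(1)[OF NN]
      by (simp add: lookup_pb mult_left_mono)
  next
    case False
    then show ?thesis using P'(2) A.effD(1)[OF NN] Div_lookup_outside[OF A.effD(1)[OF NN] False] by (simp add: lookup_pb)
  qed
qed

text \<open>Divisorial ideals are colon ideals \<open>(aA : Y)\<close> with \<open>Y\<close> finite, so they are compatible with flat extensions.\<close>

lemma dvi_pullback:
  assumes NN: "effective_divisor A NN" and x: "x \<in> A'.dvi (pb NN)"
  shows "x \<in> ext (A.dvi NN)"
proof -
  obtain a where a: "a \<in> A.dvi NN" "a \<noteq> \<zero>\<^bsub>A\<^esub>" by (rule A.dvi_nonzero[OF NN])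
  note ac = A.dviD(1)[OF a(1)] and xc = A'.dviD(1)[OF x]
  define M where "M = div_of A a - NN"
  have M: "effective_divisor A M" unfolding M_def
    by (rule A.effective_complement[OF NN a])
  \<comment> \<open>For each component \<open>p\<close> of \<open>NN\<close> an element of
    \<open>L(-M)\<close> of exact order at \<open>p\<close>; these finitely many elements determine
    \<open>L(-NN)\<close> as \<open>(aA : Y)\<close>.\<close>
  have "\<exists>y. y \<in> A.dvi M \<and> y \<noteq> \<zero>\<^bsub>A\<^esub> \<and> int (valuation A p y) = Poly_Mapping.lookup M p" if "p \<in> A.HP" for p
    by (rule A.dvi_exact[OF M that]) (intro exI conjI)
  then obtain y where y: "\<And>p. p \<in> A.HP \<Longrightarrow> y p \<in> A.dvi M" "\<And>p. p \<in> A.HP \<Longrightarrow> y p \<noteq> \<zero>\<^bsub>A\<^esub>"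
    "\<And>p. p \<in> A.HP \<Longrightarrow> int (valuation A p (y p)) = Poly_Mapping.lookup M p" by metis
  define Y where "Y = y ` Poly_Mapping.keys NN"
  have kN: "Poly_Mapping.keys NN \<subseteq> A.HP" using A.effD(1)[OF NN] by (simp add: carrier_Div)
  have Y: "finite Y" "Y \<subseteq> carrier A" using y(1) kN A.dviD(1) by (auto simp: Y_def)
  have MN: "div_of A' (\<phi> a) = pb NN + pb M" unfolding pb_div_of[OF ac a(2), symmetric] M_def pb_diff by simp
  \<comment> \<open>Upstairs too the two divisors add up to that of the image of \<open>a\<close>,
    so a product of elements of both divisorial ideals is divisible by this image.\<close>
  have d: "\<phi> a divides\<^bsub>A'\<^esub> x \<otimes>\<^bsub>A'\<^esub> \<phi> z" if z: "z \<in> Y" for z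
  proof -
    have "z \<in> A.dvi M" using z y(1) kN by (auto simp: Y_def)
    then have "x \<otimes>\<^bsub>A'\<^esub> \<phi> z \<in> A'.dvi (div_of A' (\<phi> a) + 0)"
      using A'.dvi_mult[OF x dvi_pullback_mem[OF M]] MN by simp
    then obtain c where "c \<in> A'.dvi 0" "x \<otimes>\<^bsub>A'\<^esub> \<phi> z = \<phi> a \<otimes>\<^bsub>A'\<^esub> c"
      by (rule A'.dvi_divide[rotated 2]) (use ac nonzero[OF ac a(2)] in auto)
    then show ?thesis using A'.dviD(1) by (auto intro: dividesI)
  qed
  have "{j \<in> carrier A. \<forall>z\<in>Y. a divides\<^bsub>A\<^esub> j \<otimes>\<^bsub>A\<^esub> z} \<subseteq> A.dvi NN"
  proof
    fix j assume "j \<in> {j \<in> carrier A. \<forall>z\<in>Y. a divides\<^bsub>A\<^esub> j \<otimes>\<^bsub>A\<^esub> z}"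
    then have j: "j \<in> carrier A" "\<And>z. z \<in> Y \<Longrightarrow> a divides\<^bsub>A\<^esub> j \<otimes>\<^bsub>A\<^esub> z" by auto
    show "j \<in> A.dvi NN"
    proof (rule A.dviI[OF j(1)])
      fix p assume p: "j \<noteq> \<zero>\<^bsub>A\<^esub>" "p \<in> A.HP"
      show "Poly_Mapping.lookup NN p \<le> int (valuation A p j)"
      proof (cases "p \<in> Poly_Mapping.keys NN")
        case True
        note yc = A.dviD(1)[OF y(1)[OF p(2)]] y(2)[OF p(2)]
        have jy: "j \<otimes>\<^bsub>A\<^esub> y p \<in> carrier A" "j \<otimes>\<^bsub>A\<^esub> y p \<noteq> \<zero>\<^bsub>A\<^esub>" using j(1) p(1) yc by (auto simp: A.integral_iff)
        have "a divides\<^bsub>A\<^esub> j \<otimes>\<^bsub>A\<^esub> y p" using True by (intro j(2)) (simp add: Y_def)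
        then have "valuation A p a \<le> valuation A p j + valuation A p (y p)"
          using A.valuation_mono_divides[OF p(2) jy ac a(2)] A.valuation_mult[OF p(2) j(1) p(1) yc] by simp
        moreover have "int (valuation A p (y p)) = int (valuation A p a) - Poly_Mapping.lookup NN p"
          using y(3)[OF p(2)] p(2) by (simp add: M_def lookup_minus A.lookup_div_of[OF ac a(2)])
        ultimately show ?thesis by linarith
      next
        case False then show ?thesis by (simp add: in_keys_iff)
      qed
    qed
  qed
  then show ?thesis by (rule ext_mono[OF _ extension_finite_colon(1)[OF Y ac xc d]])
qed

text \<open>Every element of the product upstairs lies in the extension of the product downstairs,
  since both factors are extended ideals by \<open>dvi_pullback\<close>;
  \<open>extension_contract\<close> then descends membership.\<close>

lemma prod_ideal_pullback:
  assumes NN: "effective_divisor A NN" and M: "effective_divisor A M" and x: "x \<in> carrier A"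
  shows "\<phi> x \<in> A'.prod_ideal (pb M) (pb NN) m \<longleftrightarrow> x \<in> A.prod_ideal M NN m"
proof
  define NN' where "NN' = frag_cmul (int m + 1) NN"
  have NN'e: "effective_divisor A NN'" unfolding NN'_def
    by (rule A.effI) (use A.effD[OF NN] in \<open>auto intro: Div_closed\<close>)
  have pbN': "pb NN' = frag_cmul (int m + 1) (pb NN)" unfolding NN'_def by (rule pb_cmul[OF A.effD(1)[OF NN]])
  have eq: "A.prod_ideal M NN m = A.dvi M \<cdot>\<^bsub>A\<^esub> A.dvi NN'" "A'.prod_ideal (pb M) (pb NN) m = A'.dvi (pb M) \<cdot>\<^bsub>A'\<^esub> A'.dvi (pb NN')"
    unfolding A.prod_ideal_def A'.prod_ideal_def NN'_def pbN'[unfolded NN'_def] by simp_all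
  have Ic: "A.prod_ideal M NN m \<subseteq> carrier A" using ideal.Icarr[OF A.prod_ideal_ideal] by blast
  {
    assume "x \<in> A.prod_ideal M NN m"
    then show "\<phi> x \<in> A'.prod_ideal (pb M) (pb NN) m"
      unfolding eq
    proof (induction)
      case (prod i j)
      have "\<phi> i \<otimes>\<^bsub>A'\<^esub> \<phi> j \<in> A'.dvi (pb M) \<cdot>\<^bsub>A'\<^esub> A'.dvi (pb NN')"
        by (rule ideal_prod.prod) (use prod dvi_pullback_mem[OF M] dvi_pullback_mem[OF NN'e] in auto)
      then show ?case using A.dviD(1)[OF prod(1)] A.dviD(1)[OF prod(2)] by simp
    next
      case (sum s1 s2)
      have "s1 \<in> carrier A" "s2 \<in> carrier A" using Ic sum(1,2) unfolding eq(1) by auto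
      then show ?case using ideal_prod.sum[OF sum(3,4)] by simp
    qed
  }
  {
    assume "\<phi> x \<in> A'.prod_ideal (pb M) (pb NN) m"
    interpret I: ideal "A.prod_ideal M NN m" A by (rule A.prod_ideal_ideal)
    interpret E: ideal "ext (A.prod_ideal M NN m)" A' by (rule ext_ideal[OF Ic]) (use I.zero_closed in blast)
    have mc: "A.dvi K \<subseteq> carrier A" for K using A.dviD(1) by blast
    have "z \<in> ext (A.prod_ideal M NN m)" if "z \<in> A'.prod_ideal (pb M) (pb NN) m" for z
      using that unfolding eq(2)
    proof (induction)
      case (prod i j)
      have i: "i \<in> ext (A.dvi M)" by (rule dvi_pullback[OF M prod(1)])
      have j: "j \<in> ext (A.dvi NN')" by (rule dvi_pullback[OF NN'e prod(2)])
      have one: "\<phi> f \<otimes>\<^bsub>A'\<^esub> j \<in> ext (A.prod_ideal M NN m)" if f: "f \<in> A.dvi M" for f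
        using j
      proof (induction)
        case (prod g c)
        have "\<phi> (f \<otimes>\<^bsub>A\<^esub> g) \<otimes>\<^bsub>A'\<^esub> c \<in> ext (A.prod_ideal M NN m)"
          by (rule extension.prod) (use f prod in \<open>auto simp: eq(1) intro: ideal_prod.prod\<close>)
        then show ?case using A.dviD(1)[OF f] A.dviD(1)[OF prod(1)] prod(2) by (simp add: A'.m_assoc)
      next
        case (sum u v)
        then show ?case using A.dviD(1)[OF f] ext_carrier[OF mc] by (simp add: A'.r_distr)
      qed
      have jc: "j \<in> carrier A'" by (rule ext_carrier[OF mc j])
      show ?case using i
      proof (induction)
        case (prod f c)
        have "c \<otimes>\<^bsub>A'\<^esub> (\<phi> f \<otimes>\<^bsub>A'\<^esub> j) \<in> ext (A.prod_ideal M NN m)" by (rule E.I_l_closed[OF one[OF prod(1)] prod(2)])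
        then show ?case using A.dviD(1)[OF prod(1)] prod(2) jc by (simp add: A'.m_ac)
      next
        case (sum u v)
        then show ?case using ext_carrier[OF mc sum(1)] ext_carrier[OF mc sum(2)] jc by (simp add: A'.l_distr)
      qed
    next
      case (sum s1 s2) then show ?case by simp
    qed
    then show "x \<in> A.prod_ideal M NN m"
      using extension_contract[OF A.prod_ideal_ideal x] \<open>\<phi> x \<in> A'.prod_ideal (pb M) (pb NN) m\<close> by blast
  }
qed

text \<open>The data \<open>NN\<close>, \<open>M\<close> and \<open>a\<close> are chosen downstairs
  and pulled back, so both criteria involve corresponding ideals. Descent restricts to
  \<open>g\<close> from \<open>A\<close>. For ascent every element of the divisorial ideal upstairs
  is a sum of multiples of such \<open>g\<close>, and the condition passes to multiples and
  sums.\<close>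

lemma coaffine_pullback:
  assumes D: "D \<in> carrier (Div A)" shows "coaffine A' (pb D) \<longleftrightarrow> coaffine A D"
proof -
  obtain b a where ba: "b \<in> carrier A" "b \<noteq> \<zero>\<^bsub>A\<^esub>" "effective_divisor A (div_of A b - D)" "a \<in> A.dvi (div_of A b - D)" "a \<noteq> \<zero>\<^bsub>A\<^esub>"
    by (rule A.exists_clearing[OF D])
  define NN where "NN = div_of A b - D"
  define M where "M = div_of A a - NN"
  have NN: "effective_divisor A NN" and a: "a \<in> A.dvi NN" "a \<noteq> \<zero>\<^bsub>A\<^esub>" using ba by (auto simp: NN_def)
  note ac = A.dviD(1)[OF a(1)]
  have M: "effective_divisor A M" unfolding M_def
    by (rule A.effective_complement[OF NN a])
  have iffA: "coaffine A D \<longleftrightarrow> (\<forall>g\<in>A.dvi NN. \<exists>m::nat. a \<otimes>\<^bsub>A\<^esub> g [^]\<^bsub>A\<^esub> m \<in> A.prod_ideal M NN m)"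
    by (rule A.coaffine_iff[OF D ba(1,2) NN_def NN a M_def])
  have hb: "\<phi> b \<in> carrier A'" "\<phi> b \<noteq> \<zero>\<^bsub>A'\<^esub>" and ha: "\<phi> a \<noteq> \<zero>\<^bsub>A'\<^esub>" using ba(1,2) nonzero ac a(2) by auto
  have NN': "pb NN = div_of A' (\<phi> b) - pb D" unfolding NN_def pb_diff pb_div_of[OF ba(1,2)] ..
  have M': "pb M = div_of A' (\<phi> a) - pb NN" unfolding M_def pb_diff pb_div_of[OF ac a(2)] ..
  have iffA': "coaffine A' (pb D) \<longleftrightarrow> (\<forall>g\<in>A'.dvi (pb NN). \<exists>m::nat. \<phi> a \<otimes>\<^bsub>A'\<^esub> g [^]\<^bsub>A'\<^esub> m \<in> A'.prod_ideal (pb M) (pb NN) m)"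
    by (rule A'.coaffine_iff[OF pb_Div[OF D] hb NN' pb_eff[OF NN] dvi_pullback_mem[OF NN a(1)] ha M'])
  have tr: "\<phi> a \<otimes>\<^bsub>A'\<^esub> \<phi> g [^]\<^bsub>A'\<^esub> m \<in> A'.prod_ideal (pb M) (pb NN) m \<longleftrightarrow> a \<otimes>\<^bsub>A\<^esub> g [^]\<^bsub>A\<^esub> m \<in> A.prod_ideal M NN m"
    if g: "g \<in> A.dvi NN" for g and m :: nat
    using prod_ideal_pullback[OF NN M, of "a \<otimes>\<^bsub>A\<^esub> g [^]\<^bsub>A\<^esub> m" m] ac A.dviD(1)[OF g] by simp
  show ?thesis
  proof
    assume c: "coaffine A' (pb D)"
    show "coaffine A D" unfolding iffA
    proof
      fix g assume g: "g \<in> A.dvi NN"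
      then show "\<exists>m::nat. a \<otimes>\<^bsub>A\<^esub> g [^]\<^bsub>A\<^esub> m \<in> A.prod_ideal M NN m"
        using c dvi_pullback_mem[OF NN g] tr[OF g] unfolding iffA' by blast
    qed
  next
    assume c: "coaffine A D"
    have hac: "\<phi> a \<in> carrier A'" using ac by simp
    have Nc: "A.dvi NN \<subseteq> carrier A" using A.dviD(1) by blast
    have mem: "y \<in> A'.dvi (pb NN)" if "y \<in> ext (A.dvi NN)" for y
      using that
    proof (induction)
      case (prod g c)
      show ?case by (rule ideal.I_r_closed[OF A'.dvi_ideal dvi_pullback_mem[OF NN prod(1)] prod(2)])
    next
      case (sum u v)
      show ?case by (rule additive_subgroup.a_closed[OF ideal.axioms(1)[OF A'.dvi_ideal] sum(3,4)])
    qed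
    have "\<exists>m::nat. \<phi> a \<otimes>\<^bsub>A'\<^esub> y [^]\<^bsub>A'\<^esub> m \<in> A'.prod_ideal (pb M) (pb NN) m" if "y \<in> ext (A.dvi NN)" for y
      using that
    proof (induction)
      case (prod g c)
      then obtain m :: nat where m: "\<phi> a \<otimes>\<^bsub>A'\<^esub> \<phi> g [^]\<^bsub>A'\<^esub> m \<in> A'.prod_ideal (pb M) (pb NN) m"
        using \<open>coaffine A D\<close> tr unfolding iffA by blast
      note gc = A.dviD(1)[OF prod(1)]
      \<comment> \<open>Scaling \<open>g\<close> by \<open>c\<close> multiplies the element in
        question by \<open>c^m\<close>, which the product ideal absorbs.\<close>
      have "c [^]\<^bsub>A'\<^esub> m \<otimes>\<^bsub>A'\<^esub> (\<phi> a \<otimes>\<^bsub>A'\<^esub> \<phi> g [^]\<^bsub>A'\<^esub> m) \<in> A'.prod_ideal (pb M) (pb NN) m"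
        by (rule ideal.I_l_closed[OF A'.prod_ideal_ideal m]) (use prod in simp)
      also have "c [^]\<^bsub>A'\<^esub> m \<otimes>\<^bsub>A'\<^esub> (\<phi> a \<otimes>\<^bsub>A'\<^esub> \<phi> g [^]\<^bsub>A'\<^esub> m) = \<phi> a \<otimes>\<^bsub>A'\<^esub> (\<phi> g \<otimes>\<^bsub>A'\<^esub> c) [^]\<^bsub>A'\<^esub> m"
        using prod gc hac by (simp add: A'.nat_pow_distrib A'.m_ac)
      finally show ?case by blast
    next
      case (sum u v)
      then show ?case using A'.coaffine_condition_sum[OF mem[OF sum(1)] _ mem[OF sum(2)] _ hac] by blast
    qed
    then show "coaffine A' (pb D)" unfolding iffA' using dvi_pullback[OF NN] by blast
  qed
qed

lemma property_K_pullback: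
  assumes "E \<in> carrier (Div A)" shows "property_K A' (pb E) \<longleftrightarrow> property_K A E"
  unfolding A.property_K_iff A'.property_K_iff
  using assms pb_Div[OF assms] coaffine_pullback[OF Div_closed(3)[OF assms]] by (simp add: pb_cmul)

end

section \<open>The induced map of affine class groups\<close>

lemma Div_coset_eq:
  assumes H: "\<And>x. x \<in> H \<Longrightarrow> - x \<in> H" "\<And>x y. x \<in> H \<Longrightarrow> y \<in> H \<Longrightarrow> x + y \<in> H" and uv: "u - v \<in> H"
  shows "H #>\<^bsub>Div R\<^esub> u = H #>\<^bsub>Div R\<^esub> v"
proof (rule Set.set_eqI)
  fix z
  have "z - v = (z - u) + (u - v)" "z - u = (z - v) + - (u - v)" by simp_all
  then have "z - u \<in> H \<longleftrightarrow> z - v \<in> H" using H uv by metis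
  then show "z \<in> H #>\<^bsub>Div R\<^esub> u \<longleftrightarrow> z \<in> H #>\<^bsub>Div R\<^esub> v" unfolding Div_def r_coset_free_iff .
qed

lemma (in normal_domain) affinely_trivial_subgroup: "subgroup (Collect (affinely_trivial R)) (Div R)"
proof (rule subgroup.intro)
  show "Collect (affinely_trivial R) \<subseteq> carrier (Div R)" using affinely_trivial_closed(1) by blast
  show "x \<otimes>\<^bsub>Div R\<^esub> y \<in> Collect (affinely_trivial R)"
    if "x \<in> Collect (affinely_trivial R)" "y \<in> Collect (affinely_trivial R)" for x y
    using that affinely_trivial_closed(3) by (simp add: Div_def)
  show "\<one>\<^bsub>Div R\<^esub> \<in> Collect (affinely_trivial R)"
    using principal_affinely_trivial[OF zero_principal] by (simp add: Div_def)
  show "inv\<^bsub>Div R\<^esub> x \<in> Collect (affinely_trivial R)" if "x \<in> Collect (affinely_trivial R)" for x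
    using that affinely_trivial_closed(1,2)[of x] by (simp add: Div_def)
qed

locale Cl_surjective_ext = normal_flat_ext +
  assumes Cl_surj: "pullback_Cl A A' \<phi> ` carrier (Cl A) = carrier (Cl A')"
begin

text \<open>Surjectivity on class groups, read on representatives.\<close>

lemma divisor_equivalent_pullback:
  assumes E': "E' \<in> carrier (Div A')" obtains E where "E \<in> carrier (Div A)" "pb E - E' \<in> principal_divisors A'"
proof -
  have "principal_divisors A' #>\<^bsub>Div A'\<^esub> E' \<in> carrier (Cl A')"
    using E' by (auto simp: Cl_def FactGroup_def RCOSETS_def)
  then obtain C where C: "C \<in> carrier (Cl A)" "pullback_Cl A A' \<phi> C = principal_divisors A' #>\<^bsub>Div A'\<^esub> E'"
    using Cl_surj by (metis (no_types, lifting) imageE)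
  then obtain E where E: "E \<in> carrier (Div A)" "C = principal_divisors A #>\<^bsub>Div A\<^esub> E"
    by (auto simp: Cl_def FactGroup_def RCOSETS_def)
  have "E \<in> C" unfolding E(2) Div_def r_coset_free_iff using A.zero_principal by simp
  moreover have "pb E \<in> principal_divisors A' #>\<^bsub>Div A'\<^esub> pb E"
    unfolding Div_def r_coset_free_iff using A'.zero_principal by simp
  ultimately have "pb E \<in> pullback_Cl A A' \<phi> C" unfolding pullback_Cl_def coset_map_def by blast
  then have "pb E - E' \<in> principal_divisors A'" unfolding C(2) Div_def r_coset_free_iff .
  then show ?thesis by (rule that[OF E(1)])
qed

text \<open>A divisor upstairs with property (K) is equivalent to some \<open>pb E\<close>, which
  carries the question down to \<open>A\<close>; this uses surjectivity on class groups. The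
  converse direction tests pulled-back divisors and supplies injectivity on the affine class
  groups.\<close>

lemma affinely_trivial_pullback:
  assumes D: "D \<in> carrier (Div A)" shows "affinely_trivial A' (pb D) \<longleftrightarrow> affinely_trivial A D"
proof
  assume t: "affinely_trivial A D"
  have "property_K A' (pb D + E')" if K: "property_K A' E'" for E'
  proof -
    have E': "E' \<in> carrier (Div A')" using K by (simp add: A'.property_K_iff)
    obtain E where E: "E \<in> carrier (Div A)" "pb E - E' \<in> principal_divisors A'" by (rule divisor_equivalent_pullback[OF E'])
    have "property_K A' (pb E)" using K A'.property_K_equivalent[OF pb_Div[OF E(1)] E' E(2)] by blast
    then have "property_K A (D + E)" using property_K_pullback[OF E(1)] t by (simp add: affinely_trivial_def)
    then have "property_K A' (pb (D + E))" using property_K_pullback[OF Div_closed(1)[OF D E(1)]] by blast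
    moreover have "pb (D + E) - (pb D + E') \<in> principal_divisors A'" using E(2) by (simp add: pb_add)
    ultimately show ?thesis
      using A'.property_K_equivalent[OF pb_Div[OF Div_closed(1)[OF D E(1)]] Div_closed(1)[OF pb_Div[OF D] E']] by blast
  qed
  then show "affinely_trivial A' (pb D)" using pb_Div[OF D] by (simp add: affinely_trivial_def)
next
  assume t: "affinely_trivial A' (pb D)"
  have "property_K A (D + E)" if K: "property_K A E" for E
  proof -
    have E: "E \<in> carrier (Div A)" using K by (simp add: A.property_K_iff)
    have "property_K A' (pb D + pb E)" using t K property_K_pullback[OF E] by (simp add: affinely_trivial_def)
    then show ?thesis using property_K_pullback[OF Div_closed(1)[OF D E]] by (simp add: pb_add)
  qed
  then show "affinely_trivial A D" using D by (simp add: affinely_trivial_def)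
qed

lemma AKG_iso: "pullback_AKG A A' \<phi> \<in> iso (AKG A) (AKG A')"
proof -
  let ?K = "Collect (affinely_trivial A)" and ?K' = "Collect (affinely_trivial A')"
  have coset: "?K #>\<^bsub>Div A\<^esub> u = ?K #>\<^bsub>Div A\<^esub> v" if "u - v \<in> ?K" for u v
    by (rule Div_coset_eq[OF _ _ that]) (use A.affinely_trivial_closed in auto)
  have coset': "?K' #>\<^bsub>Div A'\<^esub> u = ?K' #>\<^bsub>Div A'\<^esub> v" if "u - v \<in> ?K'" for u v
    by (rule Div_coset_eq[OF _ _ that]) (use A'.affinely_trivial_closed in auto)
  have K0: "0 \<in> ?K" "0 \<in> ?K'"
    using A.principal_affinely_trivial[OF A.zero_principal] A'.principal_affinely_trivial[OF A'.zero_principal] by auto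
  have cosetD: "u - v \<in> ?K" if "?K #>\<^bsub>Div A\<^esub> u = ?K #>\<^bsub>Div A\<^esub> v" for u v
  proof -
    have "u \<in> ?K #>\<^bsub>Div A\<^esub> u" unfolding Div_def r_coset_free_iff using K0 by simp
    then show ?thesis unfolding that unfolding Div_def r_coset_free_iff .
  qed
  have cosetD': "u - v \<in> ?K'" if "?K' #>\<^bsub>Div A'\<^esub> u = ?K' #>\<^bsub>Div A'\<^esub> v" for u v
  proof -
    have "u \<in> ?K' #>\<^bsub>Div A'\<^esub> u" unfolding Div_def r_coset_free_iff using K0 by simp
    then show ?thesis unfolding that unfolding Div_def r_coset_free_iff .
  qed
  \<comment> \<open>Representatives differ by an affinely trivial divisor, whose pull-back is
    affinely trivial; so the union in \<open>coset_map\<close> is one coset.\<close>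
  have im: "pullback_AKG A A' \<phi> (?K #>\<^bsub>Div A\<^esub> u) = ?K' #>\<^bsub>Div A'\<^esub> pb u" for u
    unfolding pullback_AKG_def coset_map_def
  proof (rule UN_const_on)
    show "?K #>\<^bsub>Div A\<^esub> u \<noteq> {}"
    proof -
      have "u \<in> ?K #>\<^bsub>Div A\<^esub> u" unfolding Div_def r_coset_free_iff using K0 by simp
      then show ?thesis by blast
    qed
    fix z assume "z \<in> ?K #>\<^bsub>Div A\<^esub> u"
    then have z: "z - u \<in> ?K" unfolding Div_def r_coset_free_iff .
    then have "affinely_trivial A' (pb (z - u))"
      using affinely_trivial_pullback A.affinely_trivial_closed(1) by blast
    then show "?K' #>\<^bsub>Div A'\<^esub> pb z = ?K' #>\<^bsub>Div A'\<^esub> pb u" by (intro coset') (simp add: pb_diff)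
  qed
  have carr: "C \<in> carrier (AKG A) \<longleftrightarrow> (\<exists>u\<in>carrier (Div A). C = ?K #>\<^bsub>Div A\<^esub> u)" for C
    unfolding AKG_def FactGroup_def RCOSETS_def by auto
  have carr': "C \<in> carrier (AKG A') \<longleftrightarrow> (\<exists>u\<in>carrier (Div A'). C = ?K' #>\<^bsub>Div A'\<^esub> u)" for C
    unfolding AKG_def FactGroup_def RCOSETS_def by auto
  have n: "?K \<lhd> Div A" "?K' \<lhd> Div A'"
    using comm_group.subgroup_imp_normal[OF _ A.affinely_trivial_subgroup]
      comm_group.subgroup_imp_normal[OF _ A'.affinely_trivial_subgroup]
    by (auto simp: Div_def abelian_free_Abelian_group)
  have mult: "(?K #>\<^bsub>Div A\<^esub> u) \<otimes>\<^bsub>AKG A\<^esub> (?K #>\<^bsub>Div A\<^esub> v) = ?K #>\<^bsub>Div A\<^esub> (u + v)"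
    if "u \<in> carrier (Div A)" "v \<in> carrier (Div A)" for u v
    using normal.rcos_sum[OF n(1) that] by (simp add: AKG_def FactGroup_def Div_def)
  have mult': "(?K' #>\<^bsub>Div A'\<^esub> u) \<otimes>\<^bsub>AKG A'\<^esub> (?K' #>\<^bsub>Div A'\<^esub> v) = ?K' #>\<^bsub>Div A'\<^esub> (u + v)"
    if "u \<in> carrier (Div A')" "v \<in> carrier (Div A')" for u v
    using normal.rcos_sum[OF n(2) that] by (simp add: AKG_def FactGroup_def Div_def)
  have "pullback_AKG A A' \<phi> \<in> hom (AKG A) (AKG A')"
  proof (rule homI)
    fix C assume "C \<in> carrier (AKG A)"
    then obtain u where u: "u \<in> carrier (Div A)" "C = ?K #>\<^bsub>Div A\<^esub> u" unfolding carr by blast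
    show "pullback_AKG A A' \<phi> C \<in> carrier (AKG A')" unfolding u(2) im carr' using pb_Div[OF u(1)] by blast
    fix C' assume "C' \<in> carrier (AKG A)"
    then obtain v where v: "v \<in> carrier (Div A)" "C' = ?K #>\<^bsub>Div A\<^esub> v" unfolding carr by blast
    show "pullback_AKG A A' \<phi> (C \<otimes>\<^bsub>AKG A\<^esub> C') = pullback_AKG A A' \<phi> C \<otimes>\<^bsub>AKG A'\<^esub> pullback_AKG A A' \<phi> C'"
      unfolding u(2) v(2) mult[OF u(1) v(1)] im mult'[OF pb_Div[OF u(1)] pb_Div[OF v(1)]] pb_add ..
  qed
  moreover have "bij_betw (pullback_AKG A A' \<phi>) (carrier (AKG A)) (carrier (AKG A'))"
  proof (rule bij_betw_imageI)
    show "inj_on (pullback_AKG A A' \<phi>) (carrier (AKG A))"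
    proof (rule inj_onI)
      fix C C' assume C: "C \<in> carrier (AKG A)" "C' \<in> carrier (AKG A)" and e: "pullback_AKG A A' \<phi> C = pullback_AKG A A' \<phi> C'"
      obtain u where u: "u \<in> carrier (Div A)" "C = ?K #>\<^bsub>Div A\<^esub> u" using C(1) unfolding carr by blast
      obtain v where v: "v \<in> carrier (Div A)" "C' = ?K #>\<^bsub>Div A\<^esub> v" using C(2) unfolding carr by blast
      have "affinely_trivial A' (pb (u - v))" using cosetD'[OF e[unfolded u(2) v(2) im]] by (simp add: pb_diff)
      then have "u - v \<in> ?K" using affinely_trivial_pullback[OF Div_closed(2)[OF u(1) v(1)]] by simp
      then show "C = C'" unfolding u(2) v(2) by (rule coset)
    qed
    show "pullback_AKG A A' \<phi> ` carrier (AKG A) = carrier (AKG A')"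
    proof (intro subset_antisym subsetI)
      fix C assume "C \<in> pullback_AKG A A' \<phi> ` carrier (AKG A)"
      then obtain C0 where C0: "C0 \<in> carrier (AKG A)" "C = pullback_AKG A A' \<phi> C0" by (elim imageE)
      obtain u where u: "u \<in> carrier (Div A)" "C0 = ?K #>\<^bsub>Div A\<^esub> u" using C0(1) unfolding carr by blast
      have "C = ?K' #>\<^bsub>Div A'\<^esub> pb u" unfolding C0(2) u(2) im ..
      moreover note u(1)
      ultimately obtain u where "u \<in> carrier (Div A)" "C = ?K' #>\<^bsub>Div A'\<^esub> pb u" by blast
      then show "C \<in> carrier (AKG A')" unfolding carr' using pb_Div by blast
    next
      fix C assume "C \<in> carrier (AKG A')"
      then obtain E' where E': "E' \<in> carrier (Div A')" "C = ?K' #>\<^bsub>Div A'\<^esub> E'" unfolding carr' by blast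
      obtain E where E: "E \<in> carrier (Div A)" "pb E - E' \<in> principal_divisors A'" by (rule divisor_equivalent_pullback[OF E'(1)])
      \<comment> \<open>Principal divisors are affinely trivial, so surjectivity on class groups
        passes to the affine class groups.\<close>
      have "pb E - E' \<in> ?K'" using A'.principal_affinely_trivial[OF E(2)] by simp
      then have "C = pullback_AKG A A' \<phi> (?K #>\<^bsub>Div A\<^esub> E)" unfolding E'(2) im by (rule coset'[symmetric])
      moreover have "?K #>\<^bsub>Div A\<^esub> E \<in> carrier (AKG A)" unfolding carr using E(1) by blast
      ultimately show "C \<in> pullback_AKG A A' \<phi> ` carrier (AKG A)" by (rule image_eqI)
    qed
  qed
  ultimately show ?thesis by (simp add: iso_def)
qed

end

theorem mainTheorem11:
  fixes A :: "('a, 'm) ring_scheme" and A' :: "('b, 'n) ring_scheme" and \<phi> :: "'a \<Rightarrow> 'b"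
  assumes "noetherian_normal_domain A" and "noetherian_normal_domain A'"
    and "\<phi> \<in> ring_hom A A'" and "faithfully_flat A A' \<phi>"
    and "pullback_Cl A A' \<phi> ` carrier (Cl A) = carrier (Cl A')"
  shows "(\<forall>D. affinely_trivial A D \<longrightarrow> affinely_trivial A' (pullback_divisor A A' \<phi> D)) \<and>
         pullback_AKG A A' \<phi> \<in> iso (AKG A) (AKG A')"
proof -
  interpret A: normal_domain A using assms(1) by (simp add: normal_domain_iff)
  interpret A': normal_domain A' using assms(2) by (simp add: normal_domain_iff)
  interpret Cl_surjective_ext A A' \<phi>
    by unfold_locales (fact assms)+
  show ?thesis using affinely_trivial_pullback A.affinely_trivial_closed(1) AKG_iso by blast
qed

end
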